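(* Let $q=\pm\frac1N$ with $N\in\mathbb N$, let $h\in\mathcal H_{\mathbb R}$, and let $X(h)=T((01)\otimes h)=W((01)\otimes h)$. In the right GNS representation on $\mathcal F_q(\mathcal H)$ one may decompose $X(h)=a^+_{(01)}(h)+a^-_{(01)}(h)$, where, for $\alpha\in S_0(n)$ and $F\in\mathcal H_{\mathbb R}^{\odot n}$, $$a^+_{(01)}(h)(\alpha\otimes F)=(0\ n+1)\alpha\otimes r^+(h)F$$ and $$a^-_{(01)}(h)(\alpha\otimes F)=q\sum_{k\ne\alpha^{-1}(0)}P^{[0,n]\setminus\{k\}}_{[0,n-1]}((0k)\alpha)|_{\{k\}^c}\otimes r_k^-(h)F+\delta_{\alpha(0)\ne0}\,P^{[0,n]\setminus\{\alpha^{-1}(0)\}}_{[0,n-1]}\alpha|_{\{\alpha^{-1}(0)\}^c}\otimes r^-_{\alpha^{-1}(0)}(h)F,$$ the sum being over $k\in\{1,\dots,n\}$. The distribution of $W((01)\otimes h)$ (with respect to $\varphi$) is the unnormalized average empirical distribution of a GUE matrix with mean $0$ and variance $\|h\|^2$.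
   Context: Permutations. $[n]=\{1,\dots,n\}$, $[0,n]=\{0,\dots,n\}$; $S(n)$, $S_0(n)$ are the permutation groups of $[n]$, $[0,n]$, with $S(n)\subset S_0(n)$ the permutations fixing $0$; products are composed right to left; for $m>n$, $S_0(n)\subset S_0(m)$ by fixing $n+1,\dots,m$. $\mathrm{cyc}_0(\alpha)$ is the number of cycles of $\alpha\in S_0(n)$ (fixed points are cycles) not containing $0$; $|\alpha|=n-\mathrm{cyc}_0(\alpha)$; $\chi_q$ is the linear extension of $\chi_q(\alpha)=q^{|\alpha|}$. $(01)$ is the transposition in $S_0(1)$, $(0)$ the identity of $S_0(0)$. For $\alpha\in S_0(n)$, $\beta\in S_0(k)$, $\alpha\cup\beta=\beta'\alpha\in S_0(n+k)$, where $\beta'$ fixes $[n]$ and is obtained from $\beta$ by replacing each $j\in[k]$ by $n+j$ ($0$ unchanged). For $S\subset[n]$, $\alpha|_{S^c}$ is the permutation of $[0,n]\setminus S$, $x\mapsto\alpha^m(x)$, $m=\min\{j>0:\alpha^j(x)\notin S\}$. $P^A_B$ transports permutations of $A$ to permutations of $B$ along the order-preserving bijection $A\to B$. Contractions. $\mathcal P_{1,2}(n)$: partitions $\pi$ of $[n]$ into blocks of size 1 and 2, identified with involutions; $|\pi|$ is the number of pairs, $\mathrm{supp}(\pi)$ their union. With $\ell=|\pi|$, $C_\pi(\alpha)=q^{\mathrm{cyc}_0((\pi\alpha)|_{\mathrm{supp}(\pi)^c})-\mathrm{cyc}_0(\pi\alpha)+\ell}P^{[0,n]\setminus\mathrm{supp}(\pi)}_{[0,n-2\ell]}(\pi\alpha)|_{\mathrm{supp}(\pi)^c}$;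 $C_\pi(h_1\otimes\dots\otimes h_n)=\prod_{\{i,j\}\text{ pair}}\langle h_i,h_j\rangle\bigotimes_{k\text{ singleton}}h_k$ (increasing order). $r^+(h)F=F\otimes h$ and $r_k^-(h)(h_1\otimes\dots\otimes h_n)=\langle h_k,h\rangle h_1\otimes\dots\otimes\hat h_k\otimes\dots\otimes h_n$. Algebra and Fock space. $\mathcal H_{\mathbb R}$ is a real Hilbert space, $\mathcal H$ its complexification. $U_\sigma(h_1\otimes\dots\otimes h_n)=h_{\sigma^{-1}(1)}\otimes\dots\otimes h_{\sigma^{-1}(n)}$, $\alpha\otimes_sF=\frac1{n!}\sum_{\sigma\in S(n)}\sigma\alpha\sigma^{-1}\otimes U_\sigma F$. $\mathcal{TP}(\mathcal H_{\mathbb R})=\bigoplus_{n}\mathbb C[S_0(n)]\otimes_s\mathcal H_{\mathbb R}^{\odot n}$ (complex span of $\alpha\otimes_sF$; $\odot$ is the algebraic tensor power); the algebra element corresponding to $\xi$ is $W(\xi)$ ($W(\alpha\otimes F)=W(\alpha\otimes_sF)$); $T(\alpha\otimes F)=\sum_{\pi\in\mathcal P_{1,2}(n)}W(C_\pi(\alpha)\otimes C_\pi(F))$; product $T(\alpha\otimes_sF)T(\beta\otimes_sG)=T((\alpha\cup\beta)\otimes_s(F\otimes G))$; adjoint the antilinear extension of $T(\alpha\otimes_sF)^*=T(\alpha^{-1}\otimes_sF)$. $\varphi$ is the functional with $\varphi[W((0))]=1$, $\varphi[W(\alpha\otimes F)]=0$ for $n\ge1$; it is a tracial state with $\varphi[W(\zeta)^*W(\xi)]=\langle\xi,\zeta\rangle_q$,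 where $\langle\alpha\otimes F,\beta\otimes G\rangle_q=\delta_{n=k}\sum_{\sigma\in S(n)}\chi_q(\alpha\sigma\beta^{-1}\sigma^{-1})\langle F,U_\sigma G\rangle$. The GNS Hilbert space is $\mathcal F_q(\mathcal H)$, the completion of $\mathcal{TP}(\mathcal H_{\mathbb R})$ modulo the kernel of $\langle\cdot,\cdot\rangle_q$, with $W(\xi)$ corresponding to the vector $\xi$. In the right GNS representation $A$ acts (on the dense image of $\mathcal{TP}(\mathcal H_{\mathbb R})$) by right multiplication: it sends the vector of $W(\xi)$ to the vector of $W(\xi)A$. Here $\alpha\otimes F$ denotes the class of $\alpha\otimes_sF$. Distribution. The distribution of $A=A^*$ with respect to $\varphi$ is given by its moments $\varphi[A^m]$. A GUE matrix with mean $0$ and variance $\|h\|^2$ is an $N\times N$ Hermitian random matrix $M$ with centered, jointly complex Gaussian entries satisfying $\mathbb E[M_{ij}M_{k\ell}]=\frac1N\delta_{i=\ell}\delta_{j=k}\|h\|^2$; its average empirical distribution is the expectation of its empirical eigenvalue distribution. The word "unnormalized" is the source's and is not defined further there; the source's proof identifies the distribution by the moments $\varphi[W((01)\otimes h)^m]=\sum_{\pi}q^{m/2-\mathrm{cyc}_0((0\,1\,\dots\,m)\pi)}\|h\|^m$ for even $m$ (sum over partitions $\pi$ of $[m]$ into pairs, viewed as involutions) and $0$ for odd $m$. *)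

theory Defs
  imports
    "HOL-Probability.Probability"
    "HOL-Combinatorics.Orbits"
    "HOL-Combinatorics.Transposition"
    "HOL-Library.Poly_Mapping"
    "Jordan_Normal_Form.Schur_Decomposition"
begin

section \<open>Permutations\<close>

abbreviation pinv :: "(nat \<Rightarrow> nat) \<Rightarrow> nat \<Rightarrow> nat" where
  "pinv \<sigma> \<equiv> inv_into UNIV \<sigma>"

definition S0 :: "nat \<Rightarrow> (nat \<Rightarrow> nat) set" where
  "S0 n = {\<alpha>. \<alpha> permutes {0..n}}"

definition cyc0 :: "nat set \<Rightarrow> (nat \<Rightarrow> nat) \<Rightarrow> nat" where
  "cyc0 A \<alpha> = card {c \<in> orbit \<alpha> ` A. 0 \<notin> c}"

definition chi :: "real \<Rightarrow> nat \<Rightarrow> (nat \<Rightarrow> nat) \<Rightarrow> real" where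
  "chi q n \<alpha> = q ^ (n - cyc0 {0..n} \<alpha>)"

text \<open>\<open>perm_union n \<alpha> \<beta>\<close> is \<open>\<alpha> \<union> \<beta>\<close> for \<open>\<alpha>\<close> in \<open>S0 n\<close>: the letters of \<open>\<beta>\<close> are
  shifted by \<open>n\<close>, except for the common letter \<open>0\<close>.\<close>

definition shift_letter :: "nat \<Rightarrow> nat \<Rightarrow> nat" where
  "shift_letter n j = (if j = 0 then 0 else n + j)"

definition shift_perm :: "nat \<Rightarrow> (nat \<Rightarrow> nat) \<Rightarrow> nat \<Rightarrow> nat" where
  "shift_perm n \<beta> x =
    (if x = 0 then shift_letter n (\<beta> 0)
     else if x \<le> n then x
     else shift_letter n (\<beta> (x - n)))"

definition perm_union :: "nat \<Rightarrow> (nat \<Rightarrow> nat) \<Rightarrow> (nat \<Rightarrow> nat) \<Rightarrow> nat \<Rightarrow> nat" where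
  "perm_union n \<alpha> \<beta> = shift_perm n \<beta> \<circ> \<alpha>"

text \<open>\<open>skip S \<alpha>\<close> is \<open>\<alpha>\<close> restricted to the complement of \<open>S\<close>, extended by the identity on \<open>S\<close>.\<close>

definition skip :: "nat set \<Rightarrow> (nat \<Rightarrow> nat) \<Rightarrow> nat \<Rightarrow> nat" where
  "skip S \<alpha> x = (if x \<in> S then x else (\<alpha> ^^ (LEAST j. 0 < j \<and> (\<alpha> ^^ j) x \<notin> S)) x)"

text \<open>For finite \<open>A\<close>, \<open>rank_in A\<close> is the order-preserving bijection of \<open>A\<close> onto
  \<open>{0, \<dots>, card A - 1}\<close>, and \<open>relabel A\<close> transports permutations of \<open>A\<close> along it.\<close>

definition rank_in :: "nat set \<Rightarrow> nat \<Rightarrow> nat" where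
  "rank_in A x = card {y \<in> A. y < x}"

definition relabel :: "nat set \<Rightarrow> (nat \<Rightarrow> nat) \<Rightarrow> nat \<Rightarrow> nat" where
  "relabel A \<alpha> x = (if x < card A then rank_in A (\<alpha> (inv_into A (rank_in A) x)) else x)"


section \<open>Tensors\<close>

definition fscale :: "complex \<Rightarrow> ('a \<Rightarrow>\<^sub>0 complex) \<Rightarrow> ('a \<Rightarrow>\<^sub>0 complex)" where
  "fscale c p = Poly_Mapping.map ((*) c) p"

lemma lookup_fscale: "Poly_Mapping.lookup (fscale c p) k = c * Poly_Mapping.lookup p k"
  unfolding fscale_def by (transfer) (simp add: when_def)

lemma module_fscale: "Modules.module fscale"
  by standard (rule poly_mapping_eqI, simp add: lookup_fscale lookup_add algebra_simps)+

definition multilinear_rels :: "('h::real_vector list \<Rightarrow>\<^sub>0 complex) set" where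
  "multilinear_rels =
    {Poly_Mapping.single (us @ (a *\<^sub>R x + b *\<^sub>R y) # vs) 1
       - Poly_Mapping.single (us @ x # vs) (of_real a)
       - Poly_Mapping.single (us @ y # vs) (of_real b) | us vs a b x y. True}"

definition tens_eq :: "('h::real_vector list \<Rightarrow>\<^sub>0 complex) \<Rightarrow> ('h list \<Rightarrow>\<^sub>0 complex) \<Rightarrow> bool" where
  "tens_eq p r \<longleftrightarrow> p - r \<in> Modules.module.span fscale multilinear_rels"

text \<open>The complexified tensor algebra of the real vector space \<open>'h\<close>: formal complex
  combinations of words modulo real multilinearity in each letter. Its degree \<open>n\<close> part is the
  complexification of the \<open>n\<close>th algebraic tensor power of \<open>'h\<close>.\<close>

lemma equivp_tens_eq: "equivp tens_eq"
proof (rule equivpI)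
  note span = Modules.module.span_zero[OF module_fscale] Modules.module.span_neg[OF module_fscale]
    Modules.module.span_add[OF module_fscale]
  show "reflp tens_eq"
    by (rule reflpI) (simp add: tens_eq_def span(1))
  show "symp tens_eq"
    unfolding symp_def tens_eq_def using span(2) minus_diff_eq by metis
  show "transp tens_eq"
    unfolding transp_def tens_eq_def
  proof (intro allI impI)
    fix x y z :: "'b list \<Rightarrow>\<^sub>0 complex"
    assume "x - y \<in> Modules.module.span fscale multilinear_rels"
      and "y - z \<in> Modules.module.span fscale multilinear_rels"
    from span(3)[OF this] show "x - z \<in> Modules.module.span fscale multilinear_rels" by simp
  qed
qed

quotient_type (overloaded) 'h tens = "'h::real_vector list \<Rightarrow>\<^sub>0 complex" / tens_eq
  by (rule equivp_tens_eq)

instantiation tens :: (real_vector) ab_group_add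
begin

lift_definition zero_tens :: "'a tens" is 0 .

lift_definition plus_tens :: "'a tens \<Rightarrow> 'a tens \<Rightarrow> 'a tens" is "(+)"
  unfolding tens_eq_def add_diff_add by (rule Modules.module.span_add[OF module_fscale])

lift_definition uminus_tens :: "'a tens \<Rightarrow> 'a tens" is uminus
proof -
  fix x y :: "'a list \<Rightarrow>\<^sub>0 complex"
  assume "tens_eq x y"
  then have "- (x - y) \<in> Modules.module.span fscale multilinear_rels"
    unfolding tens_eq_def by (rule Modules.module.span_neg[OF module_fscale])
  then show "tens_eq (- x) (- y)" by (simp add: tens_eq_def algebra_simps)
qed

definition minus_tens :: "'a tens \<Rightarrow> 'a tens \<Rightarrow> 'a tens" where
  "minus_tens x y = x + - y"

lemma tens_eq_refl: "tens_eq x x"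
  by (simp add: tens_eq_def Modules.module.span_zero[OF module_fscale])

instance
proof
  fix a b c :: "'a tens"
  show "a + b + c = a + (b + c)"
    by transfer (simp add: add.assoc tens_eq_refl)
  show "a + b = b + a"
    by transfer (simp add: add.commute tens_eq_refl)
  show "0 + a = a"
    by transfer (simp add: tens_eq_refl)
  show "- a + a = 0"
    by transfer (simp add: tens_eq_refl)
  show "a - b = a + - b"
    by (simp add: minus_tens_def)
qed

end

lift_definition tscale :: "complex \<Rightarrow> 'h::real_vector tens \<Rightarrow> 'h tens" is fscale
  unfolding tens_eq_def Modules.module.scale_right_diff_distrib[OF module_fscale, symmetric]
  by (rule Modules.module.span_scale[OF module_fscale])

lift_definition simple :: "'h::real_vector list \<Rightarrow> 'h tens" is
  "\<lambda>hs. Poly_Mapping.single hs 1" .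

text \<open>The real \<open>n\<close>th algebraic tensor power.\<close>

definition rtens :: "nat \<Rightarrow> 'h::real_vector tens set" where
  "rtens n = Modules.module.span (\<lambda>r. tscale (complex_of_real r)) {simple hs | hs. length hs = n}"

text \<open>The extension to tensors, linear for the scalar multiplication \<open>scl\<close> of the target space,
  of a map \<open>f\<close> given on simple tensors. It does not depend on the chosen representative if
  \<open>f\<close> is real multilinear on the words of each length, as in all uses below.\<close>

definition tens_ext :: "(complex \<Rightarrow> 'v \<Rightarrow> 'v) \<Rightarrow> ('h::real_vector list \<Rightarrow> 'v::comm_monoid_add) \<Rightarrow> 'h tens \<Rightarrow> 'v" where
  "tens_ext scl f F =
    (\<Sum>hs \<in> Poly_Mapping.keys (rep_tens F). scl (Poly_Mapping.lookup (rep_tens F) hs) (f hs))"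

text \<open>Positions in words are counted from \<open>1\<close>.\<close>

abbreviation letter :: "'h list \<Rightarrow> nat \<Rightarrow> 'h" where
  "letter hs i \<equiv> hs ! (i - 1)"

definition U_perm :: "nat \<Rightarrow> (nat \<Rightarrow> nat) \<Rightarrow> 'h::real_vector tens \<Rightarrow> 'h tens" where
  "U_perm n \<sigma> = tens_ext tscale (\<lambda>hs.
     if length hs = n then simple (map (\<lambda>i. letter hs (pinv \<sigma> i)) [1..<n+1]) else 0)"

definition r_plus :: "'h \<Rightarrow> 'h::real_vector tens \<Rightarrow> 'h tens" where
  "r_plus h = tens_ext tscale (\<lambda>hs. simple (hs @ [h]))"

definition r_minus :: "nat \<Rightarrow> 'h \<Rightarrow> 'h::real_inner tens \<Rightarrow> 'h tens" where
  "r_minus k h = tens_ext tscale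
    (\<lambda>hs. tscale (of_real (inner (letter hs k) h)) (simple (take (k - 1) hs @ drop k hs)))"


section \<open>The space of trace polynomials\<close>

text \<open>Group algebra elements with tensor coefficients: \<open>Poly_Mapping.single \<alpha> F\<close> stands for
  \<open>\<alpha> \<otimes> F\<close>, and the degree \<open>n\<close> of \<open>\<alpha> \<in> S0 n\<close> is recorded by the degree of \<open>F\<close>.\<close>

type_synonym 'h ptens = "(nat \<Rightarrow> nat) \<Rightarrow>\<^sub>0 'h tens"

definition pscale :: "complex \<Rightarrow> 'h::real_vector ptens \<Rightarrow> 'h ptens" where
  "pscale c = Poly_Mapping.map (tscale c)"

definition ptens_ext :: "(complex \<Rightarrow> 'v \<Rightarrow> 'v) \<Rightarrow>
    ((nat \<Rightarrow> nat) \<Rightarrow> 'h::real_vector list \<Rightarrow> 'v::comm_monoid_add) \<Rightarrow> 'h ptens \<Rightarrow> 'v" where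
  "ptens_ext scl f \<xi> =
    (\<Sum>\<alpha> \<in> Poly_Mapping.keys \<xi>. tens_ext scl (f \<alpha>) (Poly_Mapping.lookup \<xi> \<alpha>))"

text \<open>\<open>sym_tensor n \<alpha> F\<close> is \<open>\<alpha> \<otimes>\<^sub>s F\<close> for \<open>\<alpha> \<in> S0 n\<close> and \<open>F\<close> of degree \<open>n\<close>.\<close>

definition sym_tensor :: "nat \<Rightarrow> (nat \<Rightarrow> nat) \<Rightarrow> 'h::real_vector tens \<Rightarrow> 'h ptens" where
  "sym_tensor n \<alpha> F =
    pscale (1 / fact n)
      (\<Sum>\<sigma> | \<sigma> permutes {1..n}. Poly_Mapping.single (\<sigma> \<circ> \<alpha> \<circ> pinv \<sigma>) (U_perm n \<sigma> F))"

definition symmetrize :: "'h::real_vector ptens \<Rightarrow> 'h ptens" where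
  "symmetrize = ptens_ext pscale (\<lambda>\<alpha> hs. sym_tensor (length hs) \<alpha> (simple hs))"

text \<open>The algebra element \<open>W(\<xi>)\<close> is identified with \<open>\<xi> \<in> TP\<close>.\<close>

definition TP :: "'h::real_vector ptens set" where
  "TP = Modules.module.span pscale {sym_tensor n \<alpha> F | n \<alpha> F. \<alpha> \<in> S0 n \<and> F \<in> rtens n}"


section \<open>Contractions and the algebra structure\<close>

text \<open>Partitions into blocks of size one and two, as involutions.\<close>

definition P12 :: "nat \<Rightarrow> (nat \<Rightarrow> nat) set" where
  "P12 n = {\<pi>. \<pi> permutes {1..n} \<and> \<pi> \<circ> \<pi> = id}"

definition supp :: "(nat \<Rightarrow> nat) \<Rightarrow> nat set" where
  "supp \<pi> = {i. \<pi> i \<noteq> i}"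

definition pairs :: "(nat \<Rightarrow> nat) \<Rightarrow> nat" where
  "pairs \<pi> = card (supp \<pi>) div 2"

text \<open>The exponent of \<open>q\<close> can be negative.\<close>

definition contr_coeff :: "real \<Rightarrow> nat \<Rightarrow> (nat \<Rightarrow> nat) \<Rightarrow> (nat \<Rightarrow> nat) \<Rightarrow> real" where
  "contr_coeff q n \<pi> \<alpha> =
    q powi (int (cyc0 ({0..n} - supp \<pi>) (skip (supp \<pi>) (\<pi> \<circ> \<alpha>)))
            - int (cyc0 {0..n} (\<pi> \<circ> \<alpha>)) + int (pairs \<pi>))"

definition contr_perm :: "nat \<Rightarrow> (nat \<Rightarrow> nat) \<Rightarrow> (nat \<Rightarrow> nat) \<Rightarrow> nat \<Rightarrow> nat" where
  "contr_perm n \<pi> \<alpha> = relabel ({0..n} - supp \<pi>) (skip (supp \<pi>) (\<pi> \<circ> \<alpha>))"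

definition contr_word :: "(nat \<Rightarrow> nat) \<Rightarrow> 'h::real_inner list \<Rightarrow> 'h tens" where
  "contr_word \<pi> hs =
    tscale (of_real (\<Prod>i | i \<in> {1..length hs} \<and> i < \<pi> i. inner (letter hs i) (letter hs (\<pi> i))))
      (simple (map (letter hs) (filter (\<lambda>k. \<pi> k = k) [1..<length hs + 1])))"

text \<open>\<open>T_poly q \<xi>\<close> is the linear extension of
  \<open>T(\<alpha> \<otimes> F) = (\<Sum>\<pi>. W(C\<^sub>\<pi>(\<alpha>) \<otimes> C\<^sub>\<pi>(F)))\<close>, where \<open>W(\<beta> \<otimes> G) = W(\<beta> \<otimes>\<^sub>s G)\<close>.\<close>

definition T_poly :: "real \<Rightarrow> 'h::real_inner ptens \<Rightarrow> 'h ptens" where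
  "T_poly q = ptens_ext pscale (\<lambda>\<alpha> hs. let n = length hs in
    \<Sum>\<pi> \<in> P12 n. pscale (of_real (contr_coeff q n \<pi> \<alpha>))
      (sym_tensor (n - 2 * pairs \<pi>) (contr_perm n \<pi> \<alpha>) (contr_word \<pi> hs)))"

text \<open>The bilinear extension of \<open>(\<alpha> \<otimes> F, \<beta> \<otimes> G) \<mapsto> (\<alpha> \<union> \<beta>) \<otimes> (F \<otimes> G)\<close>.\<close>

definition ptens_union :: "'h::real_vector ptens \<Rightarrow> 'h ptens \<Rightarrow> 'h ptens" where
  "ptens_union \<xi> \<eta> = ptens_ext pscale (\<lambda>\<alpha> hs. ptens_ext pscale (\<lambda>\<beta> ks.
    Poly_Mapping.single (perm_union (length hs) \<alpha> \<beta>) (simple (hs @ ks))) \<eta>) \<xi>"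

text \<open>For \<open>q \<noteq> 0\<close>, \<open>T_poly q\<close> maps \<open>TP\<close> bijectively onto itself, because it is the identity up to terms of lower
  degree. The product is the one for which
  \<open>T(\<alpha> \<otimes>\<^sub>s F) T(\<beta> \<otimes>\<^sub>s G) = T((\<alpha> \<union> \<beta>) \<otimes>\<^sub>s (F \<otimes> G))\<close>.\<close>

definition tp_mult :: "real \<Rightarrow> 'h::real_inner ptens \<Rightarrow> 'h ptens \<Rightarrow> 'h ptens" where
  "tp_mult q \<xi> \<eta> =
    T_poly q (symmetrize (ptens_union (inv_into TP (T_poly q) \<xi>) (inv_into TP (T_poly q) \<eta>)))"

definition tp_one :: "'h::real_inner ptens" where
  "tp_one = sym_tensor 0 id (simple [])"

primrec tp_power :: "real \<Rightarrow> 'h::real_inner ptens \<Rightarrow> nat \<Rightarrow> 'h ptens" where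
  "tp_power q A 0 = tp_one"
| "tp_power q A (Suc m) = tp_mult q (tp_power q A m) A"

definition state :: "'h::real_inner ptens \<Rightarrow> complex" where
  "state = ptens_ext (*) (\<lambda>\<alpha> hs. if hs = [] then 1 else 0)"

definition X_poly :: "real \<Rightarrow> 'h::real_inner \<Rightarrow> 'h ptens" where
  "X_poly q h = T_poly q (sym_tensor 1 (Transposition.transpose 0 1) (simple [h]))"


section \<open>The Fock space\<close>

text \<open>The sesquilinear form, linear in the first argument and antilinear in the second.\<close>

definition q_inner :: "real \<Rightarrow> 'h::real_inner ptens \<Rightarrow> 'h ptens \<Rightarrow> complex" where
  "q_inner q \<xi> \<eta> = ptens_ext (*) (\<lambda>\<alpha> fs. ptens_ext (\<lambda>c z. cnj c * z) (\<lambda>\<beta> gs.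
     if length fs = length gs then
       let n = length fs in
       of_real (\<Sum>\<sigma> | \<sigma> permutes {1..n}.
         chi q n (\<alpha> \<circ> \<sigma> \<circ> pinv \<beta> \<circ> pinv \<sigma>)
           * (\<Prod>i = 1..n. inner (letter fs i) (letter gs (pinv \<sigma> i))))
     else 0) \<eta>) \<xi>"

definition q_norm :: "real \<Rightarrow> 'h::real_inner ptens \<Rightarrow> real" where
  "q_norm q \<xi> = sqrt (Re (q_inner q \<xi> \<xi>))"

definition fock_Cauchy :: "real \<Rightarrow> (nat \<Rightarrow> 'h::real_inner ptens) set" where
  "fock_Cauchy q = {x. (\<forall>m. x m \<in> TP) \<and>
     (\<forall>e>0. \<exists>M. \<forall>m\<ge>M. \<forall>n\<ge>M. q_norm q (x m - x n) < e)}"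

definition fock_rel :: "real \<Rightarrow> ((nat \<Rightarrow> 'h::real_inner ptens) \<times> (nat \<Rightarrow> 'h ptens)) set" where
  "fock_rel q = {(x, y). x \<in> fock_Cauchy q \<and> y \<in> fock_Cauchy q \<and>
     (\<lambda>n. q_norm q (x n - y n)) \<longlonglongrightarrow> 0}"

text \<open>The Fock space \<open>\<F>\<^sub>q\<close> is the completion of \<open>TP\<close> for the seminorm \<open>q_norm q\<close>. Its elements are
  classes of Cauchy sequences; identifying sequences at distance tending to \<open>0\<close> also divides
  out the kernel of \<open>q_inner q\<close>. Operations on classes are the union of the classes
  obtained from all choices of representatives, hence a single class exactly when they are
  well defined.\<close>

type_synonym 'h fock_vec = "(nat \<Rightarrow> 'h ptens) set"

definition fock :: "real \<Rightarrow> 'h::real_inner fock_vec set" where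
  "fock q = fock_Cauchy q // fock_rel q"

definition fock_add :: "real \<Rightarrow> 'h::real_inner fock_vec \<Rightarrow> 'h fock_vec \<Rightarrow> 'h fock_vec" where
  "fock_add q V W = (\<Union>x\<in>V. \<Union>y\<in>W. fock_rel q `` {\<lambda>n. x n + y n})"

definition fock_scale :: "real \<Rightarrow> complex \<Rightarrow> 'h::real_inner fock_vec \<Rightarrow> 'h fock_vec" where
  "fock_scale q c V = (\<Union>x\<in>V. fock_rel q `` {\<lambda>n. pscale c (x n)})"

definition fock_inner :: "real \<Rightarrow> 'h::real_inner fock_vec \<Rightarrow> 'h fock_vec \<Rightarrow> complex" where
  "fock_inner q V W = (THE z. \<forall>x\<in>V. \<forall>y\<in>W. (\<lambda>n. q_inner q (x n) (y n)) \<longlonglongrightarrow> z)"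

text \<open>The vector of \<open>W(\<xi>)\<close>.\<close>

definition gns_vec :: "real \<Rightarrow> 'h::real_inner ptens \<Rightarrow> 'h fock_vec" where
  "gns_vec q \<xi> = fock_rel q `` {\<lambda>_. \<xi>}"

definition gns_dom :: "real \<Rightarrow> 'h::real_inner fock_vec set" where
  "gns_dom q = gns_vec q ` TP"

definition gns_operator :: "real \<Rightarrow> ('h::real_inner fock_vec \<Rightarrow> 'h fock_vec) \<Rightarrow> bool" where
  "gns_operator q a \<longleftrightarrow>
     (\<forall>V \<in> gns_dom q. a V \<in> gns_dom q) \<and>
     (\<forall>V \<in> gns_dom q. \<forall>W \<in> gns_dom q. a (fock_add q V W) = fock_add q (a V) (a W)) \<and>
     (\<forall>c. \<forall>V \<in> gns_dom q. a (fock_scale q c V) = fock_scale q c (a V))"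

definition right_gns :: "real \<Rightarrow> 'h::real_inner ptens \<Rightarrow> 'h fock_vec \<Rightarrow> 'h fock_vec" where
  "right_gns q A V = (\<Union>\<xi> \<in> {\<xi> \<in> TP. gns_vec q \<xi> = V}. gns_vec q (tp_mult q \<xi> A))"


section \<open>GUE matrices\<close>

text \<open>Point masses count as Gaussian.\<close>

definition gaussian_rv :: "'w measure \<Rightarrow> ('w \<Rightarrow> real) \<Rightarrow> bool" where
  "gaussian_rv P Y \<longleftrightarrow> Y \<in> borel_measurable P \<and>
     (\<exists>\<mu> \<sigma>. if \<sigma> = 0 then (AE \<omega> in P. Y \<omega> = \<mu>)
            else \<sigma> > 0 \<and> distributed P lborel Y (\<lambda>x. ennreal (normal_density \<mu> \<sigma> x)))"

definition jointly_gaussian_entries :: "nat \<Rightarrow> 'w measure \<Rightarrow> ('w \<Rightarrow> complex mat) \<Rightarrow> bool" where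
  "jointly_gaussian_entries N P M \<longleftrightarrow>
     (\<forall>a b. gaussian_rv P (\<lambda>\<omega>. \<Sum>i<N. \<Sum>j<N.
        a i j * Re (M \<omega> $$ (i, j)) + b i j * Im (M \<omega> $$ (i, j))))"

definition is_GUE :: "nat \<Rightarrow> real \<Rightarrow> 'w measure \<Rightarrow> ('w \<Rightarrow> complex mat) \<Rightarrow> bool" where
  "is_GUE N v P M \<longleftrightarrow> prob_space P \<and>
     (\<forall>\<omega> \<in> space P. M \<omega> \<in> carrier_mat N N \<and> mat_adjoint (M \<omega>) = M \<omega>) \<and>
     jointly_gaussian_entries N P M \<and>
     (\<forall>i<N. \<forall>j<N. (LINT \<omega>|P. M \<omega> $$ (i, j)) = 0) \<and>
     (\<forall>i<N. \<forall>j<N. \<forall>k<N. \<forall>l<N. (LINT \<omega>|P. M \<omega> $$ (i, j) * M \<omega> $$ (k, l)) =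
        of_real (if i = l \<and> j = k then v / real N else 0))"

text \<open>The uniform distribution on the eigenvalues, with multiplicity. The eigenvalues of
  Hermitian matrices are real, so that \<open>Re\<close> only changes the type.\<close>

definition eigenvalue_distribution :: "complex mat \<Rightarrow> real measure" where
  "eigenvalue_distribution A =
     distr (measure_pmf (pmf_of_multiset (proots (char_poly A)))) borel Re"

text \<open>The expectation of the random probability measure, as the bind of the Giry monad.\<close>

definition average_eigenvalue_distribution :: "'w measure \<Rightarrow> ('w \<Rightarrow> complex mat) \<Rightarrow> real measure" where
  "average_eigenvalue_distribution P M = P \<bind> (\<lambda>\<omega>. eigenvalue_distribution (M \<omega>))"

end

theory Submission
imports Defs
begin

text \<open>The argument has three parts.

Algebra. The map \<open>T_poly q\<close> sums over all contractions of a tensor. When the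
letter \<open>n + 1\<close> is adjoined by \<open>(0 n+1)\<close>, it is either left alone or paired with one of the letters
that survived the earlier contractions. The first alternative produces \<open>Aplus h\<close>; pairing with
the letter \<open>k\<close> removes \<open>k\<close> from \<open>(0 k) \<alpha>\<close> and changes the exponent of \<open>q\<close> by one, unless \<open>k\<close>
is mapped to \<open>0\<close>. The second alternative is therefore \<open>Aminus q h\<close>, and
\<open>T_recursion\<close> says that \<open>T_poly q\<close> turns adjoining a letter into the operator \<open>Aplus h + Aminus q h\<close>.
Since \<open>T_poly q\<close> is the identity up to lower degree, it is bijective, and \<open>tp_mult_X\<close> identifies right
multiplication by \<open>X\<close> with the sum of the two operators. These computations live on permutations of
arbitrary finite sets of letters, in order that no relabelling interferes; \<open>invariant_op\<close>
transports the outcome to the standard letters.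

Fock space. The operators act on classes modulo the kernel of \<open>q_inner q\<close>, so this kernel has
to be preserved. For \<open>q = 1/N\<close> and \<open>q = -1/N\<close> the character \<open>chi q\<close> counts, up to sign and scale, the colourings
by \<open>N\<close> colours that are constant on cycles (\<open>chi_colourings\<close>), which makes
\<open>q_inner q\<close> a sum of squares of linear functionals on every finite-dimensional
piece (\<open>q_inner_sos\<close>). Hence it is positive semidefinite and Cauchy-Schwarz holds. The two operators are
adjoint to each other (\<open>adjoint\<close>), and operators with an adjoint preserve null
vectors.

Moments. By the multiplicativity of \<open>T_poly q\<close>, the \<open>m\<close>th power of \<open>X\<close> is the image under \<open>T_poly q\<close> of the cycle
\<open>(0 1 ... m)\<close> with the word \<open>h ... h\<close>, so its state is a sum over pairings \<open>\<pi>\<close> of \<open>q\<close> to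
the power \<open>m/2\<close> minus the number of cycles of \<open>\<pi> (0 1 ... m)\<close> avoiding \<open>0\<close> (\<open>state_T_cyclic\<close>). On the side of the random
matrix, the Wick formula (\<open>wick_expectation\<close>) turns the expected trace of the \<open>m\<close>th power into a sum over
pairings and over index sequences, and the index sequences compatible with a pairing are again
colourings constant on the cycles of \<open>\<pi> (0 1 ... m)\<close> (\<open>wick_trace_sum\<close>). For \<open>q = 1/N\<close> the two sums agree term by term. For
\<open>q = -1/N\<close> they agree as well because the exponent is always even
(\<open>genus_even\<close>): twice the genus of the surface glued from a polygon.\<close>

section \<open>Removing letters from permutations\<close>

lemma skip_eqI:
  assumes "x \<notin> S" "0 < j" "(\<alpha> ^^ j) x = y" "y \<notin> S" "\<And>i. 0 < i \<Longrightarrow> i < j \<Longrightarrow> (\<alpha> ^^ i) x \<in> S"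
  shows "skip S \<alpha> x = y"
proof -
  have "(LEAST j. 0 < j \<and> (\<alpha> ^^ j) x \<notin> S) = j"
    by (rule Least_equality) (use assms in \<open>auto intro: leI\<close>)
  then show ?thesis using assms by (simp add: skip_def)
qed

lemma skip_return:
  assumes "\<alpha> permutes A" "finite A" "x \<notin> S"
  obtains j where "0 < j" "(\<alpha> ^^ j) x = skip S \<alpha> x" "skip S \<alpha> x \<notin> S"
    "\<And>i. 0 < i \<Longrightarrow> i < j \<Longrightarrow> (\<alpha> ^^ i) x \<in> S"
proof -
  have "x \<in> orbit \<alpha> x"
    by (rule permutation_self_in_orbit[OF permutes_imp_permutation[OF assms(2,1)]])
  then obtain k where k: "0 < k" "(\<alpha> ^^ k) x = x" unfolding orbit_altdef by fastforce
  let ?P = "\<lambda>j. 0 < j \<and> (\<alpha> ^^ j) x \<notin> S"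
  have "?P k" using k assms by simp
  then have 1: "?P (Least ?P)" by (rule LeastI)
  have sk: "skip S \<alpha> x = (\<alpha> ^^ (Least ?P)) x" using assms(3) by (simp add: skip_def)
  show ?thesis
  proof (rule that)
    show "0 < Least ?P" "(\<alpha> ^^ (Least ?P)) x = skip S \<alpha> x" "skip S \<alpha> x \<notin> S"
      using 1 sk by simp_all
    show "(\<alpha> ^^ i) x \<in> S" if "0 < i" "i < Least ?P" for i
      using not_less_Least[OF that(2)] that(1) by blast
  qed
qed

lemma skip_fixed [simp]: "x \<in> S \<Longrightarrow> skip S \<alpha> x = x"
  by (simp add: skip_def)

lemma skip_empty [simp]: "skip {} \<alpha> = \<alpha>"
  by (rule ext, rule skip_eqI[where j = 1]) auto

lemma skip_single:
  assumes "inj \<alpha>"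
  shows "skip {s} \<alpha> = Transposition.transpose s (\<alpha> s) \<circ> \<alpha>"
proof
  fix x
  show "skip {s} \<alpha> x = (Transposition.transpose s (\<alpha> s) \<circ> \<alpha>) x"
  proof (cases "x = s")
    case False
    then have "\<alpha> x \<noteq> \<alpha> s" using assms by (auto dest: injD)
    show ?thesis
    proof (cases "\<alpha> x = s")
      case True
      have "skip {s} \<alpha> x = \<alpha> (\<alpha> x)"
        by (rule skip_eqI[where j = 2])
          (use True False \<open>\<alpha> x \<noteq> \<alpha> s\<close> in \<open>auto simp: numeral_2_eq_2 less_Suc_eq\<close>)
      then show ?thesis using True by simp
    next
      case ax: False
      have "skip {s} \<alpha> x = \<alpha> x"
        by (rule skip_eqI[where j = 1]) (use ax False in auto)
      then show ?thesis using ax \<open>\<alpha> x \<noteq> \<alpha> s\<close> by (simp add: Transposition.transpose_def)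
    qed
  qed simp
qed

lemma skip_single_fixed: "inj \<alpha> \<Longrightarrow> \<alpha> s = s \<Longrightarrow> skip {s} \<alpha> = \<alpha>"
  by (simp add: skip_single)

lemma skip_insert_aux:
  assumes "\<alpha> permutes A" "finite A" "inj (skip S \<alpha>)" "s \<notin> S"
  shows "skip (insert s S) \<alpha> = skip {s} (skip S \<alpha>)"
proof
  fix x
  show "skip (insert s S) \<alpha> x = skip {s} (skip S \<alpha>) x"
  proof (cases "x \<in> insert s S")
    case True
    have "x = s \<or> x \<noteq> s \<and> x \<noteq> skip S \<alpha> s \<and> x \<in> S"
      using True assms(4) injD[OF assms(3), of x s] skip_fixed[of x S \<alpha>] by auto
    then show ?thesis
      using True assms(3) by (auto simp: skip_single)
  next
    case x: False
    then have "x \<notin> S" "x \<noteq> s" by auto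
    obtain j where j: "0 < j" "(\<alpha> ^^ j) x = skip S \<alpha> x" "skip S \<alpha> x \<notin> S"
      "\<And>i. 0 < i \<Longrightarrow> i < j \<Longrightarrow> (\<alpha> ^^ i) x \<in> S"
      using skip_return[OF assms(1,2) \<open>x \<notin> S\<close>] by blast
    have ne: "skip S \<alpha> x \<noteq> skip S \<alpha> s" using \<open>x \<noteq> s\<close> assms(3) by (auto dest: injD)
    show ?thesis
    proof (cases "skip S \<alpha> x = s")
      case False
      have "skip (insert s S) \<alpha> x = skip S \<alpha> x"
        by (rule skip_eqI[where j = j]) (use j x False in auto)
      then show ?thesis using assms(3) False ne by (simp add: skip_single Transposition.transpose_def)
    next
      case True
      obtain k where k: "0 < k" "(\<alpha> ^^ k) s = skip S \<alpha> s" "skip S \<alpha> s \<notin> S"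
        "\<And>i. 0 < i \<Longrightarrow> i < k \<Longrightarrow> (\<alpha> ^^ i) s \<in> S"
        using skip_return[OF assms(1,2) \<open>s \<notin> S\<close>] by blast
      have add: "(\<alpha> ^^ (i + j)) x = (\<alpha> ^^ i) s" for i
        using j(2) True by (simp add: funpow_add)
      have "skip (insert s S) \<alpha> x = skip S \<alpha> s"
      proof (rule skip_eqI[where j = "k + j"])
        fix i assume i: "0 < i" "i < k + j"
        show "(\<alpha> ^^ i) x \<in> insert s S"
        proof (cases "i < j")
          case True then show ?thesis using i j(4) by auto
        next
          case False
          then obtain l where l: "i = l + j" by (metis add.commute le_iff_add not_less)
          then show ?thesis using add[of l] k(4)[of l] i by (cases "l = 0") auto
        qed
      qed (use x j k add ne True in auto)
      then show ?thesis using assms(3) True by (simp add: skip_single)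
    qed
  qed
qed

lemma skip_permutes_aux:
  assumes "\<alpha> permutes A" "finite A" "finite S"
  shows "skip S \<alpha> permutes A"
  using assms(3)
proof (induction S rule: finite_induct)
  case (insert s S)
  have "inj (skip S \<alpha>)" using insert.IH by (rule permutes_inj)
  then have *: "skip (insert s S) \<alpha> = Transposition.transpose s (skip S \<alpha> s) \<circ> skip S \<alpha>"
    using skip_insert_aux[OF assms(1,2) _ insert.hyps(2)] by (simp add: skip_single)
  show ?case
  proof (cases "s \<in> A")
    case True
    then show ?thesis unfolding *
      by (intro permutes_compose insert.IH permutes_swap_id)
        (use permutes_in_image[OF insert.IH, of s] in simp_all)
  next
    case False
    then show ?thesis unfolding * using insert.IH by (simp add: permutes_not_in)
  qed
qed (simp add: assms)

lemma skip_insert: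
  assumes "\<alpha> permutes A" "finite A" "finite S" "s \<notin> S"
  shows "skip (insert s S) \<alpha> = skip {s} (skip S \<alpha>)"
  using skip_insert_aux[OF assms(1,2) _ assms(4)] permutes_inj[OF skip_permutes_aux[OF assms(1-3)]]
  by blast

lemma skip_permutes:
  assumes "\<alpha> permutes A" "finite A" "finite S"
  shows "skip S \<alpha> permutes (A - S)"
  by (rule permutes_superset[OF skip_permutes_aux[OF assms]]) auto

text \<open>A permutation \<open>\<tau>\<close> that fixes \<open>S\<close> cannot interfere with the passage of \<open>\<alpha>\<close> through \<open>S\<close>: until the
orbit returns, \<open>\<tau>\<close> acts trivially.\<close>

lemma skip_comp_left:
  assumes "\<alpha> permutes A" "finite A" "\<tau> permutes A" "finite S" "\<And>x. x \<in> S \<Longrightarrow> \<tau> x = x"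
  shows "skip S (\<tau> \<circ> \<alpha>) = \<tau> \<circ> skip S \<alpha>"
  using assms(4,5)
proof (induction S rule: finite_induct)
  case (insert s S)
  note p = permutes_compose[OF assms(1,3)]
  have i: "inj (skip S \<alpha>)" using skip_permutes_aux[OF assms(1,2) insert.hyps(1)] by (rule permutes_inj)
  have b: "bij \<tau>" using assms(3) by (rule permutes_bij)
  have "skip (insert s S) (\<tau> \<circ> \<alpha>) = skip {s} (\<tau> \<circ> skip S \<alpha>)"
    using skip_insert[OF p assms(2) insert.hyps] insert.IH insert.prems by (metis insertI2)
  also have "\<dots> = Transposition.transpose (\<tau> s) (\<tau> (skip S \<alpha> s)) \<circ> \<tau> \<circ> skip S \<alpha>"
    using i b insert.prems by (subst skip_single) (auto simp: bij_is_inj comp_assoc intro: inj_compose)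
  also have "\<dots> = \<tau> \<circ> (Transposition.transpose s (skip S \<alpha> s) \<circ> skip S \<alpha>)"
    using inj_eq[OF bij_is_inj[OF b]] unfolding fun_eq_iff Transposition.transpose_def o_def by simp
  also have "\<dots> = \<tau> \<circ> skip (insert s S) \<alpha>"
    using skip_insert[OF assms(1,2) insert.hyps] i by (simp add: skip_single)
  finally show ?case .
qed simp

lemma skip_map_permutation:
  assumes "\<alpha> permutes A" "finite A" "inj_on f A" "S \<subseteq> A"
  shows "map_permutation A f (skip S \<alpha>) = skip (f ` S) (map_permutation A f \<alpha>)"
  using finite_subset[OF assms(4,2)] assms(4)
proof (induction S rule: finite_induct)
  case (insert s S)
  let ?m = "map_permutation A f"
  have m: "?m \<alpha> permutes f ` A" by (rule map_permutation_permutes) (use assms in \<open>auto simp: bij_betw_def\<close>)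
  have p: "skip S \<alpha> permutes A" using skip_permutes_aux[OF assms(1,2) insert.hyps(1)] .
  have p': "skip (f ` S) (?m \<alpha>) permutes f ` A"
    by (rule skip_permutes_aux[OF m]) (use assms insert in auto)
  have ns: "f s \<notin> f ` S" using insert assms(3) by (auto dest: inj_onD)
  have "?m (skip (insert s S) \<alpha>) = ?m (Transposition.transpose s (skip S \<alpha> s) \<circ> skip S \<alpha>)"
    using skip_insert[OF assms(1,2) insert.hyps] skip_single[OF permutes_inj[OF p]] by simp
  also have "\<dots> = Transposition.transpose (f s) (f (skip S \<alpha> s)) \<circ> ?m (skip S \<alpha>)"
    using assms(3) p insert.prems
    by (subst map_permutation_compose') (auto simp: map_permutation_transpose permutes_in_image)
  also have "f (skip S \<alpha> s) = ?m (skip S \<alpha>) (f s)"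
    using assms(3) insert.prems by (simp add: map_permutation_apply)
  also have "Transposition.transpose (f s) (?m (skip S \<alpha>) (f s)) \<circ> ?m (skip S \<alpha>)
      = skip {f s} (skip (f ` S) (?m \<alpha>))"
    using insert skip_single[OF permutes_inj[OF p']] by simp
  also have "\<dots> = skip (insert (f s) (f ` S)) (?m \<alpha>)"
    using skip_insert[OF m _ _ ns] assms(2) insert.hyps by simp
  finally show ?case by simp
qed simp

section \<open>Counting cycles\<close>

lemma orbit_skip_single:
  assumes "inj \<alpha>" "\<alpha> s \<noteq> s" "x \<noteq> s"
  shows "orbit (skip {s} \<alpha>) x = orbit \<alpha> x - {s}"
proof -
  let ?b = "skip {s} \<alpha>"
  have b: "?b y = (if \<alpha> y = s then \<alpha> s else \<alpha> y)" if "y \<noteq> s" for y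
    using that assms by (auto simp: skip_single Transposition.transpose_def dest: injD)
  have "y \<in> orbit \<alpha> x \<and> y \<noteq> s" if "y \<in> orbit ?b x" for y
    using that
  proof induction
    case base show ?case using b[OF assms(3)] assms(2) orbit.base[of \<alpha>] orbit.step[where f = \<alpha>] by metis
  next
    case (step y) then show ?case using b[of y] assms(2) orbit.base[of \<alpha>] orbit.step[where f = \<alpha>] by metis
  qed
  moreover have "(y \<noteq> s \<longrightarrow> y \<in> orbit ?b x) \<and> (y = s \<longrightarrow> \<alpha> s \<in> orbit ?b x)" if "y \<in> orbit \<alpha> x" for y
    using that
  proof induction
    case base show ?case using b[OF assms(3)] orbit.base[of ?b x] by auto
  next
    case (step y)
    show ?case
    proof (cases "y = s")
      case True then show ?thesis using step assms(2) by auto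
    next
      case False
      then have "?b y \<in> orbit ?b x" using step by (auto intro: orbit.intros)
      then show ?thesis using b[OF False] by auto
    qed
  qed
  ultimately show ?thesis by blast
qed

lemma orbits_eq:
  assumes "\<alpha> permutes A" "finite A" "y \<in> orbit \<alpha> x" "y \<in> orbit \<alpha> x'"
  shows "orbit \<alpha> x = orbit \<alpha> x'"
proof -
  have "permutation \<alpha>" using permutes_imp_permutation[OF assms(2,1)] .
  note c = cyclic_on_orbit'[OF this]
  show ?thesis using orbit_cyclic_eq3[OF c assms(3)] orbit_cyclic_eq3[OF c assms(4)] by simp
qed

text \<open>Removing the letter \<open>s\<close> shortens its cycle and leaves all others alone, so the count changes only
if \<open>s\<close> was a fixed point.\<close>

theorem cyc0_remove:
  assumes "\<alpha> permutes A" "finite A" "s \<in> A" "s \<noteq> 0"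
  shows "cyc0 A \<alpha> = cyc0 (A - {s}) (skip {s} \<alpha>) + (if \<alpha> s = s then 1 else 0)"
proof -
  have inj: "inj \<alpha>" using assms(1) by (rule permutes_inj)
  have perm: "permutation \<alpha>" using permutes_imp_permutation[OF assms(2,1)] .
  have self: "x \<in> orbit \<alpha> x" for x using perm by (rule permutation_self_in_orbit)
  let ?O = "{c \<in> orbit \<alpha> ` A. 0 \<notin> c}"
  let ?Q = "{c \<in> orbit (skip {s} \<alpha>) ` (A - {s}). 0 \<notin> c}"
  show ?thesis
  proof (cases "\<alpha> s = s")
    case True
    then have sk: "skip {s} \<alpha> = \<alpha>" using inj by (rule skip_single_fixed[rotated])
    have os: "orbit \<alpha> s = {s}" using True by (simp add: orbit_eq_singleton_iff)
    have "?O = insert {s} ?Q" using os assms(3,4) unfolding sk by auto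
    moreover have "{s} \<notin> ?Q" using self unfolding sk by auto
    moreover have "finite ?Q" using assms(2) by auto
    ultimately show ?thesis using True by (simp add: cyc0_def)
  next
    case False
    have o: "orbit (skip {s} \<alpha>) x = orbit \<alpha> x - {s}" if "x \<noteq> s" for x
      using orbit_skip_single[OF inj False that] .
    have os: "orbit \<alpha> s = orbit \<alpha> (\<alpha> s)"
      using orbits_eq[OF assms(1,2) orbit.base[of \<alpha> s] self] .
    have as: "\<alpha> s \<in> A" using assms by (simp add: permutes_in_image)
    have rep: "\<exists>x\<in>A - {s}. c = orbit \<alpha> x" if "c \<in> orbit \<alpha> ` A" for c
    proof -
      obtain x where x: "x \<in> A" "c = orbit \<alpha> x" using \<open>c \<in> orbit \<alpha> ` A\<close> by blast
      show ?thesis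
      proof (cases "x = s")
        case True
        then have "c = orbit \<alpha> (\<alpha> s)" using x(2) os by (rule_tac trans) simp_all
        moreover have "\<alpha> s \<in> A - {s}" using as False by blast
        ultimately show ?thesis by blast
      next
        case False
        with x show ?thesis by blast
      qed
    qed
    have "bij_betw (\<lambda>c. c - {s}) ?O ?Q"
    proof (rule bij_betwI')
      fix c d assume cd: "c \<in> ?O" "d \<in> ?O"
      obtain x where x: "x \<in> A - {s}" "c = orbit \<alpha> x" using rep[of c] cd(1) by blast
      obtain y where y: "y \<in> A - {s}" "d = orbit \<alpha> y" using rep[of d] cd(2) by blast
      note xy = x y
      show "(c - {s} = d - {s}) = (c = d)"
      proof
        assume eq: "c - {s} = d - {s}"
        have "x \<in> c" using self[of x] unfolding xy(2) .
        then have "x \<in> d" using eq xy(1) by blast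
        then show "c = d" unfolding xy(2,4) by (rule orbits_eq[OF assms(1,2) self])
      qed simp
    next
      fix c assume c: "c \<in> ?O"
      then obtain x where x: "x \<in> A - {s}" "c = orbit \<alpha> x" using rep[of c] by blast
      then have "c - {s} = orbit (skip {s} \<alpha>) x" using o[of x] by blast
      then show "c - {s} \<in> ?Q" using c x(1) by blast
    next
      fix d assume d: "d \<in> ?Q"
      then obtain x where x: "x \<in> A - {s}" "d = orbit (skip {s} \<alpha>) x" by blast
      then have "d = orbit \<alpha> x - {s}" using o[of x] by blast
      moreover have "orbit \<alpha> x \<in> ?O" using calculation d x(1) assms(4) by blast
      ultimately show "\<exists>c\<in>?O. d = c - {s}" by blast
    qed
    from bij_betw_same_card[OF this] show ?thesis using False by (simp add: cyc0_def)
  qed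
qed

lemma cyc0_base [simp]:
  assumes "\<alpha> 0 = 0"
  shows "cyc0 {0} \<alpha> = 0"
proof -
  have "orbit \<alpha> 0 = {0}" using assms by (simp add: orbit_eq_singleton_iff)
  then have "{c \<in> orbit \<alpha> ` {0}. 0 \<notin> c} = {}" by auto
  then show ?thesis unfolding cyc0_def by (metis card.empty)
qed

text \<open>Every permutation of a finite set containing \<open>0\<close> is reduced to the identity of \<open>{0}\<close> by removing one letter
at a time. All facts about the number of cycles below follow by this induction.\<close>

lemma permutes_remove_induct [consumes 3, case_names base remove]:
  assumes "\<alpha> permutes A" "finite A" "0 \<in> A"
    and base: "P {0} id"
    and remove: "\<And>A \<alpha> s. \<alpha> permutes A \<Longrightarrow> finite A \<Longrightarrow> 0 \<in> A \<Longrightarrow> s \<in> A \<Longrightarrow> s \<noteq> (0::nat) \<Longrightarrow>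
      P (A - {s}) (skip {s} \<alpha>) \<Longrightarrow> P A \<alpha>"
  shows "P A \<alpha>"
  using assms(1-3)
proof (induction "card A" arbitrary: A \<alpha> rule: less_induct)
  case less
  show ?case
  proof (cases "A = {0}")
    case True
    then have "\<alpha> = id" using less.prems by simp
    then show ?thesis using base True by simp
  next
    case False
    then obtain s where s: "s \<in> A" "s \<noteq> 0" using less.prems by blast
    have "P (A - {s}) (skip {s} \<alpha>)"
      by (rule less.hyps) (use s less.prems skip_permutes[OF less.prems(1,2)]
          card_Diff1_less[OF less.prems(2) s(1)] in auto)
    then show ?thesis using remove less.prems s by blast
  qed
qed

lemma cyc0_less:
  assumes "\<alpha> permutes A" "finite A" "0 \<in> A"
  shows "cyc0 A \<alpha> < card A"
  using assms
proof (induction rule: permutes_remove_induct)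
  case base show ?case by simp
next
  case (remove A \<alpha> s)
  have "0 < card A" using remove by (auto simp: card_gt_0_iff)
  then show ?case using remove cyc0_remove[OF remove(1,2,4,5)] by (auto simp: card_Diff_singleton)
qed

lemma sign_cyc0:
  assumes "\<alpha> permutes A" "finite A" "0 \<in> A"
  shows "sign \<alpha> = (-1) ^ (cyc0 A \<alpha> + card A + 1)"
  using assms
proof (induction rule: permutes_remove_induct)
  case base show ?case by simp
next
  case (remove A \<alpha> s)
  have c: "card A = Suc (card (A - {s}))" using remove by (metis card.remove)
  have i: "inj \<alpha>" using remove.hyps(1) by (rule permutes_inj)
  have p: "permutation \<alpha>" using permutes_imp_permutation[OF remove.hyps(2,1)] .
  have "sign (skip {s} \<alpha>) = (if \<alpha> s = s then sign \<alpha> else - sign \<alpha>)"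
    using i p by (auto simp: skip_single sign_compose permutation_swap_id sign_swap_id)
  then show ?case using remove.IH cyc0_remove[OF remove(1,2,4,5)] unfolding c
    by (auto split: if_splits)
qed

text \<open>Each cycle chooses one colour; the summand \<open>1\<close> accounts for the cycle of \<open>0\<close>, which \<open>cyc0\<close>
does not count.\<close>

lemma card_colourings:
  fixes K :: "'k set"
  assumes "\<alpha> permutes A" "finite A" "0 \<in> A" "finite K"
  shows "card {f \<in> A \<rightarrow>\<^sub>E K. \<forall>x\<in>A. f (\<alpha> x) = f x} = card K ^ (cyc0 A \<alpha> + 1)"
  using assms(1-3)
proof (induction rule: permutes_remove_induct)
  case base
  have "card {f \<in> {0::nat} \<rightarrow>\<^sub>E K. \<forall>x\<in>{0}. f (id x) = f x} = card ({0::nat} \<rightarrow>\<^sub>E K)"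
    by (intro arg_cong[of _ _ card]) auto
  then show ?case by (simp add: card_PiE)
next
  case (remove A \<alpha> s)
  let ?F = "\<lambda>A \<alpha>. {f \<in> A \<rightarrow>\<^sub>E K. \<forall>x\<in>A. f (\<alpha> x) = f x}"
  have i: "inj \<alpha>" using remove.hyps(1) by (rule permutes_inj)
  have ins: "insert s (A - {s}) = A" using remove by auto
  have inA: "\<alpha> x \<in> A \<longleftrightarrow> x \<in> A" for x using permutes_in_image[OF remove.hyps(1)] .
  have b: "skip {s} \<alpha> y = (if \<alpha> y = s then \<alpha> s else \<alpha> y)" if "y \<noteq> s" for y
    using that i by (auto simp: skip_single Transposition.transpose_def dest: injD)
  have upd: "f(s := f s) = f" for f :: "nat \<Rightarrow> 'k" by simp
  show ?case
  proof (cases "\<alpha> s = s")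
    case True
    have ns: "\<alpha> x \<noteq> s" if "x \<noteq> s" for x using that i True by (metis injD)
    have "bij_betw (\<lambda>(f, k). f(s := k)) (?F (A - {s}) (skip {s} \<alpha>) \<times> K) (?F A \<alpha>)"
    proof (rule bij_betw_byWitness[where f' = "\<lambda>g. (g(s := undefined), g s)"])
      show "(\<lambda>(f, k). f(s := k)) ` (?F (A - {s}) (skip {s} \<alpha>) \<times> K) \<subseteq> ?F A \<alpha>"
        unfolding skip_single_fixed[OF i True]
        using ns True remove(4) by (auto simp: PiE_def extensional_def Pi_def)
      show "(\<lambda>g. (g(s := undefined), g s)) ` ?F A \<alpha> \<subseteq> ?F (A - {s}) (skip {s} \<alpha>) \<times> K"
        unfolding skip_single_fixed[OF i True]
        using ns True remove(4) by (auto simp: PiE_def extensional_def Pi_def; metis)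
    qed (auto simp: PiE_def extensional_def fun_eq_iff)
    from bij_betw_same_card[OF this]
    have "card (?F A \<alpha>) = card (?F (A - {s}) (skip {s} \<alpha>)) * card K"
      by (simp add: card_cartesian_product)
    then show ?thesis using remove.IH cyc0_remove[OF remove(1,2,4,5)] True by simp
  next
    case False
    have "bij_betw (\<lambda>f. f(s := f (\<alpha> s))) (?F (A - {s}) (skip {s} \<alpha>)) (?F A \<alpha>)"
    proof (rule bij_betw_byWitness[where f' = "\<lambda>g. g(s := undefined)"])
      show "\<forall>g\<in>?F A \<alpha>. (g(s := undefined))(s := (g(s := undefined)) (\<alpha> s)) = g"
        using False remove(4) by (auto simp: fun_eq_iff)
      show "(\<lambda>f. f(s := f (\<alpha> s))) ` ?F (A - {s}) (skip {s} \<alpha>) \<subseteq> ?F A \<alpha>"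
      proof
        fix g assume "g \<in> (\<lambda>f. f(s := f (\<alpha> s))) ` ?F (A - {s}) (skip {s} \<alpha>)"
        then obtain f where f: "f \<in> (A - {s}) \<rightarrow>\<^sub>E K" "\<forall>x\<in>A - {s}. f (skip {s} \<alpha> x) = f x"
          and g: "g = f(s := f (\<alpha> s))" by blast
        have "g \<in> A \<rightarrow>\<^sub>E K"
          using f False inA[of s] remove(4) by (auto simp: g PiE_def extensional_def Pi_def)
        moreover have "g (\<alpha> x) = g x" if "x \<in> A" for x
        proof (cases "x = s")
          case False
          then have "f (skip {s} \<alpha> x) = f x" using f(2) that by blast
          then show ?thesis using b[OF False] \<open>\<alpha> s \<noteq> s\<close> False by (auto simp: g split: if_splits)
        qed (use False in \<open>simp add: g\<close>)
        ultimately show "g \<in> ?F A \<alpha>" by blast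
      qed
      show "(\<lambda>g. g(s := undefined)) ` ?F A \<alpha> \<subseteq> ?F (A - {s}) (skip {s} \<alpha>)"
      proof
        fix f assume "f \<in> (\<lambda>g. g(s := undefined)) ` ?F A \<alpha>"
        then obtain g where g: "g \<in> A \<rightarrow>\<^sub>E K" "\<forall>x\<in>A. g (\<alpha> x) = g x"
          and f: "f = g(s := undefined)" by blast
        have "f \<in> (A - {s}) \<rightarrow>\<^sub>E K"
          using g by (auto simp: f PiE_def extensional_def Pi_def)
        moreover have "f (skip {s} \<alpha> x) = f x" if "x \<in> A" "x \<noteq> s" for x
        proof -
          have "skip {s} \<alpha> x \<noteq> s" using b[of x] that False by auto
          moreover have "g (skip {s} \<alpha> x) = g x"
            using g(2) b[of x] that remove(4) by (cases "\<alpha> x = s") (metis, simp)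
          ultimately show ?thesis using that by (simp add: f)
        qed
        ultimately show "f \<in> ?F (A - {s}) (skip {s} \<alpha>)" by blast
      qed
    qed (use False in \<open>auto simp: PiE_def extensional_def fun_eq_iff\<close>)
    from bij_betw_same_card[OF this] have "card (?F A \<alpha>) = card (?F (A - {s}) (skip {s} \<alpha>))"
      by simp
    then show ?thesis using remove.IH cyc0_remove[OF remove(1,2,4,5)] False by simp
  qed
qed

lemma cyc0_map_permutation:
  assumes "\<alpha> permutes A" "finite A" "0 \<in> A" "inj_on f A" "f 0 = 0"
  shows "cyc0 (f ` A) (map_permutation A f \<alpha>) = cyc0 A \<alpha>"
proof -
  have m: "map_permutation A f \<alpha> permutes f ` A"
    by (rule map_permutation_permutes) (use assms in \<open>auto simp: bij_betw_def\<close>)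
  have o: "orbit (map_permutation A f \<alpha>) (f x) = f ` orbit \<alpha> x" if "x \<in> A" for x
  proof -
    have inA: "\<alpha> y \<in> A" if "y \<in> A" for y using permutes_in_image[OF assms(1)] that by simp
    have "y \<in> A \<and> f y \<in> orbit (map_permutation A f \<alpha>) (f x)" if "y \<in> orbit \<alpha> x" for y
      using that
    proof induction
      case base
      have "map_permutation A f \<alpha> (f x) = f (\<alpha> x)" using \<open>x \<in> A\<close> assms(4) by (rule map_permutation_apply[rotated])
      then show ?case using \<open>x \<in> A\<close> inA orbit.base[of "map_permutation A f \<alpha>" "f x"] by simp
    next
      case (step y)
      have "map_permutation A f \<alpha> (f y) = f (\<alpha> y)" using step assms(4) by (simp add: map_permutation_apply)
      then show ?case using step inA orbit.step[of "f y" "map_permutation A f \<alpha>" "f x"] by simp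
    qed
    moreover have "\<exists>z\<in>orbit \<alpha> x. z \<in> A \<and> y = f z" if "y \<in> orbit (map_permutation A f \<alpha>) (f x)" for y
      using that
    proof induction
      case base
      show ?case using \<open>x \<in> A\<close> inA assms(4) by (intro bexI[of _ "\<alpha> x"]) (auto simp: map_permutation_apply orbit.base)
    next
      case (step y)
      then obtain z where "z \<in> orbit \<alpha> x" "z \<in> A" "y = f z" by blast
      then show ?case using inA assms(4) by (intro bexI[of _ "\<alpha> z"]) (auto simp: map_permutation_apply orbit.step)
    qed
    ultimately show ?thesis by auto
  qed
  have sub: "c \<subseteq> A" if "c \<in> orbit \<alpha> ` A" for c
    using that permutes_orbit_subset[OF assms(1)] by auto
  have "bij_betw ((`) f) {c \<in> orbit \<alpha> ` A. 0 \<notin> c} {c \<in> orbit (map_permutation A f \<alpha>) ` f ` A. 0 \<notin> c}"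
  proof (rule bij_betw_imageI)
    show "inj_on ((`) f) {c \<in> orbit \<alpha> ` A. 0 \<notin> c}"
      by (rule inj_on_subset[OF inj_on_image_Pow[OF assms(4)]]) (use sub in blast)
    have z: "0 \<in> f ` c \<longleftrightarrow> 0 \<in> c" if "c \<subseteq> A" for c
      using inj_on_image_mem_iff[OF assms(4,3) that] assms(5) by simp
    show "(`) f ` {c \<in> orbit \<alpha> ` A. 0 \<notin> c} = {c \<in> orbit (map_permutation A f \<alpha>) ` f ` A. 0 \<notin> c}"
    proof -
      have "orbit (map_permutation A f \<alpha>) ` f ` A = (`) f ` (orbit \<alpha> ` A)"
        unfolding image_image by (rule image_cong[OF refl]) (rule o)
      moreover have "0 \<in> f ` orbit \<alpha> x \<longleftrightarrow> 0 \<in> orbit \<alpha> x" if "x \<in> A" for x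
        using z[OF sub[of "orbit \<alpha> x"]] that by blast
      ultimately show ?thesis by (simp add: image_Collect) blast
    qed
  qed
  from bij_betw_same_card[OF this] show ?thesis unfolding cyc0_def by simp
qed

text \<open>The contraction only loses the cycles inside \<open>S\<close>, and these are the same for \<open>\<alpha>\<close> and \<open>\<tau> \<circ> \<alpha>\<close>. The equation
is written with sums because \<open>cyc0\<close> has values in the natural numbers.\<close>

lemma cyc0_skip_comp_left:
  assumes "\<alpha> permutes A" "finite A" "\<tau> permutes A" "S \<subseteq> A" "0 \<notin> S" "\<And>x. x \<in> S \<Longrightarrow> \<tau> x = x"
  shows "cyc0 A (\<tau> \<circ> \<alpha>) + cyc0 (A - S) (skip S \<alpha>) = cyc0 (A - S) (\<tau> \<circ> skip S \<alpha>) + cyc0 A \<alpha>"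
  using finite_subset[OF assms(4,2)] assms(4-6)
proof (induction S rule: finite_induct)
  case (insert s S)
  let ?a = "skip S \<alpha>"
  have p: "?a permutes A - S" using skip_permutes[OF assms(1,2) insert.hyps(1)] .
  have t: "\<tau> permutes A - S" by (rule permutes_superset[OF assms(3)]) (use insert.prems in auto)
  have fx: "\<tau> (?a s) = s \<longleftrightarrow> ?a s = s"
    using insert.prems permutes_inj[OF assms(3)] by (metis injD insertI1)
  have s: "s \<in> A - S" "s \<noteq> 0" using insert by auto
  have A: "A - S - {s} = A - insert s S" by auto
  have "cyc0 (A - S) (\<tau> \<circ> ?a) + cyc0 (A - insert s S) (skip (insert s S) \<alpha>)
      = cyc0 (A - insert s S) (\<tau> \<circ> skip (insert s S) \<alpha>) + cyc0 (A - S) ?a"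
    using cyc0_remove[OF p _ s] cyc0_remove[OF permutes_compose[OF p t] _ s] fx assms(2)
      skip_comp_left[OF p _ t, of "{s}"] insert.prems skip_insert[OF assms(1,2) insert.hyps]
    unfolding A by auto
  moreover have "cyc0 A (\<tau> \<circ> \<alpha>) + cyc0 (A - S) ?a = cyc0 (A - S) (\<tau> \<circ> ?a) + cyc0 A \<alpha>"
    by (rule insert.IH) (use insert.prems in auto)
  ultimately show ?case by linarith
qed simp

definition char_sign :: "real \<Rightarrow> (nat \<Rightarrow> nat) \<Rightarrow> real" where
  "char_sign q \<alpha> = (if q > 0 then 1 else of_int (sign \<alpha>))"

text \<open>The sign that \<open>q = -1/N\<close> contributes is the sign of the permutation, because
\<open>n - cyc0 {0..n} \<alpha>\<close> is the minimal number of transpositions needed to write \<open>\<alpha>\<close>.\<close>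

lemma chi_colourings:
  assumes "N \<ge> 1" "q = 1 / real N \<or> q = - 1 / real N" "\<alpha> permutes {0..n}"
  shows "chi q n \<alpha> = char_sign q \<alpha> / real N ^ (n + 1)
    * real (card {f \<in> {0..n} \<rightarrow>\<^sub>E {..<N}. \<forall>x\<in>{0..n}. f (\<alpha> x) = f x})"
proof -
  let ?c = "cyc0 {0..n} \<alpha>"
  have "?c < card {0..n}" by (rule cyc0_less) (use assms in auto)
  then have c: "?c \<le> n" by simp
  have card: "card {f \<in> {0..n} \<rightarrow>\<^sub>E {..<N}. \<forall>x\<in>{0..n}. f (\<alpha> x) = f x} = N ^ (?c + 1)"
    using card_colourings[OF assms(3), of "{..<N}"] by simp
  have N: "real N ^ (n + 1) = real N ^ (n - ?c) * real N ^ (?c + 1)"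
    using c by (simp flip: power_add)
  have s: "sign \<alpha> = (-1) ^ (n - ?c)"
  proof -
    have "even (?c + card {0..n} + 1) = even (n - ?c)" using c by auto
    then show ?thesis using sign_cyc0[OF assms(3)]
      by (metis atLeastAtMost_iff finite_atLeastAtMost le0 minus_one_power_iff)
  qed
  from assms(2) show ?thesis
  proof
    assume q: "q = 1 / real N"
    then have "q > 0" using assms(1) by simp
    moreover have "q ^ (n - ?c) = 1 / real N ^ (n - ?c)" unfolding q by (rule power_one_over)
    ultimately show ?thesis using assms(1) unfolding card N
      by (simp add: chi_def char_sign_def)
  next
    assume q: "q = - 1 / real N"
    then have "\<not> q > 0" using assms(1) by simp
    moreover have "q ^ (n - ?c) = (-1) ^ (n - ?c) / real N ^ (n - ?c)"
      unfolding q by (rule power_divide)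
    ultimately show ?thesis using assms(1) s unfolding card N
      by (simp add: chi_def char_sign_def)
  qed
qed

declare upt_Suc [simp del]

section \<open>Linear and multilinear maps\<close>

abbreviation cmodule :: "(complex \<Rightarrow> 'v \<Rightarrow> 'v::ab_group_add) \<Rightarrow> bool" where
  "cmodule \<equiv> Modules.module"

abbreviation lin :: "(complex \<Rightarrow> 'v \<Rightarrow> 'v::ab_group_add) \<Rightarrow> (complex \<Rightarrow> 'w \<Rightarrow> 'w::ab_group_add) \<Rightarrow> ('v \<Rightarrow> 'w) \<Rightarrow> bool" where
  "lin \<equiv> Modules.module_hom"

lemma module_tscale: "cmodule tscale"
proof
  fix a b :: complex and x y :: "'a tens"
  show "tscale a (x + y) = tscale a x + tscale a y"
    by transfer (simp only: Modules.module.scale_right_distrib[OF module_fscale] tens_eq_refl)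
  show "tscale (a + b) x = tscale a x + tscale b x"
    by transfer (simp only: Modules.module.scale_left_distrib[OF module_fscale] tens_eq_refl)
  show "tscale a (tscale b x) = tscale (a * b) x"
    by transfer (simp only: Modules.module.scale_scale[OF module_fscale] tens_eq_refl)
  show "tscale 1 x = x"
    by transfer (simp only: Modules.module.scale_one[OF module_fscale] tens_eq_refl)
qed

interpretation ts: Modules.module tscale by (rule module_tscale)

lemma lookup_pscale: "Poly_Mapping.lookup (pscale c \<xi>) k = tscale c (Poly_Mapping.lookup \<xi> k)"
  by (simp add: pscale_def Poly_Mapping.map.rep_eq when_def)

lemma module_pscale: "cmodule pscale"
  by standard (rule poly_mapping_eqI, simp add: lookup_pscale lookup_add ts.scale_right_distrib
      ts.scale_left_distrib)+

interpretation ps: Modules.module pscale by (rule module_pscale)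

lemma module_mult: "cmodule ((*) :: complex \<Rightarrow> complex \<Rightarrow> complex)"
  by standard (simp_all add: algebra_simps)

lemma module_cnj: "cmodule (\<lambda>c z. cnj c * z)"
  by standard (simp_all add: algebra_simps)

lemma linI:
  assumes "cmodule s1" "cmodule s2" "\<And>x y. f (x + y) = f x + f y" "\<And>c x. f (s1 c x) = s2 c (f x)"
  shows "lin s1 s2 f"
  using assms by (simp add: Modules.module_hom_iff)

lemma linD:
  assumes "lin s1 s2 f"
  shows "cmodule s1" "cmodule s2" "f (x + y) = f x + f y" "f (s1 c x) = s2 c (f x)" "f 0 = 0"
    "f (x - y) = f x - f y" "f (- x) = - f x" "f (sum g I) = (\<Sum>i\<in>I. f (g i))"
  using assms Modules.module_hom.zero[OF assms] Modules.module_hom.diff[OF assms] Modules.module_hom.neg[OF assms]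
    Modules.module_hom.sum[OF assms] by (auto simp: Modules.module_hom_iff)

lemma lin_eq_span:
  assumes "lin s1 s2 f" "lin s1 s2 g" "x \<in> Modules.module.span s1 B" "\<And>x. x \<in> B \<Longrightarrow> f x = g x"
  shows "f x = g x"
proof -
  have "Modules.module_pair s1 s2" using linD(1,2)[OF assms(1)] by (simp add: Modules.module_pair_def)
  from Modules.module_pair.module_hom_eq_on_span[OF this assms(1,2) assms(4) assms(3)] show ?thesis .
qed

lemma lin_zero:
  "cmodule s1 \<Longrightarrow> cmodule s2 \<Longrightarrow> lin s1 s2 (\<lambda>x. 0)"
  by (simp add: Modules.module_hom_iff Modules.module.scale_zero_right)

lemma lin_add:
  "lin s1 s2 f \<Longrightarrow> lin s1 s2 g \<Longrightarrow> lin s1 s2 (\<lambda>x. f x + g x)"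
  by (auto simp: Modules.module_hom_iff Modules.module.scale_right_distrib)

lemma lin_scale:
  "lin s1 s2 f \<Longrightarrow> lin s1 s2 (\<lambda>x. s2 c (f x))"
  by (auto simp: Modules.module_hom_iff Modules.module.scale_scale Modules.module.scale_right_distrib ac_simps)

lemma lin_sum:
  "cmodule s1 \<Longrightarrow> cmodule s2 \<Longrightarrow> (\<And>i. i \<in> I \<Longrightarrow> lin s1 s2 (f i)) \<Longrightarrow> lin s1 s2 (\<lambda>x. \<Sum>i\<in>I. f i x)"
  by (induction I rule: infinite_finite_induct) (auto intro: lin_zero lin_add)

lemma lin_comp:
  "lin s1 s2 f \<Longrightarrow> lin s2 s3 g \<Longrightarrow> lin s1 s3 (\<lambda>x. g (f x))"
  by (auto simp: Modules.module_hom_iff)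

text \<open>Multilinearity is over the reals in the letters even though the target is a complex module, which
is what extension to the complexified tensor power requires.\<close>

definition mlin_on :: "(complex \<Rightarrow> 'v \<Rightarrow> 'v) \<Rightarrow> nat \<Rightarrow> ('h::real_vector list \<Rightarrow> 'v::ab_group_add) \<Rightarrow> bool" where
  "mlin_on scl n f \<longleftrightarrow> (\<forall>hs p a b x y. length hs = n \<longrightarrow> p < n \<longrightarrow>
     f (hs[p := a *\<^sub>R x + b *\<^sub>R y]) = scl (of_real a) (f (hs[p := x])) + scl (of_real b) (f (hs[p := y])))"

definition mlin :: "(complex \<Rightarrow> 'v \<Rightarrow> 'v) \<Rightarrow> ('h::real_vector list \<Rightarrow> 'v::ab_group_add) \<Rightarrow> bool" where
  "mlin scl f \<longleftrightarrow> (\<forall>n. mlin_on scl n f)"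

lemma mlin_onI:
  assumes "\<And>hs p a b x y. length hs = n \<Longrightarrow> p < n \<Longrightarrow>
     f (hs[p := a *\<^sub>R x + b *\<^sub>R y]) = scl (of_real a) (f (hs[p := x])) + scl (of_real b) (f (hs[p := y]))"
  shows "mlin_on scl n f"
  using assms by (simp add: mlin_on_def)

lemma mlin_onD:
  assumes "mlin_on scl n f" "length hs = n" "p < n"
  shows "f (hs[p := a *\<^sub>R x + b *\<^sub>R y]) = scl (of_real a) (f (hs[p := x])) + scl (of_real b) (f (hs[p := y]))"
  using assms by (simp add: mlin_on_def)

lemma mlin_on_cong:
  assumes "\<And>hs. length hs = n \<Longrightarrow> f hs = g hs"
  shows "mlin_on scl n f \<longleftrightarrow> mlin_on scl n g"
  using assms by (simp add: mlin_on_def)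

lemma mlin_on_hom:
  assumes "mlin_on s1 n f" "lin s1 s2 T"
  shows "mlin_on s2 n (\<lambda>hs. T (f hs))"
  by (rule mlin_onI) (simp add: mlin_onD[OF assms(1)] linD[OF assms(2)])

lemma mlin_on_sum:
  fixes f :: "'i \<Rightarrow> 'h::real_vector list \<Rightarrow> 'v::ab_group_add"
  assumes "cmodule scl" "\<And>i. i \<in> I \<Longrightarrow> mlin_on scl n (f i)"
  shows "mlin_on scl n (\<lambda>hs. \<Sum>i\<in>I. f i hs)"
proof (rule mlin_onI)
  fix hs :: "'h list" and p a b x y assume *: "length hs = n" "p < n"
  have "(\<Sum>i\<in>I. f i (hs[p := a *\<^sub>R x + b *\<^sub>R y])) =
     (\<Sum>i\<in>I. scl (of_real a) (f i (hs[p := x])) + scl (of_real b) (f i (hs[p := y])))"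
    by (rule sum.cong[OF refl]) (rule mlin_onD[OF assms(2) *])
  then show "(\<Sum>i\<in>I. f i (hs[p := a *\<^sub>R x + b *\<^sub>R y])) =
     scl (of_real a) (\<Sum>i\<in>I. f i (hs[p := x])) + scl (of_real b) (\<Sum>i\<in>I. f i (hs[p := y]))"
    by (simp add: sum.distrib Modules.module.scale_sum_right[OF assms(1)])
qed

lemma mlin_on_scale:
  assumes "cmodule scl" "mlin_on scl n f"
  shows "mlin_on scl n (\<lambda>hs. scl c (f hs))"
  by (rule mlin_on_hom[OF assms(2)]) (simp add: Modules.module.module_hom_scale_self assms(1))

lemma mlinI: "(\<And>n. mlin_on scl n f) \<Longrightarrow> mlin scl f"
  by (simp add: mlin_def)

lemma mlin_if_length:
  assumes "cmodule scl" "mlin_on scl n f"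
  shows "mlin scl (\<lambda>hs. if length hs = n then f hs else 0)"
proof (rule mlinI)
  fix m
  show "mlin_on scl m (\<lambda>hs. if length hs = n then f hs else 0)"
    by (cases "m = n")
      (use assms(2) Modules.module.scale_zero_right[OF assms(1)] in \<open>simp_all add: mlin_on_def\<close>)
qed

section \<open>Linear extension from words\<close>

definition fext :: "(complex \<Rightarrow> 'v \<Rightarrow> 'v) \<Rightarrow> ('h list \<Rightarrow> 'v::comm_monoid_add) \<Rightarrow> ('h list \<Rightarrow>\<^sub>0 complex) \<Rightarrow> 'v" where
  "fext scl f p = (\<Sum>hs \<in> Poly_Mapping.keys p. scl (Poly_Mapping.lookup p hs) (f hs))"

lemma fext_superset:
  assumes "cmodule scl" "finite K" "Poly_Mapping.keys p \<subseteq> K"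
  shows "fext scl f p = (\<Sum>hs \<in> K. scl (Poly_Mapping.lookup p hs) (f hs))"
  unfolding fext_def
  by (rule sum.mono_neutral_left)
    (use assms in \<open>auto simp: in_keys_iff Modules.module.scale_zero_left\<close>)

lemma fext_hom:
  assumes "cmodule scl"
  shows "lin fscale scl (fext scl f)"
proof (rule linI[OF module_fscale assms])
  fix x y :: "'b list \<Rightarrow>\<^sub>0 complex" and c
  let ?K = "Poly_Mapping.keys x \<union> Poly_Mapping.keys y"
  have k: "Poly_Mapping.keys (x + y) \<subseteq> ?K" by (rule keys_add)
  show "fext scl f (x + y) = fext scl f x + fext scl f y"
    using fext_superset[OF assms _ k] fext_superset[OF assms, of ?K x] fext_superset[OF assms, of ?K y]
    by (simp add: lookup_add Modules.module.scale_left_distrib[OF assms] sum.distrib)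
  have k: "Poly_Mapping.keys (fscale c x) \<subseteq> Poly_Mapping.keys x"
    by (auto simp: in_keys_iff lookup_fscale)
  show "fext scl f (fscale c x) = scl c (fext scl f x)"
    unfolding fext_superset[OF assms _ k, OF finite_keys]
    by (simp add: fext_def lookup_fscale Modules.module.scale_sum_right[OF assms] Modules.module.scale_scale[OF assms])
qed

lemma fext_single:
  assumes "cmodule scl"
  shows "fext scl f (Poly_Mapping.single hs c) = scl c (f hs)"
  using fext_superset[OF assms, of "{hs}" "Poly_Mapping.single hs c" f] by simp

text \<open>A multilinear map kills the relations that define the tensors, so its linear extension to formal
combinations of words does not see the representative.\<close>

lemma fext_tens_eq:
  assumes "cmodule scl" "mlin scl f" "tens_eq p r"
  shows "fext scl f p = fext scl f r"
proof -
  note h = fext_hom[OF assms(1), of f]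
  have "fext scl f x = 0" if "x \<in> multilinear_rels" for x
  proof -
    obtain us vs a b x' y where x: "x = Poly_Mapping.single (us @ (a *\<^sub>R x' + b *\<^sub>R y) # vs) 1
       - Poly_Mapping.single (us @ x' # vs) (of_real a)
       - Poly_Mapping.single (us @ y # vs) (of_real b)"
      using \<open>x \<in> multilinear_rels\<close> unfolding multilinear_rels_def by blast
    have m: "mlin_on scl (length (us @ x' # vs)) f" using assms(2) by (simp add: mlin_def)
    have "f (us @ (a *\<^sub>R x' + b *\<^sub>R y) # vs) = scl (of_real a) (f (us @ x' # vs)) + scl (of_real b) (f (us @ y # vs))"
      using mlin_onD[OF m refl, of "length us" a x' b y] by simp
    then show ?thesis
      by (simp add: x linD[OF h] fext_single[OF assms(1)] Modules.module.scale_one[OF assms(1)])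
  qed
  then have "fext scl f (p - r) = 0"
    using Modules.module_hom.eq_0_on_span[OF h] assms(3) unfolding tens_eq_def by blast
  then show ?thesis by (simp add: linD[OF h])
qed

lemma tens_ext_abs:
  assumes "cmodule scl" "mlin scl f"
  shows "tens_ext scl f (abs_tens p) = fext scl f p"
proof -
  have "tens_eq (rep_tens (abs_tens p)) p"
    by (metis Quotient3_rel_rep Quotient3_tens Quotient3_abs_rep tens.abs_eq_iff)
  from fext_tens_eq[OF assms this] show ?thesis by (simp add: tens_ext_def fext_def)
qed

lemma abs_tens_surj: "\<exists>p. F = abs_tens p"
  by (metis Quotient3_abs_rep Quotient3_tens)

lemma tens_ext_hom:
  assumes "cmodule scl" "mlin scl f"
  shows "lin tscale scl (tens_ext scl f)"
proof (rule linI[OF module_tscale assms(1)])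
  fix x y :: "'b tens" and c
  note h = fext_hom[OF assms(1), of f]
  obtain p r where pr: "x = abs_tens p" "y = abs_tens r" using abs_tens_surj by metis
  show "tens_ext scl f (x + y) = tens_ext scl f x + tens_ext scl f y"
    unfolding pr plus_tens.abs_eq tens_ext_abs[OF assms] by (rule linD(3)[OF h])
  show "tens_ext scl f (tscale c x) = scl c (tens_ext scl f x)"
    unfolding pr tscale.abs_eq tens_ext_abs[OF assms] by (rule linD(4)[OF h])
qed

lemma tens_ext_simple:
  assumes "cmodule scl" "mlin scl f"
  shows "tens_ext scl f (simple hs) = f hs"
  unfolding simple.abs_eq tens_ext_abs[OF assms] fext_single[OF assms(1)]
  by (rule Modules.module.scale_one[OF assms(1)])

lemma poly_mapping_induct [case_names zero single sum]:
  assumes "P 0" "\<And>k v. P (Poly_Mapping.single k v)" "\<And>f g. P f \<Longrightarrow> P g \<Longrightarrow> P (f + g)"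
  shows "P (p :: 'k \<Rightarrow>\<^sub>0 'v::comm_monoid_add)"
proof -
  have "p = (\<Sum>k\<in>Poly_Mapping.keys p. Poly_Mapping.single k (Poly_Mapping.lookup p k))"
    by (rule poly_mapping_eqI)
      (simp add: lookup_sum lookup_single when_def sum.delta' in_keys_iff)
  moreover have "P (\<Sum>k\<in>K. Poly_Mapping.single k (Poly_Mapping.lookup p k))" if "finite K" for K
    using that by (induction K rule: finite_induct) (auto intro: assms)
  ultimately show ?thesis by (metis finite_keys)
qed

lemma tens_in_span: "F \<in> ts.span (range simple)"
proof -
  obtain p where "F = abs_tens p" using abs_tens_surj by blast
  moreover have "abs_tens p \<in> ts.span (range simple)"
  proof (induction p rule: poly_mapping_induct)
    case zero
    show ?case by (simp add: zero_tens.abs_eq[symmetric] ts.span_zero)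
  next
    case (single k v)
    have "Poly_Mapping.single k v = fscale v (Poly_Mapping.single k 1)"
      by (rule poly_mapping_eqI) (simp add: lookup_fscale lookup_single when_def)
    then have "abs_tens (Poly_Mapping.single k v) = tscale v (simple k)"
      unfolding simple.abs_eq tscale.abs_eq by (rule arg_cong)
    then show ?case by (simp add: ts.span_base ts.span_scale)
  next
    case (sum f g)
    then show ?case unfolding plus_tens.abs_eq[symmetric] by (intro ts.span_add)
  qed
  ultimately show ?thesis by simp
qed

lemma mlin_simple: "mlin_on tscale n simple"
proof (rule mlin_onI)
  fix hs :: "'a list" and p a b x y assume *: "length hs = n" "p < n"
  have upd: "hs[p := z] = take p hs @ z # drop (Suc p) hs" for z
    using * by (simp add: upd_conv_take_nth_drop)
  let ?s = "\<lambda>z. Poly_Mapping.single (hs[p := z]) (1::complex)"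
  have s: "fscale c (?s z) = Poly_Mapping.single (hs[p := z]) c" for c z
    by (rule poly_mapping_eqI) (simp add: lookup_fscale lookup_single when_def)
  have "?s (a *\<^sub>R x + b *\<^sub>R y) - (fscale (of_real a) (?s x) + fscale (of_real b) (?s y)) \<in> multilinear_rels"
    unfolding s unfolding upd multilinear_rels_def diff_diff_eq[symmetric] by blast
  then have "tens_eq (?s (a *\<^sub>R x + b *\<^sub>R y)) (fscale (of_real a) (?s x) + fscale (of_real b) (?s y))"
    unfolding tens_eq_def by (rule Modules.module.span_base[OF module_fscale])
  then show "simple (hs[p := a *\<^sub>R x + b *\<^sub>R y])
      = tscale (of_real a) (simple (hs[p := x])) + tscale (of_real b) (simple (hs[p := y]))"
    by (simp add: simple.abs_eq tscale.abs_eq plus_tens.abs_eq tens.abs_eq_iff)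
qed

text \<open>The element \<open>\<alpha> \<otimes> (h\<^sub>1 \<otimes> ... \<otimes> h\<^sub>n)\<close>, not yet symmetrized.\<close>

definition gen :: "(nat \<Rightarrow> nat) \<Rightarrow> 'h::real_vector list \<Rightarrow> 'h ptens" where
  "gen \<alpha> hs = Poly_Mapping.single \<alpha> (simple hs)"

lemma single_hom: "lin tscale pscale (Poly_Mapping.single \<alpha>)"
  by (rule linI[OF module_tscale module_pscale])
    (rule poly_mapping_eqI, simp add: lookup_pscale lookup_single lookup_add when_def)+

lemma ptens_ext_hom:
  assumes "cmodule scl" "\<And>\<alpha>. mlin scl (f \<alpha>)"
  shows "lin pscale scl (ptens_ext scl f)"
proof -
  note h = tens_ext_hom[OF assms]
  have sup: "ptens_ext scl f \<xi> = (\<Sum>\<alpha> \<in> K. tens_ext scl (f \<alpha>) (Poly_Mapping.lookup \<xi> \<alpha>))"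
    if "finite K" "Poly_Mapping.keys \<xi> \<subseteq> K" for \<xi> K
    unfolding ptens_ext_def
    by (rule sum.mono_neutral_left) (use that in \<open>auto simp: in_keys_iff linD(5)[OF h]\<close>)
  show ?thesis
  proof (rule linI[OF module_pscale assms(1)])
    fix x y :: "'b ptens" and c
    let ?K = "Poly_Mapping.keys x \<union> Poly_Mapping.keys y"
    have k: "Poly_Mapping.keys (x + y) \<subseteq> ?K" by (rule keys_add)
    show "ptens_ext scl f (x + y) = ptens_ext scl f x + ptens_ext scl f y"
      using sup[OF _ k] sup[of ?K x] sup[of ?K y]
      by (simp add: lookup_add linD(3)[OF h] sum.distrib)
    have k: "Poly_Mapping.keys (pscale c x) \<subseteq> Poly_Mapping.keys x"
      by (auto simp: in_keys_iff lookup_pscale)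
    show "ptens_ext scl f (pscale c x) = scl c (ptens_ext scl f x)"
      unfolding sup[OF finite_keys k]
      by (simp add: ptens_ext_def lookup_pscale linD(4)[OF h] Modules.module.scale_sum_right[OF assms(1)])
  qed
qed

lemma ptens_ext_gen:
  assumes "cmodule scl" "\<And>\<alpha>. mlin scl (f \<alpha>)"
  shows "ptens_ext scl f (gen \<alpha> hs) = f \<alpha> hs"
  using tens_ext_simple[OF assms, of \<alpha> hs] linD(5)[OF tens_ext_hom[OF assms], of \<alpha>]
  by (cases "simple hs = 0") (simp_all add: ptens_ext_def gen_def)

lemma ptens_in_span: "\<xi> \<in> ps.span {gen \<alpha> hs | \<alpha> hs. True}"
proof (induction \<xi> rule: poly_mapping_induct)
  case zero
  show ?case by (rule ps.span_zero)
next
  case (single \<alpha> F)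
  have "Poly_Mapping.single \<alpha> ` ts.span (range simple) = ps.span (Poly_Mapping.single \<alpha> ` range simple)"
    by (rule Modules.module_hom.span_image[OF single_hom, symmetric])
  moreover have "\<dots> \<subseteq> ps.span {gen \<alpha> hs | \<alpha> hs. True}"
    by (rule ps.span_mono) (auto simp: gen_def)
  ultimately show ?case using tens_in_span[of F] by blast
next
  case (sum f g)
  then show ?case by (rule ps.span_add)
qed

lemma ptens_hom_eq:
  assumes "lin pscale scl f" "lin pscale scl g" "\<And>\<alpha> hs. f (gen \<alpha> hs) = g (gen \<alpha> hs)"
  shows "f \<xi> = g \<xi>"
  by (rule lin_eq_span[OF assms(1,2) ptens_in_span]) (use assms(3) in auto)

section \<open>Words depending linearly on a letter\<close>

lemma letter_update:
  "p < length hs \<Longrightarrow> 1 \<le> i \<Longrightarrow> letter (hs[p := x]) i = (if i = p + 1 then x else letter hs i)"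
  by (auto simp: nth_list_update)

lemma map_letter_update_notin:
  assumes "p < length hs" "p + 1 \<notin> set L" "\<And>i. i \<in> set L \<Longrightarrow> 1 \<le> i"
  shows "map (letter (hs[p := x])) L = map (letter hs) L"
proof (rule map_cong[OF refl])
  fix i assume "i \<in> set L"
  then have "p \<noteq> i - 1" using assms(2) assms(3)[of i] by auto
  then show "letter (hs[p := x]) i = letter hs i" by simp
qed

lemma map_letter_update:
  assumes "p < length hs" "distinct L" "j < length L" "L ! j = p + 1" "\<And>i. i \<in> set L \<Longrightarrow> 1 \<le> i"
  shows "map (letter (hs[p := x])) L = (map (letter hs) L)[j := x]"
proof (rule nth_equalityI)
  fix i assume i: "i < length (map (letter (hs[p := x])) L)"
  then have "1 \<le> L ! i" using assms(5) by simp
  moreover have "L ! i = p + 1 \<longleftrightarrow> i = j" using assms(2-4) i nth_eq_iff_index_eq[of L i j] by auto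
  ultimately show "map (letter (hs[p := x])) L ! i = (map (letter hs) L)[j := x] ! i"
    using assms(1,3) i by (auto simp: nth_list_update)
qed simp

text \<open>Each position contributes linearly, either through the word or through the
coefficient, but never through both.\<close>

lemma mlin_coeff_word:
  assumes L: "distinct L" "\<And>i. i \<in> set L \<Longrightarrow> 1 \<le> i"
    and lin: "\<And>hs p a b x y. length hs = n \<Longrightarrow> p < n \<Longrightarrow> p + 1 \<notin> set L \<Longrightarrow>
       c (hs[p := a *\<^sub>R x + b *\<^sub>R y]) = a * c (hs[p := x]) + b * c (hs[p := y])"
    and const: "\<And>hs p x. length hs = n \<Longrightarrow> p < n \<Longrightarrow> p + 1 \<in> set L \<Longrightarrow> c (hs[p := x]) = c hs"
  shows "mlin_on tscale n (\<lambda>hs. tscale (of_real (c hs)) (simple (map (letter hs) L)))"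
proof (rule mlin_onI)
  fix hs :: "'a list" and p a b x y assume *: "length hs = n" "p < n"
  let ?f = "\<lambda>hs. tscale (of_real (c hs)) (simple (map (letter hs) L))"
  show "?f (hs[p := a *\<^sub>R x + b *\<^sub>R y])
     = tscale (of_real a) (?f (hs[p := x])) + tscale (of_real b) (?f (hs[p := y]))"
  proof (cases "p + 1 \<in> set L")
    case False
    have "map (letter (hs[p := z])) L = map (letter hs) L" for z
      by (rule map_letter_update_notin) (use * False L in auto)
    then show ?thesis
      unfolding lin[OF * False] by (simp only: of_real_add of_real_mult ts.scale_left_distrib ts.scale_scale)
  next
    case True
    then obtain j where j: "j < length L" "L ! j = p + 1" by (metis in_set_conv_nth)
    have m: "map (letter (hs[p := z])) L = (map (letter hs) L)[j := z]" for z
      by (rule map_letter_update) (use * L j in auto)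
    have "simple ((map (letter hs) L)[j := a *\<^sub>R x + b *\<^sub>R y])
      = tscale (of_real a) (simple ((map (letter hs) L)[j := x])) + tscale (of_real b) (simple ((map (letter hs) L)[j := y]))"
      by (rule mlin_onD[OF mlin_simple refl]) (use j in simp)
    then show ?thesis unfolding m const[OF * True]
      by (simp only: ts.scale_right_distrib ts.scale_scale mult.commute)
  qed
qed

lemma mlin_word:
  assumes "distinct L" "set L = {1..n}"
  shows "mlin_on tscale n (\<lambda>hs. simple (map (letter hs) L))"
proof -
  have "mlin_on tscale n (\<lambda>hs. tscale (of_real 1) (simple (map (letter hs) L)))"
    by (rule mlin_coeff_word) (use assms in auto)
  then show ?thesis by simp
qed

lemma prod_lin:
  assumes "finite D" "i0 \<in> D" "\<And>i x. i \<in> D \<Longrightarrow> i \<noteq> i0 \<Longrightarrow> g i x = g i z"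
    "g i0 (a *\<^sub>R x + b *\<^sub>R y) = a * g i0 x + b * (g i0 y :: real)"
  shows "(\<Prod>i\<in>D. g i (a *\<^sub>R x + b *\<^sub>R y)) = a * (\<Prod>i\<in>D. g i x) + b * (\<Prod>i\<in>D. g i y)"
proof -
  have "(\<Prod>i\<in>D. g i w) = g i0 w * (\<Prod>i\<in>D - {i0}. g i z)" for w
  proof -
    have "(\<Prod>i\<in>D - {i0}. g i w) = (\<Prod>i\<in>D - {i0}. g i z)"
      by (rule prod.cong[OF refl], rule assms(3)) blast+
    then show ?thesis unfolding prod.remove[OF assms(1,2)] by simp
  qed
  note this[of "a *\<^sub>R x + b *\<^sub>R y"] this[of x] this[of y]
  then show ?thesis unfolding assms(4) by (simp add: distrib_right mult.assoc)
qed

text \<open>The list selector is unspecified beyond the end, but the unspecified value depends only on the excess,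
so that maps built from it are still multilinear.\<close>

lemma nth_out_of_range: "length xs \<le> i \<Longrightarrow> xs ! i = [] ! (i - length xs)"
  by (induction xs arbitrary: i) (auto simp: nth_Cons split: nat.splits)

lemma r_plus_hom: "lin tscale tscale (r_plus h)"
  and r_plus_simple: "r_plus h (simple hs) = simple (hs @ [h])"
proof -
  have m: "mlin tscale (\<lambda>hs. simple (hs @ [h]))"
  proof (intro mlinI mlin_onI)
    fix n and hs :: "'a list" and p a b x y assume *: "length hs = n" "p < n"
    have "mlin_on tscale (Suc n) (simple :: 'a list \<Rightarrow> _)" by (rule mlin_simple)
    from mlin_onD[OF this, of "hs @ [h]" p a x b y]
    show "simple (hs[p := a *\<^sub>R x + b *\<^sub>R y] @ [h]) =
       tscale (of_real a) (simple (hs[p := x] @ [h])) + tscale (of_real b) (simple (hs[p := y] @ [h]))"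
      using * by (simp add: list_update_append)
  qed
  show "lin tscale tscale (r_plus h)"
    unfolding r_plus_def by (rule tens_ext_hom[OF module_tscale m])
  show "r_plus h (simple hs) = simple (hs @ [h])"
    unfolding r_plus_def by (rule tens_ext_simple[OF module_tscale m])
qed

lemma map_letter_id: "map (letter hs) [1..<length hs + 1] = hs"
  by (rule nth_equalityI) auto

lemma take_drop_letter:
  assumes "1 \<le> k" "k \<le> length hs"
  shows "take (k - 1) hs @ drop k hs = map (letter hs) (filter (\<lambda>i. i \<noteq> k) [1..<length hs + 1])"
proof -
  have "[1..<length hs + 1] = [1..<k] @ k # [Suc k..<length hs + 1]"
    using upt_add_eq_append[OF assms(1), of "length hs + 1 - k"] upt_conv_Cons[of k "length hs + 1"] assms(2)
    by simp
  moreover have "filter (\<lambda>i. i \<noteq> k) [1..<k] = [1..<k]" "filter (\<lambda>i. i \<noteq> k) [Suc k..<length hs + 1] = [Suc k..<length hs + 1]"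
    by (auto intro: filter_True)
  moreover have "map (letter hs) [1..<k] = take (k - 1) hs"
    by (rule nth_equalityI) (use assms in auto)
  moreover have "map (letter hs) [Suc k..<length hs + 1] = drop k hs"
    by (rule nth_equalityI) (use assms in auto)
  ultimately show ?thesis by simp
qed

lemma r_minus_hom: "1 \<le> k \<Longrightarrow> lin tscale tscale (r_minus k h)"
  and r_minus_simple: "1 \<le> k \<Longrightarrow> r_minus k h (simple hs)
     = tscale (of_real (inner (letter hs k) h)) (simple (take (k - 1) hs @ drop k hs))"
proof -
  assume k: "1 \<le> k"
  let ?f = "\<lambda>hs. tscale (of_real (inner (letter hs k) h)) (simple (take (k - 1) hs @ drop k hs))"
  have m: "mlin tscale ?f"
  proof (rule mlinI)
    fix n
    show "mlin_on tscale n ?f"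
    proof (cases "k \<le> n")
      case True
      let ?L = "filter (\<lambda>i. i \<noteq> k) [1..<n + 1]"
      have "mlin_on tscale n (\<lambda>hs. tscale (of_real (inner (letter hs k) h)) (simple (map (letter hs) ?L)))"
      proof (rule mlin_coeff_word)
        fix hs :: "'a list" and p a b x y assume "length hs = n" "p < n" "p + 1 \<notin> set ?L"
        then have "p = k - 1" by auto
        then show "inner (letter (hs[p := a *\<^sub>R x + b *\<^sub>R y]) k) h =
            a * inner (letter (hs[p := x]) k) h + b * inner (letter (hs[p := y]) k) h"
          using \<open>length hs = n\<close> \<open>p < n\<close> by (simp add: inner_add_left)
      next
        fix hs :: "'a list" and p x assume "length hs = n" "p < n" "p + 1 \<in> set ?L"
        then show "inner (letter (hs[p := x]) k) h = inner (letter hs k) h"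
          using k by (auto simp: nth_list_update)
      qed auto
      then show ?thesis
        using take_drop_letter[OF k, where 'a = 'a] True
        by (subst mlin_on_cong[where g = "\<lambda>hs. tscale (of_real (inner (letter hs k) h)) (simple (map (letter hs) ?L))"]) auto
    next
      case False
      define c where "c = inner (([]::'a list) ! (k - 1 - n)) h"
      have "?f hs = tscale (of_real c) (simple hs)" if "length hs = n" for hs
        using nth_out_of_range[of hs "k - 1"] that False by (simp add: c_def)
      then show ?thesis
        by (subst mlin_on_cong[where g = "\<lambda>hs. tscale (of_real c) (simple hs)"])
          (auto intro: mlin_on_scale[OF module_tscale mlin_simple])
    qed
  qed
  show "lin tscale tscale (r_minus k h)"
    unfolding r_minus_def by (rule tens_ext_hom[OF module_tscale m])
  show "r_minus k h (simple hs) = ?f hs"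
    unfolding r_minus_def by (rule tens_ext_simple[OF module_tscale m])
qed

section \<open>Symmetrized tensors\<close>

definition act :: "(nat \<Rightarrow> nat) \<Rightarrow> 'h list \<Rightarrow> 'h list" where
  "act \<sigma> hs = map (\<lambda>i. letter hs (pinv \<sigma> i)) [1..<length hs + 1]"

lemma length_act [simp]: "length (act \<sigma> hs) = length hs"
  by (simp add: act_def)

lemma U_perm_hom: "\<sigma> permutes {1..n} \<Longrightarrow> lin tscale tscale (U_perm n \<sigma>)"
  and U_perm_simple: "\<sigma> permutes {1..n} \<Longrightarrow>
    U_perm n \<sigma> (simple hs) = (if length hs = n then simple (act \<sigma> hs) else 0)"
proof -
  assume s: "\<sigma> permutes {1..n}"
  let ?f = "\<lambda>hs. if length hs = n then simple (map (\<lambda>i. letter hs (pinv \<sigma> i)) [1..<n+1]) else 0"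
  have p: "pinv \<sigma> permutes {1..n}" using s by (rule permutes_inv)
  have "mlin_on tscale n (\<lambda>hs. simple (map (letter hs) (map (pinv \<sigma>) [1..<n+1])))"
  proof (rule mlin_word)
    show "distinct (map (pinv \<sigma>) [1..<n + 1])"
      using permutes_inj_on[OF p] by (simp add: distinct_map)
    show "set (map (pinv \<sigma>) [1..<n + 1]) = {1..n}"
      using permutes_image[OF p] by (simp add: atLeastLessThanSuc_atLeastAtMost)
  qed
  then have "mlin_on tscale n (\<lambda>hs. simple (map (\<lambda>i. letter hs (pinv \<sigma> i)) [1..<n+1]))"
    by (simp add: o_def)
  from mlin_if_length[OF module_tscale this] have m: "mlin tscale ?f" .
  show "lin tscale tscale (U_perm n \<sigma>)"
    unfolding U_perm_def by (rule tens_ext_hom[OF module_tscale m])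
  show "U_perm n \<sigma> (simple hs) = (if length hs = n then simple (act \<sigma> hs) else 0)"
    unfolding U_perm_def tens_ext_simple[OF module_tscale m] act_def by simp
qed

lemma sym_tensor_hom: "lin tscale pscale (sym_tensor n \<alpha>)"
  unfolding sym_tensor_def
  by (intro lin_scale[where ?s2.0 = pscale] lin_sum module_tscale module_pscale
      lin_comp[OF U_perm_hom single_hom]) simp

lemma sym_tensor_simple:
  "sym_tensor n \<alpha> (simple hs) = (if length hs = n then
     pscale (1 / fact n) (\<Sum>\<sigma> | \<sigma> permutes {1..n}. gen (\<sigma> \<circ> \<alpha> \<circ> pinv \<sigma>) (act \<sigma> hs)) else 0)"
proof -
  have "(\<Sum>\<sigma> | \<sigma> permutes {1..n}. Poly_Mapping.single (\<sigma> \<circ> \<alpha> \<circ> pinv \<sigma>) (U_perm n \<sigma> (simple hs)))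
     = (if length hs = n then (\<Sum>\<sigma> | \<sigma> permutes {1..n}. gen (\<sigma> \<circ> \<alpha> \<circ> pinv \<sigma>) (act \<sigma> hs)) else 0)"
    by (auto simp: U_perm_simple gen_def intro!: sum.cong sum.neutral)
  then show ?thesis by (simp add: sym_tensor_def)
qed

text \<open>The element \<open>\<alpha> \<otimes>\<^sub>s (h\<^sub>1 \<otimes> ... \<otimes> h\<^sub>n)\<close>.\<close>

definition Sgen :: "(nat \<Rightarrow> nat) \<Rightarrow> 'h::real_vector list \<Rightarrow> 'h ptens" where
  "Sgen \<alpha> hs = sym_tensor (length hs) \<alpha> (simple hs)"

lemma Sgen_mlin: "mlin pscale (Sgen \<alpha>)"
proof (rule mlinI)
  fix n
  have "mlin_on pscale n (\<lambda>hs. sym_tensor n \<alpha> (simple hs))"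
    by (rule mlin_on_hom[OF mlin_simple sym_tensor_hom])
  then show "mlin_on pscale n (Sgen \<alpha>)"
    by (subst mlin_on_cong[where g = "\<lambda>hs. sym_tensor n \<alpha> (simple hs)"]) (auto simp: Sgen_def)
qed

lemma symmetrize_hom: "lin pscale pscale symmetrize"
  unfolding symmetrize_def Sgen_def[symmetric]
  by (rule ptens_ext_hom[OF module_pscale]) (simp add: Sgen_mlin)

lemma symmetrize_gen: "symmetrize (gen \<alpha> hs) = Sgen \<alpha> hs"
  unfolding symmetrize_def Sgen_def[symmetric]
  by (rule ptens_ext_gen[OF module_pscale]) (simp add: Sgen_mlin)

lemma Sgen_eq: "Sgen \<alpha> hs = pscale (1 / fact (length hs))
   (\<Sum>\<sigma> | \<sigma> permutes {1..length hs}. gen (\<sigma> \<circ> \<alpha> \<circ> pinv \<sigma>) (act \<sigma> hs))"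
  by (simp add: Sgen_def sym_tensor_simple)

lemma act_act:
  assumes "\<tau> permutes {1..length hs}" "\<sigma> permutes {1..length hs}"
  shows "act \<tau> (act \<sigma> hs) = act (\<tau> \<circ> \<sigma>) hs"
proof (rule nth_equalityI)
  fix i assume "i < length (act \<tau> (act \<sigma> hs))"
  then have i: "i < length hs" by simp
  have b: "bij \<tau>" "bij \<sigma>" using assms permutes_bij by auto
  have "pinv \<tau> (Suc i) \<in> {1..length hs}"
    using permutes_in_image[OF permutes_inv[OF assms(1)]] i by simp
  then have *: "pinv \<tau> (Suc i) - 1 < length hs" "Suc (pinv \<tau> (Suc i) - 1) = pinv \<tau> (Suc i)" by auto
  have "pinv (\<tau> \<circ> \<sigma>) = pinv \<sigma> \<circ> pinv \<tau>" using b by (simp add: o_inv_distrib)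
  then show "act \<tau> (act \<sigma> hs) ! i = act (\<tau> \<circ> \<sigma>) hs ! i"
    using i * by (simp add: act_def)
qed simp

text \<open>Averaging over the symmetric group absorbs a simultaneous relabelling of the permutation and of
the word.\<close>

lemma Sgen_conj:
  assumes "\<sigma> permutes {1..length hs}"
  shows "Sgen (\<sigma> \<circ> \<alpha> \<circ> pinv \<sigma>) (act \<sigma> hs) = Sgen \<alpha> hs"
proof -
  let ?P = "{\<tau>. \<tau> permutes {1..length hs}}"
  let ?g = "\<lambda>\<tau>. gen (\<tau> \<circ> \<alpha> \<circ> pinv \<tau>) (act \<tau> hs)"
  have "(\<Sum>\<tau>\<in>?P. gen (\<tau> \<circ> (\<sigma> \<circ> \<alpha> \<circ> pinv \<sigma>) \<circ> pinv \<tau>) (act \<tau> (act \<sigma> hs))) = (\<Sum>\<tau>\<in>?P. ?g (\<tau> \<circ> \<sigma>))"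
  proof (rule sum.cong[OF refl])
    fix \<tau> assume "\<tau> \<in> ?P"
    then have t: "\<tau> permutes {1..length hs}" by simp
    have "pinv (\<tau> \<circ> \<sigma>) = pinv \<sigma> \<circ> pinv \<tau>"
      using permutes_bij[OF t] permutes_bij[OF assms] by (simp add: o_inv_distrib)
    then show "gen (\<tau> \<circ> (\<sigma> \<circ> \<alpha> \<circ> pinv \<sigma>) \<circ> pinv \<tau>) (act \<tau> (act \<sigma> hs)) = ?g (\<tau> \<circ> \<sigma>)"
      using act_act[OF t assms] by (simp add: comp_assoc)
  qed
  also have "\<dots> = (\<Sum>\<tau>\<in>?P. ?g \<tau>)"
    by (rule sum_permutations_compose_right[OF assms, symmetric]) 
  finally show ?thesis unfolding Sgen_eq length_act by simp
qed

text \<open>The span of all \<open>\<alpha> \<otimes> F\<close> with \<open>\<alpha>\<close> in the group \<open>S0 n\<close> that fits the degree \<open>n\<close> of \<open>F\<close>.\<close>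

definition unsym :: "'h::real_vector ptens set" where
  "unsym = ps.span {gen \<alpha> hs | \<alpha> hs. \<alpha> \<in> S0 (length hs)}"

lemma gen_unsym: "\<alpha> \<in> S0 (length hs) \<Longrightarrow> gen \<alpha> hs \<in> unsym"
  unfolding unsym_def by (rule ps.span_base) blast

lemma conj_S0:
  assumes "\<alpha> \<in> S0 n" "\<sigma> permutes {1..n}"
  shows "\<sigma> \<circ> \<alpha> \<circ> pinv \<sigma> \<in> S0 n"
proof -
  have "\<sigma> permutes {0..n}" by (rule permutes_subset[OF assms(2)]) auto
  then show ?thesis using assms(1) unfolding S0_def mem_Collect_eq
    by (intro permutes_compose permutes_inv)
qed

lemma Sgen_unsym: "\<alpha> \<in> S0 (length hs) \<Longrightarrow> Sgen \<alpha> hs \<in> unsym"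
  unfolding Sgen_eq unfolding unsym_def
  by (intro ps.span_scale ps.span_sum ps.span_base) (auto intro!: exI conj_S0)

lemma rtens_subset: "rtens n \<subseteq> ts.span {simple hs | hs. length hs = n}"
proof -
  have m: "Modules.module (\<lambda>r. tscale (complex_of_real r))"
    by standard (simp_all add: ts.scale_right_distrib ts.scale_left_distrib)
  show ?thesis unfolding rtens_def
    by (rule Modules.module.span_minimal[OF m])
      (auto intro: ts.span_base ts.span_add ts.span_scale ts.span_zero intro!: Modules.module.subspaceI[OF m])
qed

lemma simple_rtens: "simple hs \<in> rtens (length hs)"
proof -
  have m: "Modules.module (\<lambda>r. tscale (complex_of_real r))"
    by standard (simp_all add: ts.scale_right_distrib ts.scale_left_distrib)
  show ?thesis unfolding rtens_def by (rule Modules.module.span_base[OF m]) blast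
qed

lemma TP_eq: "(TP :: 'h::real_vector ptens set) = ps.span {Sgen \<alpha> hs | \<alpha> hs. \<alpha> \<in> S0 (length hs)}"
proof
  show "ps.span {Sgen \<alpha> hs | \<alpha> hs. \<alpha> \<in> S0 (length (hs :: 'h list))} \<subseteq> TP"
    unfolding TP_def
  proof (rule ps.span_mono, clarify)
    fix \<alpha> and hs :: "'h list" assume "\<alpha> \<in> S0 (length hs)"
    then show "\<exists>n \<alpha>' F. Sgen \<alpha> hs = sym_tensor n \<alpha>' F \<and> \<alpha>' \<in> S0 n \<and> F \<in> rtens n"
      unfolding Sgen_def using simple_rtens[of hs] by blast
  qed
  have "sym_tensor n \<alpha> F \<in> ps.span {Sgen \<alpha> hs | \<alpha> hs. \<alpha> \<in> S0 (length hs)}"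
    if "\<alpha> \<in> S0 n" "F \<in> rtens n" for n \<alpha> and F :: "'h tens"
  proof -
    have "F \<in> ts.span {simple hs | hs. length hs = n}" using that rtens_subset by blast
    then have "sym_tensor n \<alpha> F \<in> ps.span (sym_tensor n \<alpha> ` {simple hs | hs. length hs = n})"
      unfolding Modules.module_hom.span_image[OF sym_tensor_hom] by blast
    also have "\<dots> \<subseteq> ps.span {Sgen \<alpha> hs | \<alpha> hs. \<alpha> \<in> S0 (length hs)}"
      by (rule ps.span_mono) (use that in \<open>auto simp: Sgen_def\<close>)
    finally show ?thesis .
  qed
  then show "TP \<subseteq> ps.span {Sgen \<alpha> hs | \<alpha> hs. \<alpha> \<in> S0 (length (hs :: 'h list))}"
    unfolding TP_def by (intro ps.span_minimal) auto
qed

lemma TP_unsym: "TP \<subseteq> unsym"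
  unfolding TP_eq by (rule ps.span_minimal) (auto simp: Sgen_unsym, auto simp: unsym_def)

lemma Sgen_TP: "\<alpha> \<in> S0 (length hs) \<Longrightarrow> Sgen \<alpha> hs \<in> TP"
  unfolding TP_eq by (rule ps.span_base) blast

lemma symmetrize_TP: "\<xi> \<in> unsym \<Longrightarrow> symmetrize \<xi> \<in> TP"
proof -
  assume "\<xi> \<in> unsym"
  then have "symmetrize \<xi> \<in> ps.span (symmetrize ` {gen \<alpha> hs | \<alpha> hs. \<alpha> \<in> S0 (length hs)})"
    unfolding unsym_def Modules.module_hom.span_image[OF symmetrize_hom] by blast
  also have "\<dots> \<subseteq> TP" unfolding TP_eq
    by (rule ps.span_mono) (auto simp: symmetrize_gen, blast)
  finally show ?thesis .
qed

lemma hom_eq_unsym: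
  assumes "lin pscale scl f" "lin pscale scl g" "\<xi> \<in> unsym"
    "\<And>\<alpha> hs. \<alpha> \<in> S0 (length hs) \<Longrightarrow> f (gen \<alpha> hs) = g (gen \<alpha> hs)"
  shows "f \<xi> = g \<xi>"
  by (rule lin_eq_span[OF assms(1,2) assms(3)[unfolded unsym_def]]) (use assms(4) in auto)

section \<open>Tensors labelled by arbitrary sets of letters\<close>

lemma rank_in_bij:
  assumes "finite B"
  shows "bij_betw (rank_in B) B {0..<card B}"
proof -
  have lt: "rank_in B x < rank_in B y" if "x \<in> B" "y \<in> B" "x < y" for x y
    unfolding rank_in_def by (rule psubset_card_mono) (use that assms in auto)
  have inj: "inj_on (rank_in B) B"
    by (intro inj_onI) (metis lt nat_neq_iff)
  have "rank_in B ` B \<subseteq> {0..<card B}"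
    using assms unfolding rank_in_def by (auto intro!: psubset_card_mono)
  moreover have "card (rank_in B ` B) = card B" by (rule card_image[OF inj])
  ultimately have "rank_in B ` B = {0..<card B}" by (simp add: card_subset_eq)
  then show ?thesis using inj by (simp add: bij_betw_def)
qed

lemma rank_in_0 [simp]: "rank_in B 0 = 0"
  by (simp add: rank_in_def)

lemma rank_in_less:
  assumes "finite B" "x \<in> B" "y \<in> B" "x < y"
  shows "rank_in B x < rank_in B y"
  unfolding rank_in_def by (rule psubset_card_mono) (use assms in auto)

lemma relabel_eq: "finite B \<Longrightarrow> relabel B \<beta> = map_permutation B (rank_in B) \<beta>"
  using rank_in_bij[of B] by (auto simp: relabel_def map_permutation_def restrict_id_def bij_betw_def)

definition lab_word :: "nat set \<Rightarrow> (nat \<Rightarrow> nat) \<Rightarrow> (nat \<Rightarrow> 'h) \<Rightarrow> 'h list" where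
  "lab_word B f w = map (\<lambda>i. w (inv_into B f i)) [1..<card B]"

text \<open>\<open>\<beta>\<close> is a permutation of the letter set \<open>B\<close>, \<open>w b\<close> is the vector attached to the letter \<open>b \<noteq> 0\<close>, and \<open>f\<close> is any
bijection of \<open>B\<close> onto the standard letters that preserves \<open>0\<close>.\<close>

definition lab :: "nat set \<Rightarrow> (nat \<Rightarrow> nat) \<Rightarrow> (nat \<Rightarrow> nat) \<Rightarrow> (nat \<Rightarrow> 'h) \<Rightarrow> 'h::real_vector ptens" where
  "lab B f \<beta> w = Sgen (map_permutation B f \<beta>) (lab_word B f w)"

definition labelled :: "nat set \<Rightarrow> (nat \<Rightarrow> nat) \<Rightarrow> (nat \<Rightarrow> 'h) \<Rightarrow> 'h::real_vector ptens" where
  "labelled B \<beta> w = lab B (rank_in B) \<beta> w"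

lemma inv_into_0: "inj_on f B \<Longrightarrow> f 0 = 0 \<Longrightarrow> (0::nat) \<in> B \<Longrightarrow> inv_into B f 0 = (0::nat)"
  by (metis inv_into_f_f)

lemma inv_into_nz:
  assumes "bij_betw f B {0..<card B}" "f 0 = 0" "(0::nat) \<in> B" "1 \<le> i" "i < card B"
  shows "inv_into B f i \<in> B - {0}" "f (inv_into B f i) = i"
proof -
  have i: "i \<in> f ` B" using assms by (simp add: bij_betw_def)
  show f: "f (inv_into B f i) = i" using i by (rule f_inv_into_f)
  have "inv_into B f i \<noteq> 0"
  proof
    assume "inv_into B f i = 0"
    then have "i = 0" using f assms(2) by simp
    then show False using assms(4) by simp
  qed
  then show "inv_into B f i \<in> B - {0}" using inv_into_into[OF i] by simp
qed

lemma nth_upt_Suc_0: "i + 1 < m \<Longrightarrow> [1..<m] ! i = i + 1"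
  by (subst List.nth_upt) auto

text \<open>Two labellings differ by a permutation of the nonzero letters, which symmetrization
absorbs.\<close>

lemma lab_indep:
  assumes "finite B" "0 \<in> B" "\<beta> permutes B"
    and f: "bij_betw f B {0..<card B}" "f 0 = 0" and g: "bij_betw g B {0..<card B}" "g 0 = 0"
  shows "lab B f \<beta> w = lab B g \<beta> w"
proof -
  define \<sigma> where "\<sigma> = restrict_id (g \<circ> inv_into B f) {0..<card B}"
  have fi: "inj_on f B" and gi: "inj_on g B" using f g by (auto simp: bij_betw_def)
  have \<sigma>f: "\<sigma> (f b) = g b" if "b \<in> B" for b
    using that fi f(1) by (auto simp: \<sigma>_def restrict_id_def bij_betw_def)
  have p: "\<sigma> permutes {0..<card B}"
    unfolding \<sigma>_def by (intro permutes_restrict_id bij_betw_trans[OF bij_betw_inv_into[OF f(1)] g(1)])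
  have \<sigma>0: "\<sigma> 0 = 0" using \<sigma>f[OF assms(2)] f g by simp
  have p1: "\<sigma> permutes {1..card B - 1}"
    by (rule permutes_superset[OF p]) (use \<sigma>0 in \<open>auto simp: not_less_eq_eq\<close>)
  have \<sigma>i: "pinv \<sigma> (g b) = f b" if "b \<in> B" for b
    using \<sigma>f[OF that] permutes_inj[OF p] by (metis inv_f_f)
  have len: "length (lab_word B f w) = card B - 1" by (simp add: lab_word_def)
  have perm: "\<sigma> \<circ> map_permutation B f \<beta> \<circ> pinv \<sigma> = map_permutation B g \<beta>"
  proof
    fix y
    show "(\<sigma> \<circ> map_permutation B f \<beta> \<circ> pinv \<sigma>) y = map_permutation B g \<beta> y"
    proof (cases "y \<in> {0..<card B}")
      case True
      then obtain b where b: "b \<in> B" "y = g b" using g(1) by (metis bij_betw_imp_surj_on imageE)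
      have "\<beta> b \<in> B" using b assms(3) by (simp add: permutes_in_image)
      then show ?thesis using b by (simp add: \<sigma>i \<sigma>f map_permutation_apply fi gi)
    next
      case False
      have "map_permutation B f \<beta> permutes {0..<card B}" "map_permutation B g \<beta> permutes {0..<card B}"
        using map_permutation_permutes[OF _ assms(3)] f g by auto
      moreover have "pinv \<sigma> y = y" using permutes_not_in[OF permutes_inv[OF p] False] .
      ultimately show ?thesis using False p by (simp add: permutes_not_in)
    qed
  qed
  have word: "act \<sigma> (lab_word B f w) = lab_word B g w"
  proof (rule nth_equalityI)
    show l: "length (act \<sigma> (lab_word B f w)) = length (lab_word B g w)" by (simp add: lab_word_def)
    fix i assume "i < length (act \<sigma> (lab_word B f w))"
    then have i: "i + 1 < card B" by (simp add: len)
    define b where "b = inv_into B g (i + 1)"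
    have b: "b \<in> B - {0}" "g b = i + 1" using inv_into_nz[OF g assms(2) _ i] by (auto simp: b_def)
    have fb: "f b \<in> {0..<card B}" using b f by (auto simp: bij_betw_def)
    have fb0: "f b \<noteq> 0" using b f(2) inj_onD[OF fi, of b 0] assms(2) by auto
    have "act \<sigma> (lab_word B f w) ! i = lab_word B f w ! (pinv \<sigma> (i + 1) - 1)"
      using i unfolding act_def len using nth_upt_Suc_0[of i] by simp
    also have "pinv \<sigma> (i + 1) = f b" using \<sigma>i[of b] b by simp
    also have "lab_word B f w ! (f b - 1) = w (inv_into B f (f b))"
      using fb fb0 nth_upt_Suc_0[of "f b - 1" "card B"] by (simp add: lab_word_def)
    also have "\<dots> = w b" using b fi by simp
    also have "\<dots> = lab_word B g w ! i" using i nth_upt_Suc_0[OF i] by (simp add: lab_word_def b_def)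
    finally show "act \<sigma> (lab_word B f w) ! i = lab_word B g w ! i" .
  qed
  have "Sgen (\<sigma> \<circ> map_permutation B f \<beta> \<circ> pinv \<sigma>) (act \<sigma> (lab_word B f w)) = Sgen (map_permutation B f \<beta>) (lab_word B f w)"
    by (rule Sgen_conj) (use p1 len in simp)
  then show ?thesis unfolding perm word lab_def by simp
qed

lemma labelled_eq_lab:
  assumes "finite B" "0 \<in> B" "\<beta> permutes B" "bij_betw f B {0..<card B}" "f 0 = 0"
  shows "labelled B \<beta> w = lab B f \<beta> w"
  unfolding labelled_def by (rule lab_indep) (use assms rank_in_bij in auto)

text \<open>This is why labelled tensors are useful: removing letters or adjoining them needs no
renumbering.\<close>

lemma labelled_map:
  assumes B: "finite B" "0 \<in> B" "\<beta> permutes B" and h: "bij_betw h B B'" "h 0 = 0"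
    and w: "\<And>b. b \<in> B - {0} \<Longrightarrow> w' (h b) = w b"
  shows "labelled B' (map_permutation B h \<beta>) w' = labelled B \<beta> w"
proof -
  have card: "card B' = card B" using bij_betw_same_card[OF h(1)] by simp
  have fin: "finite B'" using bij_betw_finite[OF h(1)] B(1) by simp
  have r: "bij_betw (rank_in B') B' {0..<card B}" using rank_in_bij[OF fin] card by simp
  let ?f = "rank_in B' \<circ> h"
  have f: "bij_betw ?f B {0..<card B}" by (rule bij_betw_trans[OF h(1) r])
  have "lab B ?f \<beta> w = labelled B' (map_permutation B h \<beta>) w'"
  proof -
    have perm: "map_permutation B' (rank_in B') (map_permutation B h \<beta>) = map_permutation B ?f \<beta>"
      by (rule map_permutation_compose[OF h(1)]) (use r in \<open>auto simp: bij_betw_def\<close>)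
    have "w (inv_into B ?f i) = w' (inv_into B' (rank_in B') i)" if "1 \<le> i" "i < card B" for i
    proof -
      let ?b = "inv_into B ?f i"
      have b: "?b \<in> B - {0}" "rank_in B' (h ?b) = i"
        using inv_into_nz[OF f _ B(2) that] h(2) by auto
      then have "h ?b \<in> B'" using h(1) by (auto simp: bij_betw_def)
      then have "inv_into B' (rank_in B') i = h ?b"
        using b(2) r by (metis bij_betw_imp_inj_on inv_into_f_f)
      then show ?thesis using w[OF b(1)] by simp
    qed
    then have word: "lab_word B ?f w = lab_word B' (rank_in B') w'"
      unfolding lab_word_def card by (intro map_cong refl) auto
    show ?thesis unfolding labelled_def lab_def perm word ..
  qed
  moreover have "labelled B \<beta> w = lab B ?f \<beta> w"
    by (rule labelled_eq_lab[OF B f]) (use h in simp)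
  ultimately show ?thesis by simp
qed

lemma labelled_cong:
  assumes "finite B" "0 \<in> B" "\<beta> permutes B" "\<And>b. b \<in> B - {0} \<Longrightarrow> w' b = w b"
  shows "labelled B \<beta> w' = labelled B \<beta> w"
  using labelled_map[OF assms(1-3), of id B w' w] assms by simp

lemma S0_iff: "\<alpha> \<in> S0 n \<longleftrightarrow> \<alpha> permutes {0..n}"
  by (simp add: S0_def)

lemma rank_in_interval: "x \<le> n \<Longrightarrow> rank_in {0..n} x = x"
proof -
  assume "x \<le> n"
  then have "{y \<in> {0..n}. y < x} = {0..<x}" by auto
  then show ?thesis by (simp add: rank_in_def)
qed

lemma filter_eq_inv_rank:
  assumes "B \<subseteq> {0..n}" "0 \<in> B"
  shows "filter (\<lambda>i. i \<in> B) [1..<n + 1] = map (inv_into B (rank_in B)) [1..<card B]"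
proof (rule sorted_distinct_set_unique)
  have fin: "finite B" using assms finite_subset by blast
  note r = rank_in_bij[OF fin]
  have inv: "inv_into B (rank_in B) i \<in> B - {0}" "rank_in B (inv_into B (rank_in B) i) = i"
    if "i \<in> {1..<card B}" for i using inv_into_nz[OF r rank_in_0 assms(2)] that by auto
  have mono: "inv_into B (rank_in B) i < inv_into B (rank_in B) j"
    if "i \<in> {1..<card B}" "j \<in> {1..<card B}" "i < j" for i j
  proof (rule ccontr)
    assume "\<not> ?thesis"
    then have "rank_in B (inv_into B (rank_in B) j) \<le> rank_in B (inv_into B (rank_in B) i)"
      using inv[OF that(1)] inv[OF that(2)] rank_in_less[OF fin] by (metis DiffD1 linorder_neqE_nat less_imp_le order_refl)
    then show False using inv(2)[OF that(1)] inv(2)[OF that(2)] that(3) by simp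
  qed
  have sw: "sorted_wrt (<) (map (inv_into B (rank_in B)) [1..<card B])"
    unfolding sorted_wrt_map by (rule sorted_wrt_mono_rel[OF _ sorted_wrt_upt], rule mono) simp_all
  show "sorted (filter (\<lambda>i. i \<in> B) [1..<n + 1])" by (rule sorted_wrt_filter[OF sorted_upt])
  show "distinct (filter (\<lambda>i. i \<in> B) [1..<n + 1])" by simp
  show "sorted (map (inv_into B (rank_in B)) [1..<card B])" "distinct (map (inv_into B (rank_in B)) [1..<card B])"
    using strict_sorted_iff[THEN iffD1, OF sw] by blast+
  have "inv_into B (rank_in B) ` {1..<card B} = B - {0}"
  proof
    show "inv_into B (rank_in B) ` {1..<card B} \<subseteq> B - {0}"
      by (rule image_subsetI) (rule inv(1))
    show "B - {0} \<subseteq> inv_into B (rank_in B) ` {1..<card B}"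
    proof
      fix b assume b: "b \<in> B - {0}"
      then have "rank_in B b \<in> {0..<card B}" "inv_into B (rank_in B) (rank_in B b) = b"
        using r by (auto simp: bij_betw_def)
      moreover have "rank_in B b \<noteq> 0"
        using b rank_in_less[OF fin assms(2), of b] by auto
      ultimately show "b \<in> inv_into B (rank_in B) ` {1..<card B}"
        by (intro image_eqI[of _ _ "rank_in B b"]) auto
    qed
  qed
  then show "set (filter (\<lambda>i. i \<in> B) [1..<n + 1]) = set (map (inv_into B (rank_in B)) [1..<card B])"
    using assms by auto
qed

lemma labelled_filter:
  assumes "B \<subseteq> {0..length hs}" "0 \<in> B" "m = card B - 1"
  shows "sym_tensor m (relabel B \<beta>) (simple (map (letter hs) (filter (\<lambda>i. i \<in> B) [1..<length hs + 1])))
    = labelled B \<beta> (letter hs)"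
proof -
  have fin: "finite B" using assms finite_subset by blast
  have "map (letter hs) (filter (\<lambda>i. i \<in> B) [1..<length hs + 1]) = lab_word B (rank_in B) (letter hs)"
    unfolding filter_eq_inv_rank[OF assms(1,2)] lab_word_def by simp
  moreover have "length (lab_word B (rank_in B) (letter hs)) = m" using assms(3) by (simp add: lab_word_def)
  ultimately show ?thesis unfolding labelled_def lab_def Sgen_def relabel_eq[OF fin] by simp
qed

lemma relabel_interval: "\<alpha> permutes {0..n} \<Longrightarrow> relabel {0..n} \<alpha> = \<alpha>"
proof -
  assume a: "\<alpha> permutes {0..n}"
  have "map_permutation {0..n} (rank_in {0..n}) \<alpha> = map_permutation {0..n} id \<alpha>"
    by (rule map_permutation_cong[OF bij_betw_imp_inj_on[OF rank_in_bij] a])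
      (simp_all add: rank_in_interval)
  then show ?thesis using a by (simp add: relabel_eq)
qed

lemma labelled_interval:
  assumes "\<alpha> permutes {0..length hs}"
  shows "labelled {0..length hs} \<alpha> (letter hs) = Sgen \<alpha> hs"
proof -
  have "filter (\<lambda>i. i \<in> {0..length hs}) [1..<length hs + 1] = [1..<length hs + 1]"
    by (rule filter_True) auto
  then show ?thesis
    using labelled_filter[of "{0..length hs}" hs "length hs" \<alpha>] relabel_interval[OF assms] map_letter_id[of hs]
    by (simp add: Sgen_def)
qed

lemma labelled_gen:
  assumes "finite B" "0 \<in> B" "\<beta> permutes B"
  shows "labelled B \<beta> w = Sgen (map_permutation B (rank_in B) \<beta>) (lab_word B (rank_in B) w)"
    "length (lab_word B (rank_in B) w) = card B - 1"
    "map_permutation B (rank_in B) \<beta> permutes {0..card B - 1}"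
    "\<And>b. b \<in> B - {0} \<Longrightarrow> letter (lab_word B (rank_in B) w) (rank_in B b) = w b"
    "bij_betw (rank_in B) B {0..card B - 1}"
proof -
  have c: "{0..<card B} = {0..card B - 1}" using assms card_gt_0_iff[of B] by auto
  show r: "bij_betw (rank_in B) B {0..card B - 1}" using rank_in_bij[OF assms(1)] c by simp
  show "map_permutation B (rank_in B) \<beta> permutes {0..card B - 1}"
    by (rule map_permutation_permutes[OF r assms(3)])
  show "letter (lab_word B (rank_in B) w) (rank_in B b) = w b" if "b \<in> B - {0}" for b
  proof -
    have "rank_in B b \<in> {0..<card B}" using that r c by (auto simp: bij_betw_def)
    moreover have "0 < rank_in B b" using that rank_in_less[OF assms(1,2), of b] by auto
    moreover have "inv_into B (rank_in B) (rank_in B b) = b" using that r by (auto simp: bij_betw_def)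
    ultimately show ?thesis using nth_upt_Suc_0[of "rank_in B b - 1" "card B"] by (simp add: lab_word_def)
  qed
qed (simp_all add: labelled_def lab_def lab_word_def)

lemma labelled_TP:
  assumes "finite B" "0 \<in> B" "\<beta> permutes B"
  shows "labelled B \<beta> w \<in> TP"
  unfolding labelled_gen(1)[OF assms]
  by (rule Sgen_TP) (simp only: S0_iff labelled_gen(2,3)[OF assms])

text \<open>An operator that is given on words by a formula which makes sense for every letter set, and which is
invariant under bijections of letter sets, cannot distinguish a tensor from its symmetrization. The three
operators \<open>T_poly q\<close>, \<open>Aplus h\<close> and \<open>Aminus q h\<close> are all of this kind.\<close>

lemma invariant_op:
  fixes \<Phi> :: "nat set \<Rightarrow> (nat \<Rightarrow> nat) \<Rightarrow> (nat \<Rightarrow> 'h::real_vector) \<Rightarrow> 'v::ab_group_add"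
  assumes A: "lin pscale scl A"
    and gen: "\<And>\<alpha> hs. \<alpha> permutes {0..length hs} \<Longrightarrow> A (gen \<alpha> hs) = \<Phi> {0..length hs} \<alpha> (letter hs)"
    and inv: "\<And>B B' \<beta> h w w'. finite B \<Longrightarrow> 0 \<in> B \<Longrightarrow> \<beta> permutes B \<Longrightarrow> bij_betw h B B' \<Longrightarrow> h 0 = 0 \<Longrightarrow>
       (\<And>b. b \<in> B - {0} \<Longrightarrow> w' (h b) = w b) \<Longrightarrow> \<Phi> B' (map_permutation B h \<beta>) w' = \<Phi> B \<beta> w"
  shows "\<alpha> permutes {0..length hs} \<Longrightarrow> A (Sgen \<alpha> hs) = A (gen \<alpha> hs)"
    and "finite B \<Longrightarrow> 0 \<in> B \<Longrightarrow> \<beta> permutes B \<Longrightarrow> A (labelled B \<beta> w) = \<Phi> B \<beta> w"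
    and "\<xi> \<in> unsym \<Longrightarrow> A (symmetrize \<xi>) = A \<xi>"
proof -
  have conj: "A (gen (\<sigma> \<circ> \<alpha> \<circ> pinv \<sigma>) (act \<sigma> hs)) = A (gen \<alpha> hs)"
    if a: "\<alpha> permutes {0..length hs}" and s: "\<sigma> permutes {1..length hs}" for \<alpha> \<sigma> hs
  proof -
    let ?n = "length hs"
    have s0: "\<sigma> permutes {0..?n}" by (rule permutes_subset[OF s]) auto
    have \<sigma>0: "\<sigma> 0 = 0" using permutes_not_in[OF s] by simp
    have m: "\<sigma> \<circ> \<alpha> \<circ> pinv \<sigma> = map_permutation {0..?n} \<sigma> \<alpha>"
    proof
      fix y
      show "(\<sigma> \<circ> \<alpha> \<circ> pinv \<sigma>) y = map_permutation {0..?n} \<sigma> \<alpha> y"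
      proof (cases "y \<in> {0..?n}")
        case True
        then obtain b where b: "b \<in> {0..?n}" "y = \<sigma> b" using permutes_image[OF s0] by blast
        then show ?thesis
          using permutes_inj_on[OF s0] permutes_inj[OF s0] by (simp add: map_permutation_apply inv_f_f)
      next
        case False
        have "map_permutation {0..?n} \<sigma> \<alpha> permutes {0..?n}"
          by (rule map_permutation_permutes[OF permutes_imp_bij[OF s0] a])
        moreover have "pinv \<sigma> y = y" using permutes_not_in[OF permutes_inv[OF s0] False] .
        ultimately show ?thesis using False a s0 by (simp add: permutes_not_in)
      qed
    qed
    have "A (gen (map_permutation {0..?n} \<sigma> \<alpha>) (act \<sigma> hs))
        = \<Phi> {0..?n} (map_permutation {0..?n} \<sigma> \<alpha>) (letter (act \<sigma> hs))"
      using gen[of "map_permutation {0..?n} \<sigma> \<alpha>" "act \<sigma> hs"]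
        map_permutation_permutes[OF permutes_imp_bij[OF s0] a] by simp
    also have "\<dots> = \<Phi> {0..?n} \<alpha> (letter hs)"
    proof (rule inv[OF _ _ a permutes_imp_bij[OF s0] \<sigma>0])
      fix b assume b: "b \<in> {0..?n} - {0}"
      then have "\<sigma> b \<in> {1..?n}" using permutes_in_image[OF s, of b] by auto
      then show "letter (act \<sigma> hs) (\<sigma> b) = letter hs b"
        using permutes_inj[OF s0] b by (auto simp: act_def inv_f_f)
    qed auto
    finally show ?thesis unfolding m using gen[OF a] by simp
  qed
  show S: "A (Sgen \<alpha> hs) = A (gen \<alpha> hs)" if a: "\<alpha> permutes {0..length hs}" for \<alpha> hs
  proof -
    let ?n = "length hs"
    have "A (Sgen \<alpha> hs) = scl (1 / fact ?n) (\<Sum>\<sigma> | \<sigma> permutes {1..?n}. A (gen (\<sigma> \<circ> \<alpha> \<circ> pinv \<sigma>) (act \<sigma> hs)))"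
      unfolding Sgen_eq linD(4,8)[OF A] ..
    also have "(\<Sum>\<sigma> | \<sigma> permutes {1..?n}. A (gen (\<sigma> \<circ> \<alpha> \<circ> pinv \<sigma>) (act \<sigma> hs)))
       = (\<Sum>\<sigma> | \<sigma> permutes {1..?n}. A (gen \<alpha> hs))"
      by (rule sum.cong[OF refl]) (rule conj[OF a], simp)
    also have "\<dots> = scl (fact ?n) (A (gen \<alpha> hs))"
      by (simp only: Modules.module.sum_constant_scale[OF linD(2)[OF A]]) (simp add: card_permutations)
    finally show ?thesis
      by (simp add: Modules.module.scale_scale[OF linD(2)[OF A]] Modules.module.scale_one[OF linD(2)[OF A]])
  qed
  show "A (labelled B \<beta> w) = \<Phi> B \<beta> w" if "finite B" "0 \<in> B" "\<beta> permutes B"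
  proof -
    let ?hs = "lab_word B (rank_in B) w" and ?a = "map_permutation B (rank_in B) \<beta>"
    have l: "length ?hs = card B - 1" by (rule labelled_gen(2)[OF that])
    have p: "?a permutes {0..length ?hs}" unfolding l by (rule labelled_gen(3)[OF that])
    have "\<Phi> {0..length ?hs} ?a (letter ?hs) = \<Phi> B \<beta> w"
      by (rule inv[OF that]) (use l labelled_gen(4,5)[OF that] in auto)
    then show ?thesis unfolding labelled_gen(1)[OF that] S[OF p] gen[OF p] .
  qed
  show "A (symmetrize \<xi>) = A \<xi>" if "\<xi> \<in> unsym"
    by (rule hom_eq_unsym[OF lin_comp[OF symmetrize_hom A] A that])
      (simp only: symmetrize_gen S S0_iff)
qed

section \<open>Contractions over arbitrary letter sets\<close>

definition Invol :: "nat set \<Rightarrow> (nat \<Rightarrow> nat) set" where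
  "Invol B = {\<pi>. \<pi> permutes (B - {0}) \<and> \<pi> \<circ> \<pi> = id}"

lemma P12_eq: "P12 n = Invol {0..n}"
proof -
  have "{0..n} - {0} = {1..n}" by auto
  then show ?thesis by (simp add: P12_def Invol_def)
qed

lemma InvolD:
  assumes "\<pi> \<in> Invol B"
  shows "\<pi> permutes B" "\<pi> permutes (B - {0})" "\<pi> 0 = 0" "\<pi> (\<pi> x) = x" "supp \<pi> \<subseteq> B - {0}" "\<pi> x \<in> B \<longleftrightarrow> x \<in> B"
proof -
  show p: "\<pi> permutes (B - {0})" using assms by (simp add: Invol_def)
  show pb: "\<pi> permutes B" by (rule permutes_subset[OF p]) auto
  show "\<pi> 0 = 0" using permutes_not_in[OF p] by simp
  show "\<pi> (\<pi> x) = x" using assms unfolding Invol_def by (metis (mono_tags) comp_apply id_apply mem_Collect_eq)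
  show "supp \<pi> \<subseteq> B - {0}" using permutes_not_in[OF p] by (auto simp: supp_def)
  show "\<pi> x \<in> B \<longleftrightarrow> x \<in> B" by (rule permutes_in_image[OF pb])
qed

lemma InvolI: "\<pi> permutes (B - {0}) \<Longrightarrow> (\<And>x. \<pi> (\<pi> x) = x) \<Longrightarrow> \<pi> \<in> Invol B"
  by (auto simp: Invol_def fun_eq_iff)

lemma finite_Invol: "finite B \<Longrightarrow> finite (Invol B)"
  by (rule finite_subset[OF _ finite_permutations[of "B - {0}"]]) (auto simp: Invol_def)

lemma card_supp:
  assumes "\<And>x. \<pi> (\<pi> x) = x" "finite (supp \<pi>)"
  shows "card (supp \<pi>) = 2 * pairs \<pi>"
proof -
  let ?D = "{x \<in> supp \<pi>. x < \<pi> x}" and ?E = "{x \<in> supp \<pi>. \<pi> x < x}"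
  have "bij_betw \<pi> ?D ?E"
    by (rule bij_betw_byWitness[where f' = \<pi>]) (use assms(1) in \<open>auto simp: supp_def\<close>)
  then have "card ?D = card ?E" by (rule bij_betw_same_card)
  moreover have "supp \<pi> = ?D \<union> ?E" by (auto simp: supp_def)
  moreover have "card (?D \<union> ?E) = card ?D + card ?E"
    by (rule card_Un_disjoint) (use assms(2) in auto)
  ultimately have "card (supp \<pi>) = 2 * card ?D" by presburger
  then show ?thesis by (simp add: pairs_def)
qed

lemma card_minus_supp:
  assumes "\<pi> \<in> Invol B" "finite B"
  shows "card (B - supp \<pi>) = card B - 2 * pairs \<pi>"
proof -
  have s: "supp \<pi> \<subseteq> B" using InvolD(5)[OF assms(1)] by blast
  then show ?thesis
    using card_supp[OF InvolD(4)[OF assms(1)] finite_subset[OF s assms(2)]]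
    by (simp add: card_Diff_subset[OF finite_subset[OF s assms(2)] s])
qed

text \<open>The product over pairs may pick either element of each pair; picking the
smaller one with respect to any injective ranking gives the same value. Relabelling a
contraction changes the ranking.\<close>

lemma prod_transversal:
  fixes F :: "nat \<Rightarrow> nat \<Rightarrow> real" and \<kappa> :: "nat \<Rightarrow> nat"
  assumes "\<And>i. \<pi> (\<pi> i) = i" "\<And>i. i \<in> B \<Longrightarrow> \<pi> i \<in> B" "\<And>i j. F i j = F j i" "inj_on \<kappa> B"
  shows "(\<Prod>i | i \<in> B \<and> \<kappa> i < \<kappa> (\<pi> i). F i (\<pi> i)) = (\<Prod>i | i \<in> B \<and> i < \<pi> i. F i (\<pi> i))"
proof (rule prod.reindex_bij_witness[where j = "\<lambda>i. if i < \<pi> i then i else \<pi> i"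
      and i = "\<lambda>i. if \<kappa> i < \<kappa> (\<pi> i) then i else \<pi> i"])
  fix a assume a: "a \<in> {i. i \<in> B \<and> \<kappa> i < \<kappa> (\<pi> i)}"
  then have ne: "a \<noteq> \<pi> a" by auto
  show "(if \<kappa> (if a < \<pi> a then a else \<pi> a) < \<kappa> (\<pi> (if a < \<pi> a then a else \<pi> a))
      then if a < \<pi> a then a else \<pi> a else \<pi> (if a < \<pi> a then a else \<pi> a)) = a"
    using a assms(1)[of a] by auto
  show "(if a < \<pi> a then a else \<pi> a) \<in> {i. i \<in> B \<and> i < \<pi> i}"
    using a assms(1)[of a] assms(2)[of a] ne by auto
  show "F (if a < \<pi> a then a else \<pi> a) (\<pi> (if a < \<pi> a then a else \<pi> a)) = F a (\<pi> a)"
    using assms(1)[of a] assms(3)[of a "\<pi> a"] by simp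
next
  fix b assume b: "b \<in> {i. i \<in> B \<and> i < \<pi> i}"
  have ne: "\<kappa> b \<noteq> \<kappa> (\<pi> b)" using b assms(2)[of b] inj_onD[OF assms(4), of b "\<pi> b"] by auto
  show "(if (if \<kappa> b < \<kappa> (\<pi> b) then b else \<pi> b) < \<pi> (if \<kappa> b < \<kappa> (\<pi> b) then b else \<pi> b)
      then if \<kappa> b < \<kappa> (\<pi> b) then b else \<pi> b else \<pi> (if \<kappa> b < \<kappa> (\<pi> b) then b else \<pi> b)) = b"
    using b assms(1)[of b] by auto
  show "(if \<kappa> b < \<kappa> (\<pi> b) then b else \<pi> b) \<in> {i. i \<in> B \<and> \<kappa> i < \<kappa> (\<pi> i)}"
    using b assms(1)[of b] assms(2)[of b] ne by auto
qed

definition contr_weight :: "real \<Rightarrow> nat set \<Rightarrow> (nat \<Rightarrow> nat) \<Rightarrow> (nat \<Rightarrow> nat) \<Rightarrow> real" where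
  "contr_weight q B \<pi> \<beta> = q powi (int (cyc0 (B - supp \<pi>) (skip (supp \<pi>) (\<pi> \<circ> \<beta>)))
     - int (cyc0 B (\<pi> \<circ> \<beta>)) + int (pairs \<pi>))"

definition pair_weight :: "nat set \<Rightarrow> (nat \<Rightarrow> nat) \<Rightarrow> (nat \<Rightarrow> 'h::real_inner) \<Rightarrow> real" where
  "pair_weight B \<pi> w = (\<Prod>i | i \<in> B \<and> i < \<pi> i. inner (w i) (w (\<pi> i)))"

text \<open>The sum over contractions that defines \<open>T_poly q\<close>, for an arbitrary letter set.\<close>

definition T_labelled :: "real \<Rightarrow> nat set \<Rightarrow> (nat \<Rightarrow> nat) \<Rightarrow> (nat \<Rightarrow> 'h::real_inner) \<Rightarrow> 'h ptens" where
  "T_labelled q B \<beta> w = (\<Sum>\<pi>\<in>Invol B. pscale (of_real (contr_weight q B \<pi> \<beta> * pair_weight B \<pi> w))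
     (labelled (B - supp \<pi>) (skip (supp \<pi>) (\<pi> \<circ> \<beta>)) w))"

lemma contr_word_mlin:
  assumes "\<pi> \<in> P12 n"
  shows "mlin_on tscale n (contr_word \<pi>)"
proof -
  note I = InvolD[OF assms[unfolded P12_eq]]
  let ?L = "filter (\<lambda>k. \<pi> k = k) [1..<n + 1]" and ?D = "{i. i \<in> {1..n} \<and> i < \<pi> i}"
  let ?c = "\<lambda>hs. \<Prod>i\<in>?D. inner (letter hs i) (letter hs (\<pi> i))"
  have pos: "1 \<le> \<pi> i" if "1 \<le> i" for i
    using I(3) I(4)[of i] that by (cases "\<pi> i = 0") auto
  have "mlin_on tscale n (\<lambda>hs::'a list. tscale (of_real (?c hs)) (simple (map (letter hs) ?L)))"
  proof (rule mlin_coeff_word)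
    fix hs :: "'a list" and p a b x y
    assume hs: "length hs = n" "p < n" and p: "p + 1 \<notin> set ?L"
    let ?g = "\<lambda>i x. inner (letter (hs[p := x]) i) (letter (hs[p := x]) (\<pi> i))"
    have ne: "\<pi> (p + 1) \<noteq> p + 1" using p hs by auto
    have up: "letter (hs[p := z]) i = (if i = p + 1 then z else letter hs i)" if "1 \<le> i" for z i
      by (rule letter_update) (use hs that in auto)
    define i0 where "i0 = (if p + 1 < \<pi> (p + 1) then p + 1 else \<pi> (p + 1))"
    have in_n: "\<pi> (p + 1) \<in> {1..n}" using I(6)[of "p + 1"] pos[of "p + 1"] hs by auto
    have "(\<Prod>i\<in>?D. ?g i (a *\<^sub>R x + b *\<^sub>R y)) = a * (\<Prod>i\<in>?D. ?g i x) + b * (\<Prod>i\<in>?D. ?g i y)"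
    proof (rule prod_lin[where ?i0.0 = i0 and z = 0])
      show "i0 \<in> ?D" using ne in_n hs I(4)[of "p + 1"] by (auto simp: i0_def)
      fix i z assume i: "i \<in> ?D" "i \<noteq> i0"
      then have "i \<noteq> p + 1" "\<pi> i \<noteq> p + 1" using I(4)[of i] I(4)[of "p + 1"] by (auto simp: i0_def split: if_splits)
      moreover have "1 \<le> i" "1 \<le> \<pi> i" using i pos[of i] by auto
      ultimately show "?g i z = ?g i 0" using up[of i] up[of "\<pi> i"] by simp
    next
      show "?g i0 (a *\<^sub>R x + b *\<^sub>R y) = a * ?g i0 x + b * ?g i0 y"
        using up[of "p + 1"] up[of "\<pi> (p + 1)"] pos[of "p + 1"] ne I(4)[of "p + 1"]
        by (simp add: i0_def inner_add_left inner_add_right)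
    qed simp
    then show "?c (hs[p := a *\<^sub>R x + b *\<^sub>R y]) = a * ?c (hs[p := x]) + b * ?c (hs[p := y])" .
  next
    fix hs :: "'a list" and p x
    assume hs: "length hs = n" "p < n" and p: "p + 1 \<in> set ?L"
    have up: "letter (hs[p := z]) i = (if i = p + 1 then z else letter hs i)" if "1 \<le> i" for z i
      by (rule letter_update) (use hs that in auto)
    show "?c (hs[p := x]) = ?c hs"
    proof (rule prod.cong[OF refl])
      fix i assume i: "i \<in> ?D"
      have "\<pi> (p + 1) = p + 1" using p by simp
      then have "i \<noteq> p + 1" "\<pi> i \<noteq> p + 1" using i I(4)[of i] by auto
      moreover have "1 \<le> i" "1 \<le> \<pi> i" using i pos[of i] by auto
      ultimately show "inner (letter (hs[p := x]) i) (letter (hs[p := x]) (\<pi> i)) = inner (letter hs i) (letter hs (\<pi> i))"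
        using up[of i] up[of "\<pi> i"] by simp
    qed
  qed auto
  then show ?thesis
    by (subst mlin_on_cong[where g = "\<lambda>hs. tscale (of_real (?c hs)) (simple (map (letter hs) ?L))"])
      (simp_all add: contr_word_def)
qed

abbreviation T_word :: "real \<Rightarrow> (nat \<Rightarrow> nat) \<Rightarrow> 'h::real_inner list \<Rightarrow> 'h ptens" where
  "T_word q \<equiv> \<lambda>\<alpha> hs. let n = length hs in
    \<Sum>\<pi> \<in> P12 n. pscale (of_real (contr_coeff q n \<pi> \<alpha>))
      (sym_tensor (n - 2 * pairs \<pi>) (contr_perm n \<pi> \<alpha>) (contr_word \<pi> hs))"

lemma T_word_mlin: "mlin pscale (T_word q \<alpha>)"
proof (rule mlinI)
  fix n
  have "mlin_on pscale n (\<lambda>hs. \<Sum>\<pi> \<in> P12 n. pscale (of_real (contr_coeff q n \<pi> \<alpha>))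
      (sym_tensor (n - 2 * pairs \<pi>) (contr_perm n \<pi> \<alpha>) (contr_word \<pi> hs)))"
    by (intro mlin_on_sum[OF module_pscale] mlin_on_scale[OF module_pscale] mlin_on_hom[OF _ sym_tensor_hom] contr_word_mlin)
  then show "mlin_on pscale n (T_word q \<alpha>)"
    by (subst mlin_on_cong[where g = "\<lambda>hs. \<Sum>\<pi> \<in> P12 n. pscale (of_real (contr_coeff q n \<pi> \<alpha>))
      (sym_tensor (n - 2 * pairs \<pi>) (contr_perm n \<pi> \<alpha>) (contr_word \<pi> hs))"]) (simp_all add: Let_def)
qed

lemma T_hom: "lin pscale pscale (T_poly q)"
  unfolding T_poly_def by (rule ptens_ext_hom[OF module_pscale T_word_mlin])

lemma T_gen:
  assumes "\<alpha> permutes {0..length hs}"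
  shows "T_poly q (gen \<alpha> hs) = T_labelled q {0..length hs} \<alpha> (letter hs)"
proof -
  let ?n = "length hs" and ?B = "{0..length hs}"
  have "T_poly q (gen \<alpha> hs) = T_word q \<alpha> hs"
    unfolding T_poly_def by (rule ptens_ext_gen[OF module_pscale T_word_mlin])
  also have "\<dots> = T_labelled q ?B \<alpha> (letter hs)"
    unfolding Let_def T_labelled_def P12_eq
  proof (rule sum.cong[OF refl])
    fix \<pi> assume \<pi>: "\<pi> \<in> Invol ?B"
    note I = InvolD[OF \<pi>]
    let ?C = "?B - supp \<pi>"
    have c: "sym_tensor (?n - 2 * pairs \<pi>) (relabel ?C (skip (supp \<pi>) (\<pi> \<circ> \<alpha>)))
        (simple (map (letter hs) (filter (\<lambda>i. i \<in> ?C) [1..<?n + 1]))) = labelled ?C (skip (supp \<pi>) (\<pi> \<circ> \<alpha>)) (letter hs)"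
      by (rule labelled_filter) (use card_minus_supp[OF \<pi>] I(5) in auto)
    have f: "filter (\<lambda>i. i \<in> ?C) [1..<?n + 1] = filter (\<lambda>k. \<pi> k = k) [1..<?n + 1]"
      by (rule filter_cong) (auto simp: supp_def)
    have D: "{i. i \<in> {1..?n} \<and> i < \<pi> i} = {i. i \<in> ?B \<and> i < \<pi> i}"
    proof -
      have "1 \<le> i" if "i < \<pi> i" for i using that I(3) by (cases i) auto
      then show ?thesis by auto
    qed
    have "sym_tensor (?n - 2 * pairs \<pi>) (contr_perm ?n \<pi> \<alpha>) (contr_word \<pi> hs)
      = pscale (of_real (pair_weight ?B \<pi> (letter hs))) (labelled ?C (skip (supp \<pi>) (\<pi> \<circ> \<alpha>)) (letter hs))"
      unfolding contr_word_def contr_perm_def linD(4)[OF sym_tensor_hom] D pair_weight_def c[unfolded f] ..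
    then show "pscale (of_real (contr_coeff q ?n \<pi> \<alpha>))
        (sym_tensor (?n - 2 * pairs \<pi>) (contr_perm ?n \<pi> \<alpha>) (contr_word \<pi> hs))
      = pscale (of_real (contr_weight q ?B \<pi> \<alpha> * pair_weight ?B \<pi> (letter hs))) (labelled ?C (skip (supp \<pi>) (\<pi> \<circ> \<alpha>)) (letter hs))"
      by (simp only: contr_coeff_def contr_weight_def ps.scale_scale of_real_mult)
  qed
  finally show ?thesis .
qed

lemma map_permutation_restrict:
  assumes "\<gamma> permutes C" "C \<subseteq> B" "inj_on h B"
  shows "map_permutation B h \<gamma> = map_permutation C h \<gamma>"
proof
  fix y
  have hC: "inj_on h C" by (rule inj_on_subset[OF assms(3,2)])
  consider (1) b where "b \<in> C" "y = h b" | (2) b where "b \<in> B - C" "y = h b" | (3) "y \<notin> h ` B"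
    using assms(2) by blast
  then show "map_permutation B h \<gamma> y = map_permutation C h \<gamma> y"
  proof cases
    case 1
    then have "b \<in> B" using assms(2) by blast
    then show ?thesis using 1 by (simp add: map_permutation_apply assms(3) hC)
  next
    case 2
    then have "y \<notin> h ` C" using assms(2,3) by (auto dest: inj_onD)
    moreover have "map_permutation B h \<gamma> y = y"
      using 2 permutes_not_in[OF assms(1)] by (simp add: map_permutation_apply assms(3))
    ultimately show ?thesis by (simp add: map_permutation_def)
  next
    case 3
    then have "y \<notin> h ` C" using assms(2) by blast
    then show ?thesis using 3 by (simp add: map_permutation_def)
  qed
qed

lemma Invol_map:
  assumes \<pi>: "\<pi> \<in> Invol B" and h: "bij_betw h B B'" "h 0 = 0" "0 \<in> B"
  shows "map_permutation B h \<pi> \<in> Invol B'" "supp (map_permutation B h \<pi>) = h ` supp \<pi>"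
proof -
  note I = InvolD[OF \<pi>]
  have inj: "inj_on h B" using h by (simp add: bij_betw_def)
  have ap: "map_permutation B h \<pi> (h b) = h (\<pi> b)" if "b \<in> B" for b
    using that inj by (simp add: map_permutation_apply)
  have p: "map_permutation B h \<pi> permutes B'" by (rule map_permutation_permutes[OF h(1) I(1)])
  have z: "map_permutation B h \<pi> 0 = 0" using ap[OF h(3)] I(3) h(2) by simp
  show "map_permutation B h \<pi> \<in> Invol B'"
  proof (rule InvolI)
    show "map_permutation B h \<pi> permutes (B' - {0})"
      by (rule permutes_superset[OF p]) (use z in auto)
    fix y
    show "map_permutation B h \<pi> (map_permutation B h \<pi> y) = y"
    proof (cases "y \<in> B'")
      case True
      then obtain b where b: "b \<in> B" "y = h b" using h(1) by (metis bij_betw_imp_surj_on imageE)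
      then show ?thesis using ap[of b] ap[of "\<pi> b"] I(4,6) by simp
    qed (simp add: permutes_not_in[OF p])
  qed
  show "supp (map_permutation B h \<pi>) = h ` supp \<pi>"
  proof (rule Set.set_eqI)
    fix y
    show "y \<in> supp (map_permutation B h \<pi>) \<longleftrightarrow> y \<in> h ` supp \<pi>"
    proof (cases "y \<in> B'")
      case True
      then obtain b where b: "b \<in> B" "y = h b" using h(1) by (metis bij_betw_imp_surj_on imageE)
      have "h (\<pi> b) = h b \<longleftrightarrow> \<pi> b = b" using inj b I(6)[of b] by (simp add: inj_on_eq_iff)
      moreover have "y \<in> h ` supp \<pi> \<longleftrightarrow> b \<in> supp \<pi>"
        unfolding b(2) by (rule inj_on_image_mem_iff[OF inj b(1)]) (use I(5) in blast)
      ultimately show ?thesis using b ap[of b] by (simp add: supp_def)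
    next
      case False
      then have "y \<notin> h ` supp \<pi>" using I(5) h(1) by (auto simp: bij_betw_def)
      moreover have "y \<notin> supp (map_permutation B h \<pi>)"
        using permutes_not_in[OF p False] by (simp add: supp_def)
      ultimately show ?thesis by blast
    qed
  qed
qed

lemma T_labelled_map:
  assumes B: "finite B" "0 \<in> B" "\<beta> permutes B" and h: "bij_betw h B B'" "h 0 = 0"
    and w: "\<And>b. b \<in> B - {0} \<Longrightarrow> w' (h b) = w b"
  shows "T_labelled q B' (map_permutation B h \<beta>) w' = T_labelled q B \<beta> w"
proof -
  let ?m = "map_permutation B h" and ?m' = "map_permutation B' (inv_into B h)"
  have inj: "inj_on h B" and img: "h ` B = B'" using h by (auto simp: bij_betw_def)
  have h': "bij_betw (inv_into B h) B' B" by (rule bij_betw_inv_into[OF h(1)])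
  have h'0: "inv_into B h 0 = 0" by (rule inv_into_0[OF inj h(2) B(2)])
  have z': "0 \<in> B'" using img h(2) B(2) by force
  have "T_labelled q B \<beta> w = T_labelled q B' (?m \<beta>) w'"
    unfolding T_labelled_def
  proof (rule sum.reindex_bij_witness[where i = ?m' and j = ?m])
    fix \<pi> assume \<pi>: "\<pi> \<in> Invol B"
    note I = InvolD[OF \<pi>] and M = Invol_map[OF \<pi> h B(2)]
    show "?m' (?m \<pi>) = \<pi>" by (rule map_permutation_compose_inv[OF h(1) I(1)]) (simp add: inj)
    show "?m \<pi> \<in> Invol B'" by (rule M(1))
    let ?S = "supp \<pi>" and ?g = "\<pi> \<circ> \<beta>"
    have S: "?S \<subseteq> B" "0 \<notin> ?S" "finite ?S" using I(5) B(1) finite_subset by auto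
    have g: "?g permutes B" by (rule permutes_compose[OF B(3) I(1)])
    have sg: "skip ?S ?g permutes B - ?S" by (rule skip_permutes[OF g B(1) S(3)])
    have diff: "B' - h ` ?S = h ` (B - ?S)" using img inj_on_image_set_diff[OF inj _ S(1), of B] by auto
    have comp: "?m \<pi> \<circ> ?m \<beta> = ?m ?g" by (rule map_permutation_compose'[OF inj B(3), symmetric])
    have sk: "skip (h ` ?S) (?m ?g) = map_permutation (B - ?S) h (skip ?S ?g)"
      unfolding skip_map_permutation[OF g B(1) inj S(1), symmetric]
      by (rule map_permutation_restrict[OF sg _ inj]) auto
    have injS: "inj_on h (B - ?S)" by (rule inj_on_subset[OF inj]) auto
    have c1: "cyc0 (h ` (B - ?S)) (map_permutation (B - ?S) h (skip ?S ?g)) = cyc0 (B - ?S) (skip ?S ?g)"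
      by (rule cyc0_map_permutation[OF sg _ _ injS h(2)]) (use B S in auto)
    have c2: "cyc0 B' (?m ?g) = cyc0 B ?g"
      using cyc0_map_permutation[OF g B(1,2) inj h(2)] img by simp
    have fin: "finite (supp (?m \<pi>))" using M(2) S(3) by simp
    have pr: "pairs (?m \<pi>) = pairs \<pi>"
      unfolding pairs_def M(2) using card_image[OF inj_on_subset[OF inj S(1)]] by simp
    have e: "contr_weight q B' (?m \<pi>) (?m \<beta>) = contr_weight q B \<pi> \<beta>"
      unfolding contr_weight_def M(2) comp diff sk c1 c2 pr ..
    have pair_weight: "pair_weight B' (?m \<pi>) w' = pair_weight B \<pi> w"
    proof -
      have w2: "inner (w' (h i)) (w' (h (\<pi> i))) = inner (w i) (w (\<pi> i))" if "i \<in> B" "h i < h (\<pi> i)" for i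
      proof -
        have "i \<noteq> 0" using that I(3) by (metis less_irrefl)
        moreover have "\<pi> i \<noteq> 0" using I(3) I(4)[of i] \<open>i \<noteq> 0\<close> by metis
        ultimately show ?thesis using w[of i] w[of "\<pi> i"] that(1) I(6)[of i] by simp
      qed
      have ap: "?m \<pi> (h b) = h (\<pi> b)" if "b \<in> B" for b
        using that inj by (simp add: map_permutation_apply)
      have "{j. j \<in> B' \<and> j < ?m \<pi> j} = h ` {i. i \<in> B \<and> h i < h (\<pi> i)}"
        using ap img by auto
      then have "pair_weight B' (?m \<pi>) w' = (\<Prod>j\<in>h ` {i. i \<in> B \<and> h i < h (\<pi> i)}. inner (w' j) (w' (?m \<pi> j)))"
        by (simp only: pair_weight_def)
      also have "\<dots> = (\<Prod>i | i \<in> B \<and> h i < h (\<pi> i). inner (w' (h i)) (w' (?m \<pi> (h i))))"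
        by (subst prod.reindex) (auto intro: inj_on_subset[OF inj])
      also have "\<dots> = (\<Prod>i | i \<in> B \<and> h i < h (\<pi> i). inner (w i) (w (\<pi> i)))"
        by (rule prod.cong[OF refl]) (use ap w2 in auto)
      also have "\<dots> = pair_weight B \<pi> w"
        unfolding pair_weight_def
        by (rule prod_transversal[where F = "\<lambda>i j. inner (w i) (w j)"])
          (use I(4,6) inj in \<open>auto simp: inner_commute\<close>)
      finally show ?thesis .
    qed
    have "labelled (B' - supp (?m \<pi>)) (skip (supp (?m \<pi>)) (?m \<pi> \<circ> ?m \<beta>)) w' = labelled (B - ?S) (skip ?S ?g) w"
      unfolding M(2) comp diff sk
      by (rule labelled_map[OF _ _ sg]) (use B S h w injS in \<open>auto simp: bij_betw_def\<close>)
    then show "pscale (of_real (contr_weight q B' (?m \<pi>) (?m \<beta>) * pair_weight B' (?m \<pi>) w'))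
        (labelled (B' - supp (?m \<pi>)) (skip (supp (?m \<pi>)) (?m \<pi> \<circ> ?m \<beta>)) w')
      = pscale (of_real (contr_weight q B \<pi> \<beta> * pair_weight B \<pi> w)) (labelled (B - ?S) (skip ?S ?g) w)"
      unfolding e pair_weight by simp
  next
    fix \<pi> assume \<pi>: "\<pi> \<in> Invol B'"
    show "?m' \<pi> \<in> Invol B" by (rule Invol_map(1)[OF \<pi> h' h'0 z'])
    show "?m (?m' \<pi>) = \<pi>"
      by (rule map_permutation_compose_inv[OF h' InvolD(1)[OF \<pi>]]) (use img in \<open>simp add: f_inv_into_f\<close>)
  qed
  then show ?thesis by simp
qed

lemmas T_op = invariant_op[where \<Phi> = "T_labelled q" and A = "T_poly q" for q, OF T_hom T_gen T_labelled_map]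

section \<open>Creation and annihilation operators\<close>

definition Aplus :: "'h \<Rightarrow> 'h::real_inner ptens \<Rightarrow> 'h ptens" where
  "Aplus h = ptens_ext pscale (\<lambda>\<alpha> hs. sym_tensor (length hs + 1)
     (Transposition.transpose 0 (length hs + 1) \<circ> \<alpha>) (r_plus h (simple hs)))"

text \<open>The letter sent to \<open>0\<close> gets the coefficient \<open>1\<close> instead of \<open>q\<close>. For it, removing \<open>k\<close> from \<open>(0 k) \<alpha>\<close> amounts to removing
\<open>k\<close> from \<open>\<alpha>\<close>, so that the single sum covers both terms of the annihilation operator.\<close>

definition Aminus :: "real \<Rightarrow> 'h \<Rightarrow> 'h::real_inner ptens \<Rightarrow> 'h ptens" where
  "Aminus q h = ptens_ext pscale (\<lambda>\<alpha> hs. \<Sum>k\<in>{1..length hs}. pscale (of_real (if \<alpha> k = 0 then 1 else q))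
     (sym_tensor (length hs - 1) (relabel ({0..length hs} - {k}) (skip {k} (Transposition.transpose 0 k \<circ> \<alpha>)))
       (r_minus k h (simple hs))))"

definition minus_labelled :: "real \<Rightarrow> 'h \<Rightarrow> nat set \<Rightarrow> (nat \<Rightarrow> nat) \<Rightarrow> (nat \<Rightarrow> 'h::real_inner) \<Rightarrow> 'h ptens" where
  "minus_labelled q h B \<beta> w = (\<Sum>k\<in>B - {0}. pscale (of_real ((if \<beta> k = 0 then 1 else q) * inner (w k) h))
     (labelled (B - {k}) (skip {k} (Transposition.transpose 0 k \<circ> \<beta>)) w))"

text \<open>The new letter can be any letter outside \<open>B\<close> (see \<open>plus_labelled_eq\<close>); the successor of the maximum is one.\<close>

definition plus_labelled :: "'h \<Rightarrow> nat set \<Rightarrow> (nat \<Rightarrow> nat) \<Rightarrow> (nat \<Rightarrow> 'h::real_inner) \<Rightarrow> 'h ptens" where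
  "plus_labelled h B \<beta> w = (let m = Suc (Max B) in labelled (insert m B) (Transposition.transpose 0 m \<circ> \<beta>) (w(m := h)))"

lemma mlin_by_length:
  assumes "\<And>n. mlin_on scl n (g n)" "\<And>hs. f hs = g (length hs) hs"
  shows "mlin scl f"
proof (rule mlinI)
  fix n show "mlin_on scl n f"
    using mlin_on_cong[of n f "g n" scl] assms by auto
qed

lemma Aplus_mlin: "mlin pscale (\<lambda>hs. sym_tensor (length hs + 1)
     (Transposition.transpose 0 (length hs + 1) \<circ> \<alpha>) (r_plus h (simple hs)))"
  by (rule mlin_by_length[OF mlin_on_hom[OF mlin_on_hom[OF mlin_simple r_plus_hom] sym_tensor_hom]]) (rule refl)

lemma Aplus_hom: "lin pscale pscale (Aplus h)"
  unfolding Aplus_def by (rule ptens_ext_hom[OF module_pscale Aplus_mlin])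

lemma Aplus_gen: "Aplus h (gen \<alpha> hs) = Sgen (Transposition.transpose 0 (length hs + 1) \<circ> \<alpha>) (hs @ [h])"
  unfolding Aplus_def ptens_ext_gen[OF module_pscale Aplus_mlin] unfolding r_plus_simple Sgen_def by simp

lemma Aminus_mlin: "mlin pscale (\<lambda>hs. \<Sum>k\<in>{1..length hs}. pscale (of_real (if \<alpha> k = 0 then 1 else q))
     (sym_tensor (length hs - 1) (relabel ({0..length hs} - {k}) (skip {k} (Transposition.transpose 0 k \<circ> \<alpha>)))
       (r_minus k h (simple hs))))"
proof (rule mlin_by_length)
  fix n
  show "mlin_on pscale n (\<lambda>hs. \<Sum>k\<in>{1..n}. pscale (of_real (if \<alpha> k = 0 then 1 else q))
     (sym_tensor (n - 1) (relabel ({0..n} - {k}) (skip {k} (Transposition.transpose 0 k \<circ> \<alpha>)))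
       (r_minus k h (simple hs))))"
    by (intro mlin_on_sum[OF module_pscale] mlin_on_scale[OF module_pscale]
        mlin_on_hom[OF mlin_on_hom[OF mlin_simple r_minus_hom] sym_tensor_hom]) auto
qed (rule refl)

lemma Aminus_hom: "lin pscale pscale (Aminus q h)"
  unfolding Aminus_def by (rule ptens_ext_hom[OF module_pscale Aminus_mlin])

lemma sym_tensor_r_minus:
  assumes "1 \<le> k" "k \<le> length hs"
  shows "sym_tensor (length hs - 1) (relabel ({0..length hs} - {k}) \<gamma>) (r_minus k h (simple hs))
    = pscale (of_real (inner (letter hs k) h)) (labelled ({0..length hs} - {k}) \<gamma> (letter hs))"
proof -
  let ?B = "{0..length hs} - {k}"
  have f: "filter (\<lambda>i. i \<noteq> k) [1..<length hs + 1] = filter (\<lambda>i. i \<in> ?B) [1..<length hs + 1]"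
    by (rule filter_cong) auto
  have "sym_tensor (length hs - 1) (relabel ?B \<gamma>) (simple (map (letter hs) (filter (\<lambda>i. i \<in> ?B) [1..<length hs + 1])))
    = labelled ?B \<gamma> (letter hs)"
    by (rule labelled_filter) (use assms in auto)
  then show ?thesis
    unfolding r_minus_simple[OF assms(1)] take_drop_letter[OF assms] linD(4)[OF sym_tensor_hom] f by simp
qed

lemma Aminus_gen: "Aminus q h (gen \<alpha> hs) = minus_labelled q h {0..length hs} \<alpha> (letter hs)"
proof -
  have "{0..length hs} - {0} = {1..length hs}" by auto
  then show ?thesis
    unfolding Aminus_def ptens_ext_gen[OF module_pscale Aminus_mlin] minus_labelled_def
    by (intro sum.cong) (simp_all only: sym_tensor_r_minus atLeastAtMost_iff ps.scale_scale of_real_mult)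
qed

text \<open>The choice of the new letter is immaterial, since \<open>h\<close> extends to a bijection that matches the new letters.\<close>

lemma labelled_fresh:
  assumes B: "finite B" "0 \<in> B" "\<beta> permutes B" and h: "bij_betw h B B'" "h 0 = 0"
    and w: "\<And>b. b \<in> B - {0} \<Longrightarrow> w' (h b) = w b" and m: "m \<notin> B" "m' \<notin> B'"
  shows "labelled (insert m' B') (Transposition.transpose 0 m' \<circ> map_permutation B h \<beta>) (w'(m' := h0))
    = labelled (insert m B) (Transposition.transpose 0 m \<circ> \<beta>) (w(m := h0))"
proof -
  let ?h = "h(m := m')" and ?C = "insert m B"
  have inj: "inj_on h B" and img: "h ` B = B'" using h by (auto simp: bij_betw_def)
  have bij: "bij_betw ?h ?C (insert m' B')"
    using inj img m by (auto simp: bij_betw_def inj_on_def)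
  then have injC: "inj_on ?h ?C" by (simp add: bij_betw_def)
  have bC: "\<beta> permutes ?C" by (rule permutes_subset[OF B(3)]) auto
  have m0: "m \<noteq> 0" using m(1) B(2) by metis
  have tp: "Transposition.transpose 0 m permutes ?C" by (rule permutes_swap_id) (use B in auto)
  have "map_permutation ?C ?h (Transposition.transpose 0 m \<circ> \<beta>)
      = map_permutation ?C ?h (Transposition.transpose 0 m) \<circ> map_permutation ?C ?h \<beta>"
    by (rule map_permutation_compose'[OF injC bC])
  also have "map_permutation ?C ?h (Transposition.transpose 0 m) = Transposition.transpose 0 m'"
    using map_permutation_transpose[OF injC, of 0 m] B(2) m0 h(2) by simp
  also have "map_permutation ?C ?h \<beta> = map_permutation B ?h \<beta>"
    by (rule map_permutation_restrict[OF B(3) _ injC]) auto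
  also have "\<dots> = map_permutation B h \<beta>"
    by (rule map_permutation_cong[OF _ B(3)]) (use m(1) inj_on_subset[OF injC, of B] in auto)
  finally have e: "Transposition.transpose 0 m' \<circ> map_permutation B h \<beta> = map_permutation ?C ?h (Transposition.transpose 0 m \<circ> \<beta>)" ..
  show ?thesis unfolding e
  proof (rule labelled_map[OF _ _ permutes_compose[OF bC tp] bij])
    show "?h 0 = 0" using m0 h(2) by simp
    fix b assume b: "b \<in> ?C - {0}"
    show "(w'(m' := h0)) (?h b) = (w(m := h0)) b"
      using b w[of b] img m by auto
  qed (use B in auto)
qed

lemma plus_labelled_eq:
  assumes B: "finite B" "0 \<in> B" "\<beta> permutes B" and m: "m \<notin> B"
  shows "plus_labelled h B \<beta> w = labelled (insert m B) (Transposition.transpose 0 m \<circ> \<beta>) (w(m := h))"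
proof -
  have "Suc (Max B) \<notin> B" using Max_ge[OF B(1), of "Suc (Max B)"] by auto
  then show ?thesis
    using labelled_fresh[OF B, of id B w w m "Suc (Max B)" h] m B(3) by (simp add: plus_labelled_def Let_def)
qed

lemma Aplus_gen': "\<alpha> permutes {0..length hs} \<Longrightarrow> Aplus h (gen \<alpha> hs) = plus_labelled h {0..length hs} \<alpha> (letter hs)"
proof -
  assume a: "\<alpha> permutes {0..length hs}"
  let ?m = "length hs + 1" and ?t = "Transposition.transpose 0 (length hs + 1) \<circ> \<alpha>"
  have ins: "insert ?m {0..length hs} = {0..?m}" by auto
  have "\<alpha> permutes {0..?m}" by (rule permutes_subset[OF a]) auto
  then have t: "?t permutes {0..?m}" by (intro permutes_compose permutes_swap_id) auto
  have "plus_labelled h {0..length hs} \<alpha> (letter hs) = labelled {0..?m} ?t ((letter hs)(?m := h))"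
    using plus_labelled_eq[OF _ _ a, of ?m h "letter hs"] unfolding ins by simp
  also have "\<dots> = labelled {0..?m} ?t (letter (hs @ [h]))"
    by (rule labelled_cong[OF _ _ t]) (auto simp: nth_append)
  also have "\<dots> = Sgen ?t (hs @ [h])"
    using labelled_interval[of ?t "hs @ [h]"] t by simp
  finally show ?thesis by (simp only: Aplus_gen)
qed

lemma plus_labelled_map:
  assumes B: "finite B" "0 \<in> B" "\<beta> permutes B" and h: "bij_betw h B B'" "h 0 = 0"
    and w: "\<And>b. b \<in> B - {0} \<Longrightarrow> w' (h b) = w b"
  shows "plus_labelled h0 B' (map_permutation B h \<beta>) w' = plus_labelled h0 B \<beta> w"
proof -
  have f: "finite B'" using bij_betw_finite[OF h(1)] B(1) by simp
  have "Suc (Max B) \<notin> B" using Max_ge[OF B(1), of "Suc (Max B)"] by auto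
  moreover have "Suc (Max B') \<notin> B'" using Max_ge[OF f, of "Suc (Max B')"] by auto
  ultimately show ?thesis unfolding plus_labelled_def Let_def by (intro labelled_fresh assms)
qed

lemma minus_labelled_map:
  assumes B: "finite B" "0 \<in> B" "\<beta> permutes B" and h: "bij_betw h B B'" "h 0 = 0"
    and w: "\<And>b. b \<in> B - {0} \<Longrightarrow> w' (h b) = w b"
  shows "minus_labelled q h0 B' (map_permutation B h \<beta>) w' = minus_labelled q h0 B \<beta> w"
proof -
  let ?m = "map_permutation B h"
  have inj: "inj_on h B" and img: "h ` B = B'" using h by (auto simp: bij_betw_def)
  have nz: "h k \<noteq> 0" if "k \<in> B - {0}" for k
    using that inj_onD[OF inj, of k 0] B(2) h(2) by auto
  have bij: "bij_betw h (B - {0}) (B' - {0})"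
    unfolding bij_betw_def
  proof
    show "inj_on h (B - {0})" by (rule inj_on_subset[OF inj]) auto
    show "h ` (B - {0}) = B' - {0}"
      using inj_on_image_set_diff[OF inj, of B "{0}"] img h(2) B(2) by auto
  qed
  have "minus_labelled q h0 B' (?m \<beta>) w' = (\<Sum>k\<in>B - {0}. pscale (of_real ((if ?m \<beta> (h k) = 0 then 1 else q) * inner (w' (h k)) h0))
     (labelled (B' - {h k}) (skip {h k} (Transposition.transpose 0 (h k) \<circ> ?m \<beta>)) w'))"
    unfolding minus_labelled_def by (rule sum.reindex_bij_betw[OF bij, symmetric])
  also have "\<dots> = minus_labelled q h0 B \<beta> w"
    unfolding minus_labelled_def
  proof (rule sum.cong[OF refl])
    fix k assume k: "k \<in> B - {0}"
    then have kB: "k \<in> B" by simp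
    let ?g = "Transposition.transpose 0 k \<circ> \<beta>"
    have bk: "\<beta> k \<in> B" using kB B(3) by (simp add: permutes_in_image)
    have "?m \<beta> (h k) = h (\<beta> k)" using kB inj by (simp add: map_permutation_apply)
    moreover have "h (\<beta> k) = 0 \<longleftrightarrow> \<beta> k = 0" using nz[of "\<beta> k"] bk h(2) by (metis Diff_iff singletonD)
    ultimately have z: "?m \<beta> (h k) = 0 \<longleftrightarrow> \<beta> k = 0" by simp
    have g: "?g permutes B" by (intro permutes_compose[OF B(3)] permutes_swap_id) (use B kB in auto)
    have sg: "skip {k} ?g permutes B - {k}" by (rule skip_permutes[OF g B(1)]) simp
    have mg: "Transposition.transpose 0 (h k) \<circ> ?m \<beta> = ?m ?g"
      using map_permutation_compose'[OF inj B(3), of "Transposition.transpose 0 k"]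
        map_permutation_transpose[OF inj B(2) kB] h(2) by simp
    have sk: "skip {h k} (?m ?g) = map_permutation (B - {k}) h (skip {k} ?g)"
    proof -
      have "skip (h ` {k}) (?m ?g) = ?m (skip {k} ?g)"
        by (rule skip_map_permutation[OF g B(1) inj, symmetric]) (use kB in simp)
      moreover have "?m (skip {k} ?g) = map_permutation (B - {k}) h (skip {k} ?g)"
        by (rule map_permutation_restrict[OF sg _ inj]) auto
      ultimately show ?thesis by simp
    qed
    have bk: "bij_betw h (B - {k}) (B' - {h k})"
      using inj img kB by (auto simp: bij_betw_def inj_on_def)
    have "labelled (B' - {h k}) (skip {h k} (Transposition.transpose 0 (h k) \<circ> ?m \<beta>)) w' = labelled (B - {k}) (skip {k} ?g) w"
      unfolding mg sk by (rule labelled_map[OF _ _ sg bk h(2)]) (use B k w in auto)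
    then show "pscale (of_real ((if ?m \<beta> (h k) = 0 then 1 else q) * inner (w' (h k)) h0))
       (labelled (B' - {h k}) (skip {h k} (Transposition.transpose 0 (h k) \<circ> ?m \<beta>)) w')
      = pscale (of_real ((if \<beta> k = 0 then 1 else q) * inner (w k) h0)) (labelled (B - {k}) (skip {k} ?g) w)"
      unfolding z w[OF k] by simp
  qed
  finally show ?thesis .
qed

lemmas Aplus_op = invariant_op[where \<Phi> = "plus_labelled h" and A = "Aplus h" for h, OF Aplus_hom Aplus_gen' plus_labelled_map]

lemmas Aminus_op = invariant_op[where \<Phi> = "minus_labelled q h" and A = "Aminus q h" for q h, OF Aminus_hom Aminus_gen minus_labelled_map]

section \<open>Contracting one more letter\<close>

abbreviation swp :: "nat \<Rightarrow> nat \<Rightarrow> nat \<Rightarrow> nat" where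
  "swp \<equiv> Transposition.transpose"

lemma T_S: "\<alpha> permutes {0..length hs} \<Longrightarrow> T_poly q (Sgen \<alpha> hs) = T_poly q (gen \<alpha> hs)"
  by (rule T_op(1); (assumption | simp))

lemma T_symmetrize: "\<xi> \<in> unsym \<Longrightarrow> T_poly q (symmetrize \<xi>) = T_poly q \<xi>"
  by (rule T_op(3); (assumption | simp))

lemma Aplus_S: "\<alpha> permutes {0..length hs} \<Longrightarrow> Aplus h (Sgen \<alpha> hs) = Aplus h (gen \<alpha> hs)"
  by (rule Aplus_op(1); (assumption | simp))

lemma Aplus_labelled: "finite B \<Longrightarrow> 0 \<in> B \<Longrightarrow> \<beta> permutes B \<Longrightarrow> Aplus h (labelled B \<beta> w) = plus_labelled h B \<beta> w"
  by (rule Aplus_op(2); (assumption | simp))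

lemma Aminus_S: "\<alpha> permutes {0..length hs} \<Longrightarrow> Aminus q h (Sgen \<alpha> hs) = Aminus q h (gen \<alpha> hs)"
  by (rule Aminus_op(1); (assumption | simp))

lemma Aminus_labelled: "finite B \<Longrightarrow> 0 \<in> B \<Longrightarrow> \<beta> permutes B \<Longrightarrow> Aminus q h (labelled B \<beta> w) = minus_labelled q h B \<beta> w"
  by (rule Aminus_op(2); (assumption | simp))

lemma swp_comp: "swp a b \<circ> (swp a b \<circ> f) = f"
  unfolding comp_assoc[symmetric] by (simp only: transpose_comp_involutory id_comp)

text \<open>A new letter is either a singleton or paired with a former singleton.\<close>

lemma Invol_insert_sum:
  fixes g :: "(nat \<Rightarrow> nat) \<Rightarrow> 'v::comm_monoid_add"
  assumes B: "finite B" "0 \<in> B" and m: "m \<notin> B"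
  shows "(\<Sum>\<pi>\<in>Invol (insert m B). g \<pi>)
    = (\<Sum>\<pi>\<in>Invol B. g \<pi> + (\<Sum>k\<in>B - supp \<pi> - {0}. g (\<pi> \<circ> swp k m)))"
proof -
  let ?I = "Invol (insert m B)"
  have m0: "m \<noteq> 0" using m B by metis
  have fin: "finite ?I" using B by (simp add: finite_Invol)
  have split: "?I = {\<pi> \<in> ?I. \<pi> m = m} \<union> {\<pi> \<in> ?I. \<pi> m \<noteq> m}" by blast
  have one: "{\<pi> \<in> ?I. \<pi> m = m} = Invol B"
  proof (rule Set.set_eqI)
    fix \<pi>
    show "\<pi> \<in> {\<pi> \<in> ?I. \<pi> m = m} \<longleftrightarrow> \<pi> \<in> Invol B"
    proof
      assume a: "\<pi> \<in> {\<pi> \<in> ?I. \<pi> m = m}"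
      then have p: "\<pi> permutes (insert m B - {0})" using InvolD(2) by blast
      show "\<pi> \<in> Invol B"
      proof (rule InvolI)
        show "\<pi> permutes (B - {0})" by (rule permutes_superset[OF p]) (use a in auto)
        show "\<pi> (\<pi> x) = x" for x using a InvolD(4) by blast
      qed
    next
      assume a: "\<pi> \<in> Invol B"
      have "\<pi> \<in> ?I"
      proof (rule InvolI)
        show "\<pi> permutes (insert m B - {0})" by (rule permutes_subset[OF InvolD(2)[OF a]]) auto
        show "\<pi> (\<pi> x) = x" for x by (rule InvolD(4)[OF a])
      qed
      then show "\<pi> \<in> {\<pi> \<in> ?I. \<pi> m = m}" using permutes_not_in[OF InvolD(1)[OF a] m] by simp
    qed
  qed
  have two: "(\<Sum>\<pi>\<in>{\<pi> \<in> ?I. \<pi> m \<noteq> m}. g \<pi>) = (\<Sum>(\<pi>, k)\<in>(SIGMA \<pi>:Invol B. B - supp \<pi> - {0}). g (\<pi> \<circ> swp k m))"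
  proof (rule sum.reindex_bij_witness[where i = "\<lambda>(\<pi>, k). \<pi> \<circ> swp k m" and j = "\<lambda>\<pi>. (\<pi> \<circ> swp (\<pi> m) m, \<pi> m)"])
    fix \<pi> assume "\<pi> \<in> {\<pi> \<in> ?I. \<pi> m \<noteq> m}"
    then have \<pi>: "\<pi> \<in> ?I" and ne: "\<pi> m \<noteq> m" by auto
    note I = InvolD[OF \<pi>]
    let ?k = "\<pi> m" and ?p = "\<pi> \<circ> swp (\<pi> m) m"
    have k0: "?k \<noteq> 0" using I(3) I(4)[of m] m0 by metis
    have kB: "?k \<in> B" using I(6)[of m] ne by auto
    have ap: "?p x = (if x = m then m else if x = ?k then ?k else \<pi> x)" for x
      using I(4)[of m] by (auto simp: Transposition.transpose_def)
    show "(case (?p, ?k) of (\<pi>, k) \<Rightarrow> \<pi> \<circ> swp k m) = \<pi>"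
      by (simp only: prod.case comp_assoc transpose_comp_involutory comp_id)
    have pp: "?p permutes (insert m B - {0})"
      by (rule permutes_compose[OF permutes_swap_id I(2)]) (use kB k0 m0 in auto)
    have "?p \<in> Invol B"
    proof (rule InvolI)
      show "?p permutes (B - {0})" by (rule permutes_superset[OF pp]) (use ap in auto)
      have pne: "\<pi> x \<noteq> m" "\<pi> x \<noteq> ?k" if "x \<noteq> m" "x \<noteq> ?k" for x
        using that I(4)[of x] I(4)[of m] by metis+
      show "?p (?p x) = x" for x
        using pne[of x] I(4)[of x] ne by (cases "x = m"; cases "x = ?k") (simp_all only: ap if_True if_False simp_thms)
    qed
    moreover have "?k \<notin> supp ?p" unfolding supp_def mem_Collect_eq ap by simp
    ultimately show "(?p, ?k) \<in> (SIGMA \<pi>:Invol B. B - supp \<pi> - {0})" using kB k0 by simp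
    show "(case (?p, ?k) of (\<pi>, k) \<Rightarrow> g (\<pi> \<circ> swp k m)) = g \<pi>"
      by (simp only: prod.case comp_assoc transpose_comp_involutory comp_id)
  next
    fix z assume "z \<in> (SIGMA \<pi>:Invol B. B - supp \<pi> - {0})"
    then obtain \<pi> k where z: "z = (\<pi>, k)" and \<pi>: "\<pi> \<in> Invol B" and k: "k \<in> B" "k \<notin> supp \<pi>" "k \<noteq> 0" by auto
    note I = InvolD[OF \<pi>]
    have pm: "\<pi> m = m" by (rule permutes_not_in[OF I(1) m])
    have pk: "\<pi> k = k" using k(2) by (simp add: supp_def)
    have km: "k \<noteq> m" using k(1) m by metis
    let ?p = "\<pi> \<circ> swp k m"
    have ap: "?p x = (if x = m then k else if x = k then m else \<pi> x)" for x
      using pm pk by (auto simp: Transposition.transpose_def)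
    have "?p m = k" by (simp only: ap simp_thms if_True)
    then have "(?p \<circ> swp (?p m) m, ?p m) = (\<pi>, k)"
      by (simp only: comp_assoc transpose_comp_involutory comp_id)
    then show "((case z of (\<pi>, k) \<Rightarrow> \<pi> \<circ> swp k m) \<circ> swp ((case z of (\<pi>, k) \<Rightarrow> \<pi> \<circ> swp k m) m) m, (case z of (\<pi>, k) \<Rightarrow> \<pi> \<circ> swp k m) m) = z"
      unfolding z prod.case .
    have "?p \<in> ?I"
    proof (rule InvolI)
      have P: "\<pi> permutes (insert m B - {0})" by (rule permutes_subset[OF I(2)]) auto
      show "?p permutes (insert m B - {0})"
        by (rule permutes_compose[OF permutes_swap_id P]) (use k m0 in auto)
      have pne: "\<pi> x \<noteq> m" "\<pi> x \<noteq> k" if "x \<noteq> m" "x \<noteq> k" for x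
        using that pm pk I(4)[of x] by metis+
      show "?p (?p x) = x" for x
        using pne[of x] I(4)[of x] km by (cases "x = m"; cases "x = k") (simp_all only: ap if_True if_False simp_thms)
    qed
    then show "(case z of (\<pi>, k) \<Rightarrow> \<pi> \<circ> swp k m) \<in> {\<pi> \<in> ?I. \<pi> m \<noteq> m}"
      unfolding z prod.case using \<open>?p m = k\<close> km by auto
  qed
  have "(\<Sum>\<pi>\<in>?I. g \<pi>) = (\<Sum>\<pi>\<in>{\<pi> \<in> ?I. \<pi> m = m}. g \<pi>) + (\<Sum>\<pi>\<in>{\<pi> \<in> ?I. \<pi> m \<noteq> m}. g \<pi>)"
    by (subst split, rule sum.union_disjoint) (use fin in auto)
  also have "(\<Sum>\<pi>\<in>{\<pi> \<in> ?I. \<pi> m \<noteq> m}. g \<pi>) = (\<Sum>\<pi>\<in>Invol B. \<Sum>k\<in>B - supp \<pi> - {0}. g (\<pi> \<circ> swp k m))"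
    unfolding two by (rule sum.Sigma[symmetric]) (use B finite_Invol in auto)
  finally show ?thesis unfolding one by (simp only: sum.distrib)
qed

text \<open>Multiplying by \<open>(0 m)\<close> inserts the letter \<open>m\<close> into the cycle of \<open>0\<close>, which is not counted.\<close>

lemma cyc0_join:
  assumes "\<gamma> permutes C" "finite C" "0 \<in> C" "m \<notin> C"
  shows "cyc0 (insert m C) (swp 0 m \<circ> \<gamma>) = cyc0 C \<gamma>"
proof -
  have g: "\<gamma> permutes insert m C" by (rule permutes_subset[OF assms(1)]) auto
  have t: "swp 0 m \<circ> \<gamma> permutes insert m C" by (rule permutes_compose[OF g permutes_swap_id]) (use assms in auto)
  have m0: "m \<noteq> 0" using assms by metis
  have gm: "(swp 0 m \<circ> \<gamma>) m = 0" using permutes_not_in[OF assms(1,4)] by simp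
  have "skip {m} (swp 0 m \<circ> \<gamma>) = swp m 0 \<circ> (swp 0 m \<circ> \<gamma>)"
    unfolding skip_single[OF permutes_inj[OF t]] gm ..
  also have "\<dots> = \<gamma>" unfolding transpose_commute[of m 0] by (rule swp_comp)
  finally have sk: "skip {m} (swp 0 m \<circ> \<gamma>) = \<gamma>" .
  have "insert m C - {m} = C" using assms(4) by auto
  then show ?thesis
    using cyc0_remove[OF t _ _ m0] assms(2) m0 unfolding sk gm by simp
qed

text \<open>The contractions of \<open>insert m B\<close> are sorted by the contraction \<open>\<pi>\<close> of \<open>B\<close> that they induce. If \<open>m\<close> stays single, all cycle counts
agree with those for \<open>\<pi>\<close>, since \<open>m\<close> only joins the cycle of \<open>0\<close>. If \<open>m\<close> is paired with \<open>k\<close>, the product of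
the transpositions contracts to \<open>(0 k)\<close> once \<open>m\<close> is removed, and removing \<open>k\<close> as well loses a
cycle exactly if \<open>k\<close> is then fixed, that is, if \<open>k\<close> was mapped to \<open>0\<close>.\<close>

lemma T_labelled_recursion:
  fixes w :: "nat \<Rightarrow> 'h::real_inner"
  assumes B: "finite B" "0 \<in> B" "\<beta> permutes B" and m: "m \<notin> B" and q: "q \<noteq> 0"
  shows "T_labelled q (insert m B) (swp 0 m \<circ> \<beta>) (w(m := h)) = Aplus h (T_labelled q B \<beta> w) + Aminus q h (T_labelled q B \<beta> w)"
proof -
  let ?C = "insert m B" and ?w = "w(m := h)"
  have m0: "m \<noteq> 0" using m B by metis
  let ?g = "\<lambda>\<pi>. pscale (of_real (contr_weight q ?C \<pi> (swp 0 m \<circ> \<beta>) * pair_weight ?C \<pi> ?w))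
     (labelled (?C - supp \<pi>) (skip (supp \<pi>) (\<pi> \<circ> (swp 0 m \<circ> \<beta>))) ?w)"
  let ?f = "\<lambda>\<pi>. pscale (of_real (contr_weight q B \<pi> \<beta> * pair_weight B \<pi> w))"
  let ?c = "\<lambda>\<pi>. labelled (B - supp \<pi>) (skip (supp \<pi>) (\<pi> \<circ> \<beta>)) w"
  have main: "?g \<pi> = ?f \<pi> (Aplus h (?c \<pi>)) \<and>
      (\<Sum>k\<in>B - supp \<pi> - {0}. ?g (\<pi> \<circ> swp k m)) = ?f \<pi> (Aminus q h (?c \<pi>))" if \<pi>: "\<pi> \<in> Invol B" for \<pi>
  proof
    note I = InvolD[OF \<pi>]
    let ?S = "supp \<pi>" and ?a = "\<pi> \<circ> \<beta>"
    let ?b = "skip ?S ?a"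
    have S: "?S \<subseteq> B" "0 \<notin> ?S" "finite ?S" "m \<notin> ?S" using I(5) B(1) finite_subset m by auto
    have pm: "\<pi> m = m" by (rule permutes_not_in[OF I(1) m])
    have a: "?a permutes B" by (rule permutes_compose[OF B(3) I(1)])
    have aC: "?a permutes ?C" by (rule permutes_subset[OF a]) auto
    have b: "?b permutes B - ?S" by (rule skip_permutes[OF a B(1) S(3)])
    have finC: "finite ?C" using B by simp
    have tC: "swp 0 m permutes ?C" by (rule permutes_swap_id) (use B in auto)
    have tS: "swp 0 m x = x" if "x \<in> ?S" for x
    proof -
      have "x \<noteq> 0" "x \<noteq> m" using that S(2,4) by metis+
      then show ?thesis by simp
    qed
    have comm0: "\<pi> \<circ> (swp 0 m \<circ> \<beta>) = swp 0 m \<circ> ?a"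
    proof
      fix x
      have "\<pi> (swp 0 m y) = swp 0 m (\<pi> y)" for y
        using I(3) pm I(4)[of y] unfolding Transposition.transpose_def by metis
      then show "(\<pi> \<circ> (swp 0 m \<circ> \<beta>)) x = (swp 0 m \<circ> ?a) x" by simp
    qed
    have sk0: "skip ?S (swp 0 m \<circ> ?a) = swp 0 m \<circ> ?b"
      by (rule skip_comp_left[OF aC finC tC S(3) tS])
    have CS: "?C - ?S = insert m (B - ?S)" using S(4) by auto
    have bS: "finite (B - ?S)" "0 \<in> B - ?S" "m \<notin> B - ?S" using B S m by auto
    have e0: "contr_weight q ?C \<pi> (swp 0 m \<circ> \<beta>) = contr_weight q B \<pi> \<beta>"
      unfolding contr_weight_def comm0 sk0 CS cyc0_join[OF a B(1,2) m] cyc0_join[OF b bS] ..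
    have pair_weight0: "pair_weight ?C \<pi> ?w = pair_weight B \<pi> w"
    proof -
      have "{i. i \<in> ?C \<and> i < \<pi> i} = {i. i \<in> B \<and> i < \<pi> i}" using pm by auto
      moreover have "\<pi> i \<noteq> m" if "i \<in> B" for i using that I(6)[of i] m by auto
      ultimately show ?thesis unfolding pair_weight_def using m by (intro prod.cong) auto
    qed
    have "labelled (?C - ?S) (skip ?S (\<pi> \<circ> (swp 0 m \<circ> \<beta>))) ?w = Aplus h (?c \<pi>)"
      unfolding comm0 sk0 CS Aplus_labelled[OF bS(1,2) b] by (rule plus_labelled_eq[OF bS(1,2) b bS(3), symmetric])
    then show "?g \<pi> = ?f \<pi> (Aplus h (?c \<pi>))" unfolding e0 pair_weight0 by simp
    have "?g (\<pi> \<circ> swp k m) = ?f \<pi> (pscale (of_real ((if ?b k = 0 then 1 else q) * inner (w k) h))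
        (labelled (B - ?S - {k}) (skip {k} (swp 0 k \<circ> ?b)) w))" if k: "k \<in> B - ?S - {0}" for k
    proof -
      have k': "k \<in> B" "k \<notin> ?S" "k \<noteq> 0" "k \<noteq> m" using k m by auto
      have pk: "\<pi> k = k" using k'(2) by (simp add: supp_def)
      let ?p = "\<pi> \<circ> swp k m" and ?t = "swp k m \<circ> swp 0 m"
      have ap: "?p x = (if x = m then k else if x = k then m else \<pi> x)" for x
        using pm pk by (auto simp: Transposition.transpose_def)
      have sp: "supp ?p = insert k (insert m ?S)"
        unfolding supp_def ap using k'(4) by auto
      have pairs: "pairs ?p = pairs \<pi> + 1"
        unfolding pairs_def sp using S k' by simp
      have tp: "?t permutes ?C" by (intro permutes_compose permutes_swap_id) (use B k' in auto)
      have tS': "?t x = x" if "x \<in> ?S" for x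
      proof -
        have "x \<noteq> 0" "x \<noteq> m" "x \<noteq> k" using that S(2,4) k'(2) by metis+
        then show ?thesis by simp
      qed
      have comm: "?p \<circ> (swp 0 m \<circ> \<beta>) = ?t \<circ> ?a"
      proof
        fix x
        have c: "\<pi> (swp k m y) = swp k m (\<pi> y)" "\<pi> (swp 0 m y) = swp 0 m (\<pi> y)" for y
          using I(3) pm pk I(4)[of y] unfolding Transposition.transpose_def by metis+
        show "(?p \<circ> (swp 0 m \<circ> \<beta>)) x = (?t \<circ> ?a) x" by (simp add: c)
      qed
      have t3: "swp 0 m \<circ> ?t = swp 0 k \<circ> id"
        using k' m0 by (auto simp: fun_eq_iff Transposition.transpose_def)
      have skm: "skip {m} (?t \<circ> \<gamma>) = swp 0 k \<circ> \<gamma>" if g: "\<gamma> permutes D" "m \<notin> D" for \<gamma> D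
      proof -
        have i: "inj (?t \<circ> \<gamma>)"
          using permutes_inj[OF g(1)] permutes_inj[OF tp] by (rule inj_compose[rotated])
        have "(?t \<circ> \<gamma>) m = 0"
          using permutes_not_in[OF g] k' m0 by (simp add: Transposition.transpose_def)
        then have "skip {m} (?t \<circ> \<gamma>) = swp m 0 \<circ> (?t \<circ> \<gamma>)" unfolding skip_single[OF i] by simp
        \<comment> \<open>\<open>(0 m)(k m)(0 m) = (0 k)\<close>: removing \<open>m\<close> leaves the transposition of \<open>0\<close> with its partner.\<close>
        also have "\<dots> = (swp 0 m \<circ> ?t) \<circ> \<gamma>" by (simp only: transpose_commute[of m 0] comp_assoc)
        finally show ?thesis unfolding t3 by simp
      qed
      have tm: "(?t \<circ> ?a) m = 0"
        using permutes_not_in[OF a m] k' m0 by (simp add: Transposition.transpose_def)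
      have tpa: "?t \<circ> ?a permutes ?C" by (rule permutes_compose[OF aC tp])
      have kS: "k \<notin> insert m ?S" using k' by auto
      have fmS: "finite (insert m ?S)" using S(3) by simp
      have e3: "skip ?S (?t \<circ> ?a) = ?t \<circ> ?b"
        by (rule skip_comp_left[OF aC finC tp S(3) tS'])
      have e2: "skip (insert m ?S) (?t \<circ> ?a) = swp 0 k \<circ> ?b"
        by (rule trans[OF skip_insert[OF tpa finC S(3,4)]]) (simp only: e3 skm[OF b bS(3)])
      have s1: "skip (supp ?p) (?t \<circ> ?a) = skip {k} (swp 0 k \<circ> ?b)"
        unfolding sp by (rule trans[OF skip_insert[OF tpa finC fmS kS]]) (simp only: e2)
      have kk: "swp 0 k permutes B" "swp 0 k permutes B - ?S" by (rule permutes_swap_id; use B k' S in auto)+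
      have c1: "cyc0 ?C (?t \<circ> ?a) = cyc0 B (swp 0 k \<circ> ?a)"
        using cyc0_remove[OF tpa finC _ m0] m m0 unfolding tm skm[OF a m] by simp
      have kb: "(swp 0 k \<circ> ?b) k = k \<longleftrightarrow> ?b k = 0"
        using k' by (auto simp: Transposition.transpose_def)
      have c2: "cyc0 (B - ?S) (swp 0 k \<circ> ?b) = cyc0 (B - ?S - {k}) (skip {k} (swp 0 k \<circ> ?b)) + (if ?b k = 0 then 1 else 0)"
        using cyc0_remove[OF permutes_compose[OF b kk(2)] bS(1), of k] k' unfolding kb by simp
      have tk: "swp 0 k x = x" if "x \<in> ?S" for x
      proof -
        have "x \<noteq> 0" "x \<noteq> k" using that S(2) k'(2) by metis+
        then show ?thesis by simp
      qed
      \<comment> \<open>The exponent depends only on the difference of two cycle counts, which \<open>(0 k)\<close> does not change.\<close>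
      have c3: "cyc0 B (swp 0 k \<circ> ?a) + cyc0 (B - ?S) ?b = cyc0 (B - ?S) (swp 0 k \<circ> ?b) + cyc0 B ?a"
        by (rule cyc0_skip_comp_left[OF a B(1) kk(1) S(1,2)]) (rule tk)
      have diff: "?C - supp ?p = B - ?S - {k}" unfolding sp using m by auto
      have "contr_weight q ?C ?p (swp 0 m \<circ> \<beta>) = q powi (int (cyc0 (B - ?S) ?b) - int (cyc0 B ?a) + int (pairs \<pi>)
           + (if ?b k = 0 then 0 else 1))"
        unfolding contr_weight_def comm diff s1 c1 pairs
        by (rule arg_cong[where f = "power_int q"]) (use c2 c3 in \<open>simp split: if_splits\<close>)
      also have "\<dots> = contr_weight q B \<pi> \<beta> * (if ?b k = 0 then 1 else q)"
        unfolding contr_weight_def using q by (simp add: power_int_add)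
      finally have e: "contr_weight q ?C ?p (swp 0 m \<circ> \<beta>) = contr_weight q B \<pi> \<beta> * (if ?b k = 0 then 1 else q)" .
      have pair_weight: "pair_weight ?C ?p ?w = pair_weight B \<pi> w * inner (w k) h"
      proof -
        \<comment> \<open>The new pair is represented in the product by its smaller letter.\<close>
        define i0 where "i0 = (if k < m then k else m)"
        have "{i. i \<in> ?C \<and> i < ?p i} = insert i0 {i. i \<in> B \<and> i < \<pi> i}"
          unfolding ap i0_def using k' pk m by auto
        moreover have "i0 \<notin> {i. i \<in> B \<and> i < \<pi> i}" using pk m by (auto simp: i0_def)
        moreover have "inner (?w i0) (?w (?p i0)) = inner (w k) h"
          unfolding ap i0_def using k' by (auto simp: inner_commute)
        moreover have "(\<Prod>i | i \<in> B \<and> i < \<pi> i. inner (?w i) (?w (?p i))) = pair_weight B \<pi> w"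
          unfolding pair_weight_def
        proof (rule prod.cong[OF refl])
          fix i assume i: "i \<in> {i. i \<in> B \<and> i < \<pi> i}"
          then have "i \<noteq> m" "i \<noteq> k" "\<pi> i \<noteq> m" using m pk I(6)[of i] by auto
          then show "inner (?w i) (?w (?p i)) = inner (w i) (w (\<pi> i))" unfolding ap by simp
        qed
        ultimately show ?thesis unfolding pair_weight_def using B(1) by simp
      qed
      have skp: "skip {k} (swp 0 k \<circ> ?b) permutes B - ?S - {k}"
        by (rule skip_permutes[OF permutes_compose[OF b kk(2)] bS(1)]) simp
      have "labelled (B - ?S - {k}) (skip {k} (swp 0 k \<circ> ?b)) ?w = labelled (B - ?S - {k}) (skip {k} (swp 0 k \<circ> ?b)) w"
        by (rule labelled_cong[OF _ _ skp]) (use bS k' in auto)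
      then show ?thesis unfolding comm diff s1 e pair_weight by (simp add: mult_ac)
    qed
    then have "(\<Sum>k\<in>B - ?S - {0}. ?g (\<pi> \<circ> swp k m)) = (\<Sum>k\<in>B - ?S - {0}. ?f \<pi> (pscale (of_real ((if ?b k = 0 then 1 else q) * inner (w k) h))
        (labelled (B - ?S - {k}) (skip {k} (swp 0 k \<circ> ?b)) w)))"
      by (intro sum.cong[OF refl])
    also have "\<dots> = ?f \<pi> (Aminus q h (?c \<pi>))"
      unfolding Aminus_labelled[OF bS(1,2) b] minus_labelled_def by (simp only: ps.scale_sum_right)
    finally show "(\<Sum>k\<in>B - ?S - {0}. ?g (\<pi> \<circ> swp k m)) = ?f \<pi> (Aminus q h (?c \<pi>))" .
  qed
  have "T_labelled q ?C (swp 0 m \<circ> \<beta>) ?w = (\<Sum>\<pi>\<in>Invol B. ?g \<pi> + (\<Sum>k\<in>B - supp \<pi> - {0}. ?g (\<pi> \<circ> swp k m)))"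
    unfolding T_labelled_def by (rule Invol_insert_sum[OF B(1,2) m])
  also have "\<dots> = (\<Sum>\<pi>\<in>Invol B. ?f \<pi> (Aplus h (?c \<pi>)) + ?f \<pi> (Aminus q h (?c \<pi>)))"
    using main by (intro sum.cong[OF refl]) simp
  also have "\<dots> = Aplus h (T_labelled q B \<beta> w) + Aminus q h (T_labelled q B \<beta> w)"
    unfolding T_labelled_def by (simp only: sum.distrib linD(4,8)[OF Aplus_hom] linD(4,8)[OF Aminus_hom])
  finally show ?thesis .
qed

lemma T_recursion:
  assumes "\<alpha> permutes {0..length hs}" "q \<noteq> 0"
  shows "T_poly q (gen (swp 0 (length hs + 1) \<circ> \<alpha>) (hs @ [h]))
    = Aplus h (T_poly q (gen \<alpha> hs)) + Aminus q h (T_poly q (gen \<alpha> hs))"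
proof -
  let ?m = "length hs + 1" and ?t = "swp 0 (length hs + 1) \<circ> \<alpha>"
  have ins: "insert ?m {0..length hs} = {0..?m}" by auto
  have "\<alpha> permutes {0..?m}" by (rule permutes_subset[OF assms(1)]) auto
  then have t: "?t permutes {0..?m}" by (intro permutes_compose permutes_swap_id) auto
  have "T_poly q (gen ?t (hs @ [h])) = T_labelled q {0..?m} ?t (letter (hs @ [h]))"
    using T_gen[of ?t "hs @ [h]" q] t by simp
  also have "\<dots> = T_labelled q {0..?m} ?t ((letter hs)(?m := h))"
  proof -
    have "map_permutation {0..?m} id ?t = ?t" using t by simp
    moreover have "T_labelled q {0..?m} (map_permutation {0..?m} id ?t) (letter (hs @ [h])) = T_labelled q {0..?m} ?t ((letter hs)(?m := h))"
      by (rule T_labelled_map[OF _ _ t]) (auto simp: nth_append)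
    ultimately show ?thesis by simp
  qed
  also have "\<dots> = Aplus h (T_labelled q {0..length hs} \<alpha> (letter hs)) + Aminus q h (T_labelled q {0..length hs} \<alpha> (letter hs))"
    using T_labelled_recursion[OF _ _ assms(1) _ assms(2), of ?m "letter hs" h] unfolding ins by simp
  finally show ?thesis unfolding T_gen[OF assms(1)] .
qed

section \<open>Bijectivity of the contraction sum\<close>

definition TPd :: "nat \<Rightarrow> 'h::real_vector ptens set" where
  "TPd n = ps.span {Sgen \<alpha> hs | \<alpha> hs. \<alpha> \<in> S0 (length hs) \<and> length hs < n}"

lemma TPd_TP: "TPd n \<subseteq> TP"
  unfolding TPd_def TP_eq by (rule ps.span_mono) blast

lemma Sgen_TPd: "\<alpha> \<in> S0 (length hs) \<Longrightarrow> length hs < n \<Longrightarrow> Sgen \<alpha> hs \<in> TPd n"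
  unfolding TPd_def by (rule ps.span_base) blast

lemma TPd_mono: "m \<le> n \<Longrightarrow> TPd m \<subseteq> TPd n"
  unfolding TPd_def by (rule ps.span_mono) (use order_less_le_trans in blast)

lemma TP_TPd:
  assumes "\<xi> \<in> TP"
  shows "\<exists>n. \<xi> \<in> TPd n"
  using assms unfolding TP_eq
proof (induction rule: ps.span_induct_alt)
  case base
  then show ?case by (auto simp: TPd_def ps.span_zero)
next
  case (step c x y)
  then obtain n \<alpha> hs where n: "y \<in> TPd n" and x: "x = Sgen \<alpha> hs" "\<alpha> \<in> S0 (length hs)" by blast
  let ?N = "max n (length hs + 1)"
  have "x \<in> TPd ?N" unfolding x(1) by (rule Sgen_TPd[OF x(2)]) simp
  moreover have "y \<in> TPd ?N" using n TPd_mono[of n ?N] by auto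
  ultimately have "pscale c x + y \<in> TPd ?N"
    unfolding TPd_def by (intro ps.span_add ps.span_scale)
  then show ?case by blast
qed

lemma labelled_TPd:
  assumes "finite B" "0 \<in> B" "\<beta> permutes B" "card B \<le> n"
  shows "labelled B \<beta> w \<in> TPd n"
  unfolding TPd_def
proof (rule ps.span_base, intro CollectI exI conjI)
  show "labelled B \<beta> w = Sgen (map_permutation B (rank_in B) \<beta>) (lab_word B (rank_in B) w)"
    by (rule labelled_gen(1)[OF assms(1-3)])
  show "map_permutation B (rank_in B) \<beta> \<in> S0 (length (lab_word B (rank_in B) w))"
    unfolding S0_iff labelled_gen(2)[OF assms(1-3)] by (rule labelled_gen(3)[OF assms(1-3)])
  have "0 < card B" using assms by (auto simp: card_gt_0_iff)
  then show "length (lab_word B (rank_in B) w) < n"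
    unfolding labelled_gen(2)[OF assms(1-3)] using assms(4) by linarith
qed

text \<open>Only the empty contraction keeps the degree, and it has coefficient \<open>1\<close>.\<close>

lemma T_leading:
  assumes "\<alpha> permutes {0..length hs}"
  shows "T_poly q (Sgen \<alpha> hs) - Sgen \<alpha> hs \<in> TPd (length hs)"
proof -
  let ?n = "length hs" and ?B = "{0..length hs}"
  let ?g = "\<lambda>\<pi>. pscale (of_real (contr_weight q ?B \<pi> \<alpha> * pair_weight ?B \<pi> (letter hs))) (labelled (?B - supp \<pi>) (skip (supp \<pi>) (\<pi> \<circ> \<alpha>)) (letter hs))"
  have id: "id \<in> Invol ?B" by (simp add: Invol_def)
  have s: "supp id = {}" by (simp add: supp_def)
  have "pairs id = 0" unfolding pairs_def s by simp
  then have gid: "?g id = Sgen \<alpha> hs"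
    unfolding contr_weight_def pair_weight_def s using labelled_interval[OF assms] by simp
  have "?g \<pi> \<in> TPd ?n" if \<pi>: "\<pi> \<in> Invol ?B - {id}" for \<pi>
  proof -
    have pi: "\<pi> \<in> Invol ?B" using \<pi> by blast
    note I = InvolD[OF pi]
    have fS: "finite (supp \<pi>)" using I(5) finite_subset by blast
    have "\<pi> \<noteq> id" using \<pi> by blast
    then obtain x where "\<pi> x \<noteq> x" unfolding fun_eq_iff id_apply by blast
    then have "x \<in> supp \<pi>" by (simp add: supp_def)
    then have "0 < card (supp \<pi>)" using fS by (auto simp: card_gt_0_iff)
    moreover have "supp \<pi> \<subseteq> ?B" using I(5) by blast
    ultimately have c: "card (?B - supp \<pi>) \<le> ?n" by (subst card_Diff_subset[OF fS]) auto
    have a: "\<pi> \<circ> \<alpha> permutes ?B" by (rule permutes_compose[OF assms I(1)])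
    have "labelled (?B - supp \<pi>) (skip (supp \<pi>) (\<pi> \<circ> \<alpha>)) (letter hs) \<in> TPd ?n"
      by (rule labelled_TPd[OF _ _ skip_permutes[OF a _ fS] c]) (use I(5) in auto)
    then show ?thesis unfolding TPd_def by (rule ps.span_scale)
  qed
  then have "(\<Sum>\<pi>\<in>Invol ?B - {id}. ?g \<pi>) \<in> TPd ?n" unfolding TPd_def by (rule ps.span_sum)
  moreover have "T_poly q (Sgen \<alpha> hs) = ?g id + (\<Sum>\<pi>\<in>Invol ?B - {id}. ?g \<pi>)"
    unfolding T_S[OF assms] T_gen[OF assms] T_labelled_def
    by (rule sum.remove[OF finite_Invol id]) simp
  ultimately show ?thesis unfolding gid by simp
qed

lemma T_TP:
  fixes \<xi> :: "'h::real_inner ptens"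
  assumes "\<xi> \<in> TP"
  shows "T_poly q \<xi> \<in> TP"
proof -
  have "T_poly q (Sgen \<alpha> hs) \<in> TP" if "\<alpha> \<in> S0 (length hs)" for \<alpha> and hs :: "'h list"
  proof -
    have "T_poly q (Sgen \<alpha> hs) - Sgen \<alpha> hs \<in> TP"
      using T_leading[of \<alpha> hs q] that TPd_TP[of "length hs"] by (auto simp: S0_iff)
    from ps.span_add[OF this[unfolded TP_eq] Sgen_TP[OF that, unfolded TP_eq]]
    show ?thesis by (simp add: TP_eq)
  qed
  then have "T_poly q ` {Sgen \<alpha> hs | \<alpha> hs. \<alpha> \<in> S0 (length (hs :: 'h list))} \<subseteq> TP" by blast
  then have "ps.span (T_poly q ` {Sgen \<alpha> hs | \<alpha> hs. \<alpha> \<in> S0 (length (hs :: 'h list))}) \<subseteq> TP"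
    by (rule ps.span_minimal) (simp add: TP_eq)
  moreover have "T_poly q \<xi> \<in> T_poly q ` ps.span {Sgen \<alpha> hs | \<alpha> hs. \<alpha> \<in> S0 (length hs)}"
    using assms unfolding TP_eq by blast
  ultimately show ?thesis unfolding Modules.module_hom.span_image[OF T_hom] by blast
qed

lemma T_surj: "(TP :: 'h::real_inner ptens set) \<subseteq> T_poly q ` TP"
proof -
  have sub: "ps.subspace (T_poly q ` (TP :: 'h ptens set))"
    by (rule Modules.module_hom.subspace_image[OF T_hom]) (simp add: TP_eq)
  have "(TPd n :: 'h ptens set) \<subseteq> T_poly q ` TP" for n
  proof (induction n)
    case 0
    have "(TPd 0 :: 'h ptens set) = {0}" by (simp add: TPd_def)
    then show ?case using ps.subspace_0[OF sub] by simp
  next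
    case (Suc n)
    have "Sgen \<alpha> hs \<in> T_poly q ` TP" if "\<alpha> \<in> S0 (length hs)" "length hs < Suc n" for \<alpha> and hs :: "'h list"
    proof -
      have 1: "T_poly q (Sgen \<alpha> hs) - Sgen \<alpha> hs \<in> TPd n"
        using T_leading[of \<alpha> hs q] that TPd_mono[of "length hs" n] S0_iff by auto
      have 2: "T_poly q (Sgen \<alpha> hs) \<in> T_poly q ` TP" by (rule imageI[OF Sgen_TP[OF that(1)]])
      have "T_poly q (Sgen \<alpha> hs) - (T_poly q (Sgen \<alpha> hs) - Sgen \<alpha> hs) \<in> T_poly q ` TP"
        by (rule ps.subspace_diff[OF sub 2 subsetD[OF Suc.IH 1]])
      then show ?thesis by (simp only: diff_diff_eq2 add_diff_cancel_left')
    qed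
    then show ?case unfolding TPd_def[of "Suc n"] by (intro ps.span_minimal sub) auto
  qed
  then show ?thesis using TP_TPd[where 'a = 'h] by (meson subsetD subsetI)
qed

text \<open>Injectivity follows because a nonzero element and its image have the same homogeneous part
of top degree.\<close>

definition hpart :: "nat \<Rightarrow> 'h::real_vector ptens \<Rightarrow> 'h ptens" where
  "hpart n = ptens_ext pscale (\<lambda>\<alpha> hs. if length hs = n then gen \<alpha> hs else 0)"

lemma gen_mlin: "mlin_on pscale n (gen \<alpha>)"
  using mlin_on_hom[OF mlin_simple single_hom, of n \<alpha>] by (simp add: gen_def[abs_def])

lemma hpart_hom: "lin pscale pscale (hpart n)"
  unfolding hpart_def by (rule ptens_ext_hom[OF module_pscale mlin_if_length[OF module_pscale gen_mlin]])

lemma hpart_gen: "hpart n (gen \<alpha> hs) = (if length hs = n then gen \<alpha> hs else 0)"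
  unfolding hpart_def by (rule ptens_ext_gen[OF module_pscale mlin_if_length[OF module_pscale gen_mlin]])

lemma hpart_Sgen: "hpart n (Sgen \<alpha> hs) = (if length hs = n then Sgen \<alpha> hs else 0)"
  unfolding Sgen_eq linD(4,8)[OF hpart_hom] hpart_gen by simp

lemma hpart_TPd: "\<xi> \<in> TPd n \<Longrightarrow> hpart n \<xi> = 0"
  unfolding TPd_def
  by (rule lin_eq_span[OF hpart_hom lin_zero[OF module_pscale module_pscale]]) (auto simp: hpart_Sgen)

lemma hpart_diff:
  assumes "\<xi> \<in> TPd (Suc n)"
  shows "\<xi> - hpart n \<xi> \<in> TPd n"
  using assms unfolding TPd_def[of "Suc n"]
proof (induction rule: ps.span_induct_alt)
  case base
  show ?case by (simp add: linD(5)[OF hpart_hom] TPd_def ps.span_zero)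
next
  case (step c x y)
  then obtain \<alpha> hs where x: "x = Sgen \<alpha> hs" "\<alpha> \<in> S0 (length hs)" "length hs < Suc n" by blast
  have "x - hpart n x \<in> TPd n"
  proof (cases "length hs = n")
    case True
    then show ?thesis by (simp add: x(1) hpart_Sgen TPd_def ps.span_zero)
  next
    case False
    then show ?thesis using Sgen_TPd[OF x(2), of n] x(3) by (simp add: x(1) hpart_Sgen)
  qed
  then have "pscale c (x - hpart n x) + (y - hpart n y) \<in> TPd n"
    using step unfolding TPd_def by (intro ps.span_add ps.span_scale)
  then show ?case by (simp add: linD(3,4)[OF hpart_hom] ps.scale_right_diff_distrib algebra_simps)
qed

lemma hpart_T:
  assumes "\<xi> \<in> TPd (Suc n)"
  shows "hpart n (T_poly q \<xi>) = hpart n \<xi>"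
  using assms unfolding TPd_def
proof (rule lin_eq_span[OF lin_comp[OF T_hom hpart_hom] hpart_hom])
  fix x assume "x \<in> {Sgen \<alpha> hs | \<alpha> hs. \<alpha> \<in> S0 (length (hs :: 'a list)) \<and> length hs < Suc n}"
  then obtain \<alpha> hs where x: "x = Sgen \<alpha> hs" "\<alpha> \<in> S0 (length hs)" "length hs < Suc n" by blast
  have "T_poly q x - x \<in> TPd n"
    using T_leading[of \<alpha> hs q] x TPd_mono[of "length hs" n] S0_iff by auto
  then show "hpart n (T_poly q x) = hpart n x"
    using hpart_TPd linD(6)[OF hpart_hom] by (metis eq_iff_diff_eq_0)
qed

lemma T_inj: "inj_on (T_poly q) TP"
proof -
  have z: "\<xi> \<in> TPd n \<Longrightarrow> T_poly q \<xi> = 0 \<Longrightarrow> \<xi> = 0" for \<xi> :: "'a ptens" and n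
  proof (induction n)
    case 0
    then show ?case by (simp add: TPd_def)
  next
    case (Suc n)
    have "hpart n \<xi> = 0" using hpart_T[OF Suc.prems(1), of q] Suc.prems(2) by (simp add: linD(5)[OF hpart_hom])
    then show ?case using hpart_diff[OF Suc.prems(1)] Suc by simp
  qed
  show ?thesis
  proof (rule inj_onI)
    fix x y :: "'a ptens" assume *: "x \<in> TP" "y \<in> TP" "T_poly q x = T_poly q y"
    then have "x - y \<in> TP" unfolding TP_eq by (intro ps.span_diff)
    then obtain n where "x - y \<in> TPd n" using TP_TPd by blast
    moreover have "T_poly q (x - y) = 0" using *(3) by (simp add: linD(6)[OF T_hom])
    ultimately have "x - y = 0" by (rule z)
    then show "x = y" by simp
  qed
qed

lemma T_inv: "\<zeta> \<in> TP \<Longrightarrow> inv_into TP (T_poly q) (T_poly q \<zeta>) = \<zeta>"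
  by (rule inv_into_f_f[OF T_inj])

section \<open>Right multiplication by the generator\<close>

lemma union_right_mlin: "mlin pscale (\<lambda>ks. Poly_Mapping.single \<gamma> (simple (hs @ ks)))"
proof (intro mlinI mlin_onI)
  fix n and ks :: "'a list" and p a b x y assume *: "length ks = n" "p < n"
  have "mlin_on pscale (length hs + n) (\<lambda>ks::'a list. Poly_Mapping.single \<gamma> (simple ks))"
    by (rule mlin_on_hom[OF mlin_simple single_hom])
  from mlin_onD[OF this, of "hs @ ks" "length hs + p" a x b y] *
  show "Poly_Mapping.single \<gamma> (simple (hs @ ks[p := a *\<^sub>R x + b *\<^sub>R y])) =
     pscale (of_real a) (Poly_Mapping.single \<gamma> (simple (hs @ ks[p := x]))) + pscale (of_real b) (Poly_Mapping.single \<gamma> (simple (hs @ ks[p := y])))"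
    by (simp add: list_update_append)
qed

lemma union_left_mlin: "mlin pscale (\<lambda>hs. Poly_Mapping.single (\<gamma> (length hs)) (simple (hs @ ks)))"
proof (intro mlinI mlin_onI)
  fix n and hs :: "'a list" and p a b x y assume *: "length hs = n" "p < n"
  have "mlin_on pscale (n + length ks) (\<lambda>ks::'a list. Poly_Mapping.single (\<gamma> n) (simple ks))"
    by (rule mlin_on_hom[OF mlin_simple single_hom])
  from mlin_onD[OF this, of "hs @ ks" p a x b y] *
  show "Poly_Mapping.single (\<gamma> (length (hs[p := a *\<^sub>R x + b *\<^sub>R y]))) (simple (hs[p := a *\<^sub>R x + b *\<^sub>R y] @ ks)) =
     pscale (of_real a) (Poly_Mapping.single (\<gamma> (length (hs[p := x]))) (simple (hs[p := x] @ ks))) + pscale (of_real b) (Poly_Mapping.single (\<gamma> (length (hs[p := y]))) (simple (hs[p := y] @ ks)))"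
    by (simp add: list_update_append)
qed

lemma ptens_union_gen_right:
  "ptens_union \<xi> (gen \<beta> ks) = ptens_ext pscale (\<lambda>\<alpha> hs. Poly_Mapping.single (perm_union (length hs) \<alpha> \<beta>) (simple (hs @ ks))) \<xi>"
  unfolding ptens_union_def ptens_ext_gen[OF module_pscale union_right_mlin] ..

lemma ptens_union_hom: "lin pscale pscale (\<lambda>\<xi>. ptens_union \<xi> (gen \<beta> ks))"
  unfolding ptens_union_gen_right by (rule ptens_ext_hom[OF module_pscale union_left_mlin])

lemma ptens_union_gen: "ptens_union (gen \<alpha> hs) (gen \<beta> ks) = gen (perm_union (length hs) \<alpha> \<beta>) (hs @ ks)"
  unfolding ptens_union_gen_right
  by (rule trans[OF ptens_ext_gen[OF module_pscale union_left_mlin]]) (simp only: gen_def)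

lemma perm_union_swp: "perm_union n \<alpha> (swp 0 1) = swp 0 (n + 1) \<circ> \<alpha>"
proof -
  have "shift_perm n (swp 0 1) x = swp 0 (n + 1) x" for x
    by (auto simp: shift_perm_def shift_letter_def Transposition.transpose_def)
  then show ?thesis unfolding perm_union_def by (simp add: fun_eq_iff)
qed

lemma Sgen_one: "Sgen \<alpha> [h] = gen \<alpha> [h]"
proof -
  have "{\<sigma>. \<sigma> permutes {1..length [h]}} = {id}" by (auto simp: permutes_id)
  moreover have "act id [h] = [h]" by (simp add: act_def upt_rec)
  ultimately show ?thesis unfolding Sgen_eq by simp
qed

lemma swp_01_S0: "swp 0 1 \<in> S0 1"
  unfolding S0_iff by (rule permutes_swap_id) auto

lemma X_T: "T_poly q (gen (swp 0 1) [h]) = gen (swp 0 1) [h]"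
proof -
  have p: "swp 0 1 permutes {0..length [h]}" using swp_01_S0 by (simp add: S0_iff)
  have "{0..length [h]} - {0} = {1}" by auto
  then have "Invol {0..length [h]} = {\<pi>. \<pi> = id \<and> \<pi> \<circ> \<pi> = id}"
    unfolding Invol_def by (simp only: permutes_sing)
  also have "\<dots> = {id}" by (rule Set.set_eqI) (simp only: mem_Collect_eq singleton_iff, metis comp_id)
  finally have "Invol {0..length [h]} = {id}" .
  moreover have s: "supp id = {}" by (simp add: supp_def)
  moreover have "pairs id = 0" unfolding pairs_def s by simp
  ultimately show ?thesis
    unfolding T_gen[OF p] T_labelled_def contr_weight_def pair_weight_def using labelled_interval[OF p] by (simp add: Sgen_one)
qed

lemma X_poly_eq: "X_poly q h = sym_tensor 1 (swp 0 1) (simple [h])"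
  and X_poly_gen: "X_poly q h = gen (swp 0 1) [h]"
proof -
  have "sym_tensor 1 (swp 0 1) (simple [h]) = gen (swp 0 1) [h]"
    using Sgen_one[of "swp 0 1" h] by (simp add: Sgen_def)
  then show "X_poly q h = sym_tensor 1 (swp 0 1) (simple [h])" "X_poly q h = gen (swp 0 1) [h]"
    unfolding X_poly_def by (simp_all only: X_T)
qed

lemma X_TP: "X_poly q h \<in> TP"
  unfolding X_poly_gen Sgen_one[symmetric] by (rule Sgen_TP) (use swp_01_S0 in simp)

lemma union_X_unsym:
  assumes "\<zeta> \<in> unsym"
  shows "ptens_union \<zeta> (gen (swp 0 1) [h]) \<in> unsym"
proof -
  let ?U = "\<lambda>\<zeta>. ptens_union \<zeta> (gen (swp 0 1) [h])"
  have "?U \<zeta> \<in> ?U ` ps.span {gen \<alpha> hs | \<alpha> hs. \<alpha> \<in> S0 (length hs)}" using assms unfolding unsym_def by blast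
  also have "\<dots> = ps.span (?U ` {gen \<alpha> hs | \<alpha> hs. \<alpha> \<in> S0 (length hs)})"
    by (rule Modules.module_hom.span_image[OF ptens_union_hom, symmetric])
  also have "\<dots> \<subseteq> unsym" unfolding unsym_def
  proof (rule ps.span_mono, clarify)
    fix \<alpha> and hs :: "'a list" assume "\<alpha> \<in> S0 (length hs)"
    then have "\<alpha> permutes {0..length hs + 1}" unfolding S0_iff by (rule permutes_subset) auto
    then have "swp 0 (length hs + 1) \<circ> \<alpha> \<in> S0 (length (hs @ [h]))"
      unfolding S0_iff length_append by (intro permutes_compose permutes_swap_id) auto
    then show "\<exists>\<alpha>' hs'. ?U (gen \<alpha> hs) = gen \<alpha>' hs' \<and> \<alpha>' \<in> S0 (length hs')"
      unfolding ptens_union_gen perm_union_swp by blast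
  qed
  finally show ?thesis .
qed

lemma tp_mult_T:
  assumes "\<zeta> \<in> TP"
  shows "tp_mult q (T_poly q \<zeta>) (X_poly q h) = T_poly q (ptens_union \<zeta> (gen (swp 0 1) [h]))"
proof -
  have "inv_into TP (T_poly q) (X_poly q h) = X_poly q h"
    using T_inv[OF X_TP, of q q h] unfolding X_poly_gen X_T .
  then have "tp_mult q (T_poly q \<zeta>) (X_poly q h) = T_poly q (symmetrize (ptens_union \<zeta> (gen (swp 0 1) [h])))"
    unfolding tp_mult_def T_inv[OF assms] by (simp only: X_poly_gen)
  also have "\<dots> = T_poly q (ptens_union \<zeta> (gen (swp 0 1) [h]))"
    by (rule T_symmetrize) (use assms TP_unsym union_X_unsym in blast)
  finally show ?thesis .
qed

text \<open>Every element is of the form \<open>T_poly q \<zeta>\<close>, and multiplication by \<open>X\<close> adjoins one letter to \<open>\<zeta>\<close>.\<close>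

lemma tp_mult_X:
  assumes "\<xi> \<in> TP" "q \<noteq> 0"
  shows "tp_mult q \<xi> (X_poly q h) = Aplus h \<xi> + Aminus q h \<xi>"
proof -
  obtain \<zeta> where z: "\<zeta> \<in> TP" "\<xi> = T_poly q \<zeta>" using T_surj[of q] assms(1) by blast
  have "T_poly q (ptens_union \<zeta> (gen (swp 0 1) [h])) = Aplus h (T_poly q \<zeta>) + Aminus q h (T_poly q \<zeta>)"
  proof (rule hom_eq_unsym[OF lin_comp[OF ptens_union_hom T_hom] lin_add[OF lin_comp[OF T_hom Aplus_hom] lin_comp[OF T_hom Aminus_hom]]])
    show "\<zeta> \<in> unsym" using z TP_unsym by blast
    fix \<alpha> and hs :: "'a list" assume "\<alpha> \<in> S0 (length hs)"
    then show "T_poly q (ptens_union (gen \<alpha> hs) (gen (swp 0 1) [h]))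
       = Aplus h (T_poly q (gen \<alpha> hs)) + Aminus q h (T_poly q (gen \<alpha> hs))"
      unfolding ptens_union_gen perm_union_swp S0_iff by (rule T_recursion[OF _ assms(2)])
  qed
  then show ?thesis unfolding z(2) tp_mult_T[OF z(1)] .
qed

section \<open>The sesquilinear form\<close>

abbreviation cnj_scale :: "complex \<Rightarrow> complex \<Rightarrow> complex" where
  "cnj_scale \<equiv> \<lambda>c z. cnj c * z"

definition qker :: "real \<Rightarrow> (nat \<Rightarrow> nat) \<Rightarrow> 'h::real_inner list \<Rightarrow> (nat \<Rightarrow> nat) \<Rightarrow> 'h list \<Rightarrow> real" where
  "qker q \<alpha> fs \<beta> gs = (if length fs = length gs then
     (\<Sum>\<sigma> | \<sigma> permutes {1..length fs}. chi q (length fs) (\<alpha> \<circ> \<sigma> \<circ> pinv \<beta> \<circ> pinv \<sigma>)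
        * (\<Prod>i = 1..length fs. inner (letter fs i) (letter gs (pinv \<sigma> i)))) else 0)"

lemma q_inner_alt: "q_inner q \<xi> \<eta> = ptens_ext (*) (\<lambda>\<alpha> fs. ptens_ext cnj_scale (\<lambda>\<beta> gs. of_real (qker q \<alpha> fs \<beta> gs)) \<eta>) \<xi>"
proof -
  have *: "(if length fs = length gs then let n = length fs in
       of_real (\<Sum>\<sigma> | \<sigma> permutes {1..n}. chi q n (\<alpha> \<circ> \<sigma> \<circ> pinv \<beta> \<circ> pinv \<sigma>)
           * (\<Prod>i = 1..n. inner (letter fs i) (letter gs (pinv \<sigma> i)))) else 0)
    = complex_of_real (qker q \<alpha> fs \<beta> gs)" for \<alpha> \<beta> and fs gs :: "'a list"
    unfolding qker_def Let_def by simp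
  show ?thesis unfolding q_inner_def * ..
qed

lemma real_mlin:
  assumes "\<And>hs p a b x y. length hs = n \<Longrightarrow> p < n \<Longrightarrow>
     f (hs[p := a *\<^sub>R x + b *\<^sub>R y]) = a * f (hs[p := x]) + b * (f (hs[p := y]) :: real)"
  shows "mlin_on (*) n (\<lambda>hs. of_real (f hs))" "mlin_on cnj_scale n (\<lambda>hs. of_real (f hs))"
  by (rule mlin_onI, simp add: assms)+

lemma sum_lin:
  assumes "\<And>i. i \<in> I \<Longrightarrow> F i u = a * F i v + b * (F i w :: real)"
  shows "(\<Sum>i\<in>I. C i * F i u) = a * (\<Sum>i\<in>I. C i * F i v) + b * (\<Sum>i\<in>I. C i * F i w)"
proof -
  have "(\<Sum>i\<in>I. C i * F i u) = (\<Sum>i\<in>I. a * (C i * F i v) + b * (C i * F i w))"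
    by (rule sum.cong[OF refl]) (simp only: assms algebra_simps)
  then show ?thesis by (simp only: sum.distrib sum_distrib_left)
qed

lemma letter_prod_lin:
  assumes "length hs = n" "p < n" "\<sigma> permutes {1..n}"
  shows "(\<Prod>i = 1..n. inner (u i) (letter (hs[p := a *\<^sub>R x + b *\<^sub>R y]) (\<sigma> i)))
    = a * (\<Prod>i = 1..n. inner (u i) (letter (hs[p := x]) (\<sigma> i))) + b * (\<Prod>i = 1..n. inner (u i) (letter (hs[p := y]) (\<sigma> i)))"
proof (rule prod_lin[where ?i0.0 = "pinv \<sigma> (p + 1)" and z = 0])
  have s: "\<sigma> (pinv \<sigma> (p + 1)) = p + 1" using permutes_inverses(1)[OF assms(3)] .
  have m: "\<sigma> i \<in> {1..n}" if "i \<in> {1..n}" for i using permutes_in_image[OF assms(3)] that by simp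
  have up: "letter (hs[p := z]) j = (if j = p + 1 then z else letter hs j)" if "1 \<le> j" for z j
    by (rule letter_update) (use assms that in auto)
  show in1: "pinv \<sigma> (p + 1) \<in> {1..n}"
    using permutes_in_image[OF permutes_inv[OF assms(3)], of "p + 1"] assms(2) by simp
  fix i z assume i: "i \<in> {1..n}" "i \<noteq> pinv \<sigma> (p + 1)"
  have "\<sigma> i \<noteq> p + 1" using i(2) permutes_inverses(2)[OF assms(3), of i] by metis
  then show "inner (u i) (letter (hs[p := z]) (\<sigma> i)) = inner (u i) (letter (hs[p := 0]) (\<sigma> i))"
    using up[of "\<sigma> i"] m[OF i(1)] by (simp only: atLeastAtMost_iff if_False)
next
  have s: "\<sigma> (pinv \<sigma> (p + 1)) = p + 1" using permutes_inverses(1)[OF assms(3)] .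
  have up: "letter (hs[p := z]) (p + 1) = z" for z using assms by simp
  show "inner (u (pinv \<sigma> (p + 1))) (letter (hs[p := a *\<^sub>R x + b *\<^sub>R y]) (\<sigma> (pinv \<sigma> (p + 1))))
     = a * inner (u (pinv \<sigma> (p + 1))) (letter (hs[p := x]) (\<sigma> (pinv \<sigma> (p + 1))))
       + b * inner (u (pinv \<sigma> (p + 1))) (letter (hs[p := y]) (\<sigma> (pinv \<sigma> (p + 1))))"
    unfolding s up by (simp add: inner_add_right)
qed simp

lemma qker_right_mlin: "mlin cnj_scale (\<lambda>gs. of_real (qker q \<alpha> fs \<beta> gs))"
proof (rule mlin_by_length)
  fix n
  let ?F = "\<lambda>gs. if length fs = n then \<Sum>\<sigma> | \<sigma> permutes {1..n}. chi q n (\<alpha> \<circ> \<sigma> \<circ> pinv \<beta> \<circ> pinv \<sigma>)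
        * (\<Prod>i = 1..n. inner (letter fs i) (letter gs (pinv \<sigma> i))) else 0"
  show "mlin_on cnj_scale n (\<lambda>gs. of_real (?F gs))"
  proof (rule real_mlin(2))
    fix gs :: "'a list" and p a b x y assume *: "length gs = n" "p < n"
    show "?F (gs[p := a *\<^sub>R x + b *\<^sub>R y]) = a * ?F (gs[p := x]) + b * ?F (gs[p := y])"
    proof (cases "length fs = n")
      case True
      show ?thesis unfolding if_P[OF True]
      proof (rule sum_lin[where F = "\<lambda>\<sigma> gs. \<Prod>i = 1..n. inner (letter fs i) (letter gs (pinv \<sigma> i))"])
        fix \<sigma> assume "\<sigma> \<in> {\<sigma>. \<sigma> permutes {1..n}}"
        then have "pinv \<sigma> permutes {1..n}" by (simp add: permutes_inv)
        from letter_prod_lin[OF * this, of "letter fs" a x b y]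
        show "(\<Prod>i = 1..n. inner (letter fs i) (letter (gs[p := a *\<^sub>R x + b *\<^sub>R y]) (pinv \<sigma> i)))
          = a * (\<Prod>i = 1..n. inner (letter fs i) (letter (gs[p := x]) (pinv \<sigma> i)))
          + b * (\<Prod>i = 1..n. inner (letter fs i) (letter (gs[p := y]) (pinv \<sigma> i)))" .
      qed
    qed simp
  qed
qed (simp add: qker_def)

lemma qker_left_mlin: "mlin (*) (\<lambda>fs. of_real (qker q \<alpha> fs \<beta> gs))"
proof (rule mlin_by_length)
  fix n
  let ?F = "\<lambda>fs. if n = length gs then \<Sum>\<sigma> | \<sigma> permutes {1..n}. chi q n (\<alpha> \<circ> \<sigma> \<circ> pinv \<beta> \<circ> pinv \<sigma>)
        * (\<Prod>i = 1..n. inner (letter fs i) (letter gs (pinv \<sigma> i))) else 0"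
  have id: "(id::nat \<Rightarrow> nat) permutes {1..n}" by (rule permutes_id)
  show "mlin_on (*) n (\<lambda>fs. of_real (?F fs))"
  proof (rule real_mlin(1))
    fix fs :: "'a list" and p a b x y assume *: "length fs = n" "p < n"
    have "(\<Prod>i = 1..n. inner (letter (fs[p := a *\<^sub>R x + b *\<^sub>R y]) i) (v i))
       = a * (\<Prod>i = 1..n. inner (letter (fs[p := x]) i) (v i)) + b * (\<Prod>i = 1..n. inner (letter (fs[p := y]) i) (v i))" for v
      using letter_prod_lin[OF * id, of v a x b y] by (simp only: id_apply inner_commute[of "v _"])
    note 1 = this
    show "?F (fs[p := a *\<^sub>R x + b *\<^sub>R y]) = a * ?F (fs[p := x]) + b * ?F (fs[p := y])"
    proof (cases "n = length gs")
      case True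
      show ?thesis unfolding if_P[OF True]
        by (rule sum_lin[where F = "\<lambda>\<sigma> fs. \<Prod>i = 1..n. inner (letter fs i) (letter gs (pinv \<sigma> i))"], rule 1)
    qed simp
  qed
qed (simp add: qker_def)

lemma qker_ext_mlin:
  fixes \<eta> :: "'h::real_inner ptens"
  shows "mlin (*) (\<lambda>fs. ptens_ext cnj_scale (\<lambda>\<beta> gs. of_real (qker q \<alpha> fs \<beta> gs)) \<eta>)"
proof (rule mlinI, rule mlin_onI)
  fix n and hs :: "'h list" and p a b x y assume *: "length hs = n" "p < n"
  let ?E = "\<lambda>fs. ptens_ext cnj_scale (\<lambda>\<beta> gs. of_real (qker q \<alpha> fs \<beta> gs))"
  have h: "lin pscale cnj_scale (?E fs)" for fs by (rule ptens_ext_hom[OF module_cnj qker_right_mlin])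
  have g: "?E fs (gen \<beta> gs) = of_real (qker q \<alpha> fs \<beta> gs)" for fs \<beta> gs
    by (rule ptens_ext_gen[OF module_cnj qker_right_mlin])
  have "?E (hs[p := a *\<^sub>R x + b *\<^sub>R y]) \<eta> = cnj_scale (of_real a) (?E (hs[p := x]) \<eta>) + cnj_scale (of_real b) (?E (hs[p := y]) \<eta>)"
  proof (rule ptens_hom_eq[OF h])
    show "lin pscale cnj_scale (\<lambda>\<eta>. cnj_scale (of_real a) (?E (hs[p := x]) \<eta>) + cnj_scale (of_real b) (?E (hs[p := y]) \<eta>))"
      by (intro lin_add lin_scale h)
    fix \<beta> and gs :: "'h list"
    have "mlin_on (*) n (\<lambda>fs. complex_of_real (qker q \<alpha> fs \<beta> gs))"
      using qker_left_mlin[of q \<alpha> \<beta> gs] by (simp add: mlin_def)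
    from mlin_onD[OF this *]
    show "?E (hs[p := a *\<^sub>R x + b *\<^sub>R y]) (gen \<beta> gs) = cnj_scale (of_real a) (?E (hs[p := x]) (gen \<beta> gs)) + cnj_scale (of_real b) (?E (hs[p := y]) (gen \<beta> gs))"
      unfolding g by simp
  qed
  then show "?E (hs[p := a *\<^sub>R x + b *\<^sub>R y]) \<eta> = of_real a * ?E (hs[p := x]) \<eta> + of_real b * ?E (hs[p := y]) \<eta>"
    by simp
qed

lemma q_inner_left: "lin pscale (*) (\<lambda>\<xi>. q_inner q \<xi> \<eta>)"
  unfolding q_inner_alt by (rule ptens_ext_hom[OF module_mult qker_ext_mlin])

lemma q_inner_gen_left: "q_inner q (gen \<alpha> fs) \<eta> = ptens_ext cnj_scale (\<lambda>\<beta> gs. of_real (qker q \<alpha> fs \<beta> gs)) \<eta>"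
  unfolding q_inner_alt by (rule ptens_ext_gen[OF module_mult qker_ext_mlin])

lemma q_inner_gen: "q_inner q (gen \<alpha> fs) (gen \<beta> gs) = of_real (qker q \<alpha> fs \<beta> gs)"
  unfolding q_inner_gen_left by (rule ptens_ext_gen[OF module_cnj qker_right_mlin])

lemma q_inner_right: "lin pscale cnj_scale (q_inner q \<xi>)"
proof (rule linI[OF module_pscale module_cnj])
  have gl: "lin pscale cnj_scale (q_inner q (gen \<alpha> fs))" for \<alpha> and fs :: "'a list"
    unfolding q_inner_gen_left by (rule ptens_ext_hom[OF module_cnj qker_right_mlin])
  fix x y :: "'a ptens" and c
  show "q_inner q \<xi> (x + y) = q_inner q \<xi> x + q_inner q \<xi> y"
    by (rule ptens_hom_eq[OF q_inner_left lin_add[OF q_inner_left q_inner_left]]) (rule linD(3)[OF gl])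
  show "q_inner q \<xi> (pscale c x) = cnj c * q_inner q \<xi> x"
    by (rule ptens_hom_eq[OF q_inner_left lin_scale[OF q_inner_left]]) (rule linD(4)[OF gl])
qed

section \<open>Positivity of the form\<close>

text \<open>Gram-Schmidt, one vector at a time.\<close>

lemma finite_orthonormal:
  fixes H :: "'h::real_inner set"
  assumes "finite H"
  shows "\<exists>E. finite E \<and> (\<forall>e\<in>E. \<forall>d\<in>E. inner e d = (if e = d then 1 else 0)) \<and> (\<forall>u\<in>H. u = (\<Sum>e\<in>E. inner u e *\<^sub>R e))"
  using assms
proof (induction H rule: finite_induct)
  case empty
  show ?case by (rule exI[of _ "{}"]) simp
next
  case (insert v H)
  then obtain E where E: "finite E" "\<And>e d. e \<in> E \<Longrightarrow> d \<in> E \<Longrightarrow> inner e d = (if e = d then 1 else 0)"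
    "\<And>u. u \<in> H \<Longrightarrow> u = (\<Sum>e\<in>E. inner u e *\<^sub>R e)" by blast
  define r where "r = v - (\<Sum>e\<in>E. inner v e *\<^sub>R e)"
  have orth: "inner r d = 0" if "d \<in> E" for d
  proof -
    have "inner (\<Sum>e\<in>E. inner v e *\<^sub>R e) d = (\<Sum>e\<in>E. if e = d then inner v e else 0)"
      unfolding inner_sum_left by (rule sum.cong[OF refl]) (simp add: E(2) that)
    then show ?thesis unfolding r_def using E(1) that by (simp add: inner_diff_left)
  qed
  show ?case
  proof (cases "r = 0")
    case True
    then show ?thesis using E by (intro exI[of _ E]) (auto simp: r_def)
  next
    case False
    define e0 where "e0 = (1 / norm r) *\<^sub>R r"
    have o0: "inner e0 d = 0" "inner d e0 = 0" if "d \<in> E" for d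
      using orth[OF that] by (simp_all add: e0_def inner_commute)
    have n0: "inner e0 e0 = 1" using False by (simp add: e0_def dot_square_norm power2_eq_square)
    have e0E: "e0 \<notin> E" using o0(1)[of e0] n0 by auto
    have ve0: "inner v e0 *\<^sub>R e0 = r"
    proof -
      have v: "v = r + (\<Sum>e\<in>E. inner v e *\<^sub>R e)" by (simp add: r_def)
      have "inner (\<Sum>e\<in>E. inner v e *\<^sub>R e) e0 = 0"
        unfolding inner_sum_left by (rule sum.neutral) (simp add: o0)
      then have "inner v e0 = inner r e0" by (subst v) (simp only: inner_add_left add_0_right)
      then show ?thesis using False by (simp add: e0_def dot_square_norm power2_eq_square)
    qed
    show ?thesis
    proof (rule exI[of _ "insert e0 E"], intro conjI ballI)
      show "finite (insert e0 E)" using E by simp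
      fix e d assume "e \<in> insert e0 E" "d \<in> insert e0 E"
      then show "inner e d = (if e = d then 1 else 0)" using E(2) o0 n0 e0E by auto
    next
      fix u assume u: "u \<in> insert v H"
      show "u = (\<Sum>e\<in>insert e0 E. inner u e *\<^sub>R e)"
      proof (cases "u = v")
        case True
        then show ?thesis using E(1) e0E ve0 by (simp add: r_def)
      next
        case False
        then have uH: "u \<in> H" using u by simp
        have "inner (\<Sum>e\<in>E. inner u e *\<^sub>R e) e0 = 0"
          unfolding inner_sum_left by (rule sum.neutral) (simp add: o0)
        then have "inner u e0 = 0" using E(3)[OF uH] by simp
        then show ?thesis using E(1) E(3)[OF uH] e0E by simp
      qed
    qed
  qed
qed

lemma finite_parseval:
  fixes H :: "'h::real_inner set"
  assumes "finite H"
  shows "\<exists>E. finite E \<and> (\<forall>u\<in>H. \<forall>v. inner u v = (\<Sum>e\<in>E. inner u e * inner v e))"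
proof -
  obtain E where E: "finite E" "\<And>u. u \<in> H \<Longrightarrow> u = (\<Sum>e\<in>E. inner u e *\<^sub>R e)"
    using finite_orthonormal[OF assms] by blast
  have "inner u v = (\<Sum>e\<in>E. inner u e * inner v e)" if "u \<in> H" for u v
  proof -
    have "inner u v = inner (\<Sum>e\<in>E. inner u e *\<^sub>R e) v" using E(2)[OF that] by simp
    also have "\<dots> = (\<Sum>e\<in>E. inner u e * inner v e)"
      unfolding inner_sum_left inner_scaleR_left by (simp only: inner_commute[of _ v])
    finally show ?thesis .
  qed
  then show ?thesis using E(1) by blast
qed

text \<open>A frame consists of two colourings and of a vector of an orthonormal set for each letter. It indexes the squares into
which the form is decomposed.\<close>

type_synonym 'h frame = "((nat \<Rightarrow> nat) \<times> (nat \<Rightarrow> nat)) \<times> (nat \<Rightarrow> 'h)"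

definition frames :: "nat \<Rightarrow> 'h set \<Rightarrow> nat \<Rightarrow> 'h frame set" where
  "frames N E n = (({0..n} \<rightarrow>\<^sub>E {..<N}) \<times> ({0..n} \<rightarrow>\<^sub>E {..<N})) \<times> ({1..n} \<rightarrow>\<^sub>E E)"

definition frame_act :: "'h frame \<Rightarrow> (nat \<Rightarrow> nat) \<Rightarrow> 'h frame" where
  "frame_act I \<sigma> = ((fst (fst I) \<circ> \<sigma>, snd (fst I) \<circ> \<sigma>), snd I \<circ> \<sigma>)"

text \<open>The value of the functional indexed by \<open>I = ((f, g), \<kappa>)\<close> on \<open>\<alpha> \<otimes> (h\<^sub>1 \<otimes> ... \<otimes> h\<^sub>n)\<close>: the sign of \<open>\<alpha>\<close> if \<open>q < 0\<close>, the condition \<open>f \<circ> \<alpha> = g\<close>,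
and the coordinates of the vectors.\<close>

definition frame_val :: "real \<Rightarrow> nat \<Rightarrow> 'h frame \<Rightarrow> (nat \<Rightarrow> nat) \<Rightarrow> 'h::real_inner list \<Rightarrow> real" where
  "frame_val q n I \<alpha> fs = char_sign q \<alpha> * (if \<forall>x\<in>{0..n}. fst (fst I) (\<alpha> x) = snd (fst I) x then 1 else 0)
     * (\<Prod>i = 1..n. inner (letter fs i) (snd I i))"

definition frame_sym :: "real \<Rightarrow> nat \<Rightarrow> 'h frame \<Rightarrow> (nat \<Rightarrow> nat) \<Rightarrow> 'h::real_inner list \<Rightarrow> real" where
  "frame_sym q n I \<alpha> fs = (\<Sum>\<sigma> | \<sigma> permutes {1..n}. frame_val q n (frame_act I \<sigma>) \<alpha> fs)"

lemma finite_frames: "finite E \<Longrightarrow> finite (frames N E n)"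
  unfolding frames_def by (intro finite_cartesian_product finite_PiE) auto

lemma PiE_comp_perm:
  assumes "f \<in> A \<rightarrow>\<^sub>E B" "\<sigma> permutes A"
  shows "f \<circ> \<sigma> \<in> A \<rightarrow>\<^sub>E B"
proof (rule PiE_I)
  fix x assume "x \<in> A"
  then have "\<sigma> x \<in> A" using permutes_in_image[OF assms(2)] by simp
  then show "(f \<circ> \<sigma>) x \<in> B" using PiE_mem[OF assms(1)] by simp
next
  fix x assume "x \<notin> A"
  then show "(f \<circ> \<sigma>) x = undefined" using permutes_not_in[OF assms(2)] PiE_arb[OF assms(1)] by simp
qed

lemma frame_act_frames:
  assumes "I \<in> frames N E n" "\<sigma> permutes {1..n}"
  shows "frame_act I \<sigma> \<in> frames N E n"
proof -
  have "\<sigma> permutes {0..n}" by (rule permutes_subset[OF assms(2)]) auto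
  moreover have "fst (fst I) \<in> {0..n} \<rightarrow>\<^sub>E {..<N}" "snd (fst I) \<in> {0..n} \<rightarrow>\<^sub>E {..<N}" "snd I \<in> {1..n} \<rightarrow>\<^sub>E E"
    using assms(1) unfolding frames_def by (simp_all only: mem_Times_iff)
  ultimately show ?thesis unfolding frames_def frame_act_def
    by (intro SigmaI PiE_comp_perm assms(2))
qed

lemma frame_act_comp: "frame_act (frame_act I \<sigma>) \<tau> = frame_act I (\<sigma> \<circ> \<tau>)"
  by (simp only: frame_act_def fst_conv snd_conv comp_assoc)

lemma frame_act_id: "frame_act I id = I"
  by (simp only: frame_act_def comp_id prod.collapse)

lemma frames_reindex:
  assumes "\<tau> permutes {1..n}"
  shows "(\<Sum>I\<in>frames N E n. F (frame_act I \<tau>)) = (\<Sum>I\<in>frames N E n. F I)"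
proof (rule sum.reindex_bij_witness[where i = "\<lambda>I. frame_act I (pinv \<tau>)" and j = "\<lambda>I. frame_act I \<tau>"])
  fix I assume I: "I \<in> frames N E n"
  show "frame_act (frame_act I \<tau>) (pinv \<tau>) = I" "frame_act (frame_act I (pinv \<tau>)) \<tau> = I"
    by (simp_all only: frame_act_comp permutes_inv_o[OF assms] frame_act_id)
  show "frame_act I \<tau> \<in> frames N E n" "frame_act I (pinv \<tau>) \<in> frames N E n"
    using frame_act_frames[OF I] assms permutes_inv[OF assms] by blast+
qed simp

text \<open>Both inverses and conjugation disappear because the sign is a character with values \<open>1\<close> and \<open>-1\<close>.\<close>

lemma char_sign_mult:
  assumes "\<alpha> permutes {0..n}" "\<sigma> permutes {0..n}" "\<beta> permutes {0..n}"
  shows "char_sign q (\<alpha> \<circ> \<sigma> \<circ> pinv \<beta> \<circ> pinv \<sigma>) = char_sign q \<alpha> * char_sign q \<beta>"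
proof -
  have p: "permutation \<alpha>" "permutation \<beta>" "permutation \<sigma>"
    using assms permutes_imp_permutation[of "{0..n}"] by auto
  note pi = permutation_inverse[OF p(2)] permutation_inverse[OF p(3)]
  have "sign (\<alpha> \<circ> \<sigma> \<circ> pinv \<beta> \<circ> pinv \<sigma>) = sign \<alpha> * sign \<sigma> * sign \<beta> * sign \<sigma>"
    by (simp only: sign_compose permutation_compose p pi sign_inverse)
  also have "\<dots> = sign \<alpha> * sign \<beta> * (sign \<sigma> * sign \<sigma>)" by (simp only: mult_ac)
  finally show ?thesis by (simp add: char_sign_def)
qed

text \<open>A colouring \<open>f\<close> is invariant under \<open>\<alpha> \<sigma> \<beta>\<^sup>-\<^sup>1 \<sigma>\<^sup>-\<^sup>1\<close> exactly if \<open>f \<circ> \<alpha>\<close> and \<open>f \<circ> \<sigma> \<beta> \<sigma>\<^sup>-\<^sup>1\<close> coincide. Introducing the common value \<open>g\<close>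
as a second colouring separates \<open>\<alpha>\<close> from \<open>\<beta>\<close>.\<close>

lemma chi_frames:
  assumes N: "N \<ge> 1" "q = 1 / real N \<or> q = - 1 / real N"
    and p: "\<alpha> permutes {0..n}" "\<sigma> permutes {1..n}" "\<beta> permutes {0..n}"
  shows "chi q n (\<alpha> \<circ> \<sigma> \<circ> pinv \<beta> \<circ> pinv \<sigma>) = char_sign q \<alpha> * char_sign q \<beta> / real N ^ (n + 1) *
    (\<Sum>(f, g)\<in>({0..n} \<rightarrow>\<^sub>E {..<N}) \<times> ({0..n} \<rightarrow>\<^sub>E {..<N}). (if \<forall>x\<in>{0..n}. f (\<alpha> x) = g x then 1 else 0) *
       (if \<forall>x\<in>{0..n}. f (\<sigma> (\<beta> x)) = g (\<sigma> x) then 1 else 0))"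
proof -
  let ?F = "{0..n} \<rightarrow>\<^sub>E {..<N}"
  have s: "\<sigma> permutes {0..n}" by (rule permutes_subset[OF p(2)]) auto
  let ?d = "\<alpha> \<circ> \<sigma> \<circ> pinv \<beta> \<circ> pinv \<sigma>"
  have d: "?d permutes {0..n}" by (intro permutes_compose permutes_inv s p)
  have eq: "(\<forall>x\<in>{0..n}. f (?d x) = f x) \<longleftrightarrow> (\<forall>x\<in>{0..n}. f (\<sigma> (\<beta> x)) = f (\<alpha> (\<sigma> x)))" for f :: "nat \<Rightarrow> nat"
  proof
    assume l: "\<forall>x\<in>{0..n}. f (?d x) = f x"
    show "\<forall>x\<in>{0..n}. f (\<sigma> (\<beta> x)) = f (\<alpha> (\<sigma> x))"
    proof
      fix x assume "x \<in> {0..n}"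
      then have "\<sigma> (\<beta> x) \<in> {0..n}" using permutes_in_image[OF s] permutes_in_image[OF p(3)] by blast
      from l[rule_format, OF this] show "f (\<sigma> (\<beta> x)) = f (\<alpha> (\<sigma> x))"
        using permutes_inverses(2)[OF s] permutes_inverses(2)[OF p(3)] by simp
    qed
  next
    assume r: "\<forall>x\<in>{0..n}. f (\<sigma> (\<beta> x)) = f (\<alpha> (\<sigma> x))"
    show "\<forall>x\<in>{0..n}. f (?d x) = f x"
    proof
      fix x assume "x \<in> {0..n}"
      then have "pinv \<beta> (pinv \<sigma> x) \<in> {0..n}"
        using permutes_in_image[OF permutes_inv[OF s]] permutes_in_image[OF permutes_inv[OF p(3)]] by blast
      from r[rule_format, OF this] show "f (?d x) = f x"
        using permutes_inverses(1)[OF s] permutes_inverses(1)[OF p(3)] by simp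
    qed
  qed
  have fin: "finite ?F" by (intro finite_PiE) auto
  have inner: "(\<Sum>g\<in>?F. (if \<forall>x\<in>{0..n}. f (\<alpha> x) = g x then 1 else 0) * (if \<forall>x\<in>{0..n}. f (\<sigma> (\<beta> x)) = g (\<sigma> x) then 1 else (0::real)))
     = (if \<forall>x\<in>{0..n}. f (?d x) = f x then 1 else 0)" if f: "f \<in> ?F" for f
  proof -
    have fa: "f \<circ> \<alpha> \<in> ?F" by (rule PiE_comp_perm[OF f p(1)])
    have "(\<Sum>g\<in>?F. (if \<forall>x\<in>{0..n}. f (\<alpha> x) = g x then 1 else 0) * (if \<forall>x\<in>{0..n}. f (\<sigma> (\<beta> x)) = g (\<sigma> x) then 1 else (0::real)))
      = (\<Sum>g\<in>?F. if g = f \<circ> \<alpha> then (if \<forall>x\<in>{0..n}. f (\<sigma> (\<beta> x)) = f (\<alpha> (\<sigma> x)) then 1 else 0) else 0)"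
    proof (rule sum.cong[OF refl])
      fix g assume g: "g \<in> ?F"
      have "(\<forall>x\<in>{0..n}. f (\<alpha> x) = g x) \<longleftrightarrow> g = f \<circ> \<alpha>"
      proof
        assume "\<forall>x\<in>{0..n}. f (\<alpha> x) = g x"
        then show "g = f \<circ> \<alpha>" by (intro PiE_ext[OF g fa]) simp
      qed simp
      then show "(if \<forall>x\<in>{0..n}. f (\<alpha> x) = g x then 1 else 0) * (if \<forall>x\<in>{0..n}. f (\<sigma> (\<beta> x)) = g (\<sigma> x) then 1 else (0::real))
         = (if g = f \<circ> \<alpha> then (if \<forall>x\<in>{0..n}. f (\<sigma> (\<beta> x)) = f (\<alpha> (\<sigma> x)) then 1 else 0) else 0)"
        by (simp add: comp_apply)
    qed
    also have "\<dots> = (if \<forall>x\<in>{0..n}. f (\<sigma> (\<beta> x)) = f (\<alpha> (\<sigma> x)) then 1 else 0)"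
      unfolding sum.delta[OF fin] using fa by (simp only: if_True)
    finally show ?thesis unfolding eq .
  qed
  have "(\<Sum>(f, g)\<in>?F \<times> ?F. (if \<forall>x\<in>{0..n}. f (\<alpha> x) = g x then 1 else 0) *
       (if \<forall>x\<in>{0..n}. f (\<sigma> (\<beta> x)) = g (\<sigma> x) then 1 else (0::real)))
     = (\<Sum>f\<in>?F. if \<forall>x\<in>{0..n}. f (?d x) = f x then 1 else 0)"
    unfolding sum.cartesian_product[symmetric] by (rule sum.cong[OF refl inner])
  also have "\<dots> = real (card {f \<in> ?F. \<forall>x\<in>{0..n}. f (?d x) = f x})"
    using fin by (simp add: sum.If_cases Int_def conj_commute)
  finally show ?thesis
    unfolding chi_colourings[OF N d] char_sign_mult[OF p(1) s p(3)] by simp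
qed

lemma prod_parseval:
  fixes u v :: "nat \<Rightarrow> 'h::real_inner"
  assumes E: "finite E" "\<And>i w. i \<in> {1..n} \<Longrightarrow> inner (u i) w = (\<Sum>e\<in>E. inner (u i) e * inner w e)"
    and s: "\<sigma> permutes {1..n}"
  shows "(\<Prod>i = 1..n. inner (u i) (v (pinv \<sigma> i)))
    = (\<Sum>\<kappa>\<in>{1..n} \<rightarrow>\<^sub>E E. (\<Prod>i = 1..n. inner (u i) (\<kappa> i)) * (\<Prod>i = 1..n. inner (v i) (\<kappa> (\<sigma> i))))"
proof -
  have "(\<Prod>i = 1..n. inner (u i) (v (pinv \<sigma> i))) = (\<Prod>i = 1..n. \<Sum>e\<in>E. inner (u i) e * inner (v (pinv \<sigma> i)) e)"
    by (rule prod.cong[OF refl]) (rule E(2))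
  also have "\<dots> = (\<Sum>\<kappa>\<in>{1..n} \<rightarrow>\<^sub>E E. \<Prod>i = 1..n. inner (u i) (\<kappa> i) * inner (v (pinv \<sigma> i)) (\<kappa> i))"
    by (rule prod_sum_PiE) (use E in auto)
  also have "\<dots> = (\<Sum>\<kappa>\<in>{1..n} \<rightarrow>\<^sub>E E. (\<Prod>i = 1..n. inner (u i) (\<kappa> i)) * (\<Prod>i = 1..n. inner (v i) (\<kappa> (\<sigma> i))))"
  proof (rule sum.cong[OF refl])
    fix \<kappa>
    have "(\<Prod>i = 1..n. inner (v (pinv \<sigma> i)) (\<kappa> i)) = (\<Prod>i = 1..n. inner (v i) (\<kappa> (\<sigma> i)))"
      using prod.permute[OF s, of "\<lambda>i. inner (v (pinv \<sigma> i)) (\<kappa> i)"] permutes_inverses(2)[OF s] by (simp add: comp_def)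
    then show "(\<Prod>i = 1..n. inner (u i) (\<kappa> i) * inner (v (pinv \<sigma> i)) (\<kappa> i))
      = (\<Prod>i = 1..n. inner (u i) (\<kappa> i)) * (\<Prod>i = 1..n. inner (v i) (\<kappa> (\<sigma> i)))"
      by (simp add: prod.distrib)
  qed
  finally show ?thesis .
qed

text \<open>The sum over \<open>\<sigma>\<close> acts on one factor only, but the set of frames is invariant under the symmetric group. Averaging
over it puts the symmetrized functional into both factors.\<close>

lemma qker_frames:
  assumes N: "N \<ge> 1" "q = 1 / real N \<or> q = - 1 / real N"
    and p: "\<alpha> permutes {0..n}" "\<beta> permutes {0..n}" and l: "length fs = n" "length gs = n"
    and E: "finite E" "\<And>i w. i \<in> {1..n} \<Longrightarrow> inner (letter fs i) w = (\<Sum>e\<in>E. inner (letter fs i) e * inner w e)"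
  shows "qker q \<alpha> fs \<beta> gs = (\<Sum>I\<in>frames N E n. frame_sym q n I \<alpha> fs * frame_sym q n I \<beta> gs) / (fact n * real N ^ (n + 1))"
proof -
  let ?P = "{\<sigma>. \<sigma> permutes {1..n}}" and ?I = "frames N E n" and ?C = "real N ^ (n + 1)"
  have one: "chi q n (\<alpha> \<circ> \<sigma> \<circ> pinv \<beta> \<circ> pinv \<sigma>) * (\<Prod>i = 1..n. inner (letter fs i) (letter gs (pinv \<sigma> i)))
    = (\<Sum>I\<in>?I. frame_val q n I \<alpha> fs * frame_val q n (frame_act I \<sigma>) \<beta> gs) / ?C" if s: "\<sigma> \<in> ?P" for \<sigma>
  proof -
    have s': "\<sigma> permutes {1..n}" using s by simp
    let ?F = "({0..n} \<rightarrow>\<^sub>E {..<N}) \<times> ({0..n} \<rightarrow>\<^sub>E {..<N})" and ?K = "{1..n} \<rightarrow>\<^sub>E E"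
    let ?a = "\<lambda>f g. (if \<forall>x\<in>{0..n}. f (\<alpha> x) = g x then 1 else 0) * (if \<forall>x\<in>{0..n}. f (\<sigma> (\<beta> x)) = g (\<sigma> x) then 1 else (0::real))"
    let ?b = "\<lambda>\<kappa>. (\<Prod>i = 1..n. inner (letter fs i) (\<kappa> i)) * (\<Prod>i = 1..n. inner (letter gs i) (\<kappa> (\<sigma> i)))"
    let ?s = "char_sign q \<alpha> * char_sign q \<beta>"
    have "(\<Sum>I\<in>?I. frame_val q n I \<alpha> fs * frame_val q n (frame_act I \<sigma>) \<beta> gs) = (\<Sum>z\<in>?F. \<Sum>\<kappa>\<in>?K. ?s * ((case z of (f, g) \<Rightarrow> ?a f g) * ?b \<kappa>))"
      unfolding frames_def sum.cartesian_product
      by (rule sum.cong[OF refl]) (auto simp: frame_val_def frame_act_def split_beta)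
    also have "\<dots> = ?s * ((\<Sum>(f, g)\<in>?F. ?a f g) * (\<Sum>\<kappa>\<in>?K. ?b \<kappa>))"
      unfolding sum_product by (simp only: sum_distrib_left)
    finally have 1: "(\<Sum>I\<in>?I. frame_val q n I \<alpha> fs * frame_val q n (frame_act I \<sigma>) \<beta> gs) = ?s * ((\<Sum>(f, g)\<in>?F. ?a f g) * (\<Sum>\<kappa>\<in>?K. ?b \<kappa>))" .
    have 2: "(\<Prod>i = 1..n. inner (letter fs i) (letter gs (pinv \<sigma> i))) = (\<Sum>\<kappa>\<in>?K. ?b \<kappa>)"
      by (rule prod_parseval[OF E s'])
    show ?thesis
      unfolding chi_frames[OF N p(1) s' p(2)] 1 2
      by (simp only: times_divide_eq_left times_divide_eq_right mult.assoc)
  qed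
  have two: "(\<Sum>I\<in>?I. \<Sum>\<sigma>\<in>?P. frame_val q n I \<alpha> fs * frame_val q n (frame_act I \<sigma>) \<beta> gs)
    = (\<Sum>I\<in>?I. frame_val q n (frame_act I \<tau>) \<alpha> fs * frame_sym q n I \<beta> gs)" if t: "\<tau> \<in> ?P" for \<tau>
  proof -
    have t': "\<tau> permutes {1..n}" using t by simp
    have "(\<Sum>I\<in>?I. \<Sum>\<sigma>\<in>?P. frame_val q n I \<alpha> fs * frame_val q n (frame_act I \<sigma>) \<beta> gs)
      = (\<Sum>I\<in>?I. \<Sum>\<sigma>\<in>?P. frame_val q n (frame_act I \<tau>) \<alpha> fs * frame_val q n (frame_act (frame_act I \<tau>) \<sigma>) \<beta> gs)"
      by (rule frames_reindex[OF t', symmetric])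
    also have "\<dots> = (\<Sum>I\<in>?I. frame_val q n (frame_act I \<tau>) \<alpha> fs * frame_sym q n I \<beta> gs)"
    proof (rule sum.cong[OF refl])
      fix I
      have "(\<Sum>\<sigma>\<in>?P. frame_val q n (frame_act I (\<tau> \<circ> \<sigma>)) \<beta> gs) = frame_sym q n I \<beta> gs"
        unfolding frame_sym_def by (rule setum_permutations_compose_left[OF t', symmetric])
      then show "(\<Sum>\<sigma>\<in>?P. frame_val q n (frame_act I \<tau>) \<alpha> fs * frame_val q n (frame_act (frame_act I \<tau>) \<sigma>) \<beta> gs) = frame_val q n (frame_act I \<tau>) \<alpha> fs * frame_sym q n I \<beta> gs"
        unfolding frame_act_comp by (simp only: sum_distrib_left[symmetric])
    qed
    finally show ?thesis .
  qed
  let ?Z = "\<Sum>I\<in>?I. \<Sum>\<sigma>\<in>?P. frame_val q n I \<alpha> fs * frame_val q n (frame_act I \<sigma>) \<beta> gs"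
  have "qker q \<alpha> fs \<beta> gs = (\<Sum>\<sigma>\<in>?P. (\<Sum>I\<in>?I. frame_val q n I \<alpha> fs * frame_val q n (frame_act I \<sigma>) \<beta> gs) / ?C)"
    unfolding qker_def l by (simp only: simp_thms if_True) (rule sum.cong[OF refl one])
  also have "\<dots> = ?Z / ?C"
    unfolding sum_divide_distrib[symmetric] by (subst sum.swap) (rule refl)
  finally have k: "qker q \<alpha> fs \<beta> gs = ?Z / ?C" .
  have "(\<Sum>\<tau>\<in>?P. ?Z) = (\<Sum>\<tau>\<in>?P. \<Sum>I\<in>?I. frame_val q n (frame_act I \<tau>) \<alpha> fs * frame_sym q n I \<beta> gs)"
    by (rule sum.cong[OF refl two])
  also have "\<dots> = (\<Sum>I\<in>?I. frame_sym q n I \<alpha> fs * frame_sym q n I \<beta> gs)"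
    unfolding sum.swap[of _ ?I] by (simp only: frame_sym_def sum_distrib_right)
  finally have "(\<Sum>I\<in>?I. frame_sym q n I \<alpha> fs * frame_sym q n I \<beta> gs) = fact n * ?Z"
    by (simp add: card_permutations)
  then have "(\<Sum>I\<in>?I. frame_sym q n I \<alpha> fs * frame_sym q n I \<beta> gs) / (fact n * ?C) = fact n * ?Z / (fact n * ?C)"
    by (rule arg_cong)
  also have "\<dots> = ?Z / ?C" by (rule mult_divide_mult_cancel_left) simp
  finally show ?thesis unfolding k by (rule sym)
qed

lemma frame_sym_mlin: "mlin (*) (\<lambda>fs. of_real (if length fs = n then c * frame_sym q n I \<alpha> fs else 0))"
proof -
  have id: "(id::nat \<Rightarrow> nat) permutes {1..n}" by (rule permutes_id)
  have "mlin_on (*) n (\<lambda>fs. of_real (c * frame_sym q n I \<alpha> fs))"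
  proof (rule real_mlin(1))
    fix fs :: "'a list" and p a b x y assume *: "length fs = n" "p < n"
    have 1: "(\<Prod>i = 1..n. inner (letter (fs[p := a *\<^sub>R x + b *\<^sub>R y]) i) (v i))
       = a * (\<Prod>i = 1..n. inner (letter (fs[p := x]) i) (v i)) + b * (\<Prod>i = 1..n. inner (letter (fs[p := y]) i) (v i))" for v
      using letter_prod_lin[OF * id, of v a x b y] by (simp only: id_apply inner_commute[of "v _"])
    have "frame_sym q n I \<alpha> (fs[p := a *\<^sub>R x + b *\<^sub>R y]) = a * frame_sym q n I \<alpha> (fs[p := x]) + b * frame_sym q n I \<alpha> (fs[p := y])"
      unfolding frame_sym_def frame_val_def by (rule sum_lin) (rule 1)
    then show "c * frame_sym q n I \<alpha> (fs[p := a *\<^sub>R x + b *\<^sub>R y]) = a * (c * frame_sym q n I \<alpha> (fs[p := x])) + b * (c * frame_sym q n I \<alpha> (fs[p := y]))"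
      by (simp only: algebra_simps)
  qed
  from mlin_if_length[OF module_mult this] show ?thesis by (simp only: if_distrib[of of_real] of_real_0)
qed

definition sos_fun :: "real \<Rightarrow> nat \<Rightarrow> nat \<times> 'h frame \<Rightarrow> 'h::real_inner ptens \<Rightarrow> complex" where
  "sos_fun q N j = ptens_ext (*) (\<lambda>\<alpha> fs. of_real (if length fs = fst j
     then 1 / sqrt (fact (fst j) * real N ^ (fst j + 1)) * frame_sym q (fst j) (snd j) \<alpha> fs else 0))"

lemma sos_fun_hom: "lin pscale (*) (sos_fun q N j)"
  unfolding sos_fun_def by (rule ptens_ext_hom[OF module_mult frame_sym_mlin])

lemma sos_fun_gen: "sos_fun q N j (gen \<alpha> fs) = of_real (if length fs = fst j
     then 1 / sqrt (fact (fst j) * real N ^ (fst j + 1)) * frame_sym q (fst j) (snd j) \<alpha> fs else 0)"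
  unfolding sos_fun_def by (rule ptens_ext_gen[OF module_mult frame_sym_mlin])

definition unsym_on :: "'h::real_inner set \<Rightarrow> nat \<Rightarrow> 'h ptens set" where
  "unsym_on H L = ps.span {gen \<alpha> hs | \<alpha> hs. \<alpha> \<in> S0 (length hs) \<and> set hs \<subseteq> H \<and> length hs \<le> L}"

lemma unsym_unsym_on:
  assumes "\<xi> \<in> unsym"
  shows "\<exists>H L. finite H \<and> \<xi> \<in> unsym_on H L"
  using assms unfolding unsym_def
proof (induction rule: ps.span_induct_alt)
  case base
  show ?case by (rule exI[of _ "{}"]) (simp add: unsym_on_def ps.span_zero)
next
  case (step c x y)
  then obtain H L \<alpha> hs where y: "finite H" "y \<in> unsym_on H L" and x: "x = gen \<alpha> hs" "\<alpha> \<in> S0 (length hs)" by blast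
  let ?H = "H \<union> set hs" and ?L = "max L (length hs)"
  have "x \<in> unsym_on ?H ?L" unfolding unsym_on_def
  proof (rule ps.span_base, intro CollectI exI conjI)
    show "x = gen \<alpha> hs" by (rule x(1))
    show "\<alpha> \<in> S0 (length hs)" by (rule x(2))
  qed auto
  moreover have "unsym_on H L \<subseteq> unsym_on ?H ?L"
    unfolding unsym_on_def by (rule ps.span_mono) fastforce
  ultimately have "pscale c x + y \<in> unsym_on ?H ?L"
    using y(2) unfolding unsym_on_def by (intro ps.span_add ps.span_scale) auto
  moreover have "finite ?H" using y(1) by simp
  ultimately show ?case by blast
qed

lemma q_inner_sos_on:
  assumes N: "N \<ge> 1" "q = 1 / real N \<or> q = - 1 / real N"
    and E: "finite E" "\<And>u w. u \<in> H \<Longrightarrow> inner u w = (\<Sum>e\<in>E. inner u e * inner w e)"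
    and x: "\<xi> \<in> unsym_on H L" "\<eta> \<in> unsym_on H L"
  shows "q_inner q \<xi> \<eta> = (\<Sum>j\<in>(SIGMA n:{..L}. frames N E n). sos_fun q N j \<xi> * cnj (sos_fun q N j \<eta>))"
proof -
  let ?J = "SIGMA n:{..L}. frames N E n"
  let ?G = "{gen \<alpha> hs | \<alpha> hs. \<alpha> \<in> S0 (length hs) \<and> set hs \<subseteq> H \<and> length hs \<le> L}"
  have finJ: "finite ?J" using finite_frames[OF E(1)] by auto
  have gg: "q_inner q (gen \<alpha> fs) (gen \<beta> gs) = (\<Sum>j\<in>?J. sos_fun q N j (gen \<alpha> fs) * cnj (sos_fun q N j (gen \<beta> gs)))"
    if a: "\<alpha> \<in> S0 (length fs)" "set fs \<subseteq> H" "length fs \<le> L" and b: "\<beta> \<in> S0 (length gs)" for \<alpha> fs \<beta> gs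
  proof -
    let ?n = "length fs"
    let ?r = "\<lambda>j. (if ?n = fst j then 1 / sqrt (fact (fst j) * real N ^ (fst j + 1)) * frame_sym q (fst j) (snd j) \<alpha> fs else 0) *
       (if length gs = fst j then 1 / sqrt (fact (fst j) * real N ^ (fst j + 1)) * frame_sym q (fst j) (snd j) \<beta> gs else 0)"
    have "(\<Sum>j\<in>?J. sos_fun q N j (gen \<alpha> fs) * cnj (sos_fun q N j (gen \<beta> gs))) = of_real (\<Sum>j\<in>?J. ?r j)"
      unfolding sos_fun_gen complex_cnj_complex_of_real of_real_mult[symmetric] of_real_sum ..
    also have "(\<Sum>j\<in>?J. ?r j) = (\<Sum>n\<in>{..L}. \<Sum>I\<in>frames N E n. ?r (n, I))"
    proof -
      have "(\<Sum>n\<in>{..L}. \<Sum>I\<in>frames N E n. ?r (n, I)) = (\<Sum>(n, I)\<in>?J. ?r (n, I))"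
        by (rule sum.Sigma) (use finite_frames[OF E(1)] in auto)
      also have "\<dots> = (\<Sum>j\<in>?J. ?r j)"
        by (rule sum.cong[OF refl]) (simp only: split_beta prod.collapse)
      finally show ?thesis by (rule sym)
    qed
    also have "\<dots> = (\<Sum>n\<in>{..L}. if n = ?n then (\<Sum>I\<in>frames N E n. ?r (n, I)) else 0)"
      by (rule sum.cong[OF refl]) (auto intro!: sum.neutral)
    also have "\<dots> = (\<Sum>I\<in>frames N E ?n. ?r (?n, I))" using a(3) by (simp add: sum.delta)
    also have "\<dots> = qker q \<alpha> fs \<beta> gs"
    proof (cases "length gs = ?n")
      case True
      have E': "inner (letter fs i) w = (\<Sum>e\<in>E. inner (letter fs i) e * inner w e)" if "i \<in> {1..?n}" for i w
      proof -
        have "letter fs i \<in> set fs" using that by auto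
        then show ?thesis using E(2) a(2) by blast
      qed
      let ?s = "sqrt (fact ?n * real N ^ (?n + 1))"
      have ss: "?s * ?s = fact ?n * real N ^ (?n + 1)" by simp
      have "(\<Sum>I\<in>frames N E ?n. ?r (?n, I)) = (\<Sum>I\<in>frames N E ?n. frame_sym q ?n I \<alpha> fs * frame_sym q ?n I \<beta> gs / (?s * ?s))"
        by (rule sum.cong[OF refl]) (simp only: True fst_conv snd_conv simp_thms if_True times_divide_eq_right times_divide_eq_left divide_divide_eq_left mult_1)
      also have "\<dots> = qker q \<alpha> fs \<beta> gs"
        unfolding ss sum_divide_distrib[symmetric]
        by (rule qker_frames[OF N _ _ refl True E(1) E', symmetric]) (use a b True in \<open>auto simp: S0_iff\<close>)
      finally show ?thesis .
    next
      case False
      then show ?thesis by (simp add: qker_def)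
    qed
    finally show ?thesis unfolding q_inner_gen by simp
  qed
  have hom_r: "lin pscale cnj_scale (\<lambda>\<eta>. \<Sum>j\<in>?J. sos_fun q N j \<xi> * cnj (sos_fun q N j \<eta>))" for \<xi>
    by (rule linI[OF module_pscale module_cnj])
      (simp_all add: linD(3,4)[OF sos_fun_hom] sum.distrib sum_distrib_left algebra_simps)
  have hom_l: "lin pscale (*) (\<lambda>\<xi>. \<Sum>j\<in>?J. sos_fun q N j \<xi> * cnj (sos_fun q N j \<eta>))" for \<eta>
    by (rule linI[OF module_pscale module_mult])
      (simp_all add: linD(3,4)[OF sos_fun_hom] sum.distrib sum_distrib_left algebra_simps)
  show ?thesis
  proof (rule lin_eq_span[OF q_inner_left hom_l x(1)[unfolded unsym_on_def]])
    fix g assume "g \<in> ?G"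
    then obtain \<alpha> fs where g: "g = gen \<alpha> fs" "\<alpha> \<in> S0 (length fs)" "set fs \<subseteq> H" "length fs \<le> L" by blast
    show "q_inner q g \<eta> = (\<Sum>j\<in>?J. sos_fun q N j g * cnj (sos_fun q N j \<eta>))"
      by (rule lin_eq_span[OF q_inner_right hom_r x(2)[unfolded unsym_on_def]]) (use g gg in blast)
  qed
qed

text \<open>The finitely many vectors occurring in \<open>\<xi>\<close> and \<open>\<eta>\<close> lie in the span of a finite orthonormal set, over which
the frames are taken; the functionals then represent the form on the span of \<open>\<xi>\<close> and \<open>\<eta>\<close>, which is
all that Cauchy-Schwarz and the triangle inequality need.\<close>

lemma q_inner_sos:
  fixes \<xi> \<eta> :: "'h::real_inner ptens"
  assumes N: "N \<ge> 1" "q = 1 / real N \<or> q = - 1 / real N" and "\<xi> \<in> unsym" "\<eta> \<in> unsym"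
  obtains J :: "(nat \<times> 'h frame) set" and V where "finite J" "\<And>j. lin pscale (*) (V j)"
    "\<And>x y. x \<in> ps.span {\<xi>, \<eta>} \<Longrightarrow> y \<in> ps.span {\<xi>, \<eta>} \<Longrightarrow> q_inner q x y = (\<Sum>j\<in>J. V j x * cnj (V j y))"
proof -
  obtain H L H' L' where 1: "finite H" "\<xi> \<in> unsym_on H L" and 2: "finite H'" "\<eta> \<in> unsym_on H' L'"
    using unsym_unsym_on assms(3,4) by metis
  let ?H = "H \<union> H'" and ?L = "max L L'"
  have "unsym_on H L \<subseteq> unsym_on ?H ?L" "unsym_on H' L' \<subseteq> unsym_on ?H ?L"
    unfolding unsym_on_def by (rule ps.span_mono; fastforce)+
  then have "{\<xi>, \<eta>} \<subseteq> unsym_on ?H ?L" using 1 2 by auto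
  then have sub: "ps.span {\<xi>, \<eta>} \<subseteq> unsym_on ?H ?L"
    unfolding unsym_on_def by (rule ps.span_minimal) (rule ps.subspace_span)
  obtain E where E: "finite E" "\<forall>u\<in>?H. \<forall>v. inner u v = (\<Sum>e\<in>E. inner u e * inner v e)"
    using finite_parseval[of ?H] 1 2 by auto
  show ?thesis
  proof (rule that[of "SIGMA n:{..?L}. frames N E n" "sos_fun q N"])
    show "finite (SIGMA n:{..?L}. frames N E n)" using finite_frames[OF E(1)] by auto
    show "lin pscale (*) (sos_fun q N j)" for j by (rule sos_fun_hom)
    fix x y assume "x \<in> ps.span {\<xi>, \<eta>}" "y \<in> ps.span {\<xi>, \<eta>}"
    then have xy: "x \<in> unsym_on ?H ?L" "y \<in> unsym_on ?H ?L" using sub by blast+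
    show "q_inner q x y = (\<Sum>j\<in>(SIGMA n:{..?L}. frames N E n). sos_fun q N j x * cnj (sos_fun q N j y))"
      by (rule q_inner_sos_on[OF N E(1) _ xy]) (rule E(2)[rule_format])
  qed
qed

section \<open>The seminorm\<close>

lemma TP_add: "\<xi> \<in> TP \<Longrightarrow> \<eta> \<in> TP \<Longrightarrow> \<xi> + \<eta> \<in> TP"
  and TP_diff: "\<xi> \<in> TP \<Longrightarrow> \<eta> \<in> TP \<Longrightarrow> \<xi> - \<eta> \<in> TP"
  and TP_scale: "\<xi> \<in> TP \<Longrightarrow> pscale c \<xi> \<in> TP"
  unfolding TP_eq by (rule ps.span_add ps.span_diff ps.span_scale; assumption)+

context
  fixes N :: nat and q :: real
  assumes N: "N \<ge> 1" "q = 1 / real N \<or> q = - 1 / real N"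
begin

lemma q_norm_L2:
  assumes "\<And>x y. x \<in> X \<Longrightarrow> y \<in> X \<Longrightarrow> q_inner q x y = (\<Sum>j\<in>J. V j x * cnj (V j y))" "\<xi> \<in> X"
  shows "q_norm q \<xi> = L2_set (\<lambda>j. norm (V j \<xi>)) J"
proof -
  have "q_inner q \<xi> \<xi> = of_real (\<Sum>j\<in>J. (norm (V j \<xi>))\<^sup>2)"
    unfolding assms(1)[OF assms(2,2)] by (simp only: complex_norm_square of_real_sum)
  then show ?thesis by (simp add: q_norm_def L2_set_def)
qed

lemma q_inner_commute:
  assumes "\<xi> \<in> unsym" "\<eta> \<in> unsym"
  shows "q_inner q \<eta> \<xi> = cnj (q_inner q \<xi> \<eta>)"
proof -
  obtain J :: "(nat \<times> 'a frame) set" and V where V: "finite J" "\<And>j. lin pscale (*) (V j)"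
    "\<And>x y. x \<in> ps.span {\<xi>, \<eta>} \<Longrightarrow> y \<in> ps.span {\<xi>, \<eta>} \<Longrightarrow> q_inner q x y = (\<Sum>j\<in>J. V j x * cnj (V j y))"
    by (rule q_inner_sos[OF N assms]) (rule that; simp)
  have s: "\<xi> \<in> ps.span {\<xi>, \<eta>}" "\<eta> \<in> ps.span {\<xi>, \<eta>}" by (simp_all add: ps.span_base)
  show ?thesis unfolding V(3)[OF s] V(3)[OF s(2,1)] by (simp add: mult.commute)
qed

lemma q_norm_triangle:
  assumes "\<xi> \<in> unsym" "\<eta> \<in> unsym"
  shows "q_norm q (\<xi> + \<eta>) \<le> q_norm q \<xi> + q_norm q \<eta>"
proof -
  obtain J :: "(nat \<times> 'a frame) set" and V where V: "finite J" "\<And>j. lin pscale (*) (V j)"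
    "\<And>x y. x \<in> ps.span {\<xi>, \<eta>} \<Longrightarrow> y \<in> ps.span {\<xi>, \<eta>} \<Longrightarrow> q_inner q x y = (\<Sum>j\<in>J. V j x * cnj (V j y))"
    by (rule q_inner_sos[OF N assms]) (rule that; simp)
  have s: "\<xi> \<in> ps.span {\<xi>, \<eta>}" "\<eta> \<in> ps.span {\<xi>, \<eta>}" by (simp_all add: ps.span_base)
  have n: "q_norm q z = L2_set (\<lambda>j. norm (V j z)) J" if "z \<in> ps.span {\<xi>, \<eta>}" for z
    by (rule q_norm_L2[OF V(3) that])
  have "L2_set (\<lambda>j. norm (V j (\<xi> + \<eta>))) J \<le> L2_set (\<lambda>j. norm (V j \<xi>) + norm (V j \<eta>)) J"
    by (rule L2_set_mono) (simp_all add: linD(3)[OF V(2)] norm_triangle_ineq)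
  also have "\<dots> \<le> L2_set (\<lambda>j. norm (V j \<xi>)) J + L2_set (\<lambda>j. norm (V j \<eta>)) J"
    by (rule L2_set_triangle_ineq)
  finally show ?thesis unfolding n[OF s(1)] n[OF s(2)] n[OF ps.span_add[OF s]] .
qed

lemma q_norm_nonneg:
  assumes "\<xi> \<in> unsym"
  shows "0 \<le> q_norm q \<xi>"
proof -
  obtain J :: "(nat \<times> 'a frame) set" and V where V: "finite J" "\<And>j. lin pscale (*) (V j)"
    "\<And>x y. x \<in> ps.span {\<xi>, \<xi>} \<Longrightarrow> y \<in> ps.span {\<xi>, \<xi>} \<Longrightarrow> q_inner q x y = (\<Sum>j\<in>J. V j x * cnj (V j y))"
    by (rule q_inner_sos[OF N assms assms]) (rule that; simp)
  have s: "\<xi> \<in> ps.span {\<xi>, \<xi>}" by (simp add: ps.span_base)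
  have "q_norm q \<xi> = L2_set (\<lambda>j. norm (V j \<xi>)) J" by (rule q_norm_L2[OF V(3) s])
  then show ?thesis by (simp only: L2_set_nonneg)
qed

text \<open>Cauchy-Schwarz: all functionals in the sum of squares vanish on a null vector.\<close>

lemma q_norm_null:
  assumes "\<xi> \<in> unsym" "\<eta> \<in> unsym" "q_norm q \<xi> = 0"
  shows "q_inner q \<xi> \<eta> = 0"
proof -
  obtain J :: "(nat \<times> 'a frame) set" and V where V: "finite J" "\<And>j. lin pscale (*) (V j)"
    "\<And>x y. x \<in> ps.span {\<xi>, \<eta>} \<Longrightarrow> y \<in> ps.span {\<xi>, \<eta>} \<Longrightarrow> q_inner q x y = (\<Sum>j\<in>J. V j x * cnj (V j y))"
    by (rule q_inner_sos[OF N assms(1,2)]) (rule that; simp)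
  have s: "\<xi> \<in> ps.span {\<xi>, \<eta>}" "\<eta> \<in> ps.span {\<xi>, \<eta>}" by (simp_all add: ps.span_base)
  have "L2_set (\<lambda>j. norm (V j \<xi>)) J = 0" using assms(3) q_norm_L2[OF V(3) s(1)] by simp
  then have "\<forall>j\<in>J. V j \<xi> = 0" using V(1) by (simp add: L2_set_eq_0_iff)
  then show ?thesis unfolding V(3)[OF s] by (intro sum.neutral) simp
qed

end

lemma q_norm_zero: "q_norm q 0 = 0"
  by (simp add: q_norm_def linD(5)[OF q_inner_left])

lemma q_norm_scale: "q_norm q (pscale c \<xi>) = norm c * q_norm q \<xi>"
proof -
  have "q_inner q (pscale c \<xi>) (pscale c \<xi>) = (c * cnj c) * q_inner q \<xi> \<xi>"
    by (simp only: linD(4)[OF q_inner_left] linD(4)[OF q_inner_right] mult_ac)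
  also have "c * cnj c = of_real ((norm c)\<^sup>2)" by (simp only: complex_norm_square)
  finally have "Re (q_inner q (pscale c \<xi>) (pscale c \<xi>)) = (norm c)\<^sup>2 * Re (q_inner q \<xi> \<xi>)" by simp
  then show ?thesis by (simp add: q_norm_def real_sqrt_mult)
qed

lemma q_norm_minus: "q_norm q (\<xi> - \<eta>) = q_norm q (\<eta> - \<xi>)"
proof -
  have "\<xi> - \<eta> = pscale (-1) (\<eta> - \<xi>)" by (simp add: ps.scale_minus_left)
  then show ?thesis using q_norm_scale[of q "-1" "\<eta> - \<xi>"] by simp
qed

section \<open>Creation and annihilation are adjoint\<close>

lemma card_orbits: "finite A \<Longrightarrow> 0 \<in> A \<Longrightarrow> \<alpha> permutes A \<Longrightarrow> cyc0 A \<alpha> + 1 = card (orbit \<alpha> ` A)"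
proof -
  assume A: "finite A" "0 \<in> A" "\<alpha> permutes A"
  have self: "x \<in> orbit \<alpha> x" for x by (rule permutation_self_in_orbit[OF permutes_imp_permutation[OF A(1,3)]])
  have "{c \<in> orbit \<alpha> ` A. 0 \<notin> c} = orbit \<alpha> ` A - {orbit \<alpha> 0}"
  proof (intro equalityI subsetI)
    fix c assume "c \<in> {c \<in> orbit \<alpha> ` A. 0 \<notin> c}"
    then show "c \<in> orbit \<alpha> ` A - {orbit \<alpha> 0}" using self[of 0] by auto
  next
    fix c assume c: "c \<in> orbit \<alpha> ` A - {orbit \<alpha> 0}"
    then obtain x where x: "c = orbit \<alpha> x" by blast
    have "0 \<notin> c" using orbits_eq[OF A(3,1) _ self[of 0], of x] c x by auto
    then show "c \<in> {c \<in> orbit \<alpha> ` A. 0 \<notin> c}" using c by blast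
  qed
  then have "cyc0 A \<alpha> = card (orbit \<alpha> ` A) - 1"
    unfolding cyc0_def using A by (simp add: card_Diff_singleton)
  moreover have "0 < card (orbit \<alpha> ` A)" using A by (auto simp: card_gt_0_iff)
  ultimately show ?thesis by simp
qed

lemma swp_inv: "pinv (swp a b) = swp a b"
  by (rule inv_unique_comp) (simp_all only: transpose_comp_involutory)

lemma bij_swp: "bij (swp a b)"
  by (rule permutes_bij[OF permutes_swap_id[of _ UNIV]]) auto

text \<open>Not obvious from the definition, since \<open>0\<close> plays a special role; the number of all orbits is \<open>cyc0 + 1\<close>, and it is
invariant under conjugation.\<close>

lemma cyc0_comp_commute:
  assumes A: "finite A" "0 \<in> A" and p: "\<delta> permutes A" "\<tau> permutes A"
  shows "cyc0 A (\<tau> \<circ> \<delta>) = cyc0 A (\<delta> \<circ> \<tau>)"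
proof -
  have step: "\<tau> y \<in> orbit (\<tau> \<circ> \<delta>) (\<tau> x)" if "y \<in> orbit (\<delta> \<circ> \<tau>) x" for \<delta> \<tau> :: "nat \<Rightarrow> nat" and y x :: nat
    using that
  proof induction
    case base
    show ?case using orbit.base[of "\<tau> \<circ> \<delta>" "\<tau> x"] by (simp only: comp_def)
  next
    case (step y)
    show ?case using orbit.step[OF step.IH] by (simp only: comp_def)
  qed
  have o: "orbit (\<tau> \<circ> \<delta>) (\<tau> x) = \<tau> ` orbit (\<delta> \<circ> \<tau>) x" for x
  proof (intro equalityI subsetI)
    fix y assume "y \<in> \<tau> ` orbit (\<delta> \<circ> \<tau>) x"
    then show "y \<in> orbit (\<tau> \<circ> \<delta>) (\<tau> x)" using step by blast
  next
    fix y assume "y \<in> orbit (\<tau> \<circ> \<delta>) (\<tau> x)"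
    then show "y \<in> \<tau> ` orbit (\<delta> \<circ> \<tau>) x"
    proof induction
      case base
      show ?case using orbit.base[of "\<delta> \<circ> \<tau>" x] by (intro image_eqI[of _ _ "\<delta> (\<tau> x)"]) (simp_all only: comp_def)
    next
      case (step y)
      then obtain z where z: "z \<in> orbit (\<delta> \<circ> \<tau>) x" "y = \<tau> z" by blast
      show ?case using orbit.step[OF z(1)] z(2) by (intro image_eqI[of _ _ "\<delta> (\<tau> z)"]) (simp_all only: comp_def)
    qed
  qed
  have "orbit (\<tau> \<circ> \<delta>) ` A = orbit (\<tau> \<circ> \<delta>) ` \<tau> ` A" using permutes_image[OF p(2)] by simp
  also have "\<dots> = (`) \<tau> ` orbit (\<delta> \<circ> \<tau>) ` A" unfolding image_image o ..
  finally have "card (orbit (\<tau> \<circ> \<delta>) ` A) = card (orbit (\<delta> \<circ> \<tau>) ` A)"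
    using card_image[of "(`) \<tau>"] inj_on_image[of \<tau>] permutes_inj[OF p(2)]
    by (metis (no_types, lifting) inj_image_eq_iff inj_onI)
  then show ?thesis
    using card_orbits[OF A permutes_compose[OF p]] card_orbits[OF A permutes_compose[OF p(2,1)]] by simp
qed

lemma conj_eq_map:
  assumes "\<rho> permutes A" "\<gamma> permutes A"
  shows "\<rho> \<circ> \<gamma> \<circ> pinv \<rho> = map_permutation A \<rho> \<gamma>"
proof
  fix y
  show "(\<rho> \<circ> \<gamma> \<circ> pinv \<rho>) y = map_permutation A \<rho> \<gamma> y"
  proof (cases "y \<in> A")
    case True
    then obtain b where b: "b \<in> A" "y = \<rho> b" using permutes_image[OF assms(1)] by blast
    then show ?thesis
      using permutes_inj_on[OF assms(1)] permutes_inj[OF assms(1)] by (simp add: map_permutation_apply inv_f_f)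
  next
    case False
    have "map_permutation A \<rho> \<gamma> permutes A"
      by (rule map_permutation_permutes[OF permutes_imp_bij[OF assms(1)] assms(2)])
    moreover have "pinv \<rho> y = y" using permutes_not_in[OF permutes_inv[OF assms(1)] False] .
    ultimately show ?thesis using False assms by (simp add: permutes_not_in)
  qed
qed

lemma skip_inverse:
  assumes "\<epsilon> permutes A"
  shows "skip {m} (pinv \<epsilon>) = pinv (skip {m} \<epsilon>)"
proof -
  have i: "inj \<epsilon>" "inj (pinv \<epsilon>)" using permutes_inj[OF assms] permutes_inj[OF permutes_inv[OF assms]] by auto
  have b: "bij \<epsilon>" by (rule permutes_bij[OF assms])
  have "skip {m} (pinv \<epsilon>) \<circ> skip {m} \<epsilon> = id"
  proof
    fix x
    show "(skip {m} (pinv \<epsilon>) \<circ> skip {m} \<epsilon>) x = id x"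
      using permutes_inverses[OF assms] unfolding skip_single[OF i(1)] skip_single[OF i(2)]
      by (simp add: Transposition.transpose_def) (metis permutes_inverses[OF assms])
  qed
  moreover have "skip {m} \<epsilon> \<circ> skip {m} (pinv \<epsilon>) = id"
  proof
    fix x
    show "(skip {m} \<epsilon> \<circ> skip {m} (pinv \<epsilon>)) x = id x"
      using permutes_inverses[OF assms] unfolding skip_single[OF i(1)] skip_single[OF i(2)]
      by (simp add: Transposition.transpose_def) (metis permutes_inverses[OF assms])
  qed
  ultimately show ?thesis by (metis inv_unique_comp)
qed

text \<open>By conjugation the transposition \<open>(0 n+1)\<close> moves to the inverse of \<open>\<beta>\<close>, where it becomes \<open>(0 k)\<close> with \<open>\<rho> k = n + 1\<close>. The letter
\<open>n + 1\<close> can then be removed; it is a cycle of its own exactly if \<open>\<beta> k = 0\<close>, which is where the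
coefficient \<open>1\<close> in the annihilation operator comes from.\<close>

lemma chi_creation:
  assumes a: "\<alpha> permutes {0..n}" and b: "\<beta> permutes {0..n + 1}" and r: "\<rho> permutes {1..n + 1}" and k: "\<rho> k = n + 1"
  shows "chi q (n + 1) (swp 0 (n + 1) \<circ> \<alpha> \<circ> \<rho> \<circ> pinv \<beta> \<circ> pinv \<rho>)
    = (if \<beta> k = 0 then 1 else q) * chi q n (\<alpha> \<circ> \<rho> \<circ> pinv (skip {k} (swp 0 k \<circ> \<beta>)) \<circ> pinv \<rho>)"
proof -
  let ?m = "n + 1" and ?A = "{0..n + 1}"
  have r0: "\<rho> permutes ?A" by (rule permutes_subset[OF r]) auto
  have rz: "\<rho> 0 = 0" using permutes_not_in[OF r] by simp
  have kz: "k \<noteq> 0"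
  proof
    assume "k = 0"
    then show False using k rz by simp
  qed
  have kA: "k \<in> ?A" using permutes_in_image[OF r0, of k] k by simp
  have aA: "\<alpha> permutes ?A" by (rule permutes_subset[OF a]) auto
  have sm: "swp 0 ?m permutes ?A" by (rule permutes_swap_id) auto
  have sk: "swp 0 k permutes ?A" by (rule permutes_swap_id) (use kA in auto)
  \<comment> \<open>The annihilated \<open>\<beta>\<close> transported by \<open>\<rho>\<close>, so that the letter to be removed becomes \<open>n + 1\<close>.\<close>
  define \<epsilon> where "\<epsilon> = \<rho> \<circ> (swp 0 k \<circ> \<beta>) \<circ> pinv \<rho>"
  have g: "swp 0 k \<circ> \<beta> permutes ?A" by (rule permutes_compose[OF b sk])
  have e: "\<epsilon> permutes ?A" unfolding \<epsilon>_def by (intro permutes_compose permutes_inv r0 g)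
  have ei: "pinv \<epsilon> permutes ?A" by (rule permutes_inv[OF e])
  have bij: "bij \<rho>" "bij \<beta>" "bij (swp 0 k)" "bij (pinv \<rho>)"
    using permutes_bij[OF r0] permutes_bij[OF b] permutes_bij[OF sk] permutes_bij[OF permutes_inv[OF r0]] by auto
  have mi: "pinv \<epsilon> = \<rho> \<circ> pinv \<beta> \<circ> swp 0 k \<circ> pinv \<rho>"
    unfolding \<epsilon>_def using bij by (simp only: o_inv_distrib bij_comp inv_inv_eq swp_inv comp_assoc)
  have conj: "\<rho> \<circ> swp 0 k = swp 0 ?m \<circ> \<rho>"
  proof
    fix x
    have "\<rho> x = 0 \<longleftrightarrow> x = 0" "\<rho> x = ?m \<longleftrightarrow> x = k"
      using inj_eq[OF permutes_inj[OF r0], of x 0] inj_eq[OF permutes_inj[OF r0], of x k] rz k by auto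
    then show "(\<rho> \<circ> swp 0 k) x = (swp 0 ?m \<circ> \<rho>) x" using rz k by (simp add: Transposition.transpose_def)
  qed
  have conj': "swp 0 k \<circ> pinv \<rho> = pinv \<rho> \<circ> swp 0 ?m"
  proof -
    have "pinv \<rho> \<circ> (\<rho> \<circ> swp 0 k) \<circ> pinv \<rho> = pinv \<rho> \<circ> (swp 0 ?m \<circ> \<rho>) \<circ> pinv \<rho>" unfolding conj ..
    then show ?thesis
      by (simp only: comp_assoc[symmetric] permutes_inv_o[OF r0] id_comp) (simp only: comp_assoc permutes_inv_o[OF r0] comp_id)
  qed
  have mi': "pinv \<epsilon> = (\<rho> \<circ> pinv \<beta> \<circ> pinv \<rho>) \<circ> swp 0 ?m"
    unfolding mi by (simp only: comp_assoc conj')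
  let ?d = "\<alpha> \<circ> pinv \<epsilon>"
  have d: "?d permutes ?A" by (rule permutes_compose[OF ei aA])
  have "cyc0 ?A (swp 0 ?m \<circ> (\<alpha> \<circ> (\<rho> \<circ> pinv \<beta> \<circ> pinv \<rho>))) = cyc0 ?A ((\<alpha> \<circ> (\<rho> \<circ> pinv \<beta> \<circ> pinv \<rho>)) \<circ> swp 0 ?m)"
    by (rule cyc0_comp_commute) (use aA r0 b sm in \<open>auto intro!: permutes_compose permutes_inv\<close>)
  then have c1: "cyc0 ?A (swp 0 ?m \<circ> \<alpha> \<circ> \<rho> \<circ> pinv \<beta> \<circ> pinv \<rho>) = cyc0 ?A ?d"
    unfolding mi' by (simp only: comp_assoc)
  have am: "\<alpha> ?m = ?m" using permutes_not_in[OF a] by simp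
  have fixm: "?d ?m = ?m \<longleftrightarrow> \<beta> k = 0"
  proof -
    have "?d ?m = ?m \<longleftrightarrow> pinv \<epsilon> ?m = ?m"
      using am inj_eq[OF permutes_inj[OF aA], of "pinv \<epsilon> ?m" ?m] by simp
    also have "\<dots> \<longleftrightarrow> \<epsilon> ?m = ?m" using permutes_inverses[OF e] by metis
    also have "\<epsilon> ?m = \<rho> (swp 0 k (\<beta> k))"
      unfolding \<epsilon>_def using permutes_inverses(2)[OF r0, of k] k by simp
    also have "\<rho> (swp 0 k (\<beta> k)) = ?m \<longleftrightarrow> swp 0 k (\<beta> k) = k"
      using inj_eq[OF permutes_inj[OF r0], of _ k] k by simp
    also have "\<dots> \<longleftrightarrow> \<beta> k = 0" using kz by (auto simp: Transposition.transpose_def)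
    finally show ?thesis .
  qed
  have skd: "skip {?m} ?d = \<alpha> \<circ> \<rho> \<circ> pinv (skip {k} (swp 0 k \<circ> \<beta>)) \<circ> pinv \<rho>"
  proof -
    have "skip {?m} ?d = \<alpha> \<circ> skip {?m} (pinv \<epsilon>)"
      by (rule skip_comp_left[OF ei _ aA]) (use am in auto)
    also have "skip {?m} (pinv \<epsilon>) = pinv (skip {?m} \<epsilon>)" by (rule skip_inverse[OF e])
    also have "skip {?m} \<epsilon> = \<rho> \<circ> skip {k} (swp 0 k \<circ> \<beta>) \<circ> pinv \<rho>"
    proof -
      have "skip (\<rho> ` {k}) (map_permutation ?A \<rho> (swp 0 k \<circ> \<beta>)) = map_permutation ?A \<rho> (skip {k} (swp 0 k \<circ> \<beta>))"
        by (rule skip_map_permutation[OF g _ permutes_inj_on[OF r0], symmetric]) (use kA in auto)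
      then show ?thesis
        unfolding \<epsilon>_def conj_eq_map[OF r0 g] conj_eq_map[OF r0 skip_permutes_aux[OF g finite_atLeastAtMost finite.insertI[OF finite.emptyI]]]
        by (simp only: image_insert image_empty k)
    qed
    also have "pinv (\<rho> \<circ> skip {k} (swp 0 k \<circ> \<beta>) \<circ> pinv \<rho>) = \<rho> \<circ> pinv (skip {k} (swp 0 k \<circ> \<beta>)) \<circ> pinv \<rho>"
      using bij permutes_bij[OF skip_permutes_aux[OF g, of "{k}"]]
      by (simp only: finite_atLeastAtMost finite.insertI finite.emptyI o_inv_distrib bij_comp inv_inv_eq comp_assoc)
    finally show ?thesis by (simp only: comp_assoc)
  qed
  let ?e = "\<alpha> \<circ> \<rho> \<circ> pinv (skip {k} (swp 0 k \<circ> \<beta>)) \<circ> pinv \<rho>"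
  have diff: "?A - {?m} = {0..n}" by auto
  have ep: "?e permutes {0..n}" using skip_permutes[OF d _ , of "{?m}"] unfolding skd diff by simp
  have "cyc0 {0..n} ?e < card {0..n}" by (rule cyc0_less[OF ep]) auto
  then have le: "cyc0 {0..n} ?e \<le> n" by simp
  have "cyc0 ?A ?d = cyc0 {0..n} ?e + (if \<beta> k = 0 then 1 else 0)"
    using cyc0_remove[OF d, of ?m] unfolding skd diff fixm by simp
  then show ?thesis
    unfolding chi_def c1 using le by (simp add: Suc_diff_le)
qed

lemma qker_conj_left:
  assumes a: "\<alpha> permutes {0..length fs}" and b: "\<beta> permutes {0..length gs}" and t: "\<tau> permutes {1..length fs}"
  shows "qker q (\<tau> \<circ> \<alpha> \<circ> pinv \<tau>) (act \<tau> fs) \<beta> gs = qker q \<alpha> fs \<beta> gs"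
proof (cases "length fs = length gs")
  case True
  let ?n = "length fs"
  have t0: "\<tau> permutes {0..?n}" by (rule permutes_subset[OF t]) auto
  have tz: "\<tau> 0 = 0" using permutes_not_in[OF t] by simp
  have "(\<Sum>\<sigma> | \<sigma> permutes {1..?n}. chi q ?n ((\<tau> \<circ> \<alpha> \<circ> pinv \<tau>) \<circ> \<sigma> \<circ> pinv \<beta> \<circ> pinv \<sigma>)
        * (\<Prod>i = 1..?n. inner (letter (act \<tau> fs) i) (letter gs (pinv \<sigma> i))))
    = (\<Sum>\<sigma> | \<sigma> permutes {1..?n}. chi q ?n ((\<tau> \<circ> \<alpha> \<circ> pinv \<tau>) \<circ> (\<tau> \<circ> \<sigma>) \<circ> pinv \<beta> \<circ> pinv (\<tau> \<circ> \<sigma>))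
        * (\<Prod>i = 1..?n. inner (letter (act \<tau> fs) i) (letter gs (pinv (\<tau> \<circ> \<sigma>) i))))"
    by (rule setum_permutations_compose_left[OF t])
  also have "\<dots> = (\<Sum>\<sigma> | \<sigma> permutes {1..?n}. chi q ?n (\<alpha> \<circ> \<sigma> \<circ> pinv \<beta> \<circ> pinv \<sigma>)
        * (\<Prod>i = 1..?n. inner (letter fs i) (letter gs (pinv \<sigma> i))))"
  proof (rule sum.cong[OF refl])
    fix \<sigma> assume "\<sigma> \<in> {\<sigma>. \<sigma> permutes {1..?n}}"
    then have s: "\<sigma> permutes {1..?n}" by simp
    have s0: "\<sigma> permutes {0..?n}" by (rule permutes_subset[OF s]) auto
    have inv: "pinv (\<tau> \<circ> \<sigma>) = pinv \<sigma> \<circ> pinv \<tau>" by (rule o_inv_distrib[OF permutes_bij[OF t] permutes_bij[OF s]])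
    let ?d = "\<alpha> \<circ> \<sigma> \<circ> pinv \<beta> \<circ> pinv \<sigma>"
    have d: "?d permutes {0..?n}" by (intro permutes_compose permutes_inv s0 a) (use b True in simp)
    have "(\<tau> \<circ> \<alpha> \<circ> pinv \<tau>) \<circ> (\<tau> \<circ> \<sigma>) \<circ> pinv \<beta> \<circ> pinv (\<tau> \<circ> \<sigma>) = \<tau> \<circ> \<alpha> \<circ> (pinv \<tau> \<circ> \<tau>) \<circ> \<sigma> \<circ> pinv \<beta> \<circ> pinv \<sigma> \<circ> pinv \<tau>"
      unfolding inv by (simp only: comp_assoc)
    also have "\<dots> = \<tau> \<circ> ?d \<circ> pinv \<tau>" unfolding permutes_inv_o(2)[OF t] comp_id by (simp only: comp_assoc)
    also have "\<dots> = map_permutation {0..?n} \<tau> ?d" by (rule conj_eq_map[OF t0 d])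
    finally have e: "(\<tau> \<circ> \<alpha> \<circ> pinv \<tau>) \<circ> (\<tau> \<circ> \<sigma>) \<circ> pinv \<beta> \<circ> pinv (\<tau> \<circ> \<sigma>) = map_permutation {0..?n} \<tau> ?d" .
    have c: "cyc0 {0..?n} (map_permutation {0..?n} \<tau> ?d) = cyc0 {0..?n} ?d"
      using cyc0_map_permutation[OF d _ _ permutes_inj_on[OF t0] tz] unfolding permutes_image[OF t0] by simp
    have "(\<Prod>i = 1..?n. inner (letter (act \<tau> fs) i) (letter gs (pinv (\<tau> \<circ> \<sigma>) i)))
      = (\<Prod>i = 1..?n. inner (letter fs (pinv \<tau> i)) (letter gs (pinv \<sigma> (pinv \<tau> i))))"
    proof (rule prod.cong[OF refl])
      fix i assume "i \<in> {1..?n}"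
      then obtain j where j: "i = Suc j" "j < ?n" by (cases i) auto
      then have "letter (act \<tau> fs) i = letter fs (pinv \<tau> i)"
        using nth_upt_Suc_0[of j "?n + 1"] by (simp add: act_def)
      then show "inner (letter (act \<tau> fs) i) (letter gs (pinv (\<tau> \<circ> \<sigma>) i)) = inner (letter fs (pinv \<tau> i)) (letter gs (pinv \<sigma> (pinv \<tau> i)))"
        unfolding inv by simp
    qed
    also have "\<dots> = (\<Prod>i = 1..?n. inner (letter fs i) (letter gs (pinv \<sigma> i)))"
      using prod.permute[OF permutes_inv[OF t], of "\<lambda>i. inner (letter fs i) (letter gs (pinv \<sigma> i))"] by (simp add: comp_def)
    finally show "chi q ?n ((\<tau> \<circ> \<alpha> \<circ> pinv \<tau>) \<circ> (\<tau> \<circ> \<sigma>) \<circ> pinv \<beta> \<circ> pinv (\<tau> \<circ> \<sigma>))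
        * (\<Prod>i = 1..?n. inner (letter (act \<tau> fs) i) (letter gs (pinv (\<tau> \<circ> \<sigma>) i)))
      = chi q ?n ?d * (\<Prod>i = 1..?n. inner (letter fs i) (letter gs (pinv \<sigma> i)))"
      unfolding e chi_def c by simp
  qed
  finally show ?thesis unfolding qker_def length_act True by (simp only: simp_thms if_True)
qed (simp add: qker_def)

lemma q_inner_symmetrize_left:
  assumes "\<xi> \<in> unsym" "\<eta> \<in> unsym"
  shows "q_inner q (symmetrize \<xi>) \<eta> = q_inner q \<xi> \<eta>"
proof (rule hom_eq_unsym[OF lin_comp[OF symmetrize_hom q_inner_left] q_inner_left assms(1)])
  fix \<alpha> and fs :: "'a list" assume a: "\<alpha> \<in> S0 (length fs)"
  let ?n = "length fs"
  have g: "q_inner q (gen (\<sigma> \<circ> \<alpha> \<circ> pinv \<sigma>) (act \<sigma> fs)) \<eta> = q_inner q (gen \<alpha> fs) \<eta>" if "\<sigma> permutes {1..?n}" for \<sigma>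
    by (rule hom_eq_unsym[OF q_inner_right q_inner_right assms(2)])
      (simp only: q_inner_gen qker_conj_left[OF a[unfolded S0_iff] _ that] S0_iff)
  have "q_inner q (Sgen \<alpha> fs) \<eta> = 1 / fact ?n * (\<Sum>\<sigma> | \<sigma> permutes {1..?n}. q_inner q (gen (\<sigma> \<circ> \<alpha> \<circ> pinv \<sigma>) (act \<sigma> fs)) \<eta>)"
    unfolding Sgen_eq linD(4,8)[OF q_inner_left] ..
  also have "(\<Sum>\<sigma> | \<sigma> permutes {1..?n}. q_inner q (gen (\<sigma> \<circ> \<alpha> \<circ> pinv \<sigma>) (act \<sigma> fs)) \<eta>)
     = (\<Sum>\<sigma> | \<sigma> permutes {1..?n}. q_inner q (gen \<alpha> fs) \<eta>)"
    by (rule sum.cong[OF refl]) (rule g, simp)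
  also have "\<dots> = fact ?n * q_inner q (gen \<alpha> fs) \<eta>" by (simp add: card_permutations)
  finally show "q_inner q (symmetrize (gen \<alpha> fs)) \<eta> = q_inner q (gen \<alpha> fs) \<eta>"
    unfolding symmetrize_gen by simp
qed

lemma Aplus_TP: "\<xi> \<in> TP \<Longrightarrow> Aplus h \<xi> \<in> TP"
  and Aminus_TP: "\<xi> \<in> TP \<Longrightarrow> Aminus q h \<xi> \<in> TP"
proof -
  assume x: "\<xi> \<in> TP"
  have sub: "ps.subspace (TP :: 'a ptens set)" by (simp add: TP_eq)
  have "Aplus h (Sgen \<alpha> hs) \<in> TP \<and> Aminus q h (Sgen \<alpha> hs) \<in> TP" if "\<alpha> \<in> S0 (length hs)" for \<alpha> and hs :: "'a list"
  proof
    have a: "\<alpha> permutes {0..length hs}" using that by (simp only: S0_iff)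
    have "\<alpha> permutes {0..length hs + 1}" by (rule permutes_subset[OF a]) auto
    then have "swp 0 (length hs + 1) \<circ> \<alpha> \<in> S0 (length (hs @ [h]))"
      unfolding S0_iff length_append by (intro permutes_compose permutes_swap_id) auto
    then show "Aplus h (Sgen \<alpha> hs) \<in> TP" unfolding Aplus_S[OF a] Aplus_gen by (rule Sgen_TP)
    show "Aminus q h (Sgen \<alpha> hs) \<in> TP"
      unfolding Aminus_S[OF a] Aminus_gen minus_labelled_def
    proof (intro ps.subspace_sum[OF sub] ps.subspace_scale[OF sub])
      fix k assume k: "k \<in> {0..length hs} - {0}"
      have "swp 0 k \<circ> \<alpha> permutes {0..length hs}" by (rule permutes_compose[OF a permutes_swap_id]) (use k in auto)
      from skip_permutes[OF this, of "{k}"]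
      show "labelled ({0..length hs} - {k}) (skip {k} (swp 0 k \<circ> \<alpha>)) (letter hs) \<in> TP"
        by (intro labelled_TP) (use k in auto)
    qed
  qed
  note S = this
  have "Aplus h ` {Sgen \<alpha> hs | \<alpha> hs. \<alpha> \<in> S0 (length hs)} \<subseteq> TP" "Aminus q h ` {Sgen \<alpha> hs | \<alpha> hs. \<alpha> \<in> S0 (length hs)} \<subseteq> TP"
    using S by blast+
  note span = ps.span_minimal[OF this(1) sub] ps.span_minimal[OF this(2) sub]
  have "Aplus h \<xi> \<in> Aplus h ` ps.span {Sgen \<alpha> hs | \<alpha> hs. \<alpha> \<in> S0 (length hs)}"
    "Aminus q h \<xi> \<in> Aminus q h ` ps.span {Sgen \<alpha> hs | \<alpha> hs. \<alpha> \<in> S0 (length hs)}"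
    using x unfolding TP_eq by blast+
  then show "Aplus h \<xi> \<in> TP" "Aminus q h \<xi> \<in> TP"
    using span unfolding Modules.module_hom.span_image[OF Aplus_hom] Modules.module_hom.span_image[OF Aminus_hom] by blast+
qed

context
  fixes N :: nat and q :: real
  assumes N: "N \<ge> 1" "q = 1 / real N \<or> q = - 1 / real N"
begin

lemma q_inner_symmetrize_right:
  assumes "\<xi> \<in> unsym" "\<eta> \<in> unsym"
  shows "q_inner q \<xi> (symmetrize \<eta>) = q_inner q \<xi> \<eta>"
proof -
  have s: "symmetrize \<eta> \<in> unsym" using symmetrize_TP[OF assms(2)] TP_unsym by blast
  show ?thesis
    unfolding q_inner_commute[OF N s assms(1)] q_inner_symmetrize_left[OF assms(2,1)] q_inner_commute[OF N assms] by simp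
qed

lemma q_inner_labelled:
  assumes a: "\<alpha> permutes {0..n}" and l: "length fs = n" and b: "\<gamma> permutes {0..n + 1} - {k}" and k: "k \<in> {1..n + 1}"
    and gs: "length gs = n + 1"
  shows "q_inner q (gen \<alpha> fs) (labelled ({0..n + 1} - {k}) \<gamma> (letter gs)) = of_real
    (\<Sum>\<sigma> | \<sigma> permutes {1..n}. chi q n (\<alpha> \<circ> (\<sigma> \<circ> swp (n + 1) k) \<circ> pinv \<gamma> \<circ> pinv (\<sigma> \<circ> swp (n + 1) k))
      * (\<Prod>i = 1..n. inner (letter fs i) (letter gs (pinv (\<sigma> \<circ> swp (n + 1) k) i))))"
proof -
  let ?B = "{0..n + 1} - {k}" and ?f = "swp (n + 1) k"
  have card: "card ?B = n + 1" using k by simp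
  have fp: "?f permutes {0..n + 1}" by (rule permutes_swap_id) (use k in auto)
  have k0: "k \<noteq> 0" using k by simp
  have f0: "?f 0 = 0" using k0 by (simp add: Transposition.transpose_def)
  have "?f ` ?B = {0..n + 1} - {n + 1}"
  proof -
    have "?f ` ?B = ?f ` {0..n + 1} - ?f ` {k}"
      by (rule inj_on_image_set_diff[OF permutes_inj_on[OF fp]]) (use k in auto)
    then show ?thesis unfolding permutes_image[OF fp] by (simp only: image_insert image_empty transpose_apply_second)
  qed
  also have "\<dots> = {0..<card ?B}" unfolding card by auto
  finally have bij: "bij_betw ?f ?B {0..<card ?B}"
    using inj_on_subset[OF permutes_inj_on[OF fp], of ?B] by (simp add: bij_betw_def)
  have b0: "\<gamma> permutes {0..n + 1}" by (rule permutes_subset[OF b]) auto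
  have fin: "finite ?B" "0 \<in> ?B" using k by auto
  have word: "lab_word ?B ?f (letter gs) = map (\<lambda>i. letter gs (?f i)) [1..<n + 1]"
    unfolding lab_word_def card
  proof (rule map_cong[OF refl])
    fix i assume "i \<in> set [1..<n + 1]"
    then have i: "1 \<le> i" "i \<le> n" by auto
    have "?f i \<in> ?B" using i k by (auto simp: Transposition.transpose_def)
    moreover have "?f (?f i) = i" by simp
    ultimately have "inv_into ?B ?f i = ?f i" using bij by (metis bij_betw_imp_inj_on inv_into_f_f)
    then show "letter gs (inv_into ?B ?f i) = letter gs (?f i)" by simp
  qed
  let ?g = "map_permutation ?B ?f \<gamma>" and ?w = "map (\<lambda>i. letter gs (?f i)) [1..<n + 1]"
  have gp: "?g permutes {0..n}"
    using map_permutation_permutes[OF bij b] unfolding card by (simp add: atLeastLessThanSuc_atLeastAtMost)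
  have g: "?g = ?f \<circ> \<gamma> \<circ> ?f"
  proof -
    have "?g = map_permutation {0..n + 1} ?f \<gamma>"
      by (rule map_permutation_restrict[OF b _ permutes_inj_on[OF fp], symmetric]) auto
    also have "\<dots> = ?f \<circ> \<gamma> \<circ> pinv ?f" by (rule conj_eq_map[OF fp b0, symmetric])
    finally show ?thesis by (simp only: swp_inv)
  qed
  have unsym: "gen ?g ?w \<in> unsym" by (rule gen_unsym) (use gp in \<open>simp add: S0_iff\<close>)
  have unsyml: "gen \<alpha> fs \<in> unsym" by (rule gen_unsym) (use a l in \<open>simp add: S0_iff\<close>)
  have "labelled ?B \<gamma> (letter gs) = symmetrize (gen ?g ?w)"
    unfolding labelled_eq_lab[OF fin b bij f0] lab_def word symmetrize_gen ..
  then have "q_inner q (gen \<alpha> fs) (labelled ?B \<gamma> (letter gs)) = of_real (qker q \<alpha> fs ?g ?w)"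
    unfolding q_inner_gen[symmetric] by (simp only: q_inner_symmetrize_right[OF unsyml unsym])
  also have "qker q \<alpha> fs ?g ?w = (\<Sum>\<sigma> | \<sigma> permutes {1..n}. chi q n (\<alpha> \<circ> \<sigma> \<circ> pinv ?g \<circ> pinv \<sigma>)
      * (\<Prod>i = 1..n. inner (letter fs i) (letter ?w (pinv \<sigma> i))))"
    by (simp add: qker_def l)
  also have "\<dots> = (\<Sum>\<sigma> | \<sigma> permutes {1..n}. chi q n (\<alpha> \<circ> (\<sigma> \<circ> ?f) \<circ> pinv \<gamma> \<circ> pinv (\<sigma> \<circ> ?f))
      * (\<Prod>i = 1..n. inner (letter fs i) (letter gs (pinv (\<sigma> \<circ> ?f) i))))"
  proof (rule sum.cong[OF refl])
    fix \<sigma> assume "\<sigma> \<in> {\<sigma>. \<sigma> permutes {1..n}}"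
    then have s: "\<sigma> permutes {1..n}" by simp
    have bf: "bij ?f" by (rule permutes_bij[OF fp])
    have isg: "pinv (\<sigma> \<circ> ?f) = ?f \<circ> pinv \<sigma>"
      using o_inv_distrib[OF permutes_bij[OF s] bf] by (simp only: swp_inv)
    have ig: "pinv ?g = ?f \<circ> pinv \<gamma> \<circ> ?f"
      unfolding g using bf permutes_bij[OF b] by (simp only: o_inv_distrib bij_comp swp_inv comp_assoc)
    have c: "\<alpha> \<circ> \<sigma> \<circ> pinv ?g \<circ> pinv \<sigma> = \<alpha> \<circ> (\<sigma> \<circ> ?f) \<circ> pinv \<gamma> \<circ> pinv (\<sigma> \<circ> ?f)"
      unfolding isg ig by (simp only: comp_assoc)
    have "letter ?w (pinv \<sigma> i) = letter gs (pinv (\<sigma> \<circ> ?f) i)" if "i \<in> {1..n}" for i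
    proof -
      have "pinv \<sigma> i \<in> {1..n}" using permutes_in_image[OF permutes_inv[OF s]] that by simp
      then obtain j where j: "pinv \<sigma> i = Suc j" "j < n" by (cases "pinv \<sigma> i") auto
      then show ?thesis unfolding isg using nth_upt_Suc_0[of j "n + 1"] by simp
    qed
    then have "(\<Prod>i = 1..n. inner (letter fs i) (letter ?w (pinv \<sigma> i))) = (\<Prod>i = 1..n. inner (letter fs i) (letter gs (pinv (\<sigma> \<circ> ?f) i)))"
      by (intro prod.cong[OF refl]) (simp only:)
    then show "chi q n (\<alpha> \<circ> \<sigma> \<circ> pinv ?g \<circ> pinv \<sigma>) * (\<Prod>i = 1..n. inner (letter fs i) (letter ?w (pinv \<sigma> i)))
      = chi q n (\<alpha> \<circ> (\<sigma> \<circ> ?f) \<circ> pinv \<gamma> \<circ> pinv (\<sigma> \<circ> ?f)) * (\<Prod>i = 1..n. inner (letter fs i) (letter gs (pinv (\<sigma> \<circ> ?f) i)))"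
      unfolding c by (simp only:)
  qed
  finally show ?thesis .
qed

lemma q_inner_Sgen_lengths:
  assumes "length fs \<noteq> length gs"
  shows "q_inner q (gen \<alpha> fs) (Sgen \<beta> gs) = 0"
  unfolding Sgen_eq linD(4,8)[OF q_inner_right] q_inner_gen using assms by (simp add: qker_def)

text \<open>The permutations \<open>\<rho>\<close> in the sum on the left are sorted by the letter \<open>k\<close> with \<open>\<rho> k = n + 1\<close>. This letter is paired with the
created vector \<open>h\<close> and is removed by the annihilation operator.\<close>

lemma adjoint_gen:
  assumes a: "\<alpha> \<in> S0 (length fs)" and b: "\<beta> \<in> S0 (length gs)"
  shows "q_inner q (Aplus h (gen \<alpha> fs)) (gen \<beta> gs) = q_inner q (gen \<alpha> fs) (Aminus q h (gen \<beta> gs))"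
proof -
  let ?n = "length fs"
  let ?t = "swp 0 (?n + 1) \<circ> \<alpha>"
  have a': "\<alpha> permutes {0..?n}" and b': "\<beta> permutes {0..length gs}" using a b by (simp_all only: S0_iff)
  have "\<alpha> permutes {0..?n + 1}" by (rule permutes_subset[OF a']) auto
  then have "?t \<in> S0 (length (fs @ [h]))" unfolding S0_iff length_append by (intro permutes_compose permutes_swap_id) auto
  note tg = gen_unsym[OF this]
  have "q_inner q (Aplus h (gen \<alpha> fs)) (gen \<beta> gs) = q_inner q (symmetrize (gen ?t (fs @ [h]))) (gen \<beta> gs)"
    by (simp only: Aplus_gen symmetrize_gen)
  also have "\<dots> = of_real (qker q ?t (fs @ [h]) \<beta> gs)"
    unfolding q_inner_symmetrize_left[OF tg gen_unsym[OF b]] q_inner_gen ..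
  finally have L: "q_inner q (Aplus h (gen \<alpha> fs)) (gen \<beta> gs) = of_real (qker q ?t (fs @ [h]) \<beta> gs)" .
  have R: "q_inner q (gen \<alpha> fs) (Aminus q h (gen \<beta> gs)) = (\<Sum>k\<in>{0..length gs} - {0}.
     of_real ((if \<beta> k = 0 then 1 else q) * inner (letter gs k) h) *
     q_inner q (gen \<alpha> fs) (labelled ({0..length gs} - {k}) (skip {k} (swp 0 k \<circ> \<beta>)) (letter gs)))"
    unfolding Aminus_gen minus_labelled_def linD(8)[OF q_inner_right] linD(4)[OF q_inner_right] by simp
  have sp: "skip {k} (swp 0 k \<circ> \<beta>) permutes {0..length gs} - {k}" if "k \<in> {0..length gs} - {0}" for k
  proof -
    have "swp 0 k \<circ> \<beta> permutes {0..length gs}" by (rule permutes_compose[OF b' permutes_swap_id]) (use that in auto)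
    then show ?thesis by (rule skip_permutes) auto
  qed
  show ?thesis
  proof (cases "length gs = ?n + 1")
    case False
    have "q_inner q (gen \<alpha> fs) (labelled ({0..length gs} - {k}) (skip {k} (swp 0 k \<circ> \<beta>)) (letter gs)) = 0"
      if k: "k \<in> {0..length gs} - {0}" for k
    proof -
      have B: "finite ({0..length gs} - {k})" "0 \<in> {0..length gs} - {k}" using k by auto
      have "card ({0..length gs} - {k}) - 1 \<noteq> ?n" using k False by auto
      then show ?thesis unfolding labelled_gen(1)[OF B sp[OF k]]
        by (intro q_inner_Sgen_lengths) (simp only: labelled_gen(2)[OF B sp[OF k]])
    qed
    then have "q_inner q (gen \<alpha> fs) (Aminus q h (gen \<beta> gs)) = 0" unfolding R by (intro sum.neutral) simp
    moreover have "qker q ?t (fs @ [h]) \<beta> gs = 0" using False by (simp add: qker_def)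
    ultimately show ?thesis unfolding L by simp
  next
    case True
    let ?m = "?n + 1"
    let ?F = "\<lambda>\<rho>. chi q ?m (?t \<circ> \<rho> \<circ> pinv \<beta> \<circ> pinv \<rho>) * (\<Prod>i = 1..?m. inner (letter (fs @ [h]) i) (letter gs (pinv \<rho> i)))"
    have ins: "{1..?m} = insert ?m {1..?n}" by auto
    have trm: "?F (\<sigma> \<circ> swp ?m k) = (if \<beta> k = 0 then 1 else q) * inner (letter gs k) h *
       (chi q ?n (\<alpha> \<circ> (\<sigma> \<circ> swp ?m k) \<circ> pinv (skip {k} (swp 0 k \<circ> \<beta>)) \<circ> pinv (\<sigma> \<circ> swp ?m k))
         * (\<Prod>i = 1..?n. inner (letter fs i) (letter gs (pinv (\<sigma> \<circ> swp ?m k) i))))"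
      if s: "\<sigma> permutes {1..?n}" and k: "k \<in> {1..?m}" for \<sigma> k
    proof -
      let ?r = "\<sigma> \<circ> swp ?m k"
      have s1: "\<sigma> permutes {1..?m}" by (rule permutes_subset[OF s]) auto
      have r: "?r permutes {1..?m}" by (rule permutes_compose[OF permutes_swap_id s1]) (use k in auto)
      have rk: "?r k = ?m" using permutes_not_in[OF s, of ?m] by simp
      have "pinv ?r ?m = k" using rk permutes_inverses(2)[OF r] by metis
      then have "(\<Prod>i = 1..?m. inner (letter (fs @ [h]) i) (letter gs (pinv ?r i)))
        = inner h (letter gs k) * (\<Prod>i = 1..?n. inner (letter (fs @ [h]) i) (letter gs (pinv ?r i)))"
        unfolding ins by simp
      also have "(\<Prod>i = 1..?n. inner (letter (fs @ [h]) i) (letter gs (pinv ?r i))) = (\<Prod>i = 1..?n. inner (letter fs i) (letter gs (pinv ?r i)))"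
        by (rule prod.cong[OF refl]) (auto simp: nth_append)
      finally have p: "(\<Prod>i = 1..?m. inner (letter (fs @ [h]) i) (letter gs (pinv ?r i)))
        = inner h (letter gs k) * (\<Prod>i = 1..?n. inner (letter fs i) (letter gs (pinv ?r i)))" .
      show ?thesis
        unfolding p chi_creation[OF a' b'[unfolded True] r rk] by (simp only: mult_ac inner_commute[of h])
    qed
    have "qker q ?t (fs @ [h]) \<beta> gs = (\<Sum>\<rho> | \<rho> permutes {1..?m}. ?F \<rho>)"
      by (simp add: qker_def True)
    also have "\<dots> = (\<Sum>\<rho> | \<rho> permutes {1..?m}. ?F (pinv \<rho>))"
      by (rule sum_permutations_inverse)
    also have "\<dots> = (\<Sum>k\<in>{1..?m}. \<Sum>\<sigma> | \<sigma> permutes {1..?n}. ?F (pinv (swp ?m k \<circ> \<sigma>)))"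
      unfolding ins by (rule sum_over_permutations_insert) auto
    also have "\<dots> = (\<Sum>k\<in>{1..?m}. \<Sum>\<sigma> | \<sigma> permutes {1..?n}. ?F (\<sigma> \<circ> swp ?m k))"
    proof (rule sum.cong[OF refl])
      fix k
      have "(\<Sum>\<sigma> | \<sigma> permutes {1..?n}. ?F (\<sigma> \<circ> swp ?m k)) = (\<Sum>\<sigma> | \<sigma> permutes {1..?n}. ?F (pinv \<sigma> \<circ> swp ?m k))"
        by (rule sum_permutations_inverse)
      also have "\<dots> = (\<Sum>\<sigma> | \<sigma> permutes {1..?n}. ?F (pinv (swp ?m k \<circ> \<sigma>)))"
      proof (rule sum.cong[OF refl])
        fix \<sigma> assume "\<sigma> \<in> {\<sigma>. \<sigma> permutes {1..?n}}"
        then have "bij \<sigma>" by (simp add: permutes_bij)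
        then have "pinv (swp ?m k \<circ> \<sigma>) = pinv \<sigma> \<circ> swp ?m k"
          using o_inv_distrib[of "swp ?m k" \<sigma>] by (simp only: swp_inv bij_swp)
        then show "?F (pinv \<sigma> \<circ> swp ?m k) = ?F (pinv (swp ?m k \<circ> \<sigma>))" by (simp only:)
      qed
      finally show "(\<Sum>\<sigma> | \<sigma> permutes {1..?n}. ?F (pinv (swp ?m k \<circ> \<sigma>))) = (\<Sum>\<sigma> | \<sigma> permutes {1..?n}. ?F (\<sigma> \<circ> swp ?m k))" by (rule sym)
    qed
    finally have K: "qker q ?t (fs @ [h]) \<beta> gs = (\<Sum>k\<in>{1..?m}. \<Sum>\<sigma> | \<sigma> permutes {1..?n}. ?F (\<sigma> \<circ> swp ?m k))" .
    have K2: "(\<Sum>\<sigma> | \<sigma> permutes {1..?n}. ?F (\<sigma> \<circ> swp ?m k)) = (if \<beta> k = 0 then 1 else q) * inner (letter gs k) h *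
       (\<Sum>\<sigma> | \<sigma> permutes {1..?n}. chi q ?n (\<alpha> \<circ> (\<sigma> \<circ> swp ?m k) \<circ> pinv (skip {k} (swp 0 k \<circ> \<beta>)) \<circ> pinv (\<sigma> \<circ> swp ?m k))
         * (\<Prod>i = 1..?n. inner (letter fs i) (letter gs (pinv (\<sigma> \<circ> swp ?m k) i))))" if k: "k \<in> {1..?m}" for k
      unfolding sum_distrib_left by (rule sum.cong[OF refl]) (rule trm[OF _ k], simp)
    have set: "{0..length gs} - {0} = {1..?m}" unfolding True by auto
    have "of_real (qker q ?t (fs @ [h]) \<beta> gs) = q_inner q (gen \<alpha> fs) (Aminus q h (gen \<beta> gs))"
      unfolding R K set of_real_sum[of _ "{1..?m}"]
    proof (rule sum.cong[OF refl])
      fix k assume k: "k \<in> {1..?m}"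
      have sp': "skip {k} (swp 0 k \<circ> \<beta>) permutes {0..?n + 1} - {k}" using sp[of k] k unfolding True by auto
      show "complex_of_real (\<Sum>\<sigma> | \<sigma> permutes {1..?n}. ?F (\<sigma> \<circ> swp ?m k)) =
        of_real ((if \<beta> k = 0 then 1 else q) * inner (letter gs k) h) *
        q_inner q (gen \<alpha> fs) (labelled ({0..length gs} - {k}) (skip {k} (swp 0 k \<circ> \<beta>)) (letter gs))"
        unfolding True q_inner_labelled[OF a' refl sp' k True] K2[OF k] by (simp only: of_real_mult)
    qed
    then show ?thesis unfolding L .
  qed
qed

lemma adjoint:
  assumes "\<xi> \<in> unsym" "\<eta> \<in> unsym"
  shows "q_inner q (Aplus h \<xi>) \<eta> = q_inner q \<xi> (Aminus q h \<eta>)"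
proof (rule hom_eq_unsym[OF lin_comp[OF Aplus_hom q_inner_left] q_inner_left assms(1)])
  fix \<alpha> and fs :: "'a list" assume a: "\<alpha> \<in> S0 (length fs)"
  show "q_inner q (Aplus h (gen \<alpha> fs)) \<eta> = q_inner q (gen \<alpha> fs) (Aminus q h \<eta>)"
    by (rule hom_eq_unsym[OF q_inner_right lin_comp[OF Aminus_hom q_inner_right] assms(2)]) (rule adjoint_gen[OF a])
qed

text \<open>\<open>\<parallel>Aplus h \<xi>\<parallel>\<^sup>2 = \<langle>\<xi>, Aminus q h (Aplus h \<xi>)\<rangle>\<close>, which vanishes by Cauchy-Schwarz.\<close>

lemma Aplus_null:
  assumes x: "\<xi> \<in> TP" and "q_norm q \<xi> = 0"
  shows "q_norm q (Aplus h \<xi>) = 0"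
proof -
  have g: "\<xi> \<in> unsym" "Aplus h \<xi> \<in> unsym" "Aminus q h (Aplus h \<xi>) \<in> unsym"
    using x Aplus_TP[OF x, of h] Aminus_TP[OF Aplus_TP[OF x, of h], of q h] TP_unsym by auto
  have "q_inner q (Aplus h \<xi>) (Aplus h \<xi>) = 0"
    unfolding adjoint[OF g(1,2)] by (rule q_norm_null[OF N g(1,3) assms(2)])
  then show ?thesis by (simp add: q_norm_def)
qed

lemma Aminus_null:
  assumes x: "\<xi> \<in> TP" and "q_norm q \<xi> = 0"
  shows "q_norm q (Aminus q h \<xi>) = 0"
proof -
  have g: "\<xi> \<in> unsym" "Aminus q h \<xi> \<in> unsym" "Aplus h (Aminus q h \<xi>) \<in> unsym"
    using x Aminus_TP[OF x, of q h] Aplus_TP[OF Aminus_TP[OF x, of q h], of h] TP_unsym by auto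
  have "q_inner q (Aminus q h \<xi>) (Aminus q h \<xi>) = q_inner q (Aplus h (Aminus q h \<xi>)) \<xi>"
    by (rule adjoint[OF g(2,1), symmetric])
  also have "\<dots> = cnj (q_inner q \<xi> (Aplus h (Aminus q h \<xi>)))" by (rule q_inner_commute[OF N g(1,3)])
  also have "\<dots> = 0" using q_norm_null[OF N g(1,3) assms(2)] by simp
  finally show ?thesis by (simp add: q_norm_def)
qed

end

section \<open>Operators on the Fock space\<close>

text \<open>The same form as \<open>right_gns\<close>: the union over all representatives is a single class when \<open>A\<close> preserves the
kernel of the form.\<close>

definition lift_op :: "real \<Rightarrow> ('h::real_inner ptens \<Rightarrow> 'h ptens) \<Rightarrow> 'h fock_vec \<Rightarrow> 'h fock_vec" where
  "lift_op q A V = (\<Union>\<xi> \<in> {\<xi> \<in> TP. gns_vec q \<xi> = V}. gns_vec q (A \<xi>))"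

lemma right_gns_lift: "right_gns q A = lift_op q (\<lambda>\<xi>. tp_mult q \<xi> A)"
  by (simp add: fun_eq_iff right_gns_def lift_op_def)

context
  fixes N :: nat and q :: real
  assumes N: "N \<ge> 1" "q = 1 / real N \<or> q = - 1 / real N"
begin

lemma fock_CauchyD: "x \<in> fock_Cauchy q \<Longrightarrow> x m \<in> TP"
  by (simp add: fock_Cauchy_def)

lemma q_norm_tri:
  assumes "\<xi> \<in> TP" "\<eta> \<in> TP"
  shows "q_norm q (\<xi> + \<eta>) \<le> q_norm q \<xi> + q_norm q \<eta>"
  using q_norm_triangle[OF N] assms TP_unsym by blast

lemma q_norm_ge0: "\<xi> \<in> TP \<Longrightarrow> 0 \<le> q_norm q \<xi>"
  using q_norm_nonneg[OF N] TP_unsym by blast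

lemma fock_equiv: "equiv (fock_Cauchy q) (fock_rel q :: ((nat \<Rightarrow> 'h::real_inner ptens) \<times> _) set)"
proof (rule equivI)
  show "fock_rel q \<subseteq> fock_Cauchy q \<times> (fock_Cauchy q :: (nat \<Rightarrow> 'h ptens) set)" by (auto simp: fock_rel_def)
  show "refl_on (fock_Cauchy q) (fock_rel q :: ((nat \<Rightarrow> 'h ptens) \<times> _) set)"
    by (rule refl_onI) (auto simp: fock_rel_def q_norm_zero)
  show "sym (fock_rel q :: ((nat \<Rightarrow> 'h ptens) \<times> _) set)"
  proof (rule symI)
    fix x y :: "nat \<Rightarrow> 'h ptens" assume "(x, y) \<in> fock_rel q"
    moreover have "(\<lambda>n. q_norm q (x n - y n)) = (\<lambda>n. q_norm q (y n - x n))" using q_norm_minus by blast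
    ultimately show "(y, x) \<in> fock_rel q" by (simp add: fock_rel_def)
  qed
  show "trans (fock_rel q :: ((nat \<Rightarrow> 'h ptens) \<times> _) set)"
  proof (rule transI)
    fix x y z :: "nat \<Rightarrow> 'h ptens" assume xy: "(x, y) \<in> fock_rel q" and yz: "(y, z) \<in> fock_rel q"
    then have c: "x \<in> fock_Cauchy q" "y \<in> fock_Cauchy q" "z \<in> fock_Cauchy q"
      and l: "(\<lambda>n. q_norm q (x n - y n)) \<longlonglongrightarrow> 0" "(\<lambda>n. q_norm q (y n - z n)) \<longlonglongrightarrow> 0"
      by (simp_all add: fock_rel_def)
    have T: "x n - y n \<in> TP" "y n - z n \<in> TP" "x n - z n \<in> TP" for n
      by (rule TP_diff[OF fock_CauchyD fock_CauchyD], rule c, rule c)+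
    have "(\<lambda>n. q_norm q (x n - z n)) \<longlonglongrightarrow> 0"
    proof (rule tendsto_sandwich[OF _ _ tendsto_const])
      show "\<forall>\<^sub>F n in sequentially. 0 \<le> q_norm q (x n - z n)" using q_norm_ge0[OF T(3)] by simp
      show "\<forall>\<^sub>F n in sequentially. q_norm q (x n - z n) \<le> q_norm q (x n - y n) + q_norm q (y n - z n)"
      proof (intro always_eventually allI)
        fix n
        show "q_norm q (x n - z n) \<le> q_norm q (x n - y n) + q_norm q (y n - z n)"
          using q_norm_tri[OF T(1)[of n] T(2)[of n]] by simp
      qed
      show "(\<lambda>n. q_norm q (x n - y n) + q_norm q (y n - z n)) \<longlonglongrightarrow> 0" using tendsto_add[OF l] by simp
    qed
    then show "(x, z) \<in> fock_rel q" using c by (simp add: fock_rel_def)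
  qed
qed

lemma const_Cauchy: "\<xi> \<in> TP \<Longrightarrow> (\<lambda>_. \<xi>) \<in> fock_Cauchy q"
  by (auto simp: fock_Cauchy_def q_norm_zero)

lemma gns_vec_eq_iff:
  assumes "\<xi> \<in> TP" "\<eta> \<in> TP"
  shows "gns_vec q \<xi> = gns_vec q \<eta> \<longleftrightarrow> q_norm q (\<xi> - \<eta>) = 0"
proof -
  have "gns_vec q \<xi> = gns_vec q \<eta> \<longleftrightarrow> ((\<lambda>_. \<xi>), (\<lambda>_. \<eta>)) \<in> fock_rel q"
    unfolding gns_vec_def by (rule eq_equiv_class_iff[OF fock_equiv const_Cauchy[OF assms(1)] const_Cauchy[OF assms(2)]])
  also have "\<dots> \<longleftrightarrow> q_norm q (\<xi> - \<eta>) = 0"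
    using assms by (simp add: fock_rel_def const_Cauchy LIMSEQ_const_iff)
  finally show ?thesis .
qed

lemma gns_vec_members:
  assumes "x \<in> gns_vec q \<xi>"
  shows "x \<in> fock_Cauchy q" "(\<lambda>n. q_norm q (\<xi> - x n)) \<longlonglongrightarrow> 0" "\<xi> \<in> TP"
  using assms by (auto simp: gns_vec_def fock_rel_def fock_Cauchy_def)

text \<open>Every class of vectors at hand contains a constant sequence, and two Cauchy sequences at distance
tending to \<open>0\<close> define the same class.\<close>

lemma class_constI:
  assumes "(\<lambda>n. q_norm q (\<xi> - x n)) \<longlonglongrightarrow> 0" "\<xi> \<in> TP" "\<And>n. x n \<in> TP" "x \<in> fock_Cauchy q"
  shows "fock_rel q `` {x} = gns_vec q \<xi>"
proof -
  have "((\<lambda>_. \<xi>), x) \<in> fock_rel q" using assms const_Cauchy by (simp add: fock_rel_def)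
  then show ?thesis unfolding gns_vec_def using equiv_class_eq[OF fock_equiv] by metis
qed

lemma UN_const2:
  assumes "\<And>x y. x \<in> X \<Longrightarrow> y \<in> Y \<Longrightarrow> f x y = C" "a \<in> X" "b \<in> Y"
  shows "(\<Union>x\<in>X. \<Union>y\<in>Y. f x y) = C"
proof -
  have "(\<Union>x\<in>X. \<Union>y\<in>Y. f x y) = (\<Union>x\<in>X. \<Union>y\<in>Y. C)" by (intro SUP_cong refl assms(1))
  also have "\<dots> = C" using assms(2,3) by auto
  finally show ?thesis .
qed

lemma UN_const1:
  assumes "\<And>x. x \<in> X \<Longrightarrow> f x = C" "a \<in> X"
  shows "(\<Union>x\<in>X. f x) = C"
  using UN_const2[of X "{a}" "\<lambda>x _. f x" C a a] assms by simp

lemma fock_add_gns: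
  assumes "\<xi> \<in> TP" "\<eta> \<in> TP"
  shows "fock_add q (gns_vec q \<xi>) (gns_vec q \<eta>) = gns_vec q (\<xi> + \<eta>)"
proof -
  have "fock_rel q `` {\<lambda>n. x n + y n} = gns_vec q (\<xi> + \<eta>)" if x: "x \<in> gns_vec q \<xi>" and y: "y \<in> gns_vec q \<eta>" for x y
  proof (rule class_constI)
    note X = gns_vec_members[OF x] and Y = gns_vec_members[OF y]
    have Tx: "x n \<in> TP" "y n \<in> TP" for n using fock_CauchyD[OF X(1)] fock_CauchyD[OF Y(1)] by auto
    show "\<xi> + \<eta> \<in> TP" by (rule TP_add[OF assms])
    show "x n + y n \<in> TP" for n by (rule TP_add[OF Tx])
    have dec: "q_norm q (a + b - (c + d)) \<le> q_norm q (a - c) + q_norm q (b - d)"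
      if "a \<in> TP" "b \<in> TP" "c \<in> TP" "d \<in> TP" for a b c d
      using q_norm_tri[OF TP_diff[OF that(1,3)] TP_diff[OF that(2,4)]] by (simp add: algebra_simps)
    show "(\<lambda>n. q_norm q (\<xi> + \<eta> - (x n + y n))) \<longlonglongrightarrow> 0"
    proof (rule tendsto_sandwich[OF _ _ tendsto_const])
      show "\<forall>\<^sub>F n in sequentially. 0 \<le> q_norm q (\<xi> + \<eta> - (x n + y n))"
        by (intro always_eventually allI q_norm_ge0 TP_diff TP_add Tx assms)
      show "\<forall>\<^sub>F n in sequentially. q_norm q (\<xi> + \<eta> - (x n + y n)) \<le> q_norm q (\<xi> - x n) + q_norm q (\<eta> - y n)"
        using dec[OF assms Tx] by simp
      show "(\<lambda>n. q_norm q (\<xi> - x n) + q_norm q (\<eta> - y n)) \<longlonglongrightarrow> 0" using tendsto_add[OF X(2) Y(2)] by simp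
    qed
    show "(\<lambda>n. x n + y n) \<in> fock_Cauchy q"
      unfolding fock_Cauchy_def
    proof (intro CollectI conjI allI impI)
      show "x m + y m \<in> TP" for m by (rule TP_add[OF Tx])
      fix e :: real assume "e > 0"
      then have e: "e / 2 > 0" by simp
      obtain M1 where M1: "\<And>m n. m \<ge> M1 \<Longrightarrow> n \<ge> M1 \<Longrightarrow> q_norm q (x m - x n) < e / 2"
        using X(1) e unfolding fock_Cauchy_def by blast
      obtain M2 where M2: "\<And>m n. m \<ge> M2 \<Longrightarrow> n \<ge> M2 \<Longrightarrow> q_norm q (y m - y n) < e / 2"
        using Y(1) e unfolding fock_Cauchy_def by blast
      show "\<exists>M. \<forall>m\<ge>M. \<forall>n\<ge>M. q_norm q (x m + y m - (x n + y n)) < e"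
      proof (intro exI[of _ "max M1 M2"] allI impI)
        fix m n assume "max M1 M2 \<le> m" "max M1 M2 \<le> n"
        then have "q_norm q (x m - x n) < e / 2" "q_norm q (y m - y n) < e / 2" using M1 M2 by auto
        then show "q_norm q (x m + y m - (x n + y n)) < e"
          using dec[OF Tx(1)[of m] Tx(2)[of m] Tx(1)[of n] Tx(2)[of n]] by linarith
      qed
    qed
  qed
  note cl = this
  have "(\<lambda>_. \<xi>) \<in> gns_vec q \<xi>" "(\<lambda>_. \<eta>) \<in> gns_vec q \<eta>"
    using assms const_Cauchy by (simp_all add: gns_vec_def fock_rel_def q_norm_zero)
  then show ?thesis unfolding fock_add_def by (intro UN_const2 cl)
qed

lemma fock_scale_gns:
  assumes "\<xi> \<in> TP"
  shows "fock_scale q c (gns_vec q \<xi>) = gns_vec q (pscale c \<xi>)"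
proof -
  have sc: "q_norm q (pscale c a - pscale c b) = norm c * q_norm q (a - b)" for a b :: "'a ptens"
    using q_norm_scale[of q c "a - b"] by (simp only: ps.scale_right_diff_distrib)
  have "fock_rel q `` {\<lambda>n. pscale c (x n)} = gns_vec q (pscale c \<xi>)" if x: "x \<in> gns_vec q \<xi>" for x
  proof (rule class_constI)
    note X = gns_vec_members[OF x]
    show "pscale c \<xi> \<in> TP" by (rule TP_scale[OF assms])
    show T: "pscale c (x n) \<in> TP" for n by (rule TP_scale[OF fock_CauchyD[OF X(1)]])
    show "(\<lambda>n. q_norm q (pscale c \<xi> - pscale c (x n))) \<longlonglongrightarrow> 0"
      unfolding sc using tendsto_mult_right[OF X(2), of "norm c"] tendsto_mult_left[OF X(2), of "norm c"] by simp
    show "(\<lambda>n. pscale c (x n)) \<in> fock_Cauchy q"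
      unfolding fock_Cauchy_def
    proof (intro CollectI conjI allI impI)
      show "pscale c (x m) \<in> TP" for m by (rule T)
      fix e :: real assume e: "e > 0"
      have c: "0 < norm c + 1" by (rule add_nonneg_pos) auto
      then have "e / (norm c + 1) > 0" using e by simp
      then obtain M where M: "\<And>m n. m \<ge> M \<Longrightarrow> n \<ge> M \<Longrightarrow> q_norm q (x m - x n) < e / (norm c + 1)"
        using X(1) unfolding fock_Cauchy_def by blast
      show "\<exists>M. \<forall>m\<ge>M. \<forall>n\<ge>M. q_norm q (pscale c (x m) - pscale c (x n)) < e"
        unfolding sc
      proof (intro exI[of _ M] allI impI)
        fix m n assume "M \<le> m" "M \<le> n"
        then have 1: "q_norm q (x m - x n) < e / (norm c + 1)" by (rule M)
        have "0 \<le> q_norm q (x m - x n)" by (intro q_norm_ge0 TP_diff fock_CauchyD X(1))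
        then have "norm c * q_norm q (x m - x n) \<le> (norm c + 1) * q_norm q (x m - x n)" by (simp add: mult_right_mono)
        also have "\<dots> < (norm c + 1) * (e / (norm c + 1))" by (rule mult_strict_left_mono[OF 1 c])
        also have "\<dots> = e" using c by simp
        finally show "norm c * q_norm q (x m - x n) < e" .
      qed
    qed
  qed
  note cl = this
  have "(\<lambda>_. \<xi>) \<in> gns_vec q \<xi>"
    using assms const_Cauchy by (simp_all add: gns_vec_def fock_rel_def q_norm_zero)
  then show ?thesis unfolding fock_scale_def by (intro UN_const1 cl)
qed

lemma lift_op_gns:
  assumes A: "lin pscale pscale A" "\<And>\<xi>. \<xi> \<in> TP \<Longrightarrow> A \<xi> \<in> TP" "\<And>\<xi>. \<xi> \<in> TP \<Longrightarrow> q_norm q \<xi> = 0 \<Longrightarrow> q_norm q (A \<xi>) = 0"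
    and x: "\<xi> \<in> TP"
  shows "lift_op q A (gns_vec q \<xi>) = gns_vec q (A \<xi>)"
proof -
  have "gns_vec q (A \<eta>) = gns_vec q (A \<xi>)" if "\<eta> \<in> TP" "gns_vec q \<eta> = gns_vec q \<xi>" for \<eta>
  proof -
    have "q_norm q (\<eta> - \<xi>) = 0" using iffD1[OF gns_vec_eq_iff[OF that(1) x] that(2)] .
    then have "q_norm q (A \<eta> - A \<xi>) = 0"
      using A(3)[OF TP_diff[OF that(1) x]] by (simp only: linD(6)[OF A(1)])
    then show ?thesis by (rule iffD2[OF gns_vec_eq_iff[OF A(2)[OF that(1)] A(2)[OF x]]])
  qed
  note inv = this
  show ?thesis unfolding lift_op_def
    by (rule UN_const1[where a = \<xi>], rule inv) (use x in simp_all)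
qed

lemma lift_op_operator:
  assumes A: "lin pscale pscale A" "\<And>\<xi>. \<xi> \<in> TP \<Longrightarrow> A \<xi> \<in> TP" "\<And>\<xi>. \<xi> \<in> TP \<Longrightarrow> q_norm q \<xi> = 0 \<Longrightarrow> q_norm q (A \<xi>) = 0"
  shows "gns_operator q (lift_op q A)"
  unfolding gns_operator_def
proof (intro conjI ballI allI)
  note L = lift_op_gns[OF A]
  fix V :: "'a fock_vec" assume "V \<in> gns_dom q"
  then obtain \<xi> where x: "\<xi> \<in> TP" "V = gns_vec q \<xi>" by (auto simp: gns_dom_def)
  have Lx: "lift_op q A V = gns_vec q (A \<xi>)" unfolding x(2) by (rule lift_op_gns[OF A x(1)])
  show "lift_op q A V \<in> gns_dom q" unfolding Lx gns_dom_def by (rule imageI) (rule A(2)[OF x(1)])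
  fix c
  have "lift_op q A (gns_vec q (pscale c \<xi>)) = gns_vec q (A (pscale c \<xi>))"
    by (rule lift_op_gns[OF A TP_scale[OF x(1)]])
  then show "lift_op q A (fock_scale q c V) = fock_scale q c (lift_op q A V)"
    unfolding Lx unfolding x(2) by (simp only: fock_scale_gns x(1) A(2) linD(4)[OF A(1)])
next
  fix V W :: "'a fock_vec" assume "V \<in> gns_dom q" "W \<in> gns_dom q"
  then obtain \<xi> \<eta> where x: "\<xi> \<in> TP" "V = gns_vec q \<xi>" and y: "\<eta> \<in> TP" "W = gns_vec q \<eta>" by (auto simp: gns_dom_def)
  have L1: "lift_op q A V = gns_vec q (A \<xi>)" unfolding x(2) by (rule lift_op_gns[OF A x(1)])
  have L2: "lift_op q A W = gns_vec q (A \<eta>)" unfolding y(2) by (rule lift_op_gns[OF A y(1)])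
  have "lift_op q A (gns_vec q (\<xi> + \<eta>)) = gns_vec q (A (\<xi> + \<eta>))"
    by (rule lift_op_gns[OF A TP_add[OF x(1) y(1)]])
  then show "lift_op q A (fock_add q V W) = fock_add q (lift_op q A V) (lift_op q A W)"
    unfolding L1 L2 unfolding x(2) y(2) by (simp only: fock_add_gns x(1) y(1) A(2) linD(3)[OF A(1)])
qed

end

lemma Aplus_sym_tensor:
  assumes "\<alpha> \<in> S0 n" "F \<in> rtens n"
  shows "Aplus h (sym_tensor n \<alpha> F) = sym_tensor (n + 1) (swp 0 (n + 1) \<circ> \<alpha>) (r_plus h F)"
proof (rule lin_eq_span[OF lin_comp[OF sym_tensor_hom Aplus_hom] lin_comp[OF r_plus_hom sym_tensor_hom]])
  show "F \<in> ts.span {simple hs | hs. length hs = n}" using assms(2) rtens_subset by blast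
  fix x assume "x \<in> {simple hs | hs :: 'a list. length hs = n}"
  then obtain hs where x: "x = simple hs" "length hs = n" by blast
  have a: "\<alpha> permutes {0..length hs}" using assms(1) x(2) by (simp add: S0_iff)
  have "Aplus h (sym_tensor n \<alpha> x) = Aplus h (Sgen \<alpha> hs)" by (simp only: Sgen_def x)
  also have "\<dots> = Sgen (swp 0 (length hs + 1) \<circ> \<alpha>) (hs @ [h])" by (simp only: Aplus_S[OF a] Aplus_gen)
  also have "\<dots> = sym_tensor (n + 1) (swp 0 (n + 1) \<circ> \<alpha>) (r_plus h x)"
    unfolding Sgen_def x(1) r_plus_simple using x(2) by simp
  finally show "Aplus h (sym_tensor n \<alpha> x) = sym_tensor (n + 1) (swp 0 (n + 1) \<circ> \<alpha>) (r_plus h x)" .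
qed

text \<open>The term \<open>k = \<alpha>\<^sup>-\<^sup>1(0)\<close> of the single sum is split off. If \<open>\<alpha> 0 = 0\<close> there is no such letter in \<open>{1..n}\<close>.\<close>

lemma Aminus_sym_tensor:
  assumes "\<alpha> \<in> S0 n" "F \<in> rtens n"
  shows "Aminus q h (sym_tensor n \<alpha> F) = pscale (of_real q)
      (\<Sum>k \<in> {1..n} - {pinv \<alpha> 0}. sym_tensor (n - 1) (relabel ({0..n} - {k}) (skip {k} (swp 0 k \<circ> \<alpha>))) (r_minus k h F))
    + (if \<alpha> 0 \<noteq> 0 then sym_tensor (n - 1) (relabel ({0..n} - {pinv \<alpha> 0}) (skip {pinv \<alpha> 0} \<alpha>)) (r_minus (pinv \<alpha> 0) h F) else 0)"
proof -
  let ?k = "pinv \<alpha> 0"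
  let ?s = "\<lambda>k F. sym_tensor (n - 1) (relabel ({0..n} - {k}) (skip {k} (swp 0 k \<circ> \<alpha>))) (r_minus k h F)"
  have a: "\<alpha> permutes {0..n}" using assms(1) by (simp add: S0_iff)
  have k: "\<alpha> ?k = 0" "?k \<in> {0..n}" using permutes_inverses(1)[OF a] permutes_in_image[OF permutes_inv[OF a], of 0] by auto
  have iff: "\<alpha> j = 0 \<longleftrightarrow> j = ?k" for j using permutes_inverses(2)[OF a] k(1) by metis
  have main: "Aminus q h (sym_tensor n \<alpha> F) = (\<Sum>j\<in>{1..n}. pscale (of_real (if \<alpha> j = 0 then 1 else q)) (?s j F))"
  proof (rule lin_eq_span[OF lin_comp[OF sym_tensor_hom Aminus_hom]])
    show "lin tscale pscale (\<lambda>F. \<Sum>j\<in>{1..n}. pscale (of_real (if \<alpha> j = 0 then 1 else q)) (?s j F))"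
      by (intro lin_sum module_tscale module_pscale lin_scale[where ?s2.0 = pscale] lin_comp[OF r_minus_hom sym_tensor_hom]) auto
    show "F \<in> ts.span {simple hs | hs. length hs = n}" using assms(2) rtens_subset by blast
    fix x assume "x \<in> {simple hs | hs :: 'a list. length hs = n}"
    then obtain hs where x: "x = simple hs" "length hs = n" by blast
    have a': "\<alpha> permutes {0..length hs}" using a x(2) by simp
    have "sym_tensor n \<alpha> x = Sgen \<alpha> hs" by (simp only: Sgen_def x)
    then show "Aminus q h (sym_tensor n \<alpha> x) = (\<Sum>j\<in>{1..n}. pscale (of_real (if \<alpha> j = 0 then 1 else q)) (?s j x))"
      by (simp only: Aminus_S[OF a'])
        (simp only: Aminus_def ptens_ext_gen[OF module_pscale Aminus_mlin] x)
  qed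
  show ?thesis
  proof (cases "\<alpha> 0 = 0")
    case True
    then have k0: "?k = 0" using iff by metis
    have "{1..n} - {?k} = {1..n}" using k0 by auto
    moreover have "(\<Sum>j\<in>{1..n}. pscale (of_real (if \<alpha> j = 0 then 1 else q)) (?s j F)) = (\<Sum>j\<in>{1..n}. pscale (of_real q) (?s j F))"
      by (rule sum.cong[OF refl]) (simp add: iff k0)
    ultimately show ?thesis unfolding main using True by (simp add: ps.scale_sum_right)
  next
    case False
    then have "?k \<noteq> 0" using iff[of 0] by metis
    then have kn: "?k \<in> {1..n}" using k(2) by auto
    have sk: "skip {?k} (swp 0 ?k \<circ> \<alpha>) = skip {?k} \<alpha>"
    proof -
      have inj: "inj \<alpha>" "inj (swp 0 ?k \<circ> \<alpha>)"
        using permutes_inj[OF a] by (auto intro: inj_compose)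
      have ap: "(swp 0 ?k \<circ> \<alpha>) ?k = ?k" by (simp add: k(1))
      show ?thesis
        unfolding skip_single[OF inj(1)] skip_single[OF inj(2)] ap k(1)
        by (simp only: transpose_same id_comp transpose_commute[of ?k 0])
    qed
    have "(\<Sum>j\<in>{1..n}. pscale (of_real (if \<alpha> j = 0 then 1 else q)) (?s j F))
      = pscale (of_real (if \<alpha> ?k = 0 then 1 else q)) (?s ?k F) + (\<Sum>j\<in>{1..n} - {?k}. pscale (of_real (if \<alpha> j = 0 then 1 else q)) (?s j F))"
      by (rule sum.remove[OF _ kn]) simp
    also have "(\<Sum>j\<in>{1..n} - {?k}. pscale (of_real (if \<alpha> j = 0 then 1 else q)) (?s j F)) = (\<Sum>j\<in>{1..n} - {?k}. pscale (of_real q) (?s j F))"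
      by (rule sum.cong[OF refl]) (simp add: iff)
    finally have E: "(\<Sum>j\<in>{1..n}. pscale (of_real (if \<alpha> j = 0 then 1 else q)) (?s j F))
      = pscale (of_real (if \<alpha> ?k = 0 then 1 else q)) (?s ?k F) + (\<Sum>j\<in>{1..n} - {?k}. pscale (of_real q) (?s j F))" .
    show ?thesis unfolding main E sk k(1) if_P[OF False]
      by (simp only: ps.scale_sum_right simp_thms if_True of_real_1 ps.scale_one add.commute)
  qed
qed

section \<open>Pairings\<close>

definition matchings :: "nat set \<Rightarrow> (nat \<Rightarrow> nat) set" where
  "matchings A = {\<pi>. \<pi> permutes A \<and> (\<forall>x. \<pi> (\<pi> x) = x) \<and> (\<forall>x\<in>A. \<pi> x \<noteq> x)}"

lemma finite_matchings: "finite A \<Longrightarrow> finite (matchings A)"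
  by (rule finite_subset[OF _ finite_permutations[of A]]) (auto simp: matchings_def)

lemma matchingsD:
  assumes "\<pi> \<in> matchings A"
  shows "\<pi> permutes A" "\<pi> (\<pi> x) = x" "x \<in> A \<Longrightarrow> \<pi> x \<noteq> x" "\<pi> x \<in> A \<longleftrightarrow> x \<in> A"
  using assms permutes_in_image[of \<pi> A x] by (auto simp: matchings_def)

lemma matchings_empty: "matchings {} = {id}"
  by (auto simp: matchings_def)

lemma matchings_join:
  assumes "\<pi> \<in> matchings (A - {a, b})" "a \<in> A" "b \<in> A" "a \<noteq> b"
  shows "swp a b \<circ> \<pi> \<in> matchings A"
proof -
  have ab: "\<pi> a = a" "\<pi> b = b" using permutes_not_in[OF matchingsD(1)[OF assms(1)]] by auto
  have "\<pi> permutes A" by (rule permutes_subset[OF matchingsD(1)[OF assms(1)]]) auto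
  then have "swp a b \<circ> \<pi> permutes A" by (rule permutes_compose[OF _ permutes_swap_id[OF assms(2,3)]])
  moreover have "swp a b (\<pi> x) = (if x = a then b else if x = b then a else \<pi> x)" for x
  proof -
    have "\<pi> x = a \<longleftrightarrow> x = a" "\<pi> x = b \<longleftrightarrow> x = b" using ab matchingsD(2)[OF assms(1), of x] by metis+
    then show ?thesis unfolding Transposition.transpose_def using ab by auto
  qed
  moreover have "\<pi> x \<noteq> a" "\<pi> x \<noteq> b" if "x \<noteq> a" "x \<noteq> b" for x
    using ab that matchingsD(2)[OF assms(1), of x] by metis+
  ultimately show ?thesis
    using matchingsD(2,3)[OF assms(1)] assms(4) unfolding matchings_def by auto
qed

lemma matchings_split:
  assumes "\<pi> \<in> matchings A" "a \<in> A"
  shows "swp a (\<pi> a) \<circ> \<pi> \<in> matchings (A - {a, \<pi> a})"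
proof -
  let ?b = "\<pi> a"
  have b: "?b \<in> A" "?b \<noteq> a" "\<pi> ?b = a" using matchingsD[OF assms(1)] assms(2) by auto
  have p: "swp a ?b \<circ> \<pi> permutes A"
    by (rule permutes_compose[OF matchingsD(1)[OF assms(1)] permutes_swap_id[OF assms(2) b(1)]])
  have v: "swp a ?b (\<pi> x) = (if x = a \<or> x = ?b then x else \<pi> x)" for x
  proof -
    have "\<pi> x = a \<longleftrightarrow> x = ?b" "\<pi> x = ?b \<longleftrightarrow> x = a" using b(3) matchingsD(2)[OF assms(1), of x] by metis+
    then show ?thesis unfolding Transposition.transpose_def using b by auto
  qed
  have ne: "\<pi> x \<noteq> a" "\<pi> x \<noteq> ?b" if "x \<noteq> a" "x \<noteq> ?b" for x
    using b that matchingsD(2)[OF assms(1), of x] by metis+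
  have "swp a ?b \<circ> \<pi> permutes (A - {a, ?b})"
    by (rule permutes_superset[OF p]) (auto simp: v)
  then show ?thesis
    using matchingsD(2,3)[OF assms(1)] v ne unfolding matchings_def by auto
qed

text \<open>A pairing is determined by the partner \<open>b\<close> of \<open>a\<close> and by a pairing of the remaining letters.\<close>

lemma sum_matchings:
  assumes "finite A" "a \<in> A"
  shows "(\<Sum>\<pi>\<in>matchings A. f \<pi>) = (\<Sum>b\<in>A - {a}. \<Sum>\<pi>\<in>matchings (A - {a, b}). f (swp a b \<circ> \<pi>))"
proof -
  have v: "(swp a b \<circ> \<pi>) a = b" if "\<pi> \<in> matchings (A - {a, b})" for b \<pi>
    using permutes_not_in[OF matchingsD(1)[OF that], of a] by simp
  have "(\<Sum>b\<in>A - {a}. \<Sum>\<pi>\<in>matchings (A - {a, b}). f (swp a b \<circ> \<pi>))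
    = (\<Sum>(b, \<pi>)\<in>Sigma (A - {a}) (\<lambda>b. matchings (A - {a, b})). f (swp a b \<circ> \<pi>))"
    by (rule sum.Sigma) (use assms finite_matchings in auto)
  also have "\<dots> = (\<Sum>\<pi>\<in>matchings A. f \<pi>)"
  proof (rule sum.reindex_bij_witness[where i = "\<lambda>\<pi>. (\<pi> a, swp a (\<pi> a) \<circ> \<pi>)" and j = "\<lambda>(b, \<pi>). swp a b \<circ> \<pi>"])
    fix x assume "x \<in> Sigma (A - {a}) (\<lambda>b. matchings (A - {a, b}))"
    then obtain b \<pi> where x: "x = (b, \<pi>)" "b \<in> A" "b \<noteq> a" "\<pi> \<in> matchings (A - {a, b})" by auto
    show "((case x of (b, \<pi>) \<Rightarrow> swp a b \<circ> \<pi>) a, swp a ((case x of (b, \<pi>) \<Rightarrow> swp a b \<circ> \<pi>) a) \<circ> (case x of (b, \<pi>) \<Rightarrow> swp a b \<circ> \<pi>)) = x"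
      unfolding x(1) prod.case v[OF x(4)] swp_comp ..
    show "(case x of (b, \<pi>) \<Rightarrow> swp a b \<circ> \<pi>) \<in> matchings A"
      unfolding x(1) prod.case by (rule matchings_join[OF x(4) assms(2) x(2) x(3)[symmetric]])
    show "f (case x of (b, \<pi>) \<Rightarrow> swp a b \<circ> \<pi>) = (case x of (b, \<pi>) \<Rightarrow> f (swp a b \<circ> \<pi>))"
      unfolding x(1) prod.case ..
  next
    fix \<pi> assume p: "\<pi> \<in> matchings A"
    show "(case (\<pi> a, swp a (\<pi> a) \<circ> \<pi>) of (b, \<pi>) \<Rightarrow> swp a b \<circ> \<pi>) = \<pi>"
      unfolding prod.case swp_comp ..
    show "(\<pi> a, swp a (\<pi> a) \<circ> \<pi>) \<in> Sigma (A - {a}) (\<lambda>b. matchings (A - {a, b}))"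
      using matchings_split[OF p assms(2)] matchingsD(3,4)[OF p, of a] assms(2) by blast
  qed
  finally show ?thesis ..
qed

text \<open>The Wick sum, also called hafnian when \<open>c\<close> is symmetric.\<close>

definition wick :: "nat set \<Rightarrow> (nat \<Rightarrow> nat \<Rightarrow> 'c::comm_semiring_1) \<Rightarrow> 'c" where
  "wick A c = (\<Sum>\<pi>\<in>matchings A. \<Prod>i | i \<in> A \<and> i < \<pi> i. c i (\<pi> i))"

lemma wick_empty: "wick {} c = 1"
  by (simp add: wick_def matchings_empty)

text \<open>Expanding along the smallest letter avoids any symmetry assumption on \<open>c\<close>.\<close>

lemma wick_Min:
  assumes "finite A" "a \<in> A" "\<And>b. b \<in> A \<Longrightarrow> a \<le> b"
  shows "wick A c = (\<Sum>b\<in>A - {a}. c a b * wick (A - {a, b}) c)"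
  unfolding wick_def sum_matchings[OF assms(1,2)] sum_distrib_left
proof (intro sum.cong refl)
  fix b \<pi> assume b: "b \<in> A - {a}" and p: "\<pi> \<in> matchings (A - {a, b})"
  have ab: "\<pi> a = a" "\<pi> b = b" using permutes_not_in[OF matchingsD(1)[OF p]] by auto
  have "\<pi> x \<noteq> a" "\<pi> x \<noteq> b" if "x \<noteq> a" "x \<noteq> b" for x
    using ab that matchingsD(2)[OF p, of x] by metis+
  then have v: "(swp a b \<circ> \<pi>) x = (if x = a then b else if x = b then a else \<pi> x)" for x
    using ab unfolding comp_def Transposition.transpose_def by auto
  have "{i. i \<in> A \<and> i < (swp a b \<circ> \<pi>) i} = insert a {i. i \<in> A - {a, b} \<and> i < \<pi> i}"
    using b assms(2) assms(3)[of b] unfolding v by (auto split: if_splits)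
  moreover have "(\<Prod>i | i \<in> A - {a, b} \<and> i < \<pi> i. c i ((swp a b \<circ> \<pi>) i)) = (\<Prod>i | i \<in> A - {a, b} \<and> i < \<pi> i. c i (\<pi> i))"
    by (rule prod.cong) (auto simp: v simp del: comp_apply)
  ultimately show "(\<Prod>i | i \<in> A \<and> i < (swp a b \<circ> \<pi>) i. c i ((swp a b \<circ> \<pi>) i)) = c a b * (\<Prod>i | i \<in> A - {a, b} \<and> i < \<pi> i. c i (\<pi> i))"
    using assms(1) by (simp add: v del: comp_apply)
qed

lemma sign_matching:
  assumes "finite A" "\<pi> \<in> matchings A"
  shows "even (card A) \<and> sign \<pi> = (-1) ^ (card A div 2)"
  using assms
proof (induction "card A" arbitrary: A \<pi> rule: less_induct)
  case less
  show ?case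
  proof (cases "A = {}")
    case True
    then have "\<pi> = id" using less.prems(2) matchings_empty by (metis singletonD)
    then show ?thesis using True by (simp add: sign_id)
  next
    case False
    then obtain a where a: "a \<in> A" by blast
    let ?A = "A - {a, \<pi> a}" and ?p = "swp a (\<pi> a) \<circ> \<pi>"
    have ne: "\<pi> a \<in> A" "a \<noteq> \<pi> a" using matchingsD(3)[OF less.prems(2) a] matchingsD(4)[OF less.prems(2), of a] a by simp_all
    have c: "card A = card ?A + 2"
    proof -
      have "card (A - {a, \<pi> a}) = card A - card {a, \<pi> a}" by (rule card_Diff_subset) (use ne a in auto)
      moreover have "card {a, \<pi> a} \<le> card A" by (rule card_mono) (use ne a less.prems(1) in auto)
      ultimately show ?thesis using ne(2) by simp
    qed
    have p: "?p \<in> matchings ?A" by (rule matchings_split[OF less.prems(2) a])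
    have c2: "card ?A < card A" using c by linarith
    have "finite ?A" using less.prems(1) by (rule finite_Diff)
    from less.hyps[OF c2 this p] have IH: "even (card ?A)" "sign ?p = (-1) ^ (card ?A div 2)" by blast+
    have pp: "permutation (swp a (\<pi> a))" "permutation ?p"
      by (rule permutation_swap_id) (use permutation_permutes matchingsD(1)[OF p] \<open>finite ?A\<close> in metis)
    have "sign \<pi> = sign (swp a (\<pi> a) \<circ> ?p)" unfolding swp_comp ..
    also have "\<dots> = - ((-1) ^ (card ?A div 2))"
      unfolding sign_compose[OF pp] IH(2) using ne by (simp add: sign_swap_id)
    finally show ?thesis using IH(1) c by simp
  qed
qed

lemma card_ascents:
  assumes "finite A" "\<pi> \<in> matchings A"
  shows "2 * card {i. i \<in> A \<and> i < \<pi> i} = card A"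
proof -
  let ?D = "{i. i \<in> A \<and> i < \<pi> i}" and ?E = "{i. i \<in> A \<and> \<pi> i < i}"
  have "bij_betw \<pi> ?D ?E"
    by (rule bij_betw_byWitness[where f' = \<pi>]) (use matchingsD(2,4)[OF assms(2)] in auto)
  then have "card ?D = card ?E" by (rule bij_betw_same_card)
  moreover have "card (?D \<union> ?E) = card ?D + card ?E" by (rule card_Un_disjoint) (use assms(1) in auto)
  moreover have "?D \<union> ?E = A" using matchingsD(3)[OF assms(2)] by (auto simp: neq_iff)
  ultimately show ?thesis by simp
qed

lemma Invol_matching:
  "{\<pi> \<in> Invol {0..m}. supp \<pi> = {1..m}} = matchings {1..m}"
proof -
  have e: "{0..m} - {0} = {1..m}" by auto
  show ?thesis
    unfolding matchings_def Invol_def e supp_def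
    by (rule Set.set_eqI) (auto simp: fun_eq_iff permutes_def)
qed

definition cyclic :: "nat \<Rightarrow> nat \<Rightarrow> nat" where
  "cyclic m i = (if i < m then i + 1 else if i = m then 0 else i)"

lemma cyclic_0: "cyclic 0 = id"
  by (auto simp: cyclic_def)

lemma cyclic_Suc: "cyclic (Suc m) = swp 0 (m + 1) \<circ> cyclic m"
  by (rule ext) (auto simp: cyclic_def Transposition.transpose_def)

lemma cyclic_permutes: "cyclic m permutes {0..m}"
proof (induction m)
  case 0
  then show ?case unfolding cyclic_0 by (rule permutes_id)
next
  case (Suc m)
  have "cyclic m permutes {0..Suc m}" by (rule permutes_subset[OF Suc]) auto
  then show ?case unfolding cyclic_Suc by (rule permutes_compose[OF _ permutes_swap_id]) auto
qed

lemma sign_cyclic: "sign (cyclic m) = (-1) ^ m"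
proof (induction m)
  case 0
  then show ?case unfolding cyclic_0 by (simp add: sign_id)
next
  case (Suc m)
  have "permutation (cyclic m)" using cyclic_permutes[of m] permutation_permutes by (metis finite_atLeastAtMost)
  then have "sign (cyclic (Suc m)) = sign (swp 0 (m + 1)) * sign (cyclic m)"
    unfolding cyclic_Suc by (rule sign_compose[OF permutation_swap_id])
  then show ?case unfolding Suc by (simp add: sign_swap_id)
qed

text \<open>Comparing signs: \<open>\<pi>\<close> is a product of \<open>m/2\<close> transpositions and the cycle has sign \<open>(-1)\<^sup>m = 1\<close>. The number
\<open>m/2 - cyc0\<close> is twice the genus of the surface glued from a polygon along \<open>\<pi>\<close>.\<close>

lemma genus_even:
  assumes "\<pi> \<in> matchings {1..m}"
  shows "even (m div 2 + cyc0 {0..m} (\<pi> \<circ> cyclic m))"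
proof -
  have p: "\<pi> permutes {0..m}" by (rule permutes_subset[OF matchingsD(1)[OF assms]]) auto
  have q: "permutation \<pi>" "permutation (cyclic m)"
    using p cyclic_permutes[of m] permutation_permutes by (metis finite_atLeastAtMost)+
  have s: "even m" "sign \<pi> = (-1) ^ (m div 2)" using sign_matching[OF finite_atLeastAtMost assms] by simp_all
  have "(-1) ^ (m div 2) * (-1) ^ m = ((-1) ^ (cyc0 {0..m} (\<pi> \<circ> cyclic m) + card {0..m} + 1) :: int)"
    using sign_cyc0[OF permutes_compose[OF cyclic_permutes p]] sign_compose[OF q] s(2) sign_cyclic[of m] by simp
  then have "(-1) ^ (m div 2) = ((-1) ^ (cyc0 {0..m} (\<pi> \<circ> cyclic m)) :: int)"
    using s(1) by (simp add: power_add)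
  then show ?thesis by (auto simp: minus_one_power_iff split: if_splits)
qed

section \<open>Moments of the generator\<close>

lemma state_mlin: "mlin (*) (\<lambda>hs :: 'h::real_vector list. if hs = [] then 1 else 0 :: complex)"
proof (rule mlinI, rule mlin_onI)
  fix n p and hs :: "'h list" and a b x y assume "length hs = n" "p < n"
  then have "hs \<noteq> []" by auto
  then show "(if hs[p := a *\<^sub>R x + b *\<^sub>R y] = [] then 1 else 0 :: complex)
     = of_real a * (if hs[p := x] = [] then 1 else 0) + of_real b * (if hs[p := y] = [] then 1 else 0)" by simp
qed

lemma state_hom: "lin pscale (*) state"
  unfolding state_def by (rule ptens_ext_hom[OF module_mult state_mlin])

lemma state_gen: "state (gen \<alpha> hs) = (if hs = [] then 1 else 0)"
  unfolding state_def by (rule ptens_ext_gen[OF module_mult state_mlin])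

lemma state_Sgen: "state (Sgen \<alpha> hs) = (if hs = [] then 1 else 0)"
proof -
  have "act \<sigma> hs = [] \<longleftrightarrow> hs = []" for \<sigma> using length_act[of \<sigma> hs] by (metis length_0_conv)
  then have "state (Sgen \<alpha> hs) = (1 / fact (length hs)) * (\<Sum>\<sigma> | \<sigma> permutes {1..length hs}. if hs = [] then 1 else 0)"
    unfolding Sgen_eq by (simp only: linD(4)[OF state_hom] Modules.module_hom.sum[OF state_hom] state_gen)
  then show ?thesis by (auto simp: permutes_empty)
qed

lemma tp_one_T: "(tp_one :: 'a::real_inner ptens) = T_poly q (gen id [])"
proof -
  have p: "id permutes {0..length ([] :: 'a list)}" by (rule permutes_id)
  have "Invol {0..length []} = {id}" unfolding Invol_def by (auto simp: permutes_empty)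
  moreover have s: "supp id = {}" by (simp add: supp_def)
  moreover have "pairs id = 0" unfolding pairs_def s by simp
  moreover have "Sgen id ([] :: 'a list) = labelled {0..length ([] :: 'a list)} id (letter ([] :: 'a list))" by (rule labelled_interval[OF p, symmetric])
  ultimately show ?thesis
    unfolding T_gen[OF p] T_labelled_def contr_weight_def pair_weight_def tp_one_def by (simp add: Sgen_def)
qed

lemma tp_power_X:
  assumes "q \<noteq> 0"
  shows "tp_power q (X_poly q h) m = T_poly q (gen (cyclic m) (replicate m h))"
proof (induction m)
  case 0
  show ?case by (simp only: tp_power.simps replicate_0 cyclic_0 tp_one_T[of q])
next
  case (Suc m)
  have p: "cyclic m permutes {0..length (replicate m h)}" using cyclic_permutes[of m] by simp
  have "T_poly q (gen (cyclic m) (replicate m h)) \<in> TP"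
    unfolding T_S[OF p, symmetric] by (rule T_TP[OF Sgen_TP]) (use p in \<open>simp add: S0_iff\<close>)
  then have "tp_power q (X_poly q h) (Suc m) = T_poly q (gen (swp 0 (length (replicate m h) + 1) \<circ> cyclic m) (replicate m h @ [h]))"
    unfolding tp_power.simps Suc by (simp only: tp_mult_X[OF _ assms] T_recursion[OF p assms])
  then show ?case by (simp only: cyclic_Suc length_replicate replicate_append_same[symmetric] replicate_Suc)
qed

text \<open>Only contractions of all letters survive, that is, pairings. After them only the letter \<open>0\<close> is left, so the first cycle
count in the exponent vanishes.\<close>

lemma state_T_cyclic:
  "state (T_poly q (gen (cyclic m) (replicate m h)))
     = of_real (\<Sum>\<pi>\<in>matchings {1..m}. q powi (int (m div 2) - int (cyc0 {0..m} (\<pi> \<circ> cyclic m))) * ((norm h)\<^sup>2) ^ (m div 2))"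
proof -
  let ?hs = "replicate m h" and ?B = "{0..m}"
  have p: "cyclic m permutes {0..length ?hs}" using cyclic_permutes[of m] by simp
  have st: "state (labelled (?B - supp \<pi>) (skip (supp \<pi>) (\<pi> \<circ> cyclic m)) (letter ?hs)) = (if supp \<pi> = {1..m} then 1 else 0)"
    if pi: "\<pi> \<in> Invol ?B" for \<pi>
  proof -
    have sup: "supp \<pi> \<subseteq> {1..m}" using InvolD(5)[OF pi] by auto
    then have f: "finite (?B - supp \<pi>)" "0 \<in> ?B - supp \<pi>" "finite (supp \<pi>)" using finite_subset by auto
    have pp: "\<pi> \<circ> cyclic m permutes ?B" by (rule permutes_compose[OF cyclic_permutes InvolD(1)[OF pi]])
    have sk: "skip (supp \<pi>) (\<pi> \<circ> cyclic m) permutes ?B - supp \<pi>"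
      by (rule skip_permutes[OF pp]) (use sup f in auto)
    have len: "length (lab_word (?B - supp \<pi>) (rank_in (?B - supp \<pi>)) (letter ?hs)) = card (?B - supp \<pi>) - 1"
      by (simp add: lab_word_def)
    have "card (?B - supp \<pi>) = m + 1 - card (supp \<pi>)"
      by (subst card_Diff_subset) (use sup f in auto)
    moreover have "card (supp \<pi>) \<le> m" using card_mono[OF _ sup] by simp
    moreover have "supp \<pi> = {1..m}" if "card (supp \<pi>) = m" using card_subset_eq[OF _ sup] that by simp
    moreover have "card (supp \<pi>) = m" if "supp \<pi> = {1..m}" using that by simp
    ultimately have "card (?B - supp \<pi>) - 1 = 0 \<longleftrightarrow> supp \<pi> = {1..m}" by linarith
    then have "lab_word (?B - supp \<pi>) (rank_in (?B - supp \<pi>)) (letter ?hs) = [] \<longleftrightarrow> supp \<pi> = {1..m}"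
      by (simp only: len[symmetric] length_0_conv)
    then show ?thesis unfolding labelled_gen[OF f(1,2) sk] state_Sgen by simp
  qed
  have val: "contr_weight q ?B \<pi> (cyclic m) * pair_weight ?B \<pi> (letter ?hs)
      = q powi (int (m div 2) - int (cyc0 ?B (\<pi> \<circ> cyclic m))) * ((norm h)\<^sup>2) ^ (m div 2)"
    if pi: "\<pi> \<in> Invol ?B" and sup: "supp \<pi> = {1..m}" for \<pi>
  proof -
    have pp: "\<pi> \<circ> cyclic m permutes ?B" by (rule permutes_compose[OF cyclic_permutes InvolD(1)[OF pi]])
    have B: "?B - supp \<pi> = {0}" unfolding sup by auto
    have "skip (supp \<pi>) (\<pi> \<circ> cyclic m) permutes ?B - supp \<pi>"
      by (rule skip_permutes[OF pp]) (use sup in auto)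
    then have "skip (supp \<pi>) (\<pi> \<circ> cyclic m) = id" unfolding B by (simp only: permutes_sing)
    then have c: "contr_weight q ?B \<pi> (cyclic m) = q powi (int (m div 2) - int (cyc0 ?B (\<pi> \<circ> cyclic m)))"
      unfolding contr_weight_def B by (simp add: pairs_def sup del: comp_apply)
    have d: "pair_weight ?B \<pi> (letter ?hs) = (\<Prod>i | i \<in> ?B \<and> i < \<pi> i. (norm h)\<^sup>2)"
      unfolding pair_weight_def
    proof (rule prod.cong[OF refl])
      fix i assume i: "i \<in> {i. i \<in> ?B \<and> i < \<pi> i}"
      then have "i \<in> supp \<pi>" "\<pi> i \<in> supp \<pi>" using InvolD(4)[OF pi, of i] by (auto simp: supp_def)
      then show "inner (letter ?hs i) (letter ?hs (\<pi> i)) = (norm h)\<^sup>2"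
        unfolding sup by (auto simp: power2_norm_eq_inner)
    qed
    have "\<pi> \<in> matchings {1..m}" using pi sup unfolding Invol_matching[symmetric] by simp
    from card_ascents[OF _ this] have "2 * card {i. i \<in> {1..m} \<and> i < \<pi> i} = m" by simp
    moreover have "{i. i \<in> ?B \<and> i < \<pi> i} = {i. i \<in> {1..m} \<and> i < \<pi> i}"
      using InvolD(3)[OF pi] by (auto simp: Suc_le_eq intro: gr0I)
    ultimately have "card {i. i \<in> ?B \<and> i < \<pi> i} = m div 2" by simp
    then show ?thesis unfolding c d prod_constant by simp
  qed
  have "state (T_poly q (gen (cyclic m) ?hs))
    = (\<Sum>\<pi>\<in>Invol ?B. of_real (contr_weight q ?B \<pi> (cyclic m) * pair_weight ?B \<pi> (letter ?hs)) * (if supp \<pi> = {1..m} then 1 else 0))"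
    unfolding T_gen[OF p] T_labelled_def Modules.module_hom.sum[OF state_hom] linD(4)[OF state_hom] length_replicate
    by (rule sum.cong[OF refl]) (simp only: st)
  also have "\<dots> = (\<Sum>\<pi>\<in>{\<pi> \<in> Invol ?B. supp \<pi> = {1..m}}. of_real (contr_weight q ?B \<pi> (cyclic m) * pair_weight ?B \<pi> (letter ?hs)))"
    by (rule sum.mono_neutral_cong_right) (auto simp: finite_Invol)
  also have "\<dots> = (\<Sum>\<pi>\<in>matchings {1..m}. of_real (q powi (int (m div 2) - int (cyc0 {0..m} (\<pi> \<circ> cyclic m))) * ((norm h)\<^sup>2) ^ (m div 2)))"
    by (rule sum.cong[OF Invol_matching], rule arg_cong[where f = of_real], rule val) (simp_all only: Invol_matching[symmetric] mem_Collect_eq)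
  finally show ?thesis unfolding of_real_sum .
qed

section \<open>The Wick formula for Gaussian families\<close>

definition all_moments :: "'w measure \<Rightarrow> ('w \<Rightarrow> complex) \<Rightarrow> bool" where
  "all_moments P f \<longleftrightarrow> f \<in> borel_measurable P \<and> (\<forall>k. integrable P (\<lambda>\<omega>. norm (f \<omega>) ^ k))"

context prob_space
begin

lemma all_moments_integrable: "all_moments M f \<Longrightarrow> integrable M f"
  unfolding all_moments_def by (metis (no_types, lifting) integrable_norm_cancel power_one_right Bochner_Integration.integrable_cong)

lemma all_moments_const: "all_moments M (\<lambda>_. c)"
  by (simp add: all_moments_def)

lemma all_moments_add:
  assumes "all_moments M f" "all_moments M g"
  shows "all_moments M (\<lambda>\<omega>. f \<omega> + g \<omega>)"
  unfolding all_moments_def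
proof (intro conjI allI)
  have m [measurable]: "f \<in> borel_measurable M" "g \<in> borel_measurable M" using assms by (auto simp: all_moments_def)
  show "(\<lambda>\<omega>. f \<omega> + g \<omega>) \<in> borel_measurable M" by measurable
  fix k
  have "integrable M (\<lambda>\<omega>. 2 ^ k * (norm (f \<omega>) ^ k + norm (g \<omega>) ^ k))"
    using assms by (auto simp: all_moments_def)
  then show "integrable M (\<lambda>\<omega>. norm (f \<omega> + g \<omega>) ^ k)"
  proof (rule Bochner_Integration.integrable_bound)
    show "AE \<omega> in M. norm (norm (f \<omega> + g \<omega>) ^ k) \<le> norm (2 ^ k * (norm (f \<omega>) ^ k + norm (g \<omega>) ^ k))"
    proof (rule AE_I2)
      fix \<omega>
      let ?a = "norm (f \<omega>)" and ?b = "norm (g \<omega>)"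
      have "norm (f \<omega> + g \<omega>) ^ k \<le> (2 * max ?a ?b) ^ k"
        by (rule power_mono) (use norm_triangle_ineq[of "f \<omega>" "g \<omega>"] in linarith, simp)
      also have "\<dots> \<le> 2 ^ k * (?a ^ k + ?b ^ k)"
        by (auto simp: power_mult_distrib max_def)
      finally show "norm (norm (f \<omega> + g \<omega>) ^ k) \<le> norm (2 ^ k * (?a ^ k + ?b ^ k))" by simp
    qed
  qed measurable
qed

lemma all_moments_mult:
  assumes "all_moments M f" "all_moments M g"
  shows "all_moments M (\<lambda>\<omega>. f \<omega> * g \<omega>)"
  unfolding all_moments_def
proof (intro conjI allI)
  have m [measurable]: "f \<in> borel_measurable M" "g \<in> borel_measurable M" using assms by (auto simp: all_moments_def)
  show "(\<lambda>\<omega>. f \<omega> * g \<omega>) \<in> borel_measurable M" by measurable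
  fix k
  have "integrable M (\<lambda>\<omega>. norm (f \<omega>) ^ (2 * k) + norm (g \<omega>) ^ (2 * k))"
    using assms by (auto simp: all_moments_def)
  then show "integrable M (\<lambda>\<omega>. norm (f \<omega> * g \<omega>) ^ k)"
  proof (rule Bochner_Integration.integrable_bound)
    show "AE \<omega> in M. norm (norm (f \<omega> * g \<omega>) ^ k) \<le> norm (norm (f \<omega>) ^ (2 * k) + norm (g \<omega>) ^ (2 * k))"
    proof (rule AE_I2)
      fix \<omega>
      let ?a = "norm (f \<omega>) ^ k" and ?b = "norm (g \<omega>) ^ k"
      have "0 \<le> ?a * ?b" by simp
      moreover have "0 \<le> (?a - ?b)\<^sup>2" by (rule zero_le_power2)
      ultimately have "?a * ?b \<le> ?a\<^sup>2 + ?b\<^sup>2" unfolding power2_diff by linarith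
      then show "norm (norm (f \<omega> * g \<omega>) ^ k) \<le> norm (norm (f \<omega>) ^ (2 * k) + norm (g \<omega>) ^ (2 * k))"
        by (simp add: norm_mult power_mult_distrib power_even_eq)
    qed
  qed measurable
qed

lemma all_moments_sum: "(\<And>i. i \<in> I \<Longrightarrow> all_moments M (f i)) \<Longrightarrow> all_moments M (\<lambda>\<omega>. \<Sum>i\<in>I. f i \<omega>)"
  by (induction I rule: infinite_finite_induct) (simp_all add: all_moments_const all_moments_add)

lemma all_moments_prod: "(\<And>i. i \<in> I \<Longrightarrow> all_moments M (f i)) \<Longrightarrow> all_moments M (\<lambda>\<omega>. \<Prod>i\<in>I. f i \<omega>)"
  by (induction I rule: infinite_finite_induct) (simp_all add: all_moments_const all_moments_mult)

lemma all_moments_power: "all_moments M f \<Longrightarrow> all_moments M (\<lambda>\<omega>. f \<omega> ^ k)"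
  by (induction k) (simp_all add: all_moments_const all_moments_mult)

text \<open>The expectation of \<open>W (g + z f)\<^sup>m\<close> as a polynomial in \<open>z\<close>. Comparing the coefficients of \<open>z\<close> takes the place of differentiating
under the integral.\<close>

definition shift_poly :: "('a \<Rightarrow> complex) \<Rightarrow> ('a \<Rightarrow> complex) \<Rightarrow> ('a \<Rightarrow> complex) \<Rightarrow> nat \<Rightarrow> complex poly" where
  "shift_poly W f g m = (\<Sum>k\<le>m. monom (of_nat (m choose k) * (LINT \<omega>|M. W \<omega> * (f \<omega> ^ k * g \<omega> ^ (m - k)))) k)"

lemma poly_shift_poly:
  assumes "all_moments M W" "all_moments M f" "all_moments M g"
  shows "poly (shift_poly W f g m) z = (LINT \<omega>|M. W \<omega> * (g \<omega> + z * f \<omega>) ^ m)"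
proof -
  have i: "integrable M (\<lambda>\<omega>. W \<omega> * (f \<omega> ^ k * g \<omega> ^ (m - k)))" for k
    by (intro all_moments_integrable all_moments_mult all_moments_power assms)
  have "(LINT \<omega>|M. W \<omega> * (g \<omega> + z * f \<omega>) ^ m)
      = (LINT \<omega>|M. (\<Sum>k\<le>m. (of_nat (m choose k) * z ^ k) * (W \<omega> * (f \<omega> ^ k * g \<omega> ^ (m - k)))))"
  proof (rule Bochner_Integration.integral_cong[OF refl])
    fix \<omega>
    have "W \<omega> * (g \<omega> + z * f \<omega>) ^ m = W \<omega> * (z * f \<omega> + g \<omega>) ^ m" by (simp only: add.commute)
    also have "\<dots> = (\<Sum>k\<le>m. (of_nat (m choose k) * z ^ k) * (W \<omega> * (f \<omega> ^ k * g \<omega> ^ (m - k))))"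
      unfolding binomial_ring sum_distrib_left by (rule sum.cong) (simp_all add: power_mult_distrib mult_ac)
    finally show "W \<omega> * (g \<omega> + z * f \<omega>) ^ m = \<dots>" .
  qed
  also have "\<dots> = (\<Sum>k\<le>m. (of_nat (m choose k) * z ^ k) * (LINT \<omega>|M. W \<omega> * (f \<omega> ^ k * g \<omega> ^ (m - k))))"
    by (subst Bochner_Integration.integral_sum) (use i in auto)
  finally show ?thesis by (simp add: shift_poly_def poly_sum poly_monom mult_ac)
qed

lemma coeff_shift_poly:
  "coeff (shift_poly W f g m) 0 = (LINT \<omega>|M. W \<omega> * g \<omega> ^ m)"
  "coeff (shift_poly W f g m) 1 = of_nat m * (LINT \<omega>|M. W \<omega> * (f \<omega> * g \<omega> ^ (m - 1)))"
  unfolding shift_poly_def coeff_sum by (simp_all add: coeff_monom sum.delta' if_distrib[of "\<lambda>x. x = _"] cong: if_cong)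

end

text \<open>The moments of the standard normal distribution.\<close>

fun gauss_moment :: "nat \<Rightarrow> real" where
  "gauss_moment 0 = 1"
| "gauss_moment (Suc 0) = 0"
| "gauss_moment (Suc (Suc n)) = real (Suc n) * gauss_moment n"

lemma gauss_moment_odd: "odd n \<Longrightarrow> gauss_moment n = 0"
  by (induction n rule: gauss_moment.induct) auto

lemma gauss_moment_even: "gauss_moment (2 * k) * (2 ^ k * fact k) = fact (2 * k)"
proof (induction k)
  case (Suc k)
  have "gauss_moment (2 * Suc k) * (2 ^ Suc k * fact (Suc k))
      = (real (2 * k + 1) * (2 * real (k + 1))) * (gauss_moment (2 * k) * (2 ^ k * fact k))" by simp
  also have "\<dots> = fact (2 * Suc k)" unfolding Suc by (simp add: algebra_simps)
  finally show ?case .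
qed simp

text \<open>A real vector space of centered Gaussian variables. Gaussianity enters only through the moments
of single variables.\<close>

locale gaussian_space = prob_space M for M :: "'w measure" +
  fixes S :: "('w \<Rightarrow> real) set"
  assumes S_add: "u \<in> S \<Longrightarrow> v \<in> S \<Longrightarrow> (\<lambda>\<omega>. u \<omega> + v \<omega>) \<in> S"
    and S_scale: "u \<in> S \<Longrightarrow> (\<lambda>\<omega>. c * u \<omega>) \<in> S"
    and S_moments: "u \<in> S \<Longrightarrow> all_moments M (\<lambda>\<omega>. of_real (u \<omega>))"
    and S_gauss: "u \<in> S \<Longrightarrow> (LINT \<omega>|M. u \<omega> ^ m) = gauss_moment m * (LINT \<omega>|M. u \<omega> ^ 2) ^ (m div 2)"
begin

text \<open>The complexification of the space \<open>S\<close>.\<close>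

definition L :: "('w \<Rightarrow> complex) set" where
  "L = {f. \<exists>u\<in>S. \<exists>v\<in>S. f = (\<lambda>\<omega>. of_real (u \<omega>) + \<i> * of_real (v \<omega>))}"

lemma L_moments: "f \<in> L \<Longrightarrow> all_moments M f"
  unfolding L_def by (auto intro!: all_moments_add all_moments_mult all_moments_const S_moments)

lemma L_axpy:
  assumes "f \<in> L" "g \<in> L"
  shows "(\<lambda>\<omega>. g \<omega> + z * f \<omega>) \<in> L"
proof -
  obtain u v u' v' where f: "u \<in> S" "v \<in> S" "f = (\<lambda>\<omega>. of_real (u \<omega>) + \<i> * of_real (v \<omega>))"
    and g: "u' \<in> S" "v' \<in> S" "g = (\<lambda>\<omega>. of_real (u' \<omega>) + \<i> * of_real (v' \<omega>))"
    using assms unfolding L_def by blast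
  have "(\<lambda>\<omega>. u' \<omega> + (Re z * u \<omega> + (- Im z) * v \<omega>)) \<in> S" "(\<lambda>\<omega>. v' \<omega> + (Im z * u \<omega> + Re z * v \<omega>)) \<in> S"
    by (intro S_add S_scale f g)+
  moreover have "(\<lambda>\<omega>. g \<omega> + z * f \<omega>) = (\<lambda>\<omega>. of_real (u' \<omega> + (Re z * u \<omega> + (- Im z) * v \<omega>)) + \<i> * of_real (v' \<omega> + (Im z * u \<omega> + Re z * v \<omega>)))"
    unfolding f g by (rule ext) (simp add: complex_eq_iff)
  ultimately show ?thesis unfolding L_def mem_Collect_eq by (intro bexI)
qed

text \<open>For \<open>f = u + z v\<close> both sides are polynomials in \<open>z\<close>. They agree for real \<open>z\<close>, hence for \<open>z = \<i>\<close>.\<close>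

lemma L_gauss:
  assumes "f \<in> L"
  shows "(LINT \<omega>|M. f \<omega> ^ m) = of_real (gauss_moment m) * (LINT \<omega>|M. f \<omega> ^ 2) ^ (m div 2)"
proof -
  obtain u v where f: "u \<in> S" "v \<in> S" "f = (\<lambda>\<omega>. of_real (u \<omega>) + \<i> * of_real (v \<omega>))"
    using assms unfolding L_def by blast
  let ?p = "\<lambda>m. shift_poly (\<lambda>_. 1) (\<lambda>\<omega>. of_real (v \<omega>)) (\<lambda>\<omega>. of_real (u \<omega>)) m"
  let ?r = "Polynomial.smult (of_real (gauss_moment m)) (?p 2 ^ (m div 2))"
  have p: "poly (?p m) z = (LINT \<omega>|M. (of_real (u \<omega>) + z * of_real (v \<omega>)) ^ m)" for m z
    using poly_shift_poly[OF all_moments_const S_moments[OF f(2)] S_moments[OF f(1)], of 1 m z] by simp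
  have "poly (?p m - ?r) (of_real s) = 0" for s
  proof -
    have rl: "poly (?p m) (of_real s) = of_real (LINT \<omega>|M. (u \<omega> + s * v \<omega>) ^ m)" for m
    proof -
      have "poly (?p m) (of_real s) = (LINT \<omega>|M. complex_of_real ((u \<omega> + s * v \<omega>) ^ m))" unfolding p by simp
      then show ?thesis by (simp only: integral_complex_of_real)
    qed
    have "(\<lambda>\<omega>. u \<omega> + s * v \<omega>) \<in> S" by (intro S_add S_scale f)
    from S_gauss[OF this, of m] show ?thesis by (simp add: rl)
  qed
  then have "range complex_of_real \<subseteq> {z. poly (?p m - ?r) z = 0}" by auto
  moreover have "infinite (range complex_of_real)"
  proof
    assume "finite (range complex_of_real)"
    then have "finite (UNIV :: real set)" by (rule finite_imageD) (rule inj_onI, simp only: of_real_eq_iff)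
    then show False using infinite_UNIV_char_0 by metis
  qed
  ultimately have "infinite {z. poly (?p m - ?r) z = 0}" by (rule infinite_super)
  then have "?p m - ?r = 0" by (rule contrapos_np) (rule poly_roots_finite)
  then have "poly (?p m) \<i> = poly ?r \<i>" by simp
  then show ?thesis unfolding poly_smult poly_power p by (simp add: f(3))
qed

text \<open>Integration by parts for Gaussian variables. It is the coefficient of \<open>z\<close> in the formula for the moments of \<open>y + z x\<close>.\<close>

lemma stein:
  assumes "x \<in> L" "y \<in> L"
  shows "(LINT \<omega>|M. x \<omega> * y \<omega> ^ m) = of_nat m * (LINT \<omega>|M. x \<omega> * y \<omega>) * (LINT \<omega>|M. y \<omega> ^ (m - 1))"
proof -
  let ?p = "\<lambda>m. shift_poly (\<lambda>_. 1) x y m" and ?l = "(m + 1) div 2"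
  have p: "poly (?p m) z = (LINT \<omega>|M. (y \<omega> + z * x \<omega>) ^ m)" for m z
    using poly_shift_poly[OF all_moments_const L_moments[OF assms(1)] L_moments[OF assms(2)], of 1 m z] by simp
  have "poly (?p (m + 1)) z = poly (Polynomial.smult (of_real (gauss_moment (m + 1))) (?p 2 ^ ?l)) z" for z
    unfolding poly_smult poly_power p by (rule L_gauss[OF L_axpy[OF assms]])
  then have e: "?p (m + 1) = Polynomial.smult (of_real (gauss_moment (m + 1))) (?p 2 ^ ?l)"
    by (subst poly_eq_poly_eq_iff[symmetric]) (rule ext)
  have c1: "coeff q 1 = poly (pderiv q) 0" "coeff q 0 = poly q 0" for q :: "complex poly"
    by (simp_all add: poly_0_coeff_0 coeff_pderiv)
  have "coeff (?p (m + 1)) 1 = of_real (gauss_moment (m + 1)) * (of_nat ?l * coeff (?p 2) 0 ^ (?l - 1) * coeff (?p 2) 1)"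
    unfolding e c1 by (simp add: pderiv_smult pderiv_power)
  then have "of_nat (m + 1) * (LINT \<omega>|M. x \<omega> * y \<omega> ^ m)
     = of_real (gauss_moment (m + 1)) * (of_nat ?l * (LINT \<omega>|M. y \<omega> ^ 2) ^ (?l - 1) * (2 * (LINT \<omega>|M. x \<omega> * y \<omega>)))"
    unfolding coeff_shift_poly by simp
  also have "\<dots> = of_nat (m + 1) * (of_nat m * (LINT \<omega>|M. x \<omega> * y \<omega>) * (LINT \<omega>|M. y \<omega> ^ (m - 1)))"
  proof (cases "odd m")
    case True
    then obtain k where m: "m = 2 * k + 1" by (elim oddE)
    have l: "?l = k + 1" "m - 1 = 2 * k" unfolding m by simp_all
    have "gauss_moment (m + 1) = real m * gauss_moment (2 * k)" unfolding m by simp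
    moreover have "(LINT \<omega>|M. y \<omega> ^ (2 * k)) = of_real (gauss_moment (2 * k)) * (LINT \<omega>|M. y \<omega> ^ 2) ^ k"
      using L_gauss[OF assms(2), of "2 * k"] by simp
    ultimately show ?thesis unfolding l by (simp add: m algebra_simps)
  next
    case False
    then have "m = 0 \<or> odd (m - 1)" by (cases m) auto
    then show ?thesis unfolding L_gauss[OF assms(2), of "m - 1"] using False by (auto simp: gauss_moment_odd)
  qed
  finally show ?thesis by (rule mult_left_cancel[THEN iffD1, rotated]) (metis Suc_eq_plus1 of_nat_neq_0)
qed

text \<open>Polarization of \<open>stein\<close>, one factor at a time: the coefficient of \<open>z\<close> after replacing \<open>w\<close> by
\<open>w + z y\<^sub>a\<close> turns one of the factors \<open>w\<close> into the new factor \<open>y\<^sub>a\<close>.\<close>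

lemma stein_prod:
  assumes "finite A" "x \<in> L" "\<And>j. j \<in> A \<Longrightarrow> y j \<in> L" "w \<in> L"
  shows "(LINT \<omega>|M. (x \<omega> * (\<Prod>j\<in>A. y j \<omega>)) * w \<omega> ^ m)
    = of_nat m * (LINT \<omega>|M. x \<omega> * w \<omega>) * (LINT \<omega>|M. (\<Prod>j\<in>A. y j \<omega>) * w \<omega> ^ (m - 1))
      + (\<Sum>j\<in>A. (LINT \<omega>|M. x \<omega> * y j \<omega>) * (LINT \<omega>|M. (\<Prod>i\<in>A - {j}. y i \<omega>) * w \<omega> ^ m))"
  using assms(1,3,4)
proof (induction A arbitrary: w m rule: finite_induct)
  case empty
  then show ?case using stein[OF assms(2), of w m] by simp
next
  case (insert a A)
  let ?P = "\<lambda>B \<omega>. \<Prod>j\<in>B. y j \<omega>"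
  have am: "all_moments M x" "all_moments M w" "all_moments M (y a)" "\<And>B. B \<subseteq> A \<Longrightarrow> all_moments M (?P B)"
    using L_moments assms(2) insert.prems by (auto intro!: all_moments_prod)
  have xw: "poly (shift_poly x (y a) w 1) z = (LINT \<omega>|M. x \<omega> * (w \<omega> + z * y a \<omega>))" for z
    using poly_shift_poly[OF am(1,3,2), of 1 z] by simp
  let ?l = "shift_poly (\<lambda>\<omega>. x \<omega> * ?P A \<omega>) (y a) w (m + 1)"
  let ?r = "Polynomial.smult (of_nat (m + 1)) (shift_poly x (y a) w 1 * shift_poly (?P A) (y a) w m)
     + (\<Sum>j\<in>A. Polynomial.smult (LINT \<omega>|M. x \<omega> * y j \<omega>) (shift_poly (?P (A - {j})) (y a) w (m + 1)))"
  have "poly ?l z = poly ?r z" for z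
  proof -
    have "(\<lambda>\<omega>. w \<omega> + z * y a \<omega>) \<in> L" using insert.prems by (intro L_axpy) auto
    from insert.IH[OF _ this, of "m + 1"] insert.prems(1)
    show ?thesis
      unfolding poly_add poly_smult poly_mult poly_sum xw
      by (simp add: poly_shift_poly am all_moments_mult del: power_Suc)
  qed
  then have e: "?l = ?r" by (subst poly_eq_poly_eq_iff[symmetric]) (rule ext)
  have cm: "coeff (p * q) 1 = coeff p 0 * coeff q 1 + coeff p 1 * coeff q 0" for p q :: "complex poly"
    by (simp add: coeff_mult)
  have fin: "finite A" "a \<notin> A" using insert.hyps by auto
  have "coeff ?l 1 = coeff ?r 1" using e by simp
  then have "of_nat (m + 1) * (LINT \<omega>|M. x \<omega> * ?P A \<omega> * (y a \<omega> * w \<omega> ^ m)) =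
      of_nat (m + 1) * ((LINT \<omega>|M. x \<omega> * w \<omega>) * (of_nat m * (LINT \<omega>|M. ?P A \<omega> * (y a \<omega> * w \<omega> ^ (m - 1)))) + (LINT \<omega>|M. x \<omega> * y a \<omega>) * (LINT \<omega>|M. ?P A \<omega> * w \<omega> ^ m))
      + (\<Sum>j\<in>A. (LINT \<omega>|M. x \<omega> * y j \<omega>) * (of_nat (m + 1) * (LINT \<omega>|M. ?P (A - {j}) \<omega> * (y a \<omega> * w \<omega> ^ m))))"
    unfolding coeff_add coeff_smult coeff_sum cm coeff_shift_poly by simp
  also have "\<dots> = of_nat (m + 1) * (((LINT \<omega>|M. x \<omega> * w \<omega>) * (of_nat m * (LINT \<omega>|M. ?P A \<omega> * (y a \<omega> * w \<omega> ^ (m - 1)))) + (LINT \<omega>|M. x \<omega> * y a \<omega>) * (LINT \<omega>|M. ?P A \<omega> * w \<omega> ^ m))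
      + (\<Sum>j\<in>A. (LINT \<omega>|M. x \<omega> * y j \<omega>) * ((LINT \<omega>|M. ?P (A - {j}) \<omega> * (y a \<omega> * w \<omega> ^ m)))))"
    unfolding distrib_left[of _ _ "sum _ _"] sum_distrib_left by (simp only: mult.left_commute)
  finally have k: "(LINT \<omega>|M. x \<omega> * ?P A \<omega> * (y a \<omega> * w \<omega> ^ m)) = ((LINT \<omega>|M. x \<omega> * w \<omega>) * (of_nat m * (LINT \<omega>|M. ?P A \<omega> * (y a \<omega> * w \<omega> ^ (m - 1)))) + (LINT \<omega>|M. x \<omega> * y a \<omega>) * (LINT \<omega>|M. ?P A \<omega> * w \<omega> ^ m))
      + (\<Sum>j\<in>A. (LINT \<omega>|M. x \<omega> * y j \<omega>) * ((LINT \<omega>|M. ?P (A - {j}) \<omega> * (y a \<omega> * w \<omega> ^ m))))"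
    by (rule mult_left_cancel[THEN iffD1, rotated]) (metis Suc_eq_plus1 of_nat_neq_0)
  have ins: "?P (insert a A - {j}) \<omega> = y a \<omega> * ?P (A - {j}) \<omega>" if "j \<in> A" for j \<omega>
  proof -
    have "insert a A - {j} = insert a (A - {j})" using that fin(2) by auto
    then show ?thesis using fin by simp
  qed
  have "insert a A - {a} = A" using fin by auto
  then show ?case
    unfolding sum.insert[OF fin] prod.insert[OF fin]
    using k by (simp add: ins mult_ac cong: sum.cong)
qed

end

section \<open>Traces of powers and eigenvalues\<close>

lemma sum_PiE_insert:
  assumes "x \<notin> S"
  shows "(\<Sum>f\<in>PiE (insert x S) T. F f) = (\<Sum>g\<in>PiE S T. \<Sum>y\<in>T x. F (g(x := y)))"
proof -
  have "(\<Sum>f\<in>PiE (insert x S) T. F f) = (\<Sum>(y, g)\<in>T x \<times> PiE S T. F (g(x := y)))"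
    unfolding PiE_insert_eq by (subst sum.reindex[OF inj_combinator[OF assms]]) (simp add: case_prod_unfold)
  also have "\<dots> = (\<Sum>g\<in>PiE S T. \<Sum>y\<in>T x. F (g(x := y)))"
    unfolding sum.cartesian_product[symmetric] by (rule sum.swap)
  finally show ?thesis .
qed

text \<open>Matrix powers sum over walks: \<open>f a\<close> is the position after \<open>a\<close> steps.\<close>

lemma pow_mat_entry:
  fixes A :: "'a::comm_semiring_1 mat"
  assumes A: "A \<in> carrier_mat n n"
  shows "i < n \<Longrightarrow> j < n \<Longrightarrow> (A ^\<^sub>m m) $$ (i, j) =
    (\<Sum>f\<in>{0..m} \<rightarrow>\<^sub>E {..<n}. if f 0 = i \<and> f m = j then \<Prod>a\<in>{1..m}. A $$ (f (a - 1), f a) else 0)"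
proof (induction m arbitrary: j)
  case 0
  have c: "dim_row A = n" using A by simp
  have e: "{0..0} = insert 0 ({} :: nat set)" "{1..0} = ({} :: nat set)" by auto
  have "(\<Sum>f\<in>{0..0::nat} \<rightarrow>\<^sub>E {..<n}. if f 0 = i \<and> f 0 = j then \<Prod>a\<in>{1..0}. A $$ (f (a - 1), f a) else 0)
      = (\<Sum>f\<in>PiE (insert 0 {}) (\<lambda>_. {..<n}). if f 0 = i \<and> f (0::nat) = j then 1 else 0 :: 'a)"
    unfolding e prod.empty ..
  also have "\<dots> = (\<Sum>y<n. if y = i \<and> y = j then 1 else 0)"
    by (subst sum_PiE_insert) simp_all
  also have "\<dots> = (\<Sum>y<n. if y = i then (if i = j then 1 else 0) else 0)"
    by (rule sum.cong) auto
  also have "\<dots> = (if i = j then 1 else 0)" using 0(1) by simp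
  finally show ?case using 0 c by simp
next
  case (Suc m)
  let ?W = "\<lambda>m f. \<Prod>a\<in>{1..m}. A $$ (f (a - 1), f a)"
  have P: "A ^\<^sub>m m \<in> carrier_mat n n" by (rule pow_carrier_mat[OF A])
  have ins: "{0..Suc m} = insert (Suc m) {0..m}" "{1..Suc m} = insert (Suc m) {1..m}" by auto
  have "(A ^\<^sub>m Suc m) $$ (i, j) = (\<Sum>k<n. (A ^\<^sub>m m) $$ (i, k) * A $$ (k, j))"
    using P A Suc.prems by (simp add: scalar_prod_def lessThan_atLeast0)
  also have "\<dots> = (\<Sum>k<n. \<Sum>f\<in>{0..m} \<rightarrow>\<^sub>E {..<n}. if f 0 = i \<and> f m = k then ?W m f * A $$ (k, j) else 0)"
    unfolding sum_distrib_right[symmetric] if_distrib[of "\<lambda>x. x * _", symmetric]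
  proof (rule sum.cong[OF refl])
    fix k assume "k \<in> {..<n}"
    then have k: "k < n" by simp
    show "(A ^\<^sub>m m) $$ (i, k) * A $$ (k, j) = (\<Sum>f\<in>{0..m} \<rightarrow>\<^sub>E {..<n}. if f 0 = i \<and> f m = k then ?W m f * A $$ (k, j) else 0)"
      unfolding Suc.IH[OF Suc.prems(1) k] sum_distrib_right by (rule sum.cong) auto
  qed
  also have "\<dots> = (\<Sum>f\<in>{0..m} \<rightarrow>\<^sub>E {..<n}. \<Sum>k<n. if k = f m then (if f 0 = i then ?W m f * A $$ (f m, j) else 0) else 0)"
    by (subst sum.swap) (intro sum.cong refl, auto)
  also have "\<dots> = (\<Sum>f\<in>{0..m} \<rightarrow>\<^sub>E {..<n}. if f 0 = i then ?W m f * A $$ (f m, j) else 0)"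
  proof (rule sum.cong[OF refl])
    fix f assume "f \<in> {0..m} \<rightarrow>\<^sub>E {..<n}"
    then have "f m < n" using PiE_mem[of f "{0..m}" "\<lambda>_. {..<n}" m] by simp
    then show "(\<Sum>k<n. if k = f m then (if f 0 = i then ?W m f * A $$ (f m, j) else 0) else 0)
      = (if f 0 = i then ?W m f * A $$ (f m, j) else 0)" by simp
  qed
  also have "\<dots> = (\<Sum>f\<in>{0..m} \<rightarrow>\<^sub>E {..<n}. \<Sum>y<n. if y = j then (if f 0 = i then ?W m f * A $$ (f m, y) else 0) else 0)"
    using Suc.prems(2) by (intro sum.cong refl) simp
  also have "\<dots> = (\<Sum>g\<in>{0..m} \<rightarrow>\<^sub>E {..<n}. \<Sum>y<n. (\<lambda>f. if f 0 = i \<and> f (Suc m) = j then ?W (Suc m) f else 0) (g(Suc m := y)))"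
  proof (intro sum.cong refl)
    fix g y
    have "?W m (g(Suc m := y)) = ?W m g" by (rule prod.cong) auto
    then show "(if y = j then (if g 0 = i then ?W m g * A $$ (g m, y) else 0) else 0)
       = (\<lambda>f. if f 0 = i \<and> f (Suc m) = j then ?W (Suc m) f else 0) (g(Suc m := y))"
      unfolding ins(2) by (auto simp: mult.commute)
  qed
  also have "\<dots> = (\<Sum>f\<in>{0..Suc m} \<rightarrow>\<^sub>E {..<n}. if f 0 = i \<and> f (Suc m) = j then ?W (Suc m) f else 0)"
    unfolding ins(1) by (subst sum_PiE_insert) simp_all
  finally show ?case .
qed

definition mat_trace :: "'a::comm_monoid_add mat \<Rightarrow> 'a" where
  "mat_trace A = (\<Sum>i<dim_row A. A $$ (i, i))"

lemma trace_pow: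
  fixes A :: "'a::comm_semiring_1 mat"
  assumes A: "A \<in> carrier_mat n n"
  shows "mat_trace (A ^\<^sub>m m) = (\<Sum>f | f \<in> {0..m} \<rightarrow>\<^sub>E {..<n} \<and> f 0 = f m. \<Prod>a\<in>{1..m}. A $$ (f (a - 1), f a))"
proof -
  let ?W = "\<lambda>f. \<Prod>a\<in>{1..m}. A $$ (f (a - 1), f a)"
  have "dim_row (A ^\<^sub>m m) = n" using pow_carrier_mat[OF A, of m] by (rule carrier_matD(1))
  then have "mat_trace (A ^\<^sub>m m) = (\<Sum>i<n. \<Sum>f\<in>{0..m} \<rightarrow>\<^sub>E {..<n}. if f 0 = i \<and> f m = i then ?W f else 0)"
    unfolding mat_trace_def by (simp add: pow_mat_entry[OF A])
  also have "\<dots> = (\<Sum>f\<in>{0..m} \<rightarrow>\<^sub>E {..<n}. \<Sum>i<n. if i = f 0 then (if f 0 = f m then ?W f else 0) else 0)"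
    by (subst sum.swap) (intro sum.cong refl, auto)
  also have "\<dots> = (\<Sum>f\<in>{0..m} \<rightarrow>\<^sub>E {..<n}. if f 0 = f m then ?W f else 0)"
  proof (rule sum.cong[OF refl])
    fix f assume "f \<in> {0..m} \<rightarrow>\<^sub>E {..<n}"
    then have "f 0 < n" using PiE_mem[of f "{0..m}" "\<lambda>_. {..<n}" 0] by simp
    then show "(\<Sum>i<n. if i = f 0 then (if f 0 = f m then ?W f else 0) else 0) = (if f 0 = f m then ?W f else 0)" by simp
  qed
  also have "\<dots> = (\<Sum>f\<in>{f. f \<in> {0..m} \<rightarrow>\<^sub>E {..<n} \<and> f 0 = f m}. ?W f)"
    by (rule sum.mono_neutral_cong_right) (auto intro: finite_PiE)
  finally show ?thesis .
qed

lemma mat_trace_comm: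
  fixes A B :: "'a::comm_semiring_1 mat"
  assumes "A \<in> carrier_mat n n" "B \<in> carrier_mat n n"
  shows "mat_trace (A * B) = mat_trace (B * A)"
proof -
  have "mat_trace (A * B) = (\<Sum>i<n. \<Sum>k<n. A $$ (i, k) * B $$ (k, i))"
    using assms by (simp add: mat_trace_def scalar_prod_def lessThan_atLeast0)
  also have "\<dots> = (\<Sum>k<n. \<Sum>i<n. B $$ (k, i) * A $$ (i, k))"
    by (subst sum.swap) (simp add: mult.commute)
  also have "\<dots> = mat_trace (B * A)"
    using assms by (simp add: mat_trace_def scalar_prod_def lessThan_atLeast0)
  finally show ?thesis .
qed

lemma upper_triangular_pow:
  fixes B :: "'a::comm_semiring_1 mat"
  assumes B: "B \<in> carrier_mat n n" "upper_triangular B"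
  shows "upper_triangular (B ^\<^sub>m m) \<and> (\<forall>i<n. (B ^\<^sub>m m) $$ (i, i) = B $$ (i, i) ^ m)"
proof (induction m)
  case 0
  then show ?case using B by auto
next
  case (Suc m)
  have P: "B ^\<^sub>m m \<in> carrier_mat n n" by (rule pow_carrier_mat[OF B(1)])
  have u: "(B ^\<^sub>m m) $$ (i, k) = 0" if "k < i" "i < n" for i k
    using Suc that P by (auto simp: upper_triangular_def)
  have v: "B $$ (i, k) = 0" if "k < i" "i < n" for i k
    using B that by (auto simp: upper_triangular_def)
  have e: "(B ^\<^sub>m Suc m) $$ (i, j) = (\<Sum>k<n. (B ^\<^sub>m m) $$ (i, k) * B $$ (k, j))" if "i < n" "j < n" for i j
    using P B(1) that by (simp add: scalar_prod_def lessThan_atLeast0)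
  show ?case
  proof (intro conjI allI impI upper_triangularI)
    fix i j assume ji: "j < i" "i < dim_row (B ^\<^sub>m Suc m)"
    then have "i < n" using B(1) by simp
    have "(B ^\<^sub>m m) $$ (i, k) * B $$ (k, j) = 0" if "k < n" for k
      using u[of k i] v[of j k] \<open>i < n\<close> that ji(1) by (cases "k < i") auto
    then show "(B ^\<^sub>m Suc m) $$ (i, j) = 0" using e[of i j] ji(1) \<open>i < n\<close> by simp
  next
    fix i assume i: "i < n"
    have "(B ^\<^sub>m m) $$ (i, k) * B $$ (k, i) = (if k = i then B $$ (i, i) ^ Suc m else 0)" if "k < n" for k
      using u[of k i] v[of i k] Suc i that by (cases k i rule: linorder_cases) (auto simp: mult.commute)
    then show "(B ^\<^sub>m Suc m) $$ (i, i) = B $$ (i, i) ^ Suc m" using e[of i i] i by simp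
  qed
qed

text \<open>The Schur decomposition makes the matrix triangular with the roots of the characteristic polynomial on
the diagonal.\<close>

lemma trace_pow_eigenvalues:
  fixes A :: "complex mat"
  assumes A: "A \<in> carrier_mat n n" and es: "char_poly A = (\<Prod>e\<leftarrow>es. [:- e, 1:])"
  shows "mat_trace (A ^\<^sub>m m) = (\<Sum>e\<leftarrow>es. e ^ m)"
proof -
  obtain B P Q where sd: "schur_decomposition A es = (B, P, Q)" by (cases "schur_decomposition A es") auto
  note S = schur_decomposition[OF A es sd]
  have B: "upper_triangular B" "diag_mat B = es" "similar_mat_wit A B P Q" using S by auto
  note W = similar_mat_witD2[OF A B(3)]
  have "similar_mat_wit (A ^\<^sub>m m) (B ^\<^sub>m m) P Q" by (rule similar_mat_wit_pow[OF B(3)])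
  from similar_mat_witD2[OF pow_carrier_mat[OF A] this]
  have c: "A ^\<^sub>m m = P * (B ^\<^sub>m m) * Q" "B ^\<^sub>m m \<in> carrier_mat n n" by auto
  have "mat_trace (A ^\<^sub>m m) = mat_trace (Q * (P * (B ^\<^sub>m m)))"
    unfolding c(1) by (rule mat_trace_comm[of _ n]) (use W c in auto)
  also have "Q * (P * (B ^\<^sub>m m)) = (Q * P) * (B ^\<^sub>m m)"
    by (rule assoc_mult_mat[symmetric, of _ n n _ n _ n]) (use W c in auto)
  also have "\<dots> = B ^\<^sub>m m" unfolding W(2) using c(2) by (rule left_mult_one_mat)
  also have "mat_trace (B ^\<^sub>m m) = (\<Sum>i<n. B $$ (i, i) ^ m)"
    using upper_triangular_pow[OF W(5) B(1), of m] c(2) by (auto simp: mat_trace_def)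
  also have "\<dots> = (\<Sum>e\<leftarrow>diag_mat B. e ^ m)"
    using W(5) by (simp add: diag_mat_def sum_list_sum_nth lessThan_atLeast0 comp_def)
  finally show ?thesis unfolding B(2) .
qed

lemma hermitian_entry:
  assumes "(A :: complex mat) \<in> carrier_mat n n" "mat_adjoint A = A" "i < n" "j < n"
  shows "cnj (A $$ (j, i)) = A $$ (i, j)"
proof -
  have "mat_adjoint A $$ (i, j) = cnj (A $$ (j, i))"
    using assms(1,3,4) by (simp add: mat_adjoint_def mat_of_rows_def)
  then show ?thesis using assms(2) by simp
qed

lemma hermitian_eigenvalue_real:
  assumes A: "(A :: complex mat) \<in> carrier_mat n n" "mat_adjoint A = A" and e: "eigenvalue A e"
  shows "of_real (Re e) = e"
proof -
  obtain v where v: "v \<in> carrier_vec n" "v \<noteq> 0\<^sub>v n" "A *\<^sub>v v = e \<cdot>\<^sub>v v"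
    using e A(1) unfolding eigenvalue_def eigenvector_def by auto
  have Av: "(\<Sum>j<n. A $$ (i, j) * v $ j) = e * v $ i" if "i < n" for i
  proof -
    have "(A *\<^sub>v v) $ i = (\<Sum>j<n. A $$ (i, j) * v $ j)"
      using A(1) v(1) that by (simp add: scalar_prod_def lessThan_atLeast0)
    then show ?thesis unfolding v(3) using v(1) that by simp
  qed
  let ?s = "\<Sum>i<n. \<Sum>j<n. cnj (v $ i) * A $$ (i, j) * v $ j" and ?r = "\<Sum>i<n. (norm (v $ i))\<^sup>2"
  have "?s = (\<Sum>i<n. cnj (v $ i) * (\<Sum>j<n. A $$ (i, j) * v $ j))"
    by (simp only: sum_distrib_left mult.assoc)
  also have "\<dots> = (\<Sum>i<n. e * of_real ((norm (v $ i))\<^sup>2))"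
    by (rule sum.cong) (simp_all add: Av complex_norm_square del: of_real_power)
  also have "\<dots> = e * of_real ?r" by (simp only: sum_distrib_left of_real_sum)
  finally have s: "?s = e * of_real ?r" .
  have "cnj ?s = (\<Sum>i<n. \<Sum>j<n. v $ i * cnj (A $$ (i, j)) * cnj (v $ j))"
    by (simp only: cnj_sum complex_cnj_mult complex_cnj_cnj)
  also have "\<dots> = (\<Sum>i<n. \<Sum>j<n. cnj (v $ j) * A $$ (j, i) * v $ i)"
    by (intro sum.cong refl) (simp add: hermitian_entry[OF A] mult_ac)
  also have "\<dots> = ?s" by (rule sum.swap)
  finally have "cnj (e * of_real ?r) = e * of_real ?r" unfolding s .
  then have c: "cnj e * of_real ?r = e * of_real ?r" by (simp only: complex_cnj_mult complex_cnj_complex_of_real)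
  obtain i where i: "i < n" "v $ i \<noteq> 0" using v(1,2) by (metis eq_vecI carrier_vecD index_zero_vec(1,2))
  have "0 < (norm (v $ i))\<^sup>2" using i by simp
  also have "\<dots> \<le> ?r" by (rule member_le_sum) (use i in auto)
  finally have "?r \<noteq> 0" by simp
  then have "cnj e = e" using c by (simp only: mult_right_cancel of_real_eq_0_iff not_False_eq_True)
  then show ?thesis by (simp add: complex_eq_iff)
qed

lemma sum_mset_count:
  fixes g :: "'a \<Rightarrow> real"
  assumes "finite S" "set_mset A \<subseteq> S"
  shows "(\<Sum>x\<in>S. real (count A x) * g x) = (\<Sum>x\<in>#A. g x)"
  using assms(2)
proof (induction A)
  case (add a A)
  have "(\<Sum>x\<in>S. real (count (add_mset a A) x) * g x) = (\<Sum>x\<in>S. real (count A x) * g x + (if x = a then g a else 0))"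
    by (rule sum.cong) (auto simp: algebra_simps)
  then show ?case using add assms(1) by (simp add: sum.distrib)
qed simp

text \<open>All that is needed of the spectrum: the eigenvalue distribution is the uniform distribution on a list of reals whose
power sums are the traces of powers.\<close>

lemma hermitian_spectrum:
  assumes A: "(A :: complex mat) \<in> carrier_mat n n" "mat_adjoint A = A" and n: "n > 0"
  obtains ls :: "real list" where "length ls = n"
    "\<And>m. mat_trace (A ^\<^sub>m m) = of_real (\<Sum>x\<leftarrow>ls. x ^ m)"
    "\<And>f. f \<in> borel_measurable borel \<Longrightarrow> integrable (eigenvalue_distribution A) f \<and>
       (\<integral>x. f x \<partial>eigenvalue_distribution A) = (\<Sum>x\<leftarrow>ls. f x) / real n"
    "prob_space (eigenvalue_distribution A)"
proof -
  obtain es where es: "char_poly A = (\<Prod>e\<leftarrow>es. [:- e, 1:])" "length es = n"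
    using char_poly_factorized[OF A(1)] by blast
  have ne: "es \<noteq> []" using es(2) n by auto
  have pr: "proots (char_poly A) = mset es"
    unfolding es(1) 
  proof (induction es)
    case (Cons e es)
    have "proots ([:- e, 1:] * (\<Prod>e\<leftarrow>es. [:- e, 1:])) = proots [:- e, 1:] + proots (\<Prod>e\<leftarrow>es. [:- e, 1:])"
      by (rule proots_mult) (auto simp: prod_list_zero_iff)
    then show ?case using Cons by (simp del: mult_pCons_left)
  qed simp
  have real: "of_real (Re e) = e" if "e \<in> set es" for e
  proof (rule hermitian_eigenvalue_real[OF A])
    have "poly (char_poly A) e = 0" unfolding es(1) poly_prod_list prod_list_zero_iff using that by auto
    then show "eigenvalue A e" using eigenvalue_root_char_poly[OF A(1)] by simp
  qed
  let ?p = "pmf_of_multiset (mset es)"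
  have sp: "set_pmf ?p = set es" using ne by simp
  have int: "(\<integral>x. f (Re x) \<partial>measure_pmf ?p) = (\<Sum>x\<leftarrow>map Re es. f x) / real n" for f :: "real \<Rightarrow> real"
  proof -
    have "(\<integral>x. f (Re x) \<partial>measure_pmf ?p) = (\<Sum>x\<in>set es. f (Re x) * pmf ?p x)"
      by (rule integral_measure_pmf_real) (use ne in auto)
    also have "\<dots> = (\<Sum>x\<in>set es. real (count (mset es) x) * f (Re x)) / real n"
      using ne es(2) by (simp add: sum_divide_distrib mult.commute)
    also have "(\<Sum>x\<in>set es. real (count (mset es) x) * f (Re x)) = (\<Sum>x\<in>#mset es. f (Re x))"
      by (rule sum_mset_count) auto
    also have "\<dots> = (\<Sum>x\<leftarrow>map Re es. f x)" by (simp add: sum_mset_sum_list[symmetric] comp_def)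
    finally show ?thesis .
  qed
  have ed: "eigenvalue_distribution A = distr (measure_pmf ?p) borel Re"
    unfolding eigenvalue_distribution_def pr ..
  show ?thesis
  proof (rule that[of "map Re es"])
    show "length (map Re es) = n" using es(2) by simp
    fix m
    have "mat_trace (A ^\<^sub>m m) = (\<Sum>e\<leftarrow>es. e ^ m)" by (rule trace_pow_eigenvalues[OF A(1) es(1)])
    also have "\<dots> = (\<Sum>e\<leftarrow>es. of_real (Re e ^ m))"
      by (rule arg_cong[where f = sum_list], rule map_cong[OF refl]) (simp add: real)
    also have "\<dots> = of_real (\<Sum>x\<leftarrow>map Re es. x ^ m)" by (induction es) auto
    finally show "mat_trace (A ^\<^sub>m m) = of_real (\<Sum>x\<leftarrow>map Re es. x ^ m)" .
  next
    fix f :: "real \<Rightarrow> real" assume f: "f \<in> borel_measurable borel"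
    have "integrable (measure_pmf ?p) (\<lambda>x. f (Re x))"
      by (rule integrable_measure_pmf_finite) (simp add: sp)
    then show "integrable (eigenvalue_distribution A) f \<and> (\<integral>x. f x \<partial>eigenvalue_distribution A) = (\<Sum>x\<leftarrow>map Re es. f x) / real n"
      unfolding ed using int[of f] f by (simp add: integrable_distr_eq integral_distr)
  next
    show "prob_space (eigenvalue_distribution A)"
      unfolding ed by (rule prob_space.prob_space_distr[OF measure_pmf.prob_space_axioms]) simp
  qed
qed

section \<open>Trace moments of GUE matrices\<close>

lemma (in gaussian_space) wick_expectation:
  assumes "finite A" "\<And>j. j \<in> A \<Longrightarrow> y j \<in> L"
  shows "(LINT \<omega>|M. (\<Prod>j\<in>A. y j \<omega>)) = wick A (\<lambda>i j. LINT \<omega>|M. y i \<omega> * y j \<omega>)"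
  using assms
proof (induction "card A" arbitrary: A rule: less_induct)
  case less
  show ?case
  proof (cases "A = {}")
    case True
    then show ?thesis using prob_space by (simp add: wick_empty)
  next
    case False
    let ?a = "Min A"
    have a: "?a \<in> A" "\<And>b. b \<in> A \<Longrightarrow> ?a \<le> b" using False less.prems(1) by auto
    have "(LINT \<omega>|M. (\<Prod>j\<in>A. y j \<omega>)) = (LINT \<omega>|M. (y ?a \<omega> * (\<Prod>j\<in>A - {?a}. y j \<omega>)) * y ?a \<omega> ^ 0)"
      by (simp add: prod.remove[OF less.prems(1) a(1)])
    also have "\<dots> = (\<Sum>j\<in>A - {?a}. (LINT \<omega>|M. y ?a \<omega> * y j \<omega>) * (LINT \<omega>|M. (\<Prod>i\<in>A - {?a} - {j}. y i \<omega>) * y ?a \<omega> ^ 0))"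
      by (subst stein_prod) (use less.prems a(1) in auto)
    also have "\<dots> = (\<Sum>j\<in>A - {?a}. (LINT \<omega>|M. y ?a \<omega> * y j \<omega>) * wick (A - {?a, j}) (\<lambda>i j. LINT \<omega>|M. y i \<omega> * y j \<omega>))"
    proof (rule sum.cong[OF refl])
      fix j assume j: "j \<in> A - {?a}"
      have e: "A - {?a} - {j} = A - {?a, j}" by auto
      have "card (A - {?a, j}) < card A" by (rule psubset_card_mono[OF less.prems(1)]) (use a(1) in auto)
      from less.hyps[OF this] less.prems
      have "(LINT \<omega>|M. (\<Prod>i\<in>A - {?a, j}. y i \<omega>)) = wick (A - {?a, j}) (\<lambda>i j. LINT \<omega>|M. y i \<omega> * y j \<omega>)" by auto
      then show "(LINT \<omega>|M. y ?a \<omega> * y j \<omega>) * (LINT \<omega>|M. (\<Prod>i\<in>A - {?a} - {j}. y i \<omega>) * y ?a \<omega> ^ 0)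
        = (LINT \<omega>|M. y ?a \<omega> * y j \<omega>) * wick (A - {?a, j}) (\<lambda>i j. LINT \<omega>|M. y i \<omega> * y j \<omega>)"
        unfolding e by simp
    qed
    also have "\<dots> = wick A (\<lambda>i j. LINT \<omega>|M. y i \<omega> * y j \<omega>)" by (rule wick_Min[OF less.prems(1) a, symmetric])
    finally show ?thesis .
  qed
qed

text \<open>A pairing of the factors of the trace forces the indices at glued edges to coincide crosswise, which says that
the index sequence \<open>f\<close> is invariant under \<open>\<pi> \<circ> cyclic m\<close>; cyclicity \<open>f 0 = f m\<close> is the same
condition at the letter \<open>m\<close>. The invariant sequences are the colourings
counted by \<open>card_colourings\<close>.\<close>

lemma wick_trace_sum:
  fixes N m :: nat and v :: complex
  shows "(\<Sum>f | f \<in> {0..m} \<rightarrow>\<^sub>E {..<N} \<and> f 0 = f m.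
      wick {1..m} (\<lambda>a b. if f (a - 1) = f b \<and> f a = f (b - 1) then v else 0))
    = (\<Sum>\<pi>\<in>matchings {1..m}. v ^ (m div 2) * of_nat (N ^ (cyc0 {0..m} (\<pi> \<circ> cyclic m) + 1)))"
proof -
  let ?F = "{f. f \<in> {0..m} \<rightarrow>\<^sub>E {..<N} \<and> f 0 = f m}"
  have finF: "finite ?F" by (rule finite_subset[of _ "{0..m} \<rightarrow>\<^sub>E {..<N}"]) (auto intro: finite_PiE)
  have "(\<Sum>f\<in>?F. wick {1..m} (\<lambda>a b. if f (a - 1) = f b \<and> f a = f (b - 1) then v else 0))
    = (\<Sum>\<pi>\<in>matchings {1..m}. \<Sum>f\<in>?F. \<Prod>i | i \<in> {1..m} \<and> i < \<pi> i. if f (i - 1) = f (\<pi> i) \<and> f i = f (\<pi> i - 1) then v else 0)"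
    unfolding wick_def by (rule sum.swap)
  also have "\<dots> = (\<Sum>\<pi>\<in>matchings {1..m}. v ^ (m div 2) * of_nat (N ^ (cyc0 {0..m} (\<pi> \<circ> cyclic m) + 1)))"
  proof (rule sum.cong[OF refl])
    fix \<pi> assume pi: "\<pi> \<in> matchings {1..m}"
    have p: "\<pi> permutes {0..m}" by (rule permutes_subset[OF matchingsD(1)[OF pi]]) auto
    have pp: "\<pi> \<circ> cyclic m permutes {0..m}" by (rule permutes_compose[OF cyclic_permutes p])
    have p0: "\<pi> 0 = 0" using permutes_not_in[OF matchingsD(1)[OF pi], of 0] by simp
    have cd: "card {i. i \<in> {1..m} \<and> i < \<pi> i} = m div 2" using card_ascents[OF _ pi] by simp
    have iff: "(\<forall>i\<in>{i. i \<in> {1..m} \<and> i < \<pi> i}. f (i - 1) = f (\<pi> i) \<and> f i = f (\<pi> i - 1))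
        \<longleftrightarrow> (\<forall>x\<in>{0..m}. f ((\<pi> \<circ> cyclic m) x) = f x)" (is "?l \<longleftrightarrow> ?r") if f: "f 0 = f m" for f :: "nat \<Rightarrow> nat"
    proof
      assume l: ?l
      show ?r
      proof
        fix x assume x: "x \<in> {0..m}"
        show "f ((\<pi> \<circ> cyclic m) x) = f x"
        proof (cases "x = m")
          case True
          then show ?thesis using f p0 by (simp add: cyclic_def)
        next
          case False
          then have i: "x + 1 \<in> {1..m}" "cyclic m x = x + 1" using x by (auto simp: cyclic_def)
          have pi2: "\<pi> (\<pi> (x + 1)) = x + 1" "\<pi> (x + 1) \<noteq> x + 1" "\<pi> (x + 1) \<in> {1..m}"
            using matchingsD(2-4)[OF pi] i(1) by blast+
          have "f x = f (\<pi> (x + 1))"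
          proof (cases "x + 1 < \<pi> (x + 1)")
            case True
            then show ?thesis using l i(1) by (metis (mono_tags, lifting) add_diff_cancel_right' mem_Collect_eq)
          next
            case False
            then have "\<pi> (x + 1) < \<pi> (\<pi> (x + 1))" using pi2 by linarith
            then have "f (\<pi> (x + 1)) = f (\<pi> (\<pi> (x + 1)) - 1)" using l pi2(3) by blast
            then show ?thesis unfolding pi2(1) by simp
          qed
          then show ?thesis using i(2) by simp
        qed
      qed
    next
      assume r: ?r
      have k: "f (\<pi> i) = f (i - 1)" if i: "i \<in> {1..m}" for i
      proof -
        have "f ((\<pi> \<circ> cyclic m) (i - 1)) = f (i - 1)" using r i by auto
        moreover have "cyclic m (i - 1) = i" using i by (auto simp: cyclic_def)
        ultimately show ?thesis by simp
      qed
      show ?l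
      proof (rule ballI, elim CollectE conjE, rule conjI)
        fix i assume i: "i \<in> {1..m}"
        show "f (i - 1) = f (\<pi> i)" using k[OF i] ..
        have "\<pi> i \<in> {1..m}" using matchingsD(4)[OF pi] i by blast
        from k[OF this] show "f i = f (\<pi> i - 1)" unfolding matchingsD(2)[OF pi] .
      qed
    qed
    have prodv: "(\<Prod>i\<in>I. if Q i then v else 0) = (if \<forall>i\<in>I. Q i then v ^ card I else 0)" if "finite I" for I :: "nat set" and Q
      using that by (induction I rule: finite_induct) auto
    have fr: "f 0 = f m" if "\<forall>x\<in>{0..m}. f ((\<pi> \<circ> cyclic m) x) = f x" for f :: "nat \<Rightarrow> nat"
    proof -
      have "f ((\<pi> \<circ> cyclic m) m) = f m" using that by simp
      then show ?thesis using p0 by (simp add: cyclic_def)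
    qed
    have "(\<Sum>f\<in>?F. \<Prod>i | i \<in> {1..m} \<and> i < \<pi> i. if f (i - 1) = f (\<pi> i) \<and> f i = f (\<pi> i - 1) then v else 0)
      = (\<Sum>f\<in>?F. if \<forall>x\<in>{0..m}. f ((\<pi> \<circ> cyclic m) x) = f x then v ^ (m div 2) else 0)"
    proof (rule sum.cong[OF refl])
      fix f assume "f \<in> ?F"
      then have f: "f 0 = f m" by simp
      have "finite {i. i \<in> {1..m} \<and> i < \<pi> i}" by simp
      from prodv[OF this] show "(\<Prod>i | i \<in> {1..m} \<and> i < \<pi> i. if f (i - 1) = f (\<pi> i) \<and> f i = f (\<pi> i - 1) then v else 0)
         = (if \<forall>x\<in>{0..m}. f ((\<pi> \<circ> cyclic m) x) = f x then v ^ (m div 2) else 0)"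
        by (simp only: iff[OF f] cd)
    qed
    also have "\<dots> = (\<Sum>f\<in>{f \<in> {0..m} \<rightarrow>\<^sub>E {..<N}. \<forall>x\<in>{0..m}. f ((\<pi> \<circ> cyclic m) x) = f x}. v ^ (m div 2))"
      by (rule sum.mono_neutral_cong_right[OF finF]) (use fr in auto)
    also have "\<dots> = v ^ (m div 2) * of_nat (N ^ (cyc0 {0..m} (\<pi> \<circ> cyclic m) + 1))"
      unfolding sum_constant card_colourings[OF pp finite_atLeastAtMost _ finite_lessThan, simplified card_lessThan, of N]
      by (subst card_colourings[OF pp]) simp_all
    finally show "(\<Sum>f\<in>?F. \<Prod>i | i \<in> {1..m} \<and> i < \<pi> i. if f (i - 1) = f (\<pi> i) \<and> f i = f (\<pi> i - 1) then v else 0)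
      = v ^ (m div 2) * of_nat (N ^ (cyc0 {0..m} (\<pi> \<circ> cyclic m) + 1))" .
  qed
  finally show ?thesis .
qed

lemma normal_central_moment:
  assumes "\<sigma> > 0"
  shows "(\<integral>x. normal_density \<mu> \<sigma> x * (x - \<mu>) ^ m \<partial>lborel) = gauss_moment m * (\<sigma>\<^sup>2) ^ (m div 2)"
proof (cases "even m")
  case True
  then obtain k where m: "m = 2 * k" by (elim evenE)
  have "fact (2 * k) / ((2 / \<sigma>\<^sup>2) ^ k * fact k) = gauss_moment (2 * k) * (\<sigma>\<^sup>2) ^ k"
    unfolding gauss_moment_even[symmetric] using assms by (simp add: power_divide)
  then show ?thesis unfolding m by (simp add: integral_normal_moment_even[OF assms])
next
  case False
  then obtain k where m: "m = 2 * k + 1" by (elim oddE)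
  show ?thesis using integral_normal_moment_odd[OF assms, of \<mu> k] False unfolding m by (simp add: gauss_moment_odd)
qed

context prob_space
begin

lemma all_moments_real:
  "all_moments M (\<lambda>\<omega>. of_real (Y \<omega>)) \<longleftrightarrow> Y \<in> borel_measurable M \<and> (\<forall>k. integrable M (\<lambda>\<omega>. \<bar>Y \<omega>\<bar> ^ k))"
  by (simp add: all_moments_def borel_measurable_complex_iff)

lemma gaussian_moments:
  assumes "gaussian_rv M Y"
  shows "all_moments M (\<lambda>\<omega>. of_real (Y \<omega>))"
    and "(LINT \<omega>|M. Y \<omega>) = 0 \<Longrightarrow> (LINT \<omega>|M. Y \<omega> ^ m) = gauss_moment m * (LINT \<omega>|M. Y \<omega> ^ 2) ^ (m div 2)"
proof -
  obtain \<mu> \<sigma> where Y: "Y \<in> borel_measurable M"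
    and ms: "if \<sigma> = 0 then (AE \<omega> in M. Y \<omega> = \<mu>) else \<sigma> > 0 \<and> distributed M lborel Y (\<lambda>x. ennreal (normal_density \<mu> \<sigma> x))"
    using assms unfolding gaussian_rv_def by blast
  have "all_moments M (\<lambda>\<omega>. of_real (Y \<omega>)) \<and> ((LINT \<omega>|M. Y \<omega>) = 0 \<longrightarrow> (LINT \<omega>|M. Y \<omega> ^ m) = gauss_moment m * (LINT \<omega>|M. Y \<omega> ^ 2) ^ (m div 2))"
  proof (cases "\<sigma> = 0")
    case True
    then have ae: "AE \<omega> in M. Y \<omega> = \<mu>" using ms by simp
    have "integrable M (\<lambda>\<omega>. \<bar>Y \<omega>\<bar> ^ k)" for k
    proof (subst integrable_cong_AE[where g = "\<lambda>_. \<bar>\<mu>\<bar> ^ k"])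
      show "AE \<omega> in M. \<bar>Y \<omega>\<bar> ^ k = \<bar>\<mu>\<bar> ^ k" using ae by eventually_elim simp
    qed (use Y in auto)
    moreover have mom: "(LINT \<omega>|M. Y \<omega> ^ k) = \<mu> ^ k" for k
    proof -
      have "(LINT \<omega>|M. Y \<omega> ^ k) = (LINT \<omega>|M. \<mu> ^ k)"
      proof (rule integral_cong_AE)
        show "AE \<omega> in M. Y \<omega> ^ k = \<mu> ^ k" using ae by eventually_elim simp
      qed (use Y in auto)
      then show ?thesis using prob_space by simp
    qed
    moreover have "0 ^ m = gauss_moment m * (0 ^ 2) ^ (m div 2)"
      by (cases m rule: gauss_moment.cases) auto
    ultimately show ?thesis using Y mom[of 1] unfolding all_moments_real by auto
  next
    case False
    then have s: "\<sigma> > 0" and d: "distributed M lborel Y (\<lambda>x. ennreal (normal_density \<mu> \<sigma> x))" using ms by auto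
    have nn: "\<And>x. x \<in> space lborel \<Longrightarrow> 0 \<le> normal_density \<mu> \<sigma> x" by simp
    have "integrable M (\<lambda>\<omega>. \<bar>Y \<omega> - \<mu>\<bar> ^ k)" for k
    proof -
      have "integrable lborel (\<lambda>x. normal_density \<mu> \<sigma> x * (x - \<mu>) ^ k)" by (rule integrable_normal_moment[OF s])
      then have "integrable lborel (\<lambda>x. norm (normal_density \<mu> \<sigma> x * (x - \<mu>) ^ k))" by (rule integrable_norm)
      then have "integrable lborel (\<lambda>x. normal_density \<mu> \<sigma> x * \<bar>x - \<mu>\<bar> ^ k)" by (simp add: abs_mult power_abs)
      then show ?thesis by (subst distributed_integrable[OF d, symmetric]) auto
    qed
    then have c: "all_moments M (\<lambda>\<omega>. of_real (Y \<omega> - \<mu>))" unfolding all_moments_real using Y by simp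
    have am: "all_moments M (\<lambda>\<omega>. of_real (Y \<omega>))"
      using all_moments_add[OF c all_moments_const[of "of_real \<mu>"]] by simp
    have mom: "(LINT \<omega>|M. (Y \<omega> - \<mu>) ^ k) = gauss_moment k * (\<sigma>\<^sup>2) ^ (k div 2)" for k
      by (subst distributed_integral[OF d, symmetric]) (auto simp: normal_central_moment[OF s])
    have iY: "integrable M Y"
      using all_moments_integrable[OF am] by (simp add: complex_of_real_integrable_eq)
    have "(LINT \<omega>|M. Y \<omega>) = \<mu>"
      using mom[of 1] iY prob_space by (simp add: Bochner_Integration.integral_diff)
    moreover have "(LINT \<omega>|M. Y \<omega> ^ m) = gauss_moment m * (LINT \<omega>|M. Y \<omega> ^ 2) ^ (m div 2)" if "\<mu> = 0"
      using mom[of m] mom[of 2] that by (simp add: numeral_2_eq_2)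
    ultimately show ?thesis using am by simp
  qed
  then show "all_moments M (\<lambda>\<omega>. of_real (Y \<omega>))"
    "(LINT \<omega>|M. Y \<omega>) = 0 \<Longrightarrow> (LINT \<omega>|M. Y \<omega> ^ m) = gauss_moment m * (LINT \<omega>|M. Y \<omega> ^ 2) ^ (m div 2)" by auto
qed

end

section \<open>Averaging spectral distributions\<close>

text \<open>Continuous piecewise linear functions decrease to the indicator, and by Weierstrass the \<open>k\<close>th of
them is within \<open>1/(k+1)\<close> of a polynomial on \<open>[-k, k]\<close>. Convergence is pointwise, which suffices for measures with
finite support.\<close>

lemma polynomials_to_indicator:
  fixes a :: real
  shows "\<exists>p. (\<forall>k. \<exists>c d. \<forall>x. p k x = (\<Sum>i\<le>(d::nat). c i * x ^ i)) \<and> (\<forall>x. (\<lambda>k. p k x) \<longlonglongrightarrow> indicator {..a} x)"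
proof -
  let ?f = "\<lambda>(k::nat) x. max 0 (1 - real k * max 0 (x - a))"
  have "\<exists>g. (\<exists>c d. \<forall>x. g x = (\<Sum>i\<le>(d::nat). c i * x ^ i)) \<and> (\<forall>x. \<bar>x\<bar> \<le> real k \<longrightarrow> \<bar>?f k x - g x\<bar> < inverse (real (Suc k)))" for k
  proof -
    have "continuous_on {- real k..real k} (?f k)" by (intro continuous_intros)
    from Stone_Weierstrass_real_polynomial_function[OF compact_Icc this, of "inverse (real (Suc k))"]
    obtain g where g: "real_polynomial_function g" "\<And>x. x \<in> {- real k..real k} \<Longrightarrow> \<bar>?f k x - g x\<bar> < inverse (real (Suc k))" by auto
    obtain c d where "g = (\<lambda>x. \<Sum>i\<le>(d::nat). c i * x ^ i)"
      using g(1) real_polynomial_function_iff_sum by blast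
    then show ?thesis using g(2) by (intro exI[of _ g] conjI exI[of _ c] exI[of _ d]) (simp_all add: abs_le_iff)
  qed
  then obtain p where p: "\<And>k. \<exists>c d. \<forall>x. p k x = (\<Sum>i\<le>(d::nat). c i * x ^ i)"
    "\<And>k x. \<bar>x\<bar> \<le> real k \<Longrightarrow> \<bar>?f k x - p k x\<bar> < inverse (real (Suc k))" by metis
  have "(\<lambda>k. p k x) \<longlonglongrightarrow> indicator {..a} x" for x
  proof -
    have f: "(\<lambda>k. ?f k x) \<longlonglongrightarrow> indicator {..a} x"
    proof (cases "x \<le> a")
      case True
      then show ?thesis by simp
    next
      case False
      have "eventually (\<lambda>k. ?f k x = 0) sequentially"
      proof (rule eventually_sequentiallyI)
        fix k assume k: "nat \<lceil>1 / (x - a)\<rceil> \<le> k"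
        have "1 / (x - a) \<le> real k" using k by linarith
        then show "?f k x = 0" using False by (simp add: field_simps max_def)
      qed
      then have "(\<lambda>k. ?f k x) \<longlonglongrightarrow> 0" by (rule tendsto_eventually)
      then show ?thesis using False by simp
    qed
    have "(\<lambda>k. ?f k x - p k x) \<longlonglongrightarrow> 0"
    proof (rule Lim_null_comparison[OF _ LIMSEQ_inverse_real_of_nat])
      show "eventually (\<lambda>k. norm (?f k x - p k x) \<le> inverse (real (Suc k))) sequentially"
      proof (rule eventually_sequentiallyI)
        fix k assume "nat \<lceil>\<bar>x\<bar>\<rceil> \<le> k"
        then have "\<bar>x\<bar> \<le> real k" by linarith
        from p(2)[OF this] show "norm (?f k x - p k x) \<le> inverse (real (Suc k))" by simp
      qed
    qed
    from tendsto_diff[OF f this] show ?thesis by simp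
  qed
  then show ?thesis using p(1) by blast
qed

context prob_space
begin

text \<open>The Giry bind is only meaningful for measurable kernels. Here measurability is deduced from that
of the moments: distribution functions are pointwise limits of integrals of polynomials. Since \<open>x\<^sup>m\<close> may be negative, its integral
is obtained as the difference of the integrals of \<open>x\<^sup>m + 1 + x\<^sup>2\<^sup>m\<close> and \<open>1 + x\<^sup>2\<^sup>m\<close>, which are nonnegative.\<close>

lemma bind_moments:
  fixes K :: "'a \<Rightarrow> real measure" and T :: "nat \<Rightarrow> 'a \<Rightarrow> real" and c :: real
  assumes K: "\<And>\<omega>. \<omega> \<in> space M \<Longrightarrow> prob_space (K \<omega>)" "\<And>\<omega>. \<omega> \<in> space M \<Longrightarrow> sets (K \<omega>) = sets borel"
    and ls: "\<And>\<omega>. \<omega> \<in> space M \<Longrightarrow> \<exists>ls. \<forall>f\<in>borel_measurable borel. integrable (K \<omega>) f \<and> (\<integral>x. f x \<partial>K \<omega>) = (\<Sum>x\<leftarrow>ls. f x :: real) / c"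
    and T: "\<And>\<omega> m. \<omega> \<in> space M \<Longrightarrow> (\<integral>x. x ^ m \<partial>K \<omega>) = T m \<omega>"
    and int: "\<And>m. integrable M (T m)"
  shows "integrable (M \<bind> K) (\<lambda>x. x ^ m) \<and> (\<integral>x. x ^ m \<partial>(M \<bind> K)) = (\<integral>\<omega>. T m \<omega> \<partial>M)"
proof -
  have intK: "integrable (K \<omega>) f" if "\<omega> \<in> space M" "f \<in> borel_measurable borel" for \<omega> and f :: "real \<Rightarrow> real"
    using ls[OF that(1)] that(2) by blast
  have Tm [measurable]: "T m \<in> borel_measurable M" for m by (rule borel_measurable_integrable[OF int])
  have K_meas: "K \<in> measurable M (subprob_algebra borel)"
  proof (rule measurable_subprob_algebra_generated[where G = "range atMost" and \<Omega> = UNIV])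
    show "sets borel = sigma_sets UNIV (range (atMost :: real \<Rightarrow> _))"
      unfolding borel_eq_atMost by (rule sets_measure_of) auto
    show "Int_stable (range (atMost :: real \<Rightarrow> _))"
      
    proof (rule Int_stableI)
      fix A B :: "real set" assume "A \<in> range atMost" "B \<in> range atMost"
      then obtain a b where "A = {..a}" "B = {..b}" by auto
      then have "A \<inter> B = {..min a b}" by auto
      then show "A \<inter> B \<in> range atMost" by blast
    qed
    show "range (atMost :: real \<Rightarrow> _) \<subseteq> Pow UNIV" by auto
    fix \<omega> assume w: "\<omega> \<in> space M"
    show "subprob_space (K \<omega>)" by (rule prob_space_imp_subprob_space[OF K(1)[OF w]])
    show "sets (K \<omega>) = sets borel" by (rule K(2)[OF w])
  next
    fix A :: "real set" assume "A \<in> range atMost"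
    then obtain a where A: "A = {..a}" by auto
    obtain p where p: "\<And>k. \<exists>c d. \<forall>x. p k x = (\<Sum>i\<le>(d::nat). c i * x ^ i)" "\<And>x. (\<lambda>k. p k x) \<longlonglongrightarrow> indicator {..a} x"
      using polynomials_to_indicator[of a] by blast
    have pm: "p k \<in> borel_measurable borel" for k
    proof -
      obtain c d where "p k = (\<lambda>x. \<Sum>i\<le>(d::nat). c i * x ^ i)" using p(1)[of k] by blast
      then show ?thesis by simp
    qed
    have ind: "(\<lambda>\<omega>. \<integral>x. indicat_real {..a} x \<partial>K \<omega>) \<in> borel_measurable M"
    proof (rule borel_measurable_LIMSEQ_real)
      fix \<omega> assume w: "\<omega> \<in> space M"
      obtain l where l: "\<And>f. f \<in> borel_measurable borel \<Longrightarrow> (\<integral>x. f x \<partial>K \<omega>) = (\<Sum>x\<leftarrow>l. f x) / c"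
        using ls[OF w] by blast
      have "(\<lambda>k. \<Sum>x\<leftarrow>l. p k x) \<longlonglongrightarrow> (\<Sum>x\<leftarrow>l. indicator {..a} x)"
        by (induction l) (auto intro!: tendsto_add p(2))
      then have "(\<lambda>k. (\<Sum>x\<leftarrow>l. p k x) / c) \<longlonglongrightarrow> (\<Sum>x\<leftarrow>l. indicator {..a} x) / c"
        unfolding divide_inverse by (rule tendsto_mult_right)
      moreover have "(\<integral>x. p k x \<partial>K \<omega>) = (\<Sum>x\<leftarrow>l. p k x) / c" for k by (rule l[OF pm])
      moreover have "(\<integral>x. indicat_real {..a} x \<partial>K \<omega>) = (\<Sum>x\<leftarrow>l. indicator {..a} x) / c" by (rule l) simp
      ultimately show "(\<lambda>k. \<integral>x. p k x \<partial>K \<omega>) \<longlonglongrightarrow> (\<integral>x. indicat_real {..a} x \<partial>K \<omega>)" by simp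
    next
      fix k
      obtain e d where e: "p k = (\<lambda>x. \<Sum>i\<le>(d::nat). e i * x ^ i)" using p(1)[of k] by blast
      have e1: "(\<integral>x. p k x \<partial>K \<omega>) = (\<Sum>i\<le>d. e i * T i \<omega>)" if w: "\<omega> \<in> space M" for \<omega>
        unfolding e by (subst Bochner_Integration.integral_sum) (auto intro!: intK[OF w] simp: T[OF w])
      have e2: "(\<lambda>\<omega>. \<Sum>i\<le>d. e i * T i \<omega>) \<in> borel_measurable M" by measurable
      show "(\<lambda>\<omega>. \<integral>x. p k x \<partial>K \<omega>) \<in> borel_measurable M"
        by (rule iffD2[OF measurable_cong], erule e1, rule e2)
    qed
    have em: "emeasure (K \<omega>) A = ennreal (\<integral>x. indicat_real {..a} x \<partial>K \<omega>)" if w: "\<omega> \<in> space M" for \<omega>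
    proof -
      interpret Kw: prob_space "K \<omega>" by (rule K(1)[OF w])
      have "{..a} \<in> sets (K \<omega>)" using K(2)[OF w] by simp
      then show ?thesis unfolding A Kw.emeasure_eq_measure by simp
    qed
    show "(\<lambda>\<omega>. emeasure (K \<omega>) A) \<in> borel_measurable M"
      by (rule iffD2[OF measurable_cong], erule em, rule measurable_compose[OF ind measurable_ennreal])
  next
    have em: "emeasure (K \<omega>) UNIV = 1" if w: "\<omega> \<in> space M" for \<omega>
    proof -
      have "space (K \<omega>) = UNIV" using sets_eq_imp_space_eq[OF K(2)[OF w]] by simp
      then show ?thesis using prob_space.emeasure_space_1[OF K(1)[OF w]] by simp
    qed
    show "(\<lambda>\<omega>. emeasure (K \<omega>) UNIV) \<in> borel_measurable M"
      by (rule iffD2[OF measurable_cong], erule em, rule measurable_const) simp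
  qed
  have sB: "sets (M \<bind> K) = sets borel" by (rule sets_bind) (use K(2) not_empty in auto)
  have pos: "has_bochner_integral (M \<bind> K) g (\<integral>\<omega>. G \<omega> \<partial>M)"
    if g: "\<And>x. 0 \<le> g x" "g \<in> borel_measurable borel" and G: "integrable M G" "\<And>\<omega>. \<omega> \<in> space M \<Longrightarrow> (\<integral>x. g x \<partial>K \<omega>) = G \<omega>" for g :: "real \<Rightarrow> real" and G
  proof (rule has_bochner_integral_nn_integral)
    have Gp: "0 \<le> G \<omega>" if "\<omega> \<in> space M" for \<omega> unfolding G(2)[OF that, symmetric] by (rule Bochner_Integration.integral_nonneg[OF g(1)])
    show "g \<in> borel_measurable (M \<bind> K)" using g(2) measurable_cong_sets[OF sB refl] by blast
    show "0 \<le> (\<integral>\<omega>. G \<omega> \<partial>M)" using Gp by (intro integral_nonneg_AE AE_I2)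
    have "(\<integral>\<^sup>+x. ennreal (g x) \<partial>(M \<bind> K)) = (\<integral>\<^sup>+\<omega>. \<integral>\<^sup>+x. ennreal (g x) \<partial>K \<omega> \<partial>M)"
      by (rule nn_integral_bind[OF _ K_meas]) (use g(2) in simp)
    also have "\<dots> = (\<integral>\<^sup>+\<omega>. ennreal (G \<omega>) \<partial>M)"
    proof (rule nn_integral_cong)
      fix \<omega> assume w: "\<omega> \<in> space M"
      show "(\<integral>\<^sup>+x. ennreal (g x) \<partial>K \<omega>) = ennreal (G \<omega>)"
        unfolding G(2)[OF w, symmetric] by (rule nn_integral_eq_integral[OF intK[OF w g(2)]]) (simp add: g(1))
    qed
    also have "\<dots> = ennreal (\<integral>\<omega>. G \<omega> \<partial>M)"
      by (rule nn_integral_eq_integral[OF G(1)]) (use Gp in \<open>intro AE_I2\<close>)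
    finally show "(\<integral>\<^sup>+x. ennreal (g x) \<partial>(M \<bind> K)) = ennreal (\<integral>\<omega>. G \<omega> \<partial>M)" .
  qed (simp add: g(1))
  let ?G = "\<lambda>\<omega>. 1 + T (2 * m) \<omega>"
  have iK: "integrable (K \<omega>) (\<lambda>x. x ^ k)" if "\<omega> \<in> space M" for \<omega> k by (rule intK[OF that]) simp
  have cK: "integrable (K \<omega>) (\<lambda>x. 1 :: real)" if "\<omega> \<in> space M" for \<omega> by (rule intK[OF that]) simp
  have oK: "(\<integral>x. 1 \<partial>K \<omega>) = (1::real)" if "\<omega> \<in> space M" for \<omega> using prob_space.prob_space[OF K(1)[OF that]] by simp
  have h1: "has_bochner_integral (M \<bind> K) (\<lambda>x. 1 + x ^ (2 * m)) (\<integral>\<omega>. ?G \<omega> \<partial>M)"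
  proof (rule pos)
    fix \<omega> assume w: "\<omega> \<in> space M"
    show "(\<integral>x. 1 + x ^ (2 * m) \<partial>K \<omega>) = ?G \<omega>"
      using Bochner_Integration.integral_add[OF cK[OF w] iK[OF w, of "2 * m"]] unfolding T[OF w] oK[OF w] .
  qed (use int in auto)
  have h2: "has_bochner_integral (M \<bind> K) (\<lambda>x. x ^ m + (1 + x ^ (2 * m))) (\<integral>\<omega>. T m \<omega> + ?G \<omega> \<partial>M)"
  proof (rule pos)
    fix x :: real
    \<comment> \<open>This is twice the claimed expression.\<close>
    have "0 \<le> (x ^ m + 1)\<^sup>2 + (x ^ m)\<^sup>2 + 1" by (intro add_nonneg_nonneg) auto
    then show "0 \<le> x ^ m + (1 + x ^ (2 * m))" unfolding power2_sum by (simp add: power_even_eq)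
  next
    fix \<omega> assume w: "\<omega> \<in> space M"
    show "(\<integral>x. x ^ m + (1 + x ^ (2 * m)) \<partial>K \<omega>) = T m \<omega> + ?G \<omega>"
      using Bochner_Integration.integral_add[OF iK[OF w, of m] Bochner_Integration.integrable_add[OF cK[OF w] iK[OF w, of "2 * m"]]]
        Bochner_Integration.integral_add[OF cK[OF w] iK[OF w, of "2 * m"]] unfolding T[OF w] oK[OF w] by simp
  qed (use int in auto)
  have "has_bochner_integral (M \<bind> K) (\<lambda>x. x ^ m) ((\<integral>\<omega>. T m \<omega> + ?G \<omega> \<partial>M) - (\<integral>\<omega>. ?G \<omega> \<partial>M))"
    using has_bochner_integral_diff[OF h2 h1] by simp
  moreover have "(\<integral>\<omega>. T m \<omega> + ?G \<omega> \<partial>M) - (\<integral>\<omega>. ?G \<omega> \<partial>M) = (\<integral>\<omega>. T m \<omega> \<partial>M)"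
    using int by (subst Bochner_Integration.integral_add) auto
  ultimately show ?thesis by (simp add: has_bochner_integral_iff)
qed

end

section \<open>The moments of the average eigenvalue distribution\<close>

lemma sum_delta2:
  fixes F G :: "nat \<Rightarrow> nat \<Rightarrow> real"
  assumes "i < n" "j < n"
  shows "(\<Sum>a<n. \<Sum>b<n. (if a = i \<and> b = j then 1 else 0) * F a b + 0 * G a b) = F i j"
proof -
  have "(\<Sum>a<n. \<Sum>b<n. (if a = i \<and> b = j then 1 else 0) * F a b + 0 * G a b) = (\<Sum>a<n. if a = i then F i j else 0)"
  proof (rule sum.cong[OF refl])
    fix a
    have "(\<Sum>b<n. (if a = i \<and> b = j then 1 else 0) * F a b + 0 * G a b) = (\<Sum>b<n. if b = j then (if a = i then F i j else 0) else 0)"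
      by (rule sum.cong) auto
    then show "(\<Sum>b<n. (if a = i \<and> b = j then 1 else 0) * F a b + 0 * G a b) = (if a = i then F i j else 0)"
      using assms(2) by simp
  qed
  then show ?thesis using assms(1) by simp
qed

lemma wick_cong:
  assumes "\<And>i j. i \<in> A \<Longrightarrow> j \<in> A \<Longrightarrow> c i j = d i j"
  shows "wick A c = wick A d"
  unfolding wick_def by (intro sum.cong prod.cong refl) (use assms matchingsD(4) in auto)

text \<open>The real and imaginary parts of the entries span a Gaussian space, since every real linear combination of them is
Gaussian and centered. The expected traces are then computed by the Wick formula for the complex entries.\<close>

lemma gue_moments:
  fixes X :: "'w \<Rightarrow> complex mat"
  assumes gue: "is_GUE N v P X" and N: "N \<ge> 1"
  shows "integrable (average_eigenvalue_distribution P X) (\<lambda>x. x ^ m) \<and>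
    (\<integral>x. x ^ m \<partial>average_eigenvalue_distribution P X)
      = (\<Sum>\<pi>\<in>matchings {1..m}. (v / real N) ^ (m div 2) * real N ^ cyc0 {0..m} (\<pi> \<circ> cyclic m))"
proof -
  interpret prob_space P using gue by (simp add: is_GUE_def)
  let ?e = "\<lambda>i j \<omega>. X \<omega> $$ (i, j)"
  have herm: "X \<omega> \<in> carrier_mat N N" "mat_adjoint (X \<omega>) = X \<omega>" if "\<omega> \<in> space P" for \<omega>
    using gue that by (auto simp: is_GUE_def)
  have E0: "(LINT \<omega>|P. ?e i j \<omega>) = 0" if "i < N" "j < N" for i j
    using gue that by (simp add: is_GUE_def)
  have cov: "(LINT \<omega>|P. ?e i j \<omega> * ?e k l \<omega>) = of_real (if i = l \<and> j = k then v / real N else 0)"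
    if "i < N" "j < N" "k < N" "l < N" for i j k l
    using gue that by (simp add: is_GUE_def)
  define U where "U a b \<omega> = (\<Sum>i<N. \<Sum>j<N. a i j * Re (X \<omega> $$ (i, j)) + b i j * Im (X \<omega> $$ (i, j)))"
    for a b :: "nat \<Rightarrow> nat \<Rightarrow> real" and \<omega>
  define S where "S = {U a b | a b. True}"
  have gr: "gaussian_rv P (U a b)" for a b
    using gue unfolding is_GUE_def jointly_gaussian_entries_def U_def by blast
  define \<delta> where "\<delta> i j a b = (if a = i \<and> b = j then 1 else 0 :: real)" for i j a b :: nat
  have ReU: "U (\<delta> i j) (\<lambda>_ _. 0) = (\<lambda>\<omega>. Re (?e i j \<omega>))" if "i < N" "j < N" for i j
    unfolding U_def \<delta>_def by (rule ext, rule sum_delta2[OF that])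
  have ImU: "U (\<lambda>_ _. 0) (\<delta> i j) = (\<lambda>\<omega>. Im (?e i j \<omega>))" if "i < N" "j < N" for i j
    unfolding U_def \<delta>_def by (rule ext, subst add.commute, rule sum_delta2[OF that])
  have amU: "all_moments P (\<lambda>\<omega>. of_real (U a b \<omega>))" for a b by (rule gaussian_moments(1)[OF gr])
  have iU: "integrable P (U a b)" for a b
    using all_moments_integrable[OF amU] by (simp add: complex_of_real_integrable_eq)
  have eL: "?e i j = (\<lambda>\<omega>. of_real (Re (?e i j \<omega>)) + \<i> * of_real (Im (?e i j \<omega>)))" for i j
    by (rule ext) (rule complex_eq)
  have ame: "all_moments P (?e i j)" if "i < N" "j < N" for i j
    by (subst eL, intro all_moments_add all_moments_mult all_moments_const)
      (use amU[of "\<delta> i j" "\<lambda>_ _. 0"] amU[of "\<lambda>_ _. 0" "\<delta> i j"] in \<open>simp_all only: ReU[OF that] ImU[OF that]\<close>)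
  have ri: "integrable P (\<lambda>\<omega>. Re (?e i j \<omega>))" "integrable P (\<lambda>\<omega>. Im (?e i j \<omega>))"
    "(LINT \<omega>|P. Re (?e i j \<omega>)) = 0" "(LINT \<omega>|P. Im (?e i j \<omega>)) = 0" if "i < N" "j < N" for i j
    using all_moments_integrable[OF ame[OF that]] E0[OF that] by simp_all
  have EU: "(LINT \<omega>|P. U a b \<omega>) = 0" for a b
  proof -
    have "(LINT \<omega>|P. U a b \<omega>) = (\<Sum>i<N. \<Sum>j<N. LINT \<omega>|P. (a i j * Re (?e i j \<omega>) + b i j * Im (?e i j \<omega>)))"
      unfolding U_def by (subst Bochner_Integration.integral_sum, (intro Bochner_Integration.integrable_sum Bochner_Integration.integrable_add integrable_mult_right ri; simp),
        rule sum.cong[OF refl], subst Bochner_Integration.integral_sum) (intro Bochner_Integration.integrable_add integrable_mult_right ri refl; simp)+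
    also have "\<dots> = 0"
      by (intro sum.neutral ballI, subst Bochner_Integration.integral_add) (simp_all add: ri)
    finally show ?thesis .
  qed
  interpret gaussian_space P S
  proof
    fix u w c assume u: "u \<in> S"
    then obtain a b where ab: "u = U a b" by (auto simp: S_def)
    show "all_moments P (\<lambda>\<omega>. of_real (u \<omega>))" unfolding ab by (rule amU)
    show "(LINT \<omega>|P. u \<omega> ^ m) = gauss_moment m * (LINT \<omega>|P. u \<omega> ^ 2) ^ (m div 2)" for m
      unfolding ab by (rule gaussian_moments(2)[OF gr EU])
    have "(\<lambda>\<omega>. c * u \<omega>) = U (\<lambda>i j. c * a i j) (\<lambda>i j. c * b i j)"
      unfolding ab U_def by (simp add: sum_distrib_left algebra_simps)
    then show "(\<lambda>\<omega>. c * u \<omega>) \<in> S" by (auto simp: S_def)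
    assume "w \<in> S"
    then obtain a' b' where ab': "w = U a' b'" by (auto simp: S_def)
    have "(\<lambda>\<omega>. u \<omega> + w \<omega>) = U (\<lambda>i j. a i j + a' i j) (\<lambda>i j. b i j + b' i j)"
      unfolding ab ab' U_def by (simp only: sum.distrib distrib_right add_ac)
    then show "(\<lambda>\<omega>. u \<omega> + w \<omega>) \<in> S" by (auto simp: S_def)
  qed
  have inL: "?e i j \<in> L" if "i < N" "j < N" for i j
  proof -
    have "(\<lambda>\<omega>. Re (?e i j \<omega>)) \<in> S" "(\<lambda>\<omega>. Im (?e i j \<omega>)) \<in> S"
      unfolding S_def ReU[OF that, symmetric] ImU[OF that, symmetric] by blast+
    then show ?thesis unfolding L_def mem_Collect_eq by (intro bexI[where x = "\<lambda>\<omega>. Re (?e i j \<omega>)"] bexI[where x = "\<lambda>\<omega>. Im (?e i j \<omega>)"] eL)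
  qed
  let ?F = "\<lambda>m. {f :: nat \<Rightarrow> nat. f \<in> {0..m} \<rightarrow>\<^sub>E {..<N} \<and> f 0 = f m}"
  define Z where "Z m \<omega> = (\<Sum>f\<in>?F m. \<Prod>a\<in>{1..m}. X \<omega> $$ (f (a - 1), f a))" for m :: nat and \<omega>
  have fN: "f a < N" if "f \<in> ?F m" "a \<le> m" for f a m
    using that PiE_mem[of f "{0..m}" "\<lambda>_. {..<N}" a] by simp
  have amZ: "all_moments P (Z m)" for m
    unfolding Z_def by (intro all_moments_sum all_moments_prod ame) (use fN in auto)
  have EZ: "(LINT \<omega>|P. Z m \<omega>) = of_real (\<Sum>\<pi>\<in>matchings {1..m}. (v / real N) ^ (m div 2) * real N ^ (cyc0 {0..m} (\<pi> \<circ> cyclic m) + 1))" for m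
  proof -
    have "(LINT \<omega>|P. Z m \<omega>) = (\<Sum>f\<in>?F m. LINT \<omega>|P. (\<Prod>a\<in>{1..m}. X \<omega> $$ (f (a - 1), f a)))"
      unfolding Z_def by (rule Bochner_Integration.integral_sum) (intro all_moments_integrable all_moments_prod ame; use fN in auto)
    also have "\<dots> = (\<Sum>f\<in>?F m. wick {1..m} (\<lambda>a b. if f (a - 1) = f b \<and> f a = f (b - 1) then of_real (v / real N) else 0))"
    proof (rule sum.cong[OF refl])
      fix f assume f: "f \<in> ?F m"
      have "(LINT \<omega>|P. (\<Prod>a\<in>{1..m}. X \<omega> $$ (f (a - 1), f a)))
        = wick {1..m} (\<lambda>a b. LINT \<omega>|P. X \<omega> $$ (f (a - 1), f a) * X \<omega> $$ (f (b - 1), f b))"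
        by (rule wick_expectation) (use fN[OF f] in \<open>auto intro: inL\<close>)
      also have "\<dots> = wick {1..m} (\<lambda>a b. if f (a - 1) = f b \<and> f a = f (b - 1) then of_real (v / real N) else 0)"
        by (rule wick_cong, subst cov) (use fN[OF f] in auto)
      finally show "(LINT \<omega>|P. (\<Prod>a\<in>{1..m}. X \<omega> $$ (f (a - 1), f a))) = \<dots>" .
    qed
    finally show ?thesis unfolding wick_trace_sum by simp
  qed
  define T where "T m \<omega> = Re (Z m \<omega>) / real N" for m :: nat and \<omega>
  have iT: "integrable P (T m)" for m
    unfolding T_def using all_moments_integrable[OF amZ] by simp
  have ET: "(LINT \<omega>|P. T m \<omega>) = (\<Sum>\<pi>\<in>matchings {1..m}. (v / real N) ^ (m div 2) * real N ^ cyc0 {0..m} (\<pi> \<circ> cyclic m))" for m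
  proof -
    have "(LINT \<omega>|P. T m \<omega>) = Re (LINT \<omega>|P. Z m \<omega>) / real N"
      unfolding T_def using all_moments_integrable[OF amZ, of m] by simp
    then show ?thesis unfolding EZ Re_complex_of_real sum_divide_distrib using N by simp
  qed
  have spec: "\<exists>ls. (\<forall>f\<in>borel_measurable borel. integrable (eigenvalue_distribution (X \<omega>)) f \<and>
        (\<integral>x. f x \<partial>eigenvalue_distribution (X \<omega>)) = (\<Sum>x\<leftarrow>ls. f x) / real N)
      \<and> (\<forall>m. Z m \<omega> = of_real (\<Sum>x\<leftarrow>ls. x ^ m)) \<and> prob_space (eigenvalue_distribution (X \<omega>))"
    if w: "\<omega> \<in> space P" for \<omega>
  proof -
    obtain ls :: "real list" where ls: "length ls = N"
      "\<And>m. mat_trace (X \<omega> ^\<^sub>m m) = of_real (\<Sum>x\<leftarrow>ls. x ^ m)"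
      "\<And>f. f \<in> borel_measurable borel \<Longrightarrow> integrable (eigenvalue_distribution (X \<omega>)) f \<and>
        (\<integral>x. f x \<partial>eigenvalue_distribution (X \<omega>)) = (\<Sum>x\<leftarrow>ls. f x) / real N"
      "prob_space (eigenvalue_distribution (X \<omega>))"
      using hermitian_spectrum[OF herm[OF w]] N by (metis less_eq_Suc_le One_nat_def)
    have "Z m \<omega> = mat_trace (X \<omega> ^\<^sub>m m)" for m unfolding Z_def trace_pow[OF herm(1)[OF w]] ..
    then show ?thesis using ls by auto
  qed
  have "integrable (P \<bind> (\<lambda>\<omega>. eigenvalue_distribution (X \<omega>))) (\<lambda>x. x ^ m) \<and>
    (\<integral>x. x ^ m \<partial>(P \<bind> (\<lambda>\<omega>. eigenvalue_distribution (X \<omega>)))) = (LINT \<omega>|P. T m \<omega>)"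
  proof (rule bind_moments[where c = "real N"])
    fix \<omega> assume w: "\<omega> \<in> space P"
    show "prob_space (eigenvalue_distribution (X \<omega>))" using spec[OF w] by blast
    show "sets (eigenvalue_distribution (X \<omega>)) = sets borel" by (simp add: eigenvalue_distribution_def)
    show "\<exists>ls. \<forall>f\<in>borel_measurable borel. integrable (eigenvalue_distribution (X \<omega>)) f \<and>
        (\<integral>x. f x \<partial>eigenvalue_distribution (X \<omega>)) = (\<Sum>x\<leftarrow>ls. f x) / real N" using spec[OF w] by blast
    fix m
    obtain ls where ls: "\<forall>f\<in>borel_measurable borel. (\<integral>x. f x \<partial>eigenvalue_distribution (X \<omega>)) = (\<Sum>x\<leftarrow>ls. f x) / real N"
      "Z m \<omega> = of_real (\<Sum>x\<leftarrow>ls. x ^ m)" using spec[OF w] by blast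
    have "(\<lambda>x. x ^ m) \<in> borel_measurable (borel :: real measure)" by simp
    from bspec[OF ls(1) this] show "(\<integral>x. x ^ m \<partial>eigenvalue_distribution (X \<omega>)) = T m \<omega>"
      unfolding T_def ls(2) Re_complex_of_real .
  qed (rule iT)
  then show ?thesis unfolding average_eigenvalue_distribution_def ET .
qed

text \<open>The sign in \<open>q = -1/N\<close> disappears because the exponents are even.\<close>

lemma state_power_gue:
  assumes N: "N \<ge> 1" and q: "q = 1 / real N \<or> q = - 1 / real N"
  shows "state (tp_power q (X_poly q h) m)
    = of_real (\<Sum>\<pi>\<in>matchings {1..m}. ((norm h)\<^sup>2 / real N) ^ (m div 2) * real N ^ cyc0 {0..m} (\<pi> \<circ> cyclic m))"
proof -
  have q0: "q \<noteq> 0" using assms by auto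
  have pw: "q powi (int k - int c) = real N ^ c / real N ^ k" if "even (k + c)" for k c
  proof -
    have "q powi (int k - int c) = q ^ k / q ^ c" using q0 by (simp add: power_int_diff)
    also have "\<dots> = (1 / real N) ^ k / (1 / real N) ^ c"
    proof (cases "q = 1 / real N")
      case False
      then have "q = - (1 / real N)" using q by simp
      then have "q ^ k = (- 1) ^ k * (1 / real N) ^ k" "q ^ c = (- 1) ^ c * (1 / real N) ^ c"
        by (simp_all only: power_minus[of "1 / real N"])
      then show ?thesis using that by (auto simp: minus_one_power_iff)
    qed simp
    also have "\<dots> = real N ^ c / real N ^ k" using N by (simp add: power_one_over field_simps)
    finally show ?thesis .
  qed
  show ?thesis unfolding tp_power_X[OF q0] state_T_cyclic
    by (rule arg_cong[where f = of_real], rule sum.cong[OF refl], subst pw[OF genus_even]) (simp_all add: power_divide)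
qed

theorem theoremV36:
  fixes q :: real and N :: nat and h :: "'h::{real_inner, complete_space}"
  assumes "N \<ge> 1" and "q = 1 / real N \<or> q = - 1 / real N"
  shows "X_poly q h = sym_tensor 1 (Transposition.transpose 0 1) (simple [h]) \<and>
    (\<exists>a_plus a_minus.
      gns_operator q a_plus \<and> gns_operator q a_minus \<and>
      (\<forall>V \<in> gns_dom q. right_gns q (X_poly q h) V = fock_add q (a_plus V) (a_minus V)) \<and>
      (\<forall>n. \<forall>\<alpha> \<in> S0 n. \<forall>F \<in> rtens n.
        a_plus (gns_vec q (sym_tensor n \<alpha> F)) =
          gns_vec q (sym_tensor (n + 1) (Transposition.transpose 0 (n + 1) \<circ> \<alpha>) (r_plus h F)) \<and>
        a_minus (gns_vec q (sym_tensor n \<alpha> F)) =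
          gns_vec q
            (pscale (of_real q)
               (\<Sum>k \<in> {1..n} - {pinv \<alpha> 0}.
                  sym_tensor (n - 1)
                    (relabel ({0..n} - {k}) (skip {k} (Transposition.transpose 0 k \<circ> \<alpha>)))
                    (r_minus k h F))
             + (if \<alpha> 0 \<noteq> 0
                then sym_tensor (n - 1)
                       (relabel ({0..n} - {pinv \<alpha> 0}) (skip {pinv \<alpha> 0} \<alpha>))
                       (r_minus (pinv \<alpha> 0) h F)
                else 0)))) \<and>
    (\<forall>(P :: 'w measure) M. is_GUE N ((norm h)\<^sup>2) P M \<longrightarrow>
      (\<forall>m. integrable (average_eigenvalue_distribution P M) (\<lambda>x. x ^ m) \<and>
           state (tp_power q (X_poly q h) m) =
             of_real (\<integral>x. x ^ m \<partial>average_eigenvalue_distribution P M)))"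
proof (intro conjI)
  show "X_poly q h = sym_tensor 1 (Transposition.transpose 0 1) (simple [h])" by (rule X_poly_eq)
next
  show "\<forall>(P :: 'w measure) M. is_GUE N ((norm h)\<^sup>2) P M \<longrightarrow>
      (\<forall>m. integrable (average_eigenvalue_distribution P M) (\<lambda>x. x ^ m) \<and>
           state (tp_power q (X_poly q h) m) =
             of_real (\<integral>x. x ^ m \<partial>average_eigenvalue_distribution P M))"
  proof (intro allI impI)
    fix P :: "'w measure" and M m assume "is_GUE N ((norm h)\<^sup>2) P M"
    note g = gue_moments[OF this assms(1), of m]
    show "integrable (average_eigenvalue_distribution P M) (\<lambda>x. x ^ m) \<and>
           state (tp_power q (X_poly q h) m) =
             of_real (\<integral>x. x ^ m \<partial>average_eigenvalue_distribution P M)"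
      by (rule conjI[OF conjunct1[OF g]]) (simp only: state_power_gue[OF assms] conjunct2[OF g])
  qed
next
  have q0: "q \<noteq> 0" using assms by auto
  let ?p = "lift_op q (Aplus h)" and ?m = "lift_op q (Aminus q h)"
  note p = Aplus_hom[of h] Aplus_TP[of _ h] Aplus_null[OF assms, of _ h]
  note m = Aminus_hom[of q h] Aminus_TP[of _ q h] Aminus_null[OF assms, of _ h]
  show "\<exists>a_plus a_minus. gns_operator q a_plus \<and> gns_operator q a_minus \<and>
      (\<forall>V \<in> gns_dom q. right_gns q (X_poly q h) V = fock_add q (a_plus V) (a_minus V)) \<and>
      (\<forall>n. \<forall>\<alpha> \<in> S0 n. \<forall>F \<in> rtens n.
        a_plus (gns_vec q (sym_tensor n \<alpha> F)) =
          gns_vec q (sym_tensor (n + 1) (Transposition.transpose 0 (n + 1) \<circ> \<alpha>) (r_plus h F)) \<and>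
        a_minus (gns_vec q (sym_tensor n \<alpha> F)) =
          gns_vec q
            (pscale (of_real q)
               (\<Sum>k \<in> {1..n} - {pinv \<alpha> 0}.
                  sym_tensor (n - 1)
                    (relabel ({0..n} - {k}) (skip {k} (Transposition.transpose 0 k \<circ> \<alpha>)))
                    (r_minus k h F))
             + (if \<alpha> 0 \<noteq> 0
                then sym_tensor (n - 1)
                       (relabel ({0..n} - {pinv \<alpha> 0}) (skip {pinv \<alpha> 0} \<alpha>))
                       (r_minus (pinv \<alpha> 0) h F)
                else 0)))"
  proof (rule exI[of _ ?p], rule exI[of _ ?m], intro conjI ballI allI)
    show "gns_operator q ?p" by (rule lift_op_operator[OF assms p])
    show "gns_operator q ?m" by (rule lift_op_operator[OF assms m])
  next
    fix V :: "'h fock_vec" assume "V \<in> gns_dom q"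
    then obtain \<xi> where x: "\<xi> \<in> TP" and V: "V = gns_vec q \<xi>" by (auto simp: gns_dom_def)
    let ?s = "\<lambda>\<xi>. Aplus h \<xi> + Aminus q h \<xi>"
    have null: "q_norm q (?s \<zeta>) = 0" if z: "\<zeta> \<in> TP" "q_norm q \<zeta> = 0" for \<zeta>
      using q_norm_tri[OF assms p(2)[OF z(1)] m(2)[OF z(1)]] q_norm_ge0[OF assms TP_add[OF p(2)[OF z(1)] m(2)[OF z(1)]]]
      unfolding p(3)[OF z] m(3)[OF z] by simp
    have Vp: "?p V = gns_vec q (Aplus h \<xi>)" unfolding V by (rule lift_op_gns[OF assms p x])
    have Vm: "?m V = gns_vec q (Aminus q h \<xi>)" unfolding V by (rule lift_op_gns[OF assms m x])
    have "right_gns q (X_poly q h) V = lift_op q ?s V"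
      unfolding right_gns_lift lift_op_def by (rule SUP_cong[OF refl]) (simp add: tp_mult_X[OF _ q0])
    also have "\<dots> = gns_vec q (?s \<xi>)"
      unfolding V by (rule lift_op_gns[OF assms lin_add[OF p(1) m(1)] TP_add[OF p(2) m(2)] null x])
    also have "\<dots> = fock_add q (?p V) (?m V)"
      unfolding Vp Vm by (rule fock_add_gns[OF assms p(2)[OF x] m(2)[OF x], symmetric])
    finally show "right_gns q (X_poly q h) V = fock_add q (?p V) (?m V)" .
  next
    fix n \<alpha> and F :: "'h tens" assume a: "\<alpha> \<in> S0 n" "F \<in> rtens n"
    have t: "sym_tensor n \<alpha> F \<in> TP" unfolding TP_def by (rule ps.span_base) (use a in blast)
    show "?p (gns_vec q (sym_tensor n \<alpha> F)) =
          gns_vec q (sym_tensor (n + 1) (Transposition.transpose 0 (n + 1) \<circ> \<alpha>) (r_plus h F))"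
      using lift_op_gns[OF assms p t] unfolding Aplus_sym_tensor[OF a] .
    show "?m (gns_vec q (sym_tensor n \<alpha> F)) =
          gns_vec q
            (pscale (of_real q)
               (\<Sum>k \<in> {1..n} - {pinv \<alpha> 0}.
                  sym_tensor (n - 1)
                    (relabel ({0..n} - {k}) (skip {k} (Transposition.transpose 0 k \<circ> \<alpha>)))
                    (r_minus k h F))
             + (if \<alpha> 0 \<noteq> 0
                then sym_tensor (n - 1)
                       (relabel ({0..n} - {pinv \<alpha> 0}) (skip {pinv \<alpha> 0} \<alpha>))
                       (r_minus (pinv \<alpha> 0) h F)
                else 0))"
      using lift_op_gns[OF assms m t] unfolding Aminus_sym_tensor[OF a] .
  qed
qed

end
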